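(* Assume $N\ge1$, $k\ge0$, $a>0$, $a+2\langle k\rangle+N>2$ and that either (i) $N=1$ and $a>0$, or (ii) $a\in\{1,2\}$. Let $\alpha>0$. There exists a constant $K=K_\alpha>0$ such that \[\bigl\|\|\cdot\|^{\alpha/2}f\bigr\|_{L^2_{k,a}}\cdot\bigl\|\|\cdot\|^{\alpha/2}\mathcal{F}_{k,a}f\bigr\|_{L^2_{k,a}}\ge K\|f\|^2_{L^2_{k,a}}\quad\text{for all } f\in L^2_{k,a}(\mathbb{R}^N).\]
   Context: Let $\langle\cdot,\cdot\rangle$, $\|\cdot\|$ be the Euclidean inner product and norm on $\mathbb{R}^N$. Let $\mathcal{R}\subset\mathbb{R}^N\setminus\{0\}$ be a reduced root system with positive subsystem $\mathcal{R}^+$, let $r_\alpha(x)=x-2\frac{\langle\alpha,x\rangle}{\|\alpha\|^2}\alpha$, let $\mathfrak{C}$ be the finite group generated by the $r_\alpha$, and let $k:\mathcal{R}\to[0,\infty)$, $\alpha\mapsto k_\alpha$, be a $\mathfrak{C}$-invariant (multiplicity) function; $\langle k\rangle=\sum_{\alpha\in\mathcal{R}^+}k_\alpha$. For $a>0$ put $\vartheta_k(x)=\prod_{\alpha\in\mathcal{R}^+}|\langle\alpha,x\rangle|^{2k_\alpha}$, $\vartheta_{k,a}(x)=\|x\|^{a-2}\vartheta_k(x)$, $d\mu_{k,a}(x)=\vartheta_{k,a}(x)\,dx$, $L^p_{k,a}(\mathbb{R}^N)=L^p(\mathbb{R}^N,\mu_{k,a})$. The Dunkl Laplacian is $\Delta_kf(x)=\Delta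 f(x)+\sum_{\alpha\in\mathcal{R}^+}k_\alpha\bigl(\frac{2\langle\nabla f(x),\alpha\rangle}{\langle\alpha,x\rangle}-\|\alpha\|^2\frac{f(x)-f(r_\alpha x)}{\langle\alpha,x\rangle^2}\bigr)$. If $a+2\langle k\rangle+N>2$, the $(k,a)$-generalized Fourier transform is the unitary operator on $L^2_{k,a}(\mathbb{R}^N)$ given by $\mathcal{F}_{k,a}=\exp\bigl[\frac{i\pi}{2a}(2\langle k\rangle+N+a-2)\bigr]\exp\bigl[\frac{i\pi}{2a}(\|x\|^{2-a}\Delta_k-\|x\|^a)\bigr]$. Equivalently, it is the unitary operator determined by $\mathcal{F}_{k,a}\Phi_{\ell}(p,\cdot)=e^{-i\pi(\ell+m/a)}\Phi_\ell(p,\cdot)$ for $\ell,m\in\{0,1,2,\dots\}$ and $p$ a homogeneous polynomial of degree $m$ with $\Delta_kp=0$, where $\Phi_\ell(p,x)=p(x)L_\ell^{(\lambda_m)}(\frac2a\|x\|^a)e^{-\|x\|^a/a}$, $\lambda_m=\frac1a(2m+2\langle k\rangle+N-2)$, and $L_\ell^{(\lambda)}$ are Laguerre polynomials (these functions span a dense subspace). Weighted norms may take the value $+\infty$. *)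

theory Defs
  imports "HOL-Analysis.Analysis"
begin

text \<open>The space \<open>\<real>\<^sup>N\<close> is an arbitrary type \<open>'a :: euclidean_space\<close>, with \<open>N = DIM('a) \<ge> 1\<close>.\<close>

section \<open>Root systems and multiplicity functions\<close>

definition root_reflection :: "'a::euclidean_space \<Rightarrow> 'a \<Rightarrow> 'a" where
  "root_reflection \<alpha> x = x - (2 * (\<alpha> \<bullet> x) / (norm \<alpha>)\<^sup>2) *\<^sub>R \<alpha>"

text \<open>As usual for Dunkl operators, neither integrality nor spanning is required.\<close>

definition reduced_root_system :: "'a::euclidean_space set \<Rightarrow> bool" where
  "reduced_root_system R \<longleftrightarrow>
     finite R \<and> 0 \<notin> R \<and>
     (\<forall>\<alpha>\<in>R. R \<inter> range (\<lambda>t. t *\<^sub>R \<alpha>) = {\<alpha>, - \<alpha>}) \<and>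
     (\<forall>\<alpha>\<in>R. root_reflection \<alpha> ` R = R)"

definition positive_subsystem :: "'a::euclidean_space set \<Rightarrow> 'a set \<Rightarrow> bool" where
  "positive_subsystem R Rp \<longleftrightarrow>
     (\<exists>\<beta>. (\<forall>\<alpha>\<in>R. \<alpha> \<bullet> \<beta> \<noteq> 0) \<and> Rp = {\<alpha>\<in>R. \<alpha> \<bullet> \<beta> > 0})"

text \<open>Closure under inverses is automatic, since reflections are involutions.\<close>

inductive_set reflection_group :: "'a::euclidean_space set \<Rightarrow> ('a \<Rightarrow> 'a) set"
  for R :: "'a set" where
  id: "id \<in> reflection_group R"
| comp: "\<lbrakk>\<alpha> \<in> R; g \<in> reflection_group R\<rbrakk> \<Longrightarrow> root_reflection \<alpha> \<circ> g \<in> reflection_group R"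

definition multiplicity_function :: "'a::euclidean_space set \<Rightarrow> ('a \<Rightarrow> real) \<Rightarrow> bool" where
  "multiplicity_function R k \<longleftrightarrow>
     (\<forall>\<alpha>\<in>R. k \<alpha> \<ge> 0) \<and> (\<forall>g\<in>reflection_group R. \<forall>\<alpha>\<in>R. k (g \<alpha>) = k \<alpha>)"

definition mult_sum :: "'a::euclidean_space set \<Rightarrow> ('a \<Rightarrow> real) \<Rightarrow> real" where
  "mult_sum Rp k = (\<Sum>\<alpha>\<in>Rp. k \<alpha>)"


section \<open>The weighted measure and its \<open>L\<^sup>2\<close> space\<close>

text \<open>Since \<open>0 powr c = 0\<close> for every \<open>c\<close>, including \<open>c = 0\<close>, these formulas can differ from the
  conventional ones at the origin and on the hyperplanes orthogonal to a root, which form a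
  Lebesgue null set.\<close>

definition dunkl_weight :: "'a::euclidean_space set \<Rightarrow> ('a \<Rightarrow> real) \<Rightarrow> 'a \<Rightarrow> real" where
  "dunkl_weight Rp k x = (\<Prod>\<alpha>\<in>Rp. \<bar>\<alpha> \<bullet> x\<bar> powr (2 * k \<alpha>))"

definition ka_weight :: "'a::euclidean_space set \<Rightarrow> ('a \<Rightarrow> real) \<Rightarrow> real \<Rightarrow> 'a \<Rightarrow> real" where
  "ka_weight Rp k a x = norm x powr (a - 2) * dunkl_weight Rp k x"

definition ka_measure :: "'a::euclidean_space set \<Rightarrow> ('a \<Rightarrow> real) \<Rightarrow> real \<Rightarrow> 'a measure" where
  "ka_measure Rp k a = density lborel (\<lambda>x. ennreal (ka_weight Rp k a x))"

definition L2_norm :: "'a measure \<Rightarrow> ('a \<Rightarrow> complex) \<Rightarrow> ennreal" where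
  "L2_norm M f =
     (let I = \<integral>\<^sup>+ x. ennreal ((cmod (f x))\<^sup>2) \<partial>M
      in if I = \<infinity> then \<infinity> else ennreal (sqrt (enn2real I)))"

text \<open>Elements of \<open>L\<^sup>2\<close> are represented by functions; equality in \<open>L\<^sup>2\<close> is equality almost
  everywhere.\<close>

definition L2_space :: "'a measure \<Rightarrow> ('a \<Rightarrow> complex) set" where
  "L2_space M = {f \<in> borel_measurable M. L2_norm M f < \<infinity>}"

text \<open>A surjective linear isometry of \<open>L\<^sup>2\<close>. Linearity and norm preservation imply that \<open>U\<close>
  respects equality almost everywhere.\<close>

definition unitary_on_L2 ::
    "'a measure \<Rightarrow> (('a \<Rightarrow> complex) \<Rightarrow> ('a \<Rightarrow> complex)) \<Rightarrow> bool" where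
  "unitary_on_L2 M U \<longleftrightarrow>
     (\<forall>f\<in>L2_space M. U f \<in> L2_space M \<and> L2_norm M (U f) = L2_norm M f) \<and>
     (\<forall>f\<in>L2_space M. \<forall>g\<in>L2_space M. \<forall>c d.
        AE x in M. U (\<lambda>y. c * f y + d * g y) x = c * U f x + d * U g x) \<and>
     (\<forall>g\<in>L2_space M. \<exists>f\<in>L2_space M. AE x in M. U f x = g x)"


section \<open>The Dunkl Laplacian and its homogeneous harmonic polynomials\<close>

definition laplacian ::
    "('a::euclidean_space \<Rightarrow> 'b::real_normed_vector) \<Rightarrow> 'a \<Rightarrow> 'b" where
  "laplacian f x =
     (\<Sum>b\<in>Basis. frechet_derivative (\<lambda>y. frechet_derivative f (at y) b) (at x) b)"

definition dunkl_laplacian ::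
    "'a::euclidean_space set \<Rightarrow> ('a \<Rightarrow> real) \<Rightarrow> ('a \<Rightarrow> 'b::real_normed_vector) \<Rightarrow> 'a \<Rightarrow> 'b" where
  "dunkl_laplacian Rp k f x =
     laplacian f x +
     (\<Sum>\<alpha>\<in>Rp. k \<alpha> *\<^sub>R
        ((2 / (\<alpha> \<bullet> x)) *\<^sub>R frechet_derivative f (at x) \<alpha>
         - ((norm \<alpha>)\<^sup>2 / (\<alpha> \<bullet> x)\<^sup>2) *\<^sub>R (f x - f (root_reflection \<alpha> x))))"

text \<open>For a polynomial \<open>p\<close> the singularities of the formula for \<open>\<Delta>\<^sub>k p\<close> on the hyperplanes
  orthogonal to the roots are removable. Division by zero would give a wrong value there, so
  \<open>\<Delta>\<^sub>k p = 0\<close> is imposed on the dense complement; by continuity it then holds everywhere.\<close>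

definition harmonic_poly ::
    "'a::euclidean_space set \<Rightarrow> ('a \<Rightarrow> real) \<Rightarrow> nat \<Rightarrow> ('a \<Rightarrow> complex) \<Rightarrow> bool" where
  "harmonic_poly Rp k m p \<longleftrightarrow>
     polynomial_function p \<and>
     (\<forall>t x. p (t *\<^sub>R x) = t ^ m *\<^sub>R p x) \<and>
     (\<forall>x. (\<forall>\<alpha>\<in>Rp. \<alpha> \<bullet> x \<noteq> 0) \<longrightarrow> dunkl_laplacian Rp k p x = 0)"


section \<open>The \<open>(k,a)\<close>-generalized Fourier transform\<close>

definition laguerre :: "nat \<Rightarrow> real \<Rightarrow> real \<Rightarrow> real" where
  "laguerre l c t =
     (\<Sum>j\<le>l. (-1) ^ j * ((real l + c) gchoose (l - j)) * t ^ j / fact j)"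

definition ka_lambda ::
    "'a::euclidean_space set \<Rightarrow> ('a \<Rightarrow> real) \<Rightarrow> real \<Rightarrow> nat \<Rightarrow> real" where
  "ka_lambda Rp k a m = (2 * real m + 2 * mult_sum Rp k + real DIM('a) - 2) / a"

definition ka_Phi ::
    "'a::euclidean_space set \<Rightarrow> ('a \<Rightarrow> real) \<Rightarrow> real \<Rightarrow> nat \<Rightarrow> nat \<Rightarrow> ('a \<Rightarrow> complex) \<Rightarrow> 'a \<Rightarrow> complex"
  where
  "ka_Phi Rp k a l m p x =
     p x * complex_of_real
       (laguerre l (ka_lambda Rp k a m) (2 / a * norm x powr a) * exp (- (norm x powr a / a)))"

definition is_ka_fourier ::
    "'a::euclidean_space set \<Rightarrow> ('a \<Rightarrow> real) \<Rightarrow> real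
      \<Rightarrow> (('a \<Rightarrow> complex) \<Rightarrow> ('a \<Rightarrow> complex)) \<Rightarrow> bool" where
  "is_ka_fourier Rp k a F \<longleftrightarrow>
     unitary_on_L2 (ka_measure Rp k a) F \<and>
     (\<forall>l m p. harmonic_poly Rp k m p \<longrightarrow>
        (AE x in ka_measure Rp k a.
           F (ka_Phi Rp k a l m p) x =
             exp (- (\<i> * complex_of_real (pi * (real l + real m / a)))) * ka_Phi Rp k a l m p x))"

text \<open>The operator \<open>\<F>\<^bsub>k,a\<^esub> = exp (\<i>\<pi>/(2a) (2\<langle>k\<rangle> + N + a - 2)) exp (\<i>\<pi>/(2a) (\<parallel>x\<parallel>\<^bsup>2-a\<^esup> \<Delta>\<^sub>k - \<parallel>x\<parallel>\<^bsup>a\<^esup>))\<close>,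
  described by its spectral decomposition: the functions \<^const>\<open>ka_Phi\<close> are eigenfunctions of
  \<open>\<parallel>x\<parallel>\<^bsup>2-a\<^esup> \<Delta>\<^sub>k - \<parallel>x\<parallel>\<^bsup>a\<^esup>\<close>, with eigenvalue \<open>- (2al + 2m + 2\<langle>k\<rangle> + N + a - 2)\<close>,
  and span a dense subspace. Hence, if \<open>a > 0\<close> and \<open>a + 2\<langle>k\<rangle> + N > 2\<close>, an operator satisfying \<^const>\<open>is_ka_fourier\<close> exists and is unique up to
  equality almost everywhere; the choice operator only fixes representatives.\<close>

definition ka_fourier ::
    "'a::euclidean_space set \<Rightarrow> ('a \<Rightarrow> real) \<Rightarrow> real \<Rightarrow> ('a \<Rightarrow> complex) \<Rightarrow> ('a \<Rightarrow> complex)" where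
  "ka_fourier Rp k a = (SOME F. is_ka_fourier Rp k a F)"

end

theory Submission
  imports Defs
begin

text \<open>On functions \<open>p(x) u(\<parallel>x\<parallel>)\<close> with \<open>p\<close> harmonic of degree \<open>m\<close>, the transform is determined by its
  action on Gaussians: with \<open>\<phi>(x) = \<parallel>x\<parallel>\<^sup>a / a\<close> and \<open>\<nu> = \<lambda>\<^sub>m + 1\<close> it maps \<open>p e\<^bsup>-z\<phi>\<^esup>\<close> to
  \<open>e\<^bsup>-\<i>\<pi>m/a\<^esup> z\<^bsup>-\<nu>\<^esup> p e\<^bsup>-\<phi>/z\<^esup>\<close>. These families have equal Gram matrices, by scaling and by the orthogonality of
  harmonics of different degrees, and both are total in \<open>L\<^sup>2\<close>, so they define a unitary operator; comparing inner
  products with Gaussians shows that it has the prescribed Laguerre eigenfunctions, hence it is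
  \<open>\<F>\<^bsub>k,a\<^esub>\<close>. The operator \<open>e\<^bsup>-\<phi>/t\<^esup> \<F> e\<^bsup>-t\<phi>\<^esup>\<close> acts on the
  exponents \<open>z\<close> by a contraction of the half plane, which yields
  \<open>\<parallel>e\<^bsup>-\<phi>/t\<^esup> \<F> e\<^bsup>-t\<phi>\<^esup>\<parallel> \<le> \<rho> < 1\<close> with \<open>\<rho>\<close> independent of \<open>t\<close>: no function can be concentrated near the
  origin together with its transform. Splitting
  \<open>\<F>f = (1 - e\<^bsup>-\<phi>/t\<^esup>) \<F>f + e\<^bsup>-\<phi>/t\<^esup> \<F> (1 - e\<^bsup>-t\<phi>\<^esup>) f + e\<^bsup>-\<phi>/t\<^esup> \<F> e\<^bsup>-t\<phi>\<^esup> f\<close> and optimizing in \<open>t\<close> gives the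
  inequality. The kernel of the transform is never needed.\<close>

section \<open>The space of square integrable functions\<close>

text \<open>The transform is given only by a choice from its spectral description, so a unitary
  operator with the prescribed eigenfunctions has to exist and be unique before anything can be said
  about it. Gaussians replace the Laguerre functions because their inner products are pure powers:
  within one degree m the Gram entry of exponents z, z' is \<open>(z + z') powr (- nm m)\<close>
  times a form in the harmonics alone. That form is a common factor throughout, so no orthonormal
  basis of harmonics is chosen. The image of a Gaussian comes from the Laguerre generating function:
  the eigenvalue factor (-1)^l replaces w by -w, hence the exponent z = (1 + w) / (1 - w) by 1 / z.
  The assumption a + 2<k> + N > 2 makes \<open>nm 0\<close> positive, which gives both the
  integrability of Gaussians at the origin and \<open>rho\<close> < 1. Independence of t reflects
  scaling: the exponent map z -> 1 / (z + t) + 1 / t sends t sqrt 2 to sqrt 2 / t, and in the Cayley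
  coordinates centred at these two points it is multiplication by -1 / \<open>gam\<close>, whatever
  t is.\<close>

definition nrm :: "'a measure \<Rightarrow> ('a \<Rightarrow> complex) \<Rightarrow> real" where
  "nrm M f = sqrt (\<integral>x. (cmod (f x))\<^sup>2 \<partial>M)"

definition ip :: "'a measure \<Rightarrow> ('a \<Rightarrow> complex) \<Rightarrow> ('a \<Rightarrow> complex) \<Rightarrow> complex" where
  "ip M f g = (\<integral>x. f x * cnj (g x) \<partial>M)"

lemma L2_space_iff:
  "f \<in> L2_space M \<longleftrightarrow> f \<in> borel_measurable M \<and> integrable M (\<lambda>x. (cmod (f x))\<^sup>2)"
proof -
  have "(\<integral>\<^sup>+x. ennreal ((cmod (f x))\<^sup>2) \<partial>M) < \<infinity> \<longleftrightarrow> L2_norm M f < \<infinity>"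
    by (auto simp: L2_norm_def Let_def less_top)
  then show ?thesis
    by (auto simp: L2_space_def integrable_iff_bounded less_top)
qed

lemma L2_spaceI:
  "f \<in> borel_measurable M \<Longrightarrow> integrable M (\<lambda>x. (cmod (f x))\<^sup>2) \<Longrightarrow> f \<in> L2_space M"
  by (simp add: L2_space_iff)

lemma L2_space_measurable[measurable_dest]: "f \<in> L2_space M \<Longrightarrow> f \<in> borel_measurable M"
  by (simp add: L2_space_iff)

lemma L2_space_integrable_sq: "f \<in> L2_space M \<Longrightarrow> integrable M (\<lambda>x. (cmod (f x))\<^sup>2)"
  by (simp add: L2_space_iff)

lemma L2_norm_eq_nrm:
  assumes "f \<in> L2_space M"
  shows "L2_norm M f = ennreal (nrm M f)"
proof -
  have *: "(\<integral>\<^sup>+x. ennreal ((cmod (f x))\<^sup>2) \<partial>M) = ennreal (\<integral>x. (cmod (f x))\<^sup>2 \<partial>M)"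
    using assms by (intro nn_integral_eq_integral L2_space_integrable_sq) auto
  show ?thesis
    by (simp add: L2_norm_def Let_def * nrm_def)
qed

lemma nrm_nonneg[simp]: "nrm M f \<ge> 0"
  by (simp add: nrm_def)

lemma nrm_sq: "(nrm M f)\<^sup>2 = (\<integral>x. (cmod (f x))\<^sup>2 \<partial>M)"
  by (simp add: nrm_def)

lemma nrm_cong_AE:
  assumes "AE x in M. f x = g x" "f \<in> borel_measurable M" "g \<in> borel_measurable M"
  shows "nrm M f = nrm M g"
  unfolding nrm_def using assms by (intro arg_cong[where f=sqrt] integral_cong_AE) auto

lemma L2_space_dominated:
  assumes "g \<in> borel_measurable M" "integrable M (\<lambda>x. (h x)\<^sup>2)" "AE x in M. cmod (g x) \<le> h x"
  shows "g \<in> L2_space M"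
proof (rule L2_spaceI)
  show "integrable M (\<lambda>x. (cmod (g x))\<^sup>2)"
    by (rule Bochner_Integration.integrable_bound[OF assms(2)])
      (use assms in \<open>auto elim!: eventually_mono intro!: power_mono\<close>)
qed (use assms in auto)

lemma L2_space_bound:
  assumes "g \<in> borel_measurable M" "f \<in> L2_space M" "AE x in M. cmod (g x) \<le> cmod (f x)"
  shows "g \<in> L2_space M"
  using L2_space_dominated[OF assms(1) L2_space_integrable_sq[OF assms(2)] assms(3)] .

lemma L2_zero[simp]: "(\<lambda>x. 0) \<in> L2_space M"
  by (auto simp: L2_space_iff)

lemma L2_scale[intro]: "f \<in> L2_space M \<Longrightarrow> (\<lambda>x. c * f x) \<in> L2_space M"
  by (auto simp: L2_space_iff norm_mult power_mult_distrib)

lemma cmod_add_sq_le: "(cmod (a + b))\<^sup>2 \<le> 2 * (cmod a)\<^sup>2 + 2 * (cmod b)\<^sup>2"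
proof -
  have "(cmod (a + b))\<^sup>2 \<le> (cmod a + cmod b)\<^sup>2"
    by (intro power_mono norm_triangle_ineq) auto
  also have "\<dots> \<le> 2 * (cmod a)\<^sup>2 + 2 * (cmod b)\<^sup>2"
    using sum_squares_bound[of "cmod a" "cmod b"] by (simp add: power2_eq_square algebra_simps)
  finally show ?thesis .
qed

lemma L2_add[intro]:
  assumes "f \<in> L2_space M" "g \<in> L2_space M"
  shows "(\<lambda>x. f x + g x) \<in> L2_space M"
proof (rule L2_spaceI)
  have "integrable M (\<lambda>x. 2 * (cmod (f x))\<^sup>2 + 2 * (cmod (g x))\<^sup>2)"
    using assms by (auto simp: L2_space_iff)
  then show "integrable M (\<lambda>x. (cmod (f x + g x))\<^sup>2)"
    by (rule Bochner_Integration.integrable_bound)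
      (use assms cmod_add_sq_le in \<open>auto simp: L2_space_iff\<close>)
qed (use assms in \<open>auto simp: L2_space_iff\<close>)

lemma L2_diff[intro]:
  assumes "f \<in> L2_space M" "g \<in> L2_space M"
  shows "(\<lambda>x. f x - g x) \<in> L2_space M"
  using L2_add[OF assms(1) L2_scale[OF assms(2), of "-1"]] by simp

lemma L2_sum[intro]:
  "(\<And>i. i \<in> S \<Longrightarrow> f i \<in> L2_space M) \<Longrightarrow> (\<lambda>x. \<Sum>i\<in>S. f i x) \<in> L2_space M"
  by (induction S rule: infinite_finite_induct) auto

lemma L2_comb[intro]:
  "(\<And>i. i \<in> S \<Longrightarrow> f i \<in> L2_space M) \<Longrightarrow> (\<lambda>x. \<Sum>i\<in>S. c i * f i x) \<in> L2_space M"
  by (rule L2_sum) auto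

lemma borel_measurable_cnj[measurable]: "cnj \<in> borel_measurable borel"
  by (intro borel_measurable_continuous_onI continuous_intros)

lemma L2_prod_integrable:
  assumes "f \<in> L2_space M" "g \<in> L2_space M"
  shows "integrable M (\<lambda>x. cmod (f x) * cmod (g x))"
proof -
  have I: "integrable M (\<lambda>x. (cmod (f x))\<^sup>2 + (cmod (g x))\<^sup>2)"
    using assms by (auto simp: L2_space_iff)
  have *: "cmod u * cmod v \<le> (cmod u)\<^sup>2 + (cmod v)\<^sup>2" for u v
  proof -
    have "2 * (cmod u * cmod v) \<le> (cmod u)\<^sup>2 + (cmod v)\<^sup>2"
      using sum_squares_bound[of "cmod u" "cmod v"] by (simp add: mult.assoc)
    moreover have "0 \<le> cmod u * cmod v" by simp
    ultimately show ?thesis by linarith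
  qed
  show ?thesis
    by (rule Bochner_Integration.integrable_bound[OF I]) (use assms * in \<open>auto simp: L2_space_iff\<close>)
qed

lemma ip_integrable:
  assumes "f \<in> L2_space M" "g \<in> L2_space M"
  shows "integrable M (\<lambda>x. f x * cnj (g x))"
  by (rule Bochner_Integration.integrable_bound[OF L2_prod_integrable[OF assms]])
    (use assms in \<open>auto simp: L2_space_iff norm_mult\<close>)

lemma ip_add_left:
  assumes "f \<in> L2_space M" "g \<in> L2_space M" "h \<in> L2_space M"
  shows "ip M (\<lambda>x. f x + g x) h = ip M f h + ip M g h"
  using assms unfolding ip_def by (simp add: ring_distribs ip_integrable)

lemma ip_scale_left: "ip M (\<lambda>x. c * f x) h = c * ip M f h"
  unfolding ip_def by (simp add: mult.assoc)

lemma ip_cnj: "ip M g f = cnj (ip M f g)"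
  unfolding ip_def by (simp flip: Bochner_Integration.integral_cnj add: mult.commute)

lemma ip_scale_right: "ip M f (\<lambda>x. c * g x) = cnj c * ip M f g"
  by (subst (1 2) ip_cnj) (simp add: ip_scale_left)

lemma ip_add_right:
  assumes "f \<in> L2_space M" "g \<in> L2_space M" "h \<in> L2_space M"
  shows "ip M f (\<lambda>x. g x + h x) = ip M f g + ip M f h"
  by (subst (1 2 3) ip_cnj) (simp add: ip_add_left assms)

lemma ip_sum_left:
  assumes "\<And>i. i \<in> S \<Longrightarrow> f i \<in> L2_space M" "h \<in> L2_space M"
  shows "ip M (\<lambda>x. \<Sum>i\<in>S. c i * f i x) h = (\<Sum>i\<in>S. c i * ip M (f i) h)"
  using assms
proof (induction S rule: infinite_finite_induct)
  case (insert x F)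
  then have "(\<lambda>y. \<Sum>i\<in>F. c i * f i y) \<in> L2_space M" "(\<lambda>y. c x * f x y) \<in> L2_space M" by auto
  with insert show ?case by (simp add: ip_add_left ip_scale_left)
qed (auto simp: ip_def)

lemma ip_sum_right:
  assumes "\<And>i. i \<in> S \<Longrightarrow> f i \<in> L2_space M" "h \<in> L2_space M"
  shows "ip M h (\<lambda>x. \<Sum>i\<in>S. c i * f i x) = (\<Sum>i\<in>S. cnj (c i) * ip M h (f i))"
proof -
  have "ip M h (\<lambda>x. \<Sum>i\<in>S. c i * f i x) = cnj (\<Sum>i\<in>S. c i * ip M (f i) h)"
    by (subst ip_cnj) (simp add: ip_sum_left assms)
  also have "\<dots> = (\<Sum>i\<in>S. cnj (c i) * ip M h (f i))"
    by (simp add: ip_cnj[of M h])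
  finally show ?thesis .
qed

lemma ip_self: "ip M f f = of_real ((nrm M f)\<^sup>2)"
  unfolding ip_def nrm_sq integral_complex_of_real[symmetric]
  by (intro Bochner_Integration.integral_cong) (auto simp: complex_norm_square simp del: of_real_power)

lemma nrm_comb_sq:
  assumes "\<And>i. i \<in> S \<Longrightarrow> f i \<in> L2_space M"
  shows "of_real ((nrm M (\<lambda>x. \<Sum>i\<in>S. c i * f i x))\<^sup>2) =
    (\<Sum>i\<in>S. \<Sum>j\<in>S. c i * cnj (c j) * ip M (f i) (f j))"
  unfolding ip_self[symmetric] using assms
  by (simp add: ip_sum_left ip_sum_right L2_comb sum_distrib_left mult.assoc)

text \<open>Integrate 2 u v <= s u^2 + v^2 / s and optimize in s > 0. The best s is the quotient of
  the norms; if a norm vanishes no best s exists, and extreme values of s lead to a contradiction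
  instead.\<close>

lemma Cauchy_Schwarz_L2:
  assumes "f \<in> L2_space M" "g \<in> L2_space M"
  shows "(\<integral>x. cmod (f x) * cmod (g x) \<partial>M) \<le> nrm M f * nrm M g"
proof -
  let ?I = "\<integral>x. cmod (f x) * cmod (g x) \<partial>M"
  have *: "2 * ?I \<le> s * (nrm M f)\<^sup>2 + (nrm M g)\<^sup>2 / s" if "s > 0" for s
  proof -
    have "2 * ?I = (\<integral>x. 2 * (cmod (f x) * cmod (g x)) \<partial>M)" by simp
    also have "\<dots> \<le> (\<integral>x. s * (cmod (f x))\<^sup>2 + (cmod (g x))\<^sup>2 / s \<partial>M)"
    proof (rule integral_mono)
      fix x
      have "0 \<le> (s * cmod (f x) - cmod (g x))\<^sup>2 / s" using that by simp
      then show "2 * (cmod (f x) * cmod (g x)) \<le> s * (cmod (f x))\<^sup>2 + (cmod (g x))\<^sup>2 / s"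
        using that by (simp add: power2_eq_square field_simps)
    qed (use assms L2_prod_integrable[OF assms] in \<open>auto simp: L2_space_iff\<close>)
    also have "\<dots> = s * (nrm M f)\<^sup>2 + (nrm M g)\<^sup>2 / s"
      using assms by (simp add: nrm_sq L2_space_iff)
    finally show ?thesis .
  qed
  have I0: "?I \<ge> 0" by (intro integral_nonneg_AE) auto
  show ?thesis
  proof (cases "nrm M f = 0 \<or> nrm M g = 0")
    case True
    show ?thesis
    proof (rule ccontr)
      assume "\<not> ?thesis"
      then have I: "?I > 0" using True by auto
      \<comment> \<open>\<open>A + 1\<close> dominates both squared norms, so s = (A + 1) / I,
        respectively s = I / (A + 1), makes the surviving term at most I and gives 2 I <= I.\<close>
      define A where "A = (nrm M f)\<^sup>2 + (nrm M g)\<^sup>2"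
      have A: "A \<ge> 0" by (simp add: A_def)
      have "(nrm M f)\<^sup>2 \<le> A + 1" "(nrm M g)\<^sup>2 \<le> A + 1" by (simp_all add: A_def)
      then have le: "(nrm M f)\<^sup>2 / (A + 1) \<le> 1" "(nrm M g)\<^sup>2 / (A + 1) \<le> 1" using A by simp_all
      have "2 * ?I \<le> ?I"
      proof (cases "nrm M f = 0")
        case True
        have s: "(A + 1) / ?I > 0" using I A by simp
        have "2 * ?I \<le> (nrm M g)\<^sup>2 / ((A + 1) / ?I)" using *[OF s] True by simp
        also have "\<dots> = (nrm M g)\<^sup>2 / (A + 1) * ?I" by simp
        also have "\<dots> \<le> 1 * ?I" using I le by (intro mult_right_mono) auto
        finally show ?thesis by simp
      next
        case False
        then have g: "nrm M g = 0" using True by simp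
        have s: "?I / (A + 1) > 0" using I A by simp
        have "2 * ?I \<le> (?I / (A + 1)) * (nrm M f)\<^sup>2" using *[OF s] g by simp
        also have "\<dots> = (nrm M f)\<^sup>2 / (A + 1) * ?I" by simp
        also have "\<dots> \<le> 1 * ?I" using I le by (intro mult_right_mono) auto
        finally show ?thesis by simp
      qed
      then show False using I by simp
    qed
  next
    case False
    then have pos: "nrm M f > 0" "nrm M g > 0"
      using nrm_nonneg[of M f] nrm_nonneg[of M g] by linarith+
    with *[of "nrm M g / nrm M f"] show ?thesis
      by (simp add: power2_eq_square field_simps)
  qed
qed

lemma cmod_ip_le:
  assumes "f \<in> L2_space M" "g \<in> L2_space M"
  shows "cmod (ip M f g) \<le> nrm M f * nrm M g"
proof -
  have "cmod (ip M f g) \<le> (\<integral>x. cmod (f x * cnj (g x)) \<partial>M)"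
    unfolding ip_def by (rule integral_norm_bound)
  also have "\<dots> = (\<integral>x. cmod (f x) * cmod (g x) \<partial>M)" by (simp add: norm_mult)
  finally show ?thesis using Cauchy_Schwarz_L2[OF assms] by linarith
qed

lemma nrm_triangle:
  assumes "f \<in> L2_space M" "g \<in> L2_space M"
  shows "nrm M (\<lambda>x. f x + g x) \<le> nrm M f + nrm M g"
proof (rule power2_le_imp_le)
  have "(nrm M (\<lambda>x. f x + g x))\<^sup>2 \<le>
      (\<integral>x. (cmod (f x))\<^sup>2 + 2 * (cmod (f x) * cmod (g x)) + (cmod (g x))\<^sup>2 \<partial>M)"
    unfolding nrm_sq
  proof (rule integral_mono)
    fix x
    have "(cmod (f x + g x))\<^sup>2 \<le> (cmod (f x) + cmod (g x))\<^sup>2"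
      by (intro power_mono norm_triangle_ineq) auto
    then show "(cmod (f x + g x))\<^sup>2 \<le> (cmod (f x))\<^sup>2 + 2 * (cmod (f x) * cmod (g x)) + (cmod (g x))\<^sup>2"
      by (simp add: power2_eq_square algebra_simps)
  qed (use assms L2_prod_integrable[OF assms] L2_add[OF assms] in \<open>auto simp: L2_space_iff\<close>)
  also have "\<dots> = (nrm M f)\<^sup>2 + 2 * (\<integral>x. cmod (f x) * cmod (g x) \<partial>M) + (nrm M g)\<^sup>2"
    using assms L2_prod_integrable[OF assms] by (simp add: nrm_sq L2_space_iff)
  also have "\<dots> \<le> (nrm M f + nrm M g)\<^sup>2"
    using Cauchy_Schwarz_L2[OF assms] by (simp add: power2_eq_square algebra_simps)
  finally show "(nrm M (\<lambda>x. f x + g x))\<^sup>2 \<le> (nrm M f + nrm M g)\<^sup>2" .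
qed simp

lemma nrm_scale: "nrm M (\<lambda>x. c * f x) = cmod c * nrm M f"
  unfolding nrm_def by (simp add: norm_mult power_mult_distrib real_sqrt_mult)

lemma nrm_minus_commute: "nrm M (\<lambda>x. f x - g x) = nrm M (\<lambda>x. g x - f x)"
  by (simp add: nrm_def norm_minus_commute)

lemma nrm_triangle_diff:
  assumes "f \<in> L2_space M" "g \<in> L2_space M" "h \<in> L2_space M"
  shows "nrm M (\<lambda>x. f x - h x) \<le> nrm M (\<lambda>x. f x - g x) + nrm M (\<lambda>x. g x - h x)"
  using nrm_triangle[OF L2_diff[OF assms(1,2)] L2_diff[OF assms(2,3)]] by simp

lemma nrm_diff_ge:
  assumes "f \<in> L2_space M" "g \<in> L2_space M"
  shows "\<bar>nrm M f - nrm M g\<bar> \<le> nrm M (\<lambda>x. f x - g x)"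
  using nrm_triangle[OF L2_diff[OF assms] assms(2)]
    nrm_triangle[OF L2_diff[OF assms(2,1)] assms(1)] nrm_minus_commute[of M f g] by simp

lemma nrm_mono_AE:
  assumes "f \<in> L2_space M" "g \<in> L2_space M" "AE x in M. cmod (f x) \<le> cmod (g x)"
  shows "nrm M f \<le> nrm M g"
  unfolding nrm_def using assms
  by (intro real_sqrt_le_mono integral_mono_AE L2_space_integrable_sq) (auto intro: power_mono)

lemma nrm_eq_0_iff:
  assumes "f \<in> L2_space M"
  shows "nrm M f = 0 \<longleftrightarrow> (AE x in M. f x = 0)"
  using integral_nonneg_eq_0_iff_AE[OF L2_space_integrable_sq[OF assms]] by (simp add: nrm_def)

section \<open>Completeness\<close>

lemma nrm_le_iff_nn:
  assumes "f \<in> borel_measurable M" "(\<integral>\<^sup>+x. ennreal ((cmod (f x))\<^sup>2) \<partial>M) \<le> ennreal (c\<^sup>2)" "c \<ge> 0"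
  shows "f \<in> L2_space M" "nrm M f \<le> c"
proof -
  show f: "f \<in> L2_space M"
    using assms(1) le_less_trans[OF assms(2) ennreal_less_top]
    by (auto simp: L2_space_iff integrable_iff_bounded)
  have "ennreal ((nrm M f)\<^sup>2) \<le> ennreal (c\<^sup>2)"
    using assms(2) nn_integral_eq_integral[OF L2_space_integrable_sq[OF f]] by (simp add: nrm_sq)
  then have "(nrm M f)\<^sup>2 \<le> c\<^sup>2" by (subst (asm) ennreal_le_iff) auto
  then show "nrm M f \<le> c" using assms(3) by (rule power2_le_imp_le)
qed

text \<open>Since \<open>\<bar>d\<^sub>n\<bar> \<le> 2\<^sup>-\<^sup>n + 2\<^sup>n \<bar>d\<^sub>n\<bar>\<^sup>2\<close>, almost everywhere convergence only needs the
  integrability of the series of \<open>2\<^sup>n \<bar>d\<^sub>n\<bar>\<^sup>2\<close>.\<close>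

lemma L2_complete:
  assumes L2: "\<And>n. f n \<in> L2_space M"
    and close: "\<And>n. nrm M (\<lambda>x. f (Suc n) x - f n x) \<le> (1/2) ^ n"
  shows "\<exists>g\<in>L2_space M. \<forall>n. nrm M (\<lambda>x. g x - f n x) \<le> 2 * (1/2) ^ n"
proof -
  define d where "d n x = f (Suc n) x - f n x" for n x
  have dL2: "d n \<in> L2_space M" for n unfolding d_def using L2 by auto
  note [measurable] = L2_space_measurable[OF dL2] L2_space_measurable[OF L2]
  have "(\<integral>\<^sup>+x. (\<Sum>n. ennreal (2 ^ n * (cmod (d n x))\<^sup>2)) \<partial>M)
      = (\<Sum>n. \<integral>\<^sup>+x. ennreal (2 ^ n * (cmod (d n x))\<^sup>2) \<partial>M)"
    by (rule nn_integral_suminf) auto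
  also have "\<dots> = (\<Sum>n. ennreal (2 ^ n * (nrm M (d n))\<^sup>2))"
  proof (rule suminf_cong)
    fix n
    have "(\<integral>\<^sup>+x. ennreal (2 ^ n * (cmod (d n x))\<^sup>2) \<partial>M) = ennreal (\<integral>x. 2 ^ n * (cmod (d n x))\<^sup>2 \<partial>M)"
      using L2_space_integrable_sq[OF dL2] by (intro nn_integral_eq_integral) auto
    then show "(\<integral>\<^sup>+x. ennreal (2 ^ n * (cmod (d n x))\<^sup>2) \<partial>M) = ennreal (2 ^ n * (nrm M (d n))\<^sup>2)"
      by (simp add: nrm_sq)
  qed
  also have "\<dots> \<le> (\<Sum>n. ennreal ((1/2) ^ n))"
  proof (intro suminf_le ennreal_leI)
    fix n
    have "2 ^ n * (nrm M (d n))\<^sup>2 \<le> 2 ^ n * ((1/2) ^ n)\<^sup>2"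
      using close[of n] by (intro mult_left_mono power_mono) (auto simp: d_def[abs_def])
    also have "\<dots> = (1/2 :: real) ^ n"
      by (simp add: power2_eq_square power_one_over)
    finally show "2 ^ n * (nrm M (d n))\<^sup>2 \<le> (1/2) ^ n" .
  qed auto
  also have "\<dots> = ennreal (\<Sum>n. (1/2) ^ n)"
    by (rule suminf_ennreal2) auto
  also have "\<dots> < \<infinity>" by simp
  finally have "(\<integral>\<^sup>+x. (\<Sum>n. ennreal (2 ^ n * (cmod (d n x))\<^sup>2)) \<partial>M) \<noteq> \<infinity>" by simp
  then have "AE x in M. (\<Sum>n. ennreal (2 ^ n * (cmod (d n x))\<^sup>2)) \<noteq> \<infinity>"
    by (intro nn_integral_PInf_AE) auto
  then have conv: "AE x in M. (\<lambda>n. f n x) \<longlonglongrightarrow> lim (\<lambda>n. f n x)"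
  proof eventually_elim
    case (elim x)
    have "summable (\<lambda>n. 2 ^ n * (cmod (d n x))\<^sup>2)"
      using elim by (intro summable_suminf_not_top) auto
    then have s: "summable (\<lambda>n. (1/2) ^ n + 2 ^ n * (cmod (d n x))\<^sup>2)"
      by (intro summable_add summable_geometric) auto
    have b: "cmod (d n x) \<le> (1/2) ^ n + 2 ^ n * (cmod (d n x))\<^sup>2" for n
    proof -
      have "2 * (2 ^ n * cmod (d n x)) \<le> 1 + (2 ^ n * cmod (d n x))\<^sup>2"
        using sum_squares_bound[of 1 "2 ^ n * cmod (d n x)"] by simp
      then have "2 ^ n * cmod (d n x) \<le> 1 + (2 ^ n * cmod (d n x))\<^sup>2"
        using mult_nonneg_nonneg[OF zero_le_power[OF zero_le_numeral[of "num.Bit0 num.One"]] norm_ge_zero[of "d n x"], of n] by linarith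
      then show ?thesis by (simp add: power2_eq_square field_simps)
    qed
    have "summable (\<lambda>n. d n x)"
      by (rule summable_comparison_test'[OF s, of 0]) (rule b)
    then have "(\<lambda>n. \<Sum>i<n. d i x) \<longlonglongrightarrow> suminf (\<lambda>n. d n x)"
      by (simp add: summable_LIMSEQ)
    then have "(\<lambda>n. f n x - f 0 x) \<longlonglongrightarrow> suminf (\<lambda>n. d n x)"
      by (simp add: d_def sum_lessThan_telescope[of "\<lambda>n. f n x"])
    then have "(\<lambda>n. (f n x - f 0 x) + f 0 x) \<longlonglongrightarrow> suminf (\<lambda>n. d n x) + f 0 x"
      by (intro tendsto_intros)
    then have "convergent (\<lambda>n. f n x)" by (auto simp: convergent_def)
    then show ?case by (simp add: convergent_LIMSEQ_iff)
  qed
  define g where "g x = lim (\<lambda>n. f n x)" for x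
  have [measurable]: "g \<in> borel_measurable M"
    unfolding g_def by (rule borel_measurable_lim_metric) auto
  \<comment> \<open>The bound is the exact difference of two geometric tails, so that the induction
    closes; dropping the negative part leaves a bound uniform in k.\<close>
  have tele: "nrm M (\<lambda>x. f (n + k) x - f n x) \<le> 2 * (1/2) ^ n - 2 * (1/2) ^ (n + k)" for n k
  proof (induction k)
    case (Suc k)
    have "nrm M (\<lambda>x. f (n + Suc k) x - f n x) \<le>
        nrm M (\<lambda>x. f (Suc (n + k)) x - f (n + k) x) + nrm M (\<lambda>x. f (n + k) x - f n x)"
      using nrm_triangle_diff[OF L2 L2 L2, of "Suc (n + k)" n "n + k"] by simp
    also have "\<dots> \<le> (1/2) ^ (n + k) + (2 * (1/2) ^ n - 2 * (1/2) ^ (n + k))"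
      using Suc close by (intro add_mono) auto
    finally show ?case by simp
  qed (simp add: nrm_def)
  have "(\<lambda>x. g x - f n x) \<in> L2_space M \<and> nrm M (\<lambda>x. g x - f n x) \<le> 2 * (1/2) ^ n" for n
  proof -
    have "(\<integral>\<^sup>+x. ennreal ((cmod (g x - f n x))\<^sup>2) \<partial>M) =
        (\<integral>\<^sup>+x. liminf (\<lambda>k. ennreal ((cmod (f (n + k) x - f n x))\<^sup>2)) \<partial>M)"
    proof (rule nn_integral_cong_AE)
      show "AE x in M. ennreal ((cmod (g x - f n x))\<^sup>2) =
          liminf (\<lambda>k. ennreal ((cmod (f (n + k) x - f n x))\<^sup>2))"
        using conv
      proof eventually_elim
        case (elim x)
        have "(\<lambda>k. f (k + n) x) \<longlonglongrightarrow> g x"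
          using LIMSEQ_ignore_initial_segment[OF elim] unfolding g_def by simp
        then have "(\<lambda>k. ennreal ((cmod (f (n + k) x - f n x))\<^sup>2)) \<longlonglongrightarrow> ennreal ((cmod (g x - f n x))\<^sup>2)"
          by (intro tendsto_intros tendsto_ennrealI) (simp add: add.commute)
        then show ?case by (rule lim_imp_Liminf[OF sequentially_bot, symmetric])
      qed
    qed
    \<comment> \<open>Fatou: convergence is known only almost everywhere, and square integrability
      of the limit's distance to \<open>f n\<close> is itself part of the claim.\<close>
    also have "\<dots> \<le> liminf (\<lambda>k. \<integral>\<^sup>+x. ennreal ((cmod (f (n + k) x - f n x))\<^sup>2) \<partial>M)"
      by (rule nn_integral_liminf) auto
    also have "\<dots> \<le> liminf (\<lambda>k::nat. ennreal ((2 * (1/2) ^ n)\<^sup>2))"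
    proof (intro Liminf_mono always_eventually allI)
      fix k
      have "(\<lambda>x. f (n + k) x - f n x) \<in> L2_space M" using L2 by auto
      then have "(\<integral>\<^sup>+x. ennreal ((cmod (f (n + k) x - f n x))\<^sup>2) \<partial>M) = ennreal ((nrm M (\<lambda>x. f (n + k) x - f n x))\<^sup>2)"
        by (subst nn_integral_eq_integral) (auto simp: nrm_sq L2_space_iff)
      also have "\<dots> \<le> ennreal ((2 * (1/2) ^ n)\<^sup>2)"
        using tele[of n k] zero_le_power[of "1/2::real" "n + k"]
        by (intro ennreal_leI power_mono) (auto intro: order_trans)
      finally show "(\<integral>\<^sup>+x. ennreal ((cmod (f (n + k) x - f n x))\<^sup>2) \<partial>M) \<le> ennreal ((2 * (1/2) ^ n)\<^sup>2)" .
    qed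
    also have "\<dots> = ennreal ((2 * (1/2) ^ n)\<^sup>2)" by (simp add: Liminf_const)
    finally have le: "(\<integral>\<^sup>+x. ennreal ((cmod (g x - f n x))\<^sup>2) \<partial>M) \<le> ennreal ((2 * (1/2) ^ n)\<^sup>2)" .
    have m: "(\<lambda>x. g x - f n x) \<in> borel_measurable M" by simp
    show ?thesis using nrm_le_iff_nn[OF m le] by simp
  qed
  note gn = this
  have "(\<lambda>x. (g x - f 0 x) + f 0 x) \<in> L2_space M"
    by (rule L2_add[OF conjunct1[OF gn] L2])
  then show ?thesis using gn by auto
qed

section \<open>Closed linear spans and extension of isometries\<close>

text \<open>The generators are indexed by names, so that one list of coefficients can be applied to
  two families; the extension of isometries rests on this.\<close>

definition clspan :: "'a measure \<Rightarrow> 'i set \<Rightarrow> ('i \<Rightarrow> 'a \<Rightarrow> complex) \<Rightarrow> ('a \<Rightarrow> complex) set" where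
  "clspan M I u = {f \<in> L2_space M. \<forall>e>0. \<exists>S c. finite S \<and> S \<subseteq> I \<and>
     nrm M (\<lambda>x. f x - (\<Sum>s\<in>S. c s * u s x)) < e}"

lemma clspan_L2: "f \<in> clspan M I u \<Longrightarrow> f \<in> L2_space M"
  by (simp add: clspan_def)

lemma clspan_approx:
  assumes "f \<in> clspan M I u" "e > 0"
  obtains S c where "finite S" "S \<subseteq> I" "nrm M (\<lambda>x. f x - (\<Sum>s\<in>S. c s * u s x)) < e"
  using assms by (auto simp: clspan_def)

lemma clspan_base:
  assumes "s \<in> I" "u s \<in> L2_space M"
  shows "u s \<in> clspan M I u"
  unfolding clspan_def
proof (intro CollectI conjI allI impI assms)
  fix e :: real assume "e > 0"
  then show "\<exists>S c. finite S \<and> S \<subseteq> I \<and> nrm M (\<lambda>x. u s x - (\<Sum>s\<in>S. c s * u s x)) < e"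
    using assms by (intro exI[of _ "{s}"] exI[of _ "\<lambda>_. 1"]) (auto simp: nrm_def)
qed

text \<open>Two combinations have different supports, hence the extension by zero to the union. The
  coefficients stay explicit so that they can be reused for a second family.\<close>

lemma comb_add:
  fixes u :: "'i \<Rightarrow> 'a \<Rightarrow> complex"
  assumes "finite S" "finite T"
  shows "(\<Sum>s\<in>S \<union> T. (a * (if s \<in> S then c s else 0) + b * (if s \<in> T then d s else 0)) * u s x)
     = a * (\<Sum>s\<in>S. c s * u s x) + b * (\<Sum>s\<in>T. d s * u s x)"
proof -
  have "(\<Sum>s\<in>S \<union> T. (a * (if s \<in> S then c s else 0) + b * (if s \<in> T then d s else 0)) * u s x)
    = (\<Sum>s\<in>S \<union> T. a * (if s \<in> S then c s * u s x else 0)) + (\<Sum>s\<in>S \<union> T. b * (if s \<in> T then d s * u s x else 0))"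
    unfolding sum.distrib[symmetric] by (intro sum.cong) (auto simp: algebra_simps)
  also have "\<dots> = a * (\<Sum>s\<in>S \<union> T. (if s \<in> S then c s * u s x else 0)) + b * (\<Sum>s\<in>S \<union> T. (if s \<in> T then d s * u s x else 0))"
    by (simp add: sum_distrib_left)
  also have "(\<Sum>s\<in>S \<union> T. (if s \<in> S then c s * u s x else 0)) = (\<Sum>s\<in>S. c s * u s x)"
    using assms by (intro sum.mono_neutral_cong_right) auto
  also have "(\<Sum>s\<in>S \<union> T. (if s \<in> T then d s * u s x else 0)) = (\<Sum>s\<in>T. d s * u s x)"
    using assms by (intro sum.mono_neutral_cong_right) auto
  finally show ?thesis .
qed

lemma nrm_lin_comb_le:
  assumes "f \<in> L2_space M" "g \<in> L2_space M"
  shows "nrm M (\<lambda>x. a * f x + b * g x) \<le> cmod a * nrm M f + cmod b * nrm M g"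
  using nrm_triangle[OF L2_scale[OF assms(1), of a] L2_scale[OF assms(2), of b]]
  by (simp add: nrm_scale)

lemma clspan_limit:
  assumes u: "\<And>s. s \<in> I \<Longrightarrow> u s \<in> L2_space M" and f: "f \<in> L2_space M"
    and lim: "\<And>e. e > 0 \<Longrightarrow> \<exists>g\<in>clspan M I u. nrm M (\<lambda>x. f x - g x) < e"
  shows "f \<in> clspan M I u"
  unfolding clspan_def
proof (intro CollectI conjI allI impI f)
  fix e :: real assume e: "e > 0"
  obtain g where g: "g \<in> clspan M I u" "nrm M (\<lambda>x. f x - g x) < e / 2" using lim[of "e/2"] e by auto
  obtain S c where S: "finite S" "S \<subseteq> I" "nrm M (\<lambda>x. g x - (\<Sum>s\<in>S. c s * u s x)) < e / 2"
    using clspan_approx[OF g(1), of "e/2"] e by auto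
  have "nrm M (\<lambda>x. f x - (\<Sum>s\<in>S. c s * u s x)) < e"
    using nrm_triangle_diff[OF f clspan_L2[OF g(1)], of "\<lambda>x. \<Sum>s\<in>S. c s * u s x"] S u g(2)
    by (fastforce intro!: L2_comb)
  with S show "\<exists>S c. finite S \<and> S \<subseteq> I \<and> nrm M (\<lambda>x. f x - (\<Sum>s\<in>S. c s * u s x)) < e" by blast
qed

lemma clspan_lin_comb:
  assumes u: "\<And>s. s \<in> I \<Longrightarrow> u s \<in> L2_space M"
    and f: "f \<in> clspan M I u" and g: "g \<in> clspan M I u"
  shows "(\<lambda>x. a * f x + b * g x) \<in> clspan M I u"
  unfolding clspan_def
proof (intro CollectI conjI allI impI)
  show "(\<lambda>x. a * f x + b * g x) \<in> L2_space M" using f g by (auto dest!: clspan_L2)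
  fix e :: real assume e: "e > 0"
  \<comment> \<open>The summand 1 keeps K positive when a = b = 0 and makes the final estimate
    strict.\<close>
  define K where "K = cmod a + cmod b + 1"
  have K: "K > 0" by (simp add: K_def add_nonneg_pos)
  obtain S c where S: "finite S" "S \<subseteq> I" "nrm M (\<lambda>x. f x - (\<Sum>s\<in>S. c s * u s x)) < e / K"
    using clspan_approx[OF f, of "e/K"] e K by auto
  obtain T d where T: "finite T" "T \<subseteq> I" "nrm M (\<lambda>x. g x - (\<Sum>s\<in>T. d s * u s x)) < e / K"
    using clspan_approx[OF g, of "e/K"] e K by auto
  let ?c = "\<lambda>s. a * (if s \<in> S then c s else 0) + b * (if s \<in> T then d s else 0)"
  have L: "(\<lambda>x. f x - (\<Sum>s\<in>S. c s * u s x)) \<in> L2_space M" "(\<lambda>x. g x - (\<Sum>s\<in>T. d s * u s x)) \<in> L2_space M"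
    using S T u f g by (auto dest!: clspan_L2 intro!: L2_diff L2_comb)
  have "nrm M (\<lambda>x. (a * f x + b * g x) - (\<Sum>s\<in>S \<union> T. ?c s * u s x))
      = nrm M (\<lambda>x. a * (f x - (\<Sum>s\<in>S. c s * u s x)) + b * (g x - (\<Sum>s\<in>T. d s * u s x)))"
    unfolding comb_add[OF S(1) T(1)] by (simp add: algebra_simps)
  also have "\<dots> \<le> cmod a * (e / K) + cmod b * (e / K)"
    using S T by (intro order_trans[OF nrm_lin_comb_le[OF L]] add_mono mult_left_mono) auto
  also have "\<dots> = (cmod a + cmod b) * (e / K)" by (rule distrib_right[symmetric])
    also have "\<dots> < K * (e / K)" using e K by (intro mult_strict_right_mono) (auto simp: K_def)
  finally have "nrm M (\<lambda>x. (a * f x + b * g x) - (\<Sum>s\<in>S \<union> T. ?c s * u s x)) < e" using K by simp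
  with S T show "\<exists>S c. finite S \<and> S \<subseteq> I \<and> nrm M (\<lambda>x. (a * f x + b * g x) - (\<Sum>s\<in>S. c s * u s x)) < e"
    by (intro exI[of _ "S \<union> T"] exI[of _ ?c]) auto
qed

lemma clspan_zero: "(\<lambda>x. 0) \<in> clspan M I u"
  unfolding clspan_def
proof (intro CollectI conjI allI impI L2_zero)
  fix e :: real assume "e > 0"
  then show "\<exists>S c. finite S \<and> S \<subseteq> I \<and> nrm M (\<lambda>x. 0 - (\<Sum>s\<in>S. c s * u s x)) < e"
    by (intro exI[of _ "{}"]) (auto simp: nrm_def)
qed

lemma clspan_scale:
  assumes "\<And>s. s \<in> I \<Longrightarrow> u s \<in> L2_space M" "f \<in> clspan M I u"
  shows "(\<lambda>x. a * f x) \<in> clspan M I u"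
  using clspan_lin_comb[OF assms(1,2) clspan_zero, of a 0] by simp

lemma clspan_comb:
  assumes "\<And>s. s \<in> I \<Longrightarrow> u s \<in> L2_space M" "\<And>i. i \<in> S \<Longrightarrow> f i \<in> clspan M I u"
  shows "(\<lambda>x. \<Sum>i\<in>S. c i * f i x) \<in> clspan M I u"
  using assms(2)
proof (induction S rule: infinite_finite_induct)
  case (insert x F)
  then show ?case
    using clspan_lin_comb[where I = I and u = u and f = "f x" and g = "\<lambda>y. \<Sum>i\<in>F. c i * f i y" and a = "c x" and b = 1]
      assms(1) by simp
qed (auto simp: clspan_zero)

text \<open>The tool behind every density statement: a closed span is stable under almost everywhere
  limits with a square integrable majorant.\<close>

lemma clspan_dominated:
  fixes h :: "nat \<Rightarrow> 'a \<Rightarrow> complex"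
  assumes u: "\<And>s. s \<in> I \<Longrightarrow> u s \<in> L2_space M"
    and h: "\<And>n. h n \<in> clspan M I u" and f[measurable]: "f \<in> borel_measurable M"
    and lim: "AE x in M. (\<lambda>n. h n x) \<longlonglongrightarrow> f x"
    and G: "G \<in> borel_measurable M" "integrable M (\<lambda>x. (G x :: real)\<^sup>2)" "\<And>n. AE x in M. cmod (h n x) \<le> G x"
  shows "f \<in> clspan M I u"
proof -
  note [measurable] = L2_space_measurable[OF clspan_L2[OF h]] G(1)
  have all: "AE x in M. \<forall>n. cmod (h n x) \<le> G x"
    using G(3) by (simp add: AE_all_countable)
  then have fG: "AE x in M. cmod (f x) \<le> G x" using lim
  proof eventually_elim
    case (elim x)
    then show ?case
      by (intro tendsto_upperbound[OF tendsto_norm[OF elim(2)]]) auto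
  qed
  then have fL2: "f \<in> L2_space M" by (intro L2_space_dominated[OF f G(2)])
  have "(\<lambda>n. \<integral>x. (cmod (f x - h n x))\<^sup>2 \<partial>M) \<longlonglongrightarrow> (\<integral>x. 0 \<partial>M)"
  proof (rule integral_dominated_convergence)
    show "integrable M (\<lambda>x. 4 * (G x)\<^sup>2)" using G by auto
    show "AE x in M. (\<lambda>n. (cmod (f x - h n x))\<^sup>2) \<longlonglongrightarrow> 0"
      using lim
    proof eventually_elim
      case (elim x)
      have "(\<lambda>n. (cmod (f x - h n x))\<^sup>2) \<longlonglongrightarrow> (cmod (f x - f x))\<^sup>2" by (intro tendsto_intros elim)
      then show ?case by simp
    qed
    show "AE x in M. norm ((cmod (f x - h n x))\<^sup>2) \<le> 4 * (G x)\<^sup>2" for n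
      using all fG
    proof eventually_elim
      case (elim x)
      then have "cmod (f x - h n x) \<le> 2 * G x"
        using norm_triangle_ineq4[of "f x" "h n x"] by (smt (verit))
      then have "(cmod (f x - h n x))\<^sup>2 \<le> (2 * G x)\<^sup>2" by (intro power_mono) auto
      then show ?case by (simp add: power_mult_distrib)
    qed
  qed auto
  then have "(\<lambda>n. nrm M (\<lambda>x. f x - h n x)) \<longlonglongrightarrow> sqrt 0"
    unfolding nrm_def by (intro tendsto_real_sqrt) simp
  then have lim0: "(\<lambda>n. nrm M (\<lambda>x. f x - h n x)) \<longlonglongrightarrow> 0" by simp
  show ?thesis
  proof (rule clspan_limit[OF u fL2])
    fix e :: real assume "e > 0"
    then have "eventually (\<lambda>n. nrm M (\<lambda>x. f x - h n x) < e) sequentially"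
      using lim0 by (rule order_tendstoD[rotated])
    then show "\<exists>g\<in>clspan M I u. nrm M (\<lambda>x. f x - g x) < e"
      using h by (auto simp: eventually_sequentially)
  qed
qed

text \<open>The graph of the closure of \<open>u s\<close> |-> \<open>v s\<close>: both functions
  are approximated by the same coefficients. The relation is symmetric in the two families, so
  inverses come for free.\<close>

definition same_coeffs :: "'a measure \<Rightarrow> 'i set \<Rightarrow> ('i \<Rightarrow> 'a \<Rightarrow> complex) \<Rightarrow> ('i \<Rightarrow> 'a \<Rightarrow> complex) \<Rightarrow>
    ('a \<Rightarrow> complex) \<Rightarrow> ('a \<Rightarrow> complex) \<Rightarrow> bool" where
  "same_coeffs M I u v f g \<longleftrightarrow> (\<forall>e>0. \<exists>S c. finite S \<and> S \<subseteq> I \<and>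
     nrm M (\<lambda>x. f x - (\<Sum>s\<in>S. c s * u s x)) < e \<and> nrm M (\<lambda>x. g x - (\<Sum>s\<in>S. c s * v s x)) < e)"

lemma same_coeffs_sym: "same_coeffs M I u v f g \<Longrightarrow> same_coeffs M I v u g f"
  unfolding same_coeffs_def by blast

lemma same_coeffs_base:
  assumes "s \<in> I"
  shows "same_coeffs M I u v (u s) (v s)"
  unfolding same_coeffs_def
proof (intro allI impI)
  fix e :: real assume "e > 0"
  then show "\<exists>S c. finite S \<and> S \<subseteq> I \<and> nrm M (\<lambda>x. u s x - (\<Sum>s\<in>S. c s * u s x)) < e \<and>
      nrm M (\<lambda>x. v s x - (\<Sum>s\<in>S. c s * v s x)) < e"
    using assms by (intro exI[of _ "{s}"] exI[of _ "\<lambda>_. 1"]) (auto simp: nrm_def)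
qed

lemma same_coeffs_lin_comb:
  assumes u: "\<And>s. s \<in> I \<Longrightarrow> u s \<in> L2_space M" and v: "\<And>s. s \<in> I \<Longrightarrow> v s \<in> L2_space M"
    and L: "f \<in> L2_space M" "g \<in> L2_space M" "f' \<in> L2_space M" "g' \<in> L2_space M"
    and R: "same_coeffs M I u v f g" "same_coeffs M I u v f' g'"
  shows "same_coeffs M I u v (\<lambda>x. a * f x + b * f' x) (\<lambda>x. a * g x + b * g' x)"
  unfolding same_coeffs_def
proof (intro allI impI)
  fix e :: real assume e: "e > 0"
  define K where "K = cmod a + cmod b + 1"
  have K: "K > 0" by (simp add: K_def add_nonneg_pos)
  have eK: "e / K > 0" using e K by simp
  obtain S c where S: "finite S" "S \<subseteq> I" "nrm M (\<lambda>x. f x - (\<Sum>s\<in>S. c s * u s x)) < e / K"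
      "nrm M (\<lambda>x. g x - (\<Sum>s\<in>S. c s * v s x)) < e / K"
    using R(1) eK unfolding same_coeffs_def by meson
  obtain T d where T: "finite T" "T \<subseteq> I" "nrm M (\<lambda>x. f' x - (\<Sum>s\<in>T. d s * u s x)) < e / K"
      "nrm M (\<lambda>x. g' x - (\<Sum>s\<in>T. d s * v s x)) < e / K"
    using R(2) eK unfolding same_coeffs_def by meson
  let ?c = "\<lambda>s. a * (if s \<in> S then c s else 0) + b * (if s \<in> T then d s else 0)"
  have *: "nrm M (\<lambda>x. (a * f x + b * f' x) - (\<Sum>s\<in>S \<union> T. ?c s * u s x)) < e"
    if "\<And>s. s \<in> I \<Longrightarrow> u s \<in> L2_space M" "f \<in> L2_space M" "f' \<in> L2_space M"
      "nrm M (\<lambda>x. f x - (\<Sum>s\<in>S. c s * u s x)) < e / K" "nrm M (\<lambda>x. f' x - (\<Sum>s\<in>T. d s * u s x)) < e / K"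
    for u f f'
  proof -
    have L: "(\<lambda>x. f x - (\<Sum>s\<in>S. c s * u s x)) \<in> L2_space M" "(\<lambda>x. f' x - (\<Sum>s\<in>T. d s * u s x)) \<in> L2_space M"
      using S T that by (auto intro!: L2_diff L2_comb)
    have "nrm M (\<lambda>x. (a * f x + b * f' x) - (\<Sum>s\<in>S \<union> T. ?c s * u s x))
      = nrm M (\<lambda>x. a * (f x - (\<Sum>s\<in>S. c s * u s x)) + b * (f' x - (\<Sum>s\<in>T. d s * u s x)))"
      unfolding comb_add[OF S(1) T(1)] by (simp add: algebra_simps)
    also have "\<dots> \<le> cmod a * (e / K) + cmod b * (e / K)"
      using that by (intro order_trans[OF nrm_lin_comb_le[OF L]] add_mono mult_left_mono) auto
    also have "\<dots> = (cmod a + cmod b) * (e / K)" by (rule distrib_right[symmetric])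
    also have "\<dots> < K * (e / K)" using e K by (intro mult_strict_right_mono) (auto simp: K_def)
    finally show ?thesis using K by simp
  qed
  show "\<exists>S c. finite S \<and> S \<subseteq> I \<and> nrm M (\<lambda>x. (a * f x + b * f' x) - (\<Sum>s\<in>S. c s * u s x)) < e \<and>
      nrm M (\<lambda>x. (a * g x + b * g' x) - (\<Sum>s\<in>S. c s * v s x)) < e"
    using S T *[of u f f'] *[of v g g'] u v L
    by (intro exI[of _ "S \<union> T"] exI[of _ ?c]) auto
qed

locale isometric_families =
  fixes M :: "'a measure" and I :: "'i set" and u v :: "'i \<Rightarrow> 'a \<Rightarrow> complex"
  assumes u: "\<And>s. s \<in> I \<Longrightarrow> u s \<in> L2_space M" and v: "\<And>s. s \<in> I \<Longrightarrow> v s \<in> L2_space M"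
    and gram: "\<And>s t. s \<in> I \<Longrightarrow> t \<in> I \<Longrightarrow> ip M (u s) (u t) = ip M (v s) (v t)"
    and dense_u: "clspan M I u = L2_space M" and dense_v: "clspan M I v = L2_space M"
begin

lemma swap: "isometric_families M I v u"
  by unfold_locales (use u v gram dense_u dense_v in auto)

lemma nrm_comb_eq:
  assumes "S \<subseteq> I"
  shows "nrm M (\<lambda>x. \<Sum>s\<in>S. c s * u s x) = nrm M (\<lambda>x. \<Sum>s\<in>S. c s * v s x)"
proof -
  have "complex_of_real ((nrm M (\<lambda>x. \<Sum>s\<in>S. c s * u s x))\<^sup>2) = of_real ((nrm M (\<lambda>x. \<Sum>s\<in>S. c s * v s x))\<^sup>2)"
    using assms u v gram
    by (subst (1 2) nrm_comb_sq) (auto intro!: sum.cong simp: subset_eq)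
  then have "(nrm M (\<lambda>x. \<Sum>s\<in>S. c s * u s x))\<^sup>2 = (nrm M (\<lambda>x. \<Sum>s\<in>S. c s * v s x))\<^sup>2"
    unfolding of_real_eq_iff .
  then show ?thesis by (rule power2_eq_imp_eq) auto
qed

lemma same_coeffs_nrm:
  assumes "f \<in> L2_space M" "g \<in> L2_space M" "same_coeffs M I u v f g"
  shows "nrm M f = nrm M g"
proof -
  have "\<bar>nrm M f - nrm M g\<bar> \<le> e" if e: "e > 0" for e
  proof -
    obtain S c where S: "finite S" "S \<subseteq> I" "nrm M (\<lambda>x. f x - (\<Sum>s\<in>S. c s * u s x)) < e / 2"
      "nrm M (\<lambda>x. g x - (\<Sum>s\<in>S. c s * v s x)) < e / 2"
      using assms(3) half_gt_zero[OF e] unfolding same_coeffs_def by blast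
    have "(\<lambda>x. \<Sum>s\<in>S. c s * u s x) \<in> L2_space M" "(\<lambda>x. \<Sum>s\<in>S. c s * v s x) \<in> L2_space M"
      using S u v by (auto intro!: L2_comb)
    from nrm_diff_ge[OF assms(1) this(1)] nrm_diff_ge[OF assms(2) this(2)] S nrm_comb_eq[OF S(2), of c]
    show ?thesis by linarith
  qed
  then have "\<bar>nrm M f - nrm M g\<bar> \<le> 0" by (rule field_le_epsilon) simp
  then show ?thesis by simp
qed

text \<open>Coefficients approximating f along u give a Cauchy sequence along v, because
  combinations with the same coefficients have the same norm; its limit is the partner of f.\<close>

lemma same_coeffs_total:
  assumes f: "f \<in> L2_space M"
  shows "\<exists>g\<in>L2_space M. same_coeffs M I u v f g"
proof -
  \<comment> \<open>Half of 2^-n, so that two consecutive errors add up to at most 2^-n, the rate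
    that \<open>L2_complete\<close> asks for. Support and coefficients form a pair to allow a single
    choice.\<close>
  have "\<forall>n. \<exists>p. finite (fst p) \<and> fst p \<subseteq> I \<and>
      nrm M (\<lambda>x. f x - (\<Sum>s\<in>fst p. snd p s * u s x)) < (1/2) ^ n / 2"
  proof
    fix n
    have fcl: "f \<in> clspan M I u" using f dense_u by simp
    have "(1/2::real) ^ n / 2 > 0" by simp
    from clspan_approx[OF fcl this] obtain S c where "finite S" "S \<subseteq> I"
      "nrm M (\<lambda>x. f x - (\<Sum>s\<in>S. c s * u s x)) < (1/2) ^ n / 2" .
    then show "\<exists>p. finite (fst p) \<and> fst p \<subseteq> I \<and>
        nrm M (\<lambda>x. f x - (\<Sum>s\<in>fst p. snd p s * u s x)) < (1/2) ^ n / 2"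
      by (intro exI[of _ "(S, c)"]) simp
  qed
  from choice[OF this] obtain p where p: "\<And>n. finite (fst (p n))" "\<And>n. fst (p n) \<subseteq> I"
    "\<And>n. nrm M (\<lambda>x. f x - (\<Sum>s\<in>fst (p n). snd (p n) s * u s x)) < (1/2) ^ n / 2" by blast
  define S c where "S n = fst (p n)" and "c n = snd (p n)" for n
  have S: "\<And>n. finite (S n)" "\<And>n. S n \<subseteq> I"
    and cl: "\<And>n. nrm M (\<lambda>x. f x - (\<Sum>s\<in>S n. c n s * u s x)) < (1/2) ^ n / 2"
    using p by (simp_all add: S_def c_def)
  define U where "U n x = (\<Sum>s\<in>S n. c n s * u s x)" for n x
  define V where "V n x = (\<Sum>s\<in>S n. c n s * v s x)" for n x
  have UL: "U n \<in> L2_space M" and VL: "V n \<in> L2_space M" for n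
    unfolding U_def[abs_def] V_def[abs_def] using subsetD[OF S(2)] u v by (auto intro!: L2_comb)
  have cl: "nrm M (\<lambda>x. f x - U n x) < (1/2) ^ n / 2" for n
    using cl by (simp add: U_def)
  have "nrm M (\<lambda>x. V (Suc n) x - V n x) \<le> (1/2) ^ n" for n
  proof -
    \<comment> \<open>The increment of V is one combination over the union of two supports; only in
      this form does \<open>nrm_comb_eq\<close> turn it into the increment of U.\<close>
    let ?c = "\<lambda>s. 1 * (if s \<in> S (Suc n) then c (Suc n) s else 0) + (-1) * (if s \<in> S n then c n s else 0)"
    have "nrm M (\<lambda>x. V (Suc n) x - V n x) = nrm M (\<lambda>x. \<Sum>s\<in>S (Suc n) \<union> S n. ?c s * v s x)"
      unfolding comb_add[OF S(1) S(1)] V_def by simp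
    also have "\<dots> = nrm M (\<lambda>x. \<Sum>s\<in>S (Suc n) \<union> S n. ?c s * u s x)"
      using S by (intro nrm_comb_eq[symmetric]) auto
    also have "\<dots> = nrm M (\<lambda>x. U (Suc n) x - U n x)"
      unfolding comb_add[OF S(1) S(1)] U_def by simp
    also have "\<dots> \<le> nrm M (\<lambda>x. f x - U (Suc n) x) + nrm M (\<lambda>x. f x - U n x)"
      using nrm_triangle_diff[OF UL f UL, of "Suc n" n] by (simp add: nrm_minus_commute[of M f])
    also have "\<dots> \<le> (1/2) ^ n"
      using cl[of n] cl[of "Suc n"] by (simp add: field_simps) (use zero_less_power[of "2::real" n] in linarith)?
    finally show ?thesis .
  qed
  from L2_complete[OF VL this] obtain g where g: "g \<in> L2_space M" "\<And>n. nrm M (\<lambda>x. g x - V n x) \<le> 2 * (1/2) ^ n"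
    by auto
  have "same_coeffs M I u v f g"
    unfolding same_coeffs_def
  proof (intro allI impI)
    fix e :: real assume "e > 0"
    then obtain n where n: "(1/2::real) ^ n < e / 2"
      using real_arch_pow_inv[of "e/2" "1/2"] by auto
    have "nrm M (\<lambda>x. f x - U n x) < e" "nrm M (\<lambda>x. g x - V n x) < e"
      using n cl[of n] g(2)[of n] \<open>e > 0\<close> by linarith+
    then show "\<exists>S c. finite S \<and> S \<subseteq> I \<and> nrm M (\<lambda>x. f x - (\<Sum>s\<in>S. c s * u s x)) < e \<and>
        nrm M (\<lambda>x. g x - (\<Sum>s\<in>S. c s * v s x)) < e"
      using S unfolding U_def V_def by blast
  qed
  with g show ?thesis by blast
qed

text \<open>By linearity 0 is related to g - g', and related functions have equal norms.\<close>

lemma same_coeffs_unique: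
  assumes L: "f \<in> L2_space M" "g \<in> L2_space M" "g' \<in> L2_space M"
    and R: "same_coeffs M I u v f g" "same_coeffs M I u v f g'"
  shows "AE x in M. g x = g' x"
proof -
  have "same_coeffs M I u v (\<lambda>x. 1 * f x + (-1) * f x) (\<lambda>x. 1 * g x + (-1) * g' x)"
    by (intro same_coeffs_lin_comb u v L R)
  then have "nrm M (\<lambda>x. g x - g' x) = nrm M (\<lambda>x. 0)"
    using same_coeffs_nrm[OF L2_zero L2_diff[OF L(2,3)]] by simp
  then have "nrm M (\<lambda>x. g x - g' x) = 0" by (simp add: nrm_def)
  then show ?thesis using nrm_eq_0_iff[OF L2_diff[OF L(2,3)]] by simp
qed

text \<open>Existence and uniqueness of partners make the relation an operator. For surjectivity a
  preimage is found by exchanging the families.\<close>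

lemma unitary_extension: "\<exists>U. unitary_on_L2 M U \<and> (\<forall>s\<in>I. AE x in M. U (u s) x = v s x)"
proof -
  define U where "U f = (SOME g. g \<in> L2_space M \<and> same_coeffs M I u v f g)" for f
  have U: "U f \<in> L2_space M" "same_coeffs M I u v f (U f)" if "f \<in> L2_space M" for f
    using someI_ex[of "\<lambda>g. g \<in> L2_space M \<and> same_coeffs M I u v f g"] same_coeffs_total[OF that]
    unfolding U_def by auto
  have "unitary_on_L2 M U"
    unfolding unitary_on_L2_def
  proof (intro conjI ballI allI)
    fix f assume f: "f \<in> L2_space M"
    show "U f \<in> L2_space M" by (rule U[OF f])
    show "L2_norm M (U f) = L2_norm M f"
      using same_coeffs_nrm[OF f U[OF f]] by (simp add: L2_norm_eq_nrm f U)
  next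
    fix f g c d assume f: "f \<in> L2_space M" and g: "g \<in> L2_space M"
    have L: "(\<lambda>y. c * f y + d * g y) \<in> L2_space M" "(\<lambda>y. c * U f y + d * U g y) \<in> L2_space M"
      by (intro L2_add L2_scale f g U(1))+
    show "AE x in M. U (\<lambda>y. c * f y + d * g y) x = c * U f x + d * U g x"
      by (rule same_coeffs_unique[OF L(1) U(1)[OF L(1)] L(2) U(2)[OF L(1)]
            same_coeffs_lin_comb[OF u v f U(1)[OF f] g U(1)[OF g] U(2)[OF f] U(2)[OF g]]])
  next
    fix g assume g: "g \<in> L2_space M"
    obtain f where f: "f \<in> L2_space M" "same_coeffs M I v u g f"
      using isometric_families.same_coeffs_total[OF swap g] by blast
    from same_coeffs_unique[OF f(1) U(1)[OF f(1)] g U(2)[OF f(1)] same_coeffs_sym[OF f(2)]] f(1)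
    show "\<exists>f\<in>L2_space M. AE x in M. U f x = g x" by blast
  qed
  moreover have "AE x in M. U (u s) x = v s x" if "s \<in> I" for s
    by (rule same_coeffs_unique[OF u[OF that] U(1)[OF u[OF that]] v[OF that] U(2)[OF u[OF that]]
          same_coeffs_base[OF that]])
  ultimately show ?thesis by blast
qed

end

section \<open>Dunkl harmonic polynomials\<close>

abbreviation dder :: "'a::real_normed_vector \<Rightarrow> ('a \<Rightarrow> 'b::real_normed_vector) \<Rightarrow> 'a \<Rightarrow> 'b" where
  "dder v f x \<equiv> frechet_derivative f (at x) v"

lemma dderI: "(f has_derivative f') (at x) \<Longrightarrow> dder v f x = f' v"
  by (metis frechet_derivative_at)

lemma has_derivative_dder:
  "f differentiable (at x) \<Longrightarrow> (f has_derivative (\<lambda>v. dder v f x)) (at x)"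
  by (simp add: frechet_derivative_works)

lemma dder_const: "dder v (\<lambda>x. c) x = 0"
  by (rule dderI) (auto intro!: derivative_eq_intros)

lemma dder_inner: "dder v (\<lambda>x. b \<bullet> x) x = b \<bullet> v"
  by (rule dderI) (auto intro!: derivative_eq_intros)

lemma dder_norm_sq: "dder v (\<lambda>x. (norm x)\<^sup>2) x = 2 * (v \<bullet> x)"
proof (rule dderI)
  show "((\<lambda>x. (norm x)\<^sup>2) has_derivative (\<lambda>v. 2 * (v \<bullet> x))) (at x)"
    unfolding power2_norm_eq_inner
    by (rule has_derivative_eq_rhs[OF has_derivative_inner[OF has_derivative_ident has_derivative_ident]])
      (auto simp: inner_commute)
qed

lemma dder_add:
  assumes "f differentiable (at x)" "g differentiable (at x)"
  shows "dder v (\<lambda>x. f x + g x) x = dder v f x + dder v g x"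
  by (rule dderI) (intro has_derivative_add has_derivative_dder assms)

lemma dder_mult:
  fixes f g :: "'a::real_normed_vector \<Rightarrow> real"
  assumes "f differentiable (at x)" "g differentiable (at x)"
  shows "dder v (\<lambda>x. f x * g x) x = dder v f x * g x + f x * dder v g x"
  using dderI[OF has_derivative_mult[OF has_derivative_dder[OF assms(1)] has_derivative_dder[OF assms(2)]], of v]
  by simp

lemma dder_bounded_linear:
  assumes "bounded_linear T" "f differentiable (at x)"
  shows "dder v (\<lambda>x. T (f x)) x = T (dder v f x)"
  by (rule dderI) (intro bounded_linear.has_derivative[OF assms(1)] has_derivative_dder assms)

lemma dder_bounded_linear_self: "bounded_linear T \<Longrightarrow> dder v T x = T v"
  by (rule dderI) (rule bounded_linear_imp_has_derivative)

lemma differentiable_real_poly: "real_polynomial_function f \<Longrightarrow> f differentiable (at x)"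
  by (rule differentiable_at_real_polynomial_function)

lemma real_polynomial_function_dder:
  "real_polynomial_function p \<Longrightarrow> real_polynomial_function (dder v p)"
proof (induction rule: real_polynomial_function.induct)
  case (linear f)
  then have "dder v f = (\<lambda>x. f v)" by (auto simp: dder_bounded_linear_self)
  then show ?case by (simp add: real_polynomial_function.intros(2))
next
  case (const c)
  then show ?case by (simp add: dder_const[abs_def] real_polynomial_function.intros(2))
next
  case (add f g)
  then have "dder v (\<lambda>x. f x + g x) = (\<lambda>x. dder v f x + dder v g x)"
    by (auto simp: dder_add differentiable_real_poly)
  with add show ?case by (simp add: real_polynomial_function.intros(3))
next
  case (mult f g)
  then have "dder v (\<lambda>x. f x * g x) = (\<lambda>x. dder v f x * g x + f x * dder v g x)"
    by (auto simp: dder_mult differentiable_real_poly)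
  with mult show ?case by (auto intro!: real_polynomial_function.intros(2-4))
qed

lemma polynomial_function_dder:
  fixes p :: "'a::real_normed_vector \<Rightarrow> 'b::euclidean_space"
  assumes "polynomial_function p"
  shows "polynomial_function (dder v p)"
  unfolding polynomial_function_def
proof (intro allI impI)
  fix T :: "'b \<Rightarrow> real" assume T: "bounded_linear T"
  then have "T \<circ> dder v p = dder v (T \<circ> p)"
    using assms by (auto simp: o_def dder_bounded_linear differentiable_at_polynomial_function)
  moreover have "real_polynomial_function (T \<circ> p)"
    using assms T by (auto simp: polynomial_function_def)
  ultimately show "real_polynomial_function (T \<circ> dder v p)"
    by (simp add: real_polynomial_function_dder)
qed

text \<open>Used with the real part, the imaginary part and the embedding of the reals, to move
  harmonicity between real and complex polynomials.\<close>

lemma dunkl_laplacian_bounded_linear: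
  fixes p :: "'a::euclidean_space \<Rightarrow> 'b::euclidean_space"
  assumes T: "bounded_linear T" and p: "polynomial_function p"
  shows "dunkl_laplacian Rp k (\<lambda>x. T (p x)) x = T (dunkl_laplacian Rp k p x)"
proof -
  interpret T: bounded_linear T by (rule T)
  have 1: "dder v (\<lambda>x. T (p x)) = (\<lambda>x. T (dder v p x))" for v
    using p by (auto simp: dder_bounded_linear[OF T] differentiable_at_polynomial_function)
  have 2: "dder v (\<lambda>x. T (dder v p x)) x = T (dder v (dder v p) x)" for v x
    using polynomial_function_dder[OF p]
    by (auto simp: dder_bounded_linear[OF T] differentiable_at_polynomial_function)
  show ?thesis
    unfolding dunkl_laplacian_def laplacian_def fun_cong[OF 1] 2
    by (simp add: T.add T.sum T.scaleR T.diff)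
qed

section \<open>Homogeneous polynomials and divided differences\<close>

text \<open>The degree is an integer so that differentiation lowers it by one
  without exception; the only polynomial of negative degree is zero.\<close>

inductive hpoly :: "int \<Rightarrow> ('a::euclidean_space \<Rightarrow> real) \<Rightarrow> bool" where
  zero: "hpoly d (\<lambda>x. 0)"
| const: "hpoly 0 (\<lambda>x. c)"
| inner: "hpoly 1 (\<lambda>x. b \<bullet> x)"
| add: "hpoly d p \<Longrightarrow> hpoly d q \<Longrightarrow> hpoly d (\<lambda>x. p x + q x)"
| mult: "hpoly d p \<Longrightarrow> hpoly e q \<Longrightarrow> hpoly (d + e) (\<lambda>x. p x * q x)"

lemma hpoly_poly: "hpoly d p \<Longrightarrow> real_polynomial_function p"
  by (induction rule: hpoly.induct)
    (auto intro!: real_polynomial_function.intros(2-4) intro: real_polynomial_function.intros(1)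
      bounded_linear_inner_right)

lemma hpoly_differentiable: "hpoly d p \<Longrightarrow> p differentiable (at x)"
  by (rule differentiable_real_poly[OF hpoly_poly])

lemma hpoly_neg: "hpoly d p \<Longrightarrow> d < 0 \<Longrightarrow> p x = 0"
proof (induction rule: hpoly.induct)
  case (mult d p e q)
  then have "d < 0 \<or> e < 0" by auto
  with mult show ?case by auto
qed auto

lemma hpoly_hom: "hpoly d p \<Longrightarrow> d \<ge> 0 \<Longrightarrow> p (t *\<^sub>R x) = t ^ nat d * p x"
proof (induction rule: hpoly.induct)
  case (mult d p e q)
  show ?case
  proof (cases "d \<ge> 0 \<and> e \<ge> 0")
    case True
    with mult show ?thesis by (simp add: nat_add_distrib power_add)
  next
    case False
    with mult.hyps hpoly_neg show ?thesis by (metis linorder_not_le mult_zero_left mult_zero_right)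
  qed
qed (auto simp: algebra_simps)

lemma hpoly_mult': "hpoly d p \<Longrightarrow> hpoly e q \<Longrightarrow> f = d + e \<Longrightarrow> hpoly f (\<lambda>x. p x * q x)"
  by (simp add: hpoly.mult)

lemma hpoly_scale: "hpoly d p \<Longrightarrow> hpoly d (\<lambda>x. c * p x)"
  using hpoly.mult[OF hpoly.const] by fastforce

lemma hpoly_diff: "hpoly d p \<Longrightarrow> hpoly d q \<Longrightarrow> hpoly d (\<lambda>x. p x - q x)"
  using hpoly.add[OF _ hpoly_scale[of d q "-1"]] by simp

lemma hpoly_sum: "(\<And>i. i \<in> S \<Longrightarrow> hpoly d (p i)) \<Longrightarrow> hpoly d (\<lambda>x. \<Sum>i\<in>S. p i x)"
  by (induction S rule: infinite_finite_induct) (auto intro: hpoly.intros)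

lemma hpoly_norm_sq: "hpoly 2 (\<lambda>x::'a::euclidean_space. (norm x)\<^sup>2)"
proof -
  have "hpoly 2 (\<lambda>x::'a. \<Sum>b\<in>Basis. (b \<bullet> x) * (b \<bullet> x))"
    by (intro hpoly_sum hpoly_mult'[of 1 _ 1] hpoly.inner) auto
  moreover have "(\<Sum>b\<in>Basis. (b \<bullet> x) * (b \<bullet> x)) = (norm x)\<^sup>2" for x :: 'a
    unfolding power2_norm_eq_inner euclidean_inner[of x x] by (simp add: inner_commute)
  ultimately show ?thesis by simp
qed

lemma hpoly_norm_pow:
  assumes "hpoly d p"
  shows "hpoly (d + 2 * int j) (\<lambda>x. norm x ^ (2 * j) * p x)"
proof (induction j)
  case (Suc j)
  show ?case
    using hpoly.mult[OF hpoly_norm_sq Suc] by (simp add: algebra_simps power2_eq_square)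
qed (use assms in auto)

lemma hpoly_reflection: "hpoly d p \<Longrightarrow> hpoly d (\<lambda>x. p (root_reflection \<alpha> x))"
proof (induction rule: hpoly.induct)
  case (inner b)
  have "hpoly 1 (\<lambda>x. b \<bullet> x + (- (2 * (b \<bullet> \<alpha>)) / (norm \<alpha>)\<^sup>2) * (\<alpha> \<bullet> x))"
    by (intro hpoly.add hpoly_scale hpoly.inner)
  moreover have "b \<bullet> root_reflection \<alpha> x = b \<bullet> x + (- (2 * (b \<bullet> \<alpha>)) / (norm \<alpha>)\<^sup>2) * (\<alpha> \<bullet> x)" for x
    by (simp add: root_reflection_def inner_diff_right)
  ultimately show ?case by simp
qed (auto intro: hpoly.intros)

lemma hpoly_dder: "hpoly d p \<Longrightarrow> hpoly (d - 1) (dder v p)"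
proof (induction rule: hpoly.induct)
  case (zero d)
  then show ?case by (simp add: dder_const[abs_def] hpoly.zero)
next
  case (const c)
  then show ?case by (simp add: dder_const[abs_def] hpoly.zero)
next
  case (inner b)
  then show ?case using hpoly.const by (simp add: dder_inner[abs_def])
next
  case (add d p q)
  then have "dder v (\<lambda>x. p x + q x) = (\<lambda>x. dder v p x + dder v q x)"
    by (auto simp: dder_add hpoly_differentiable)
  with add show ?case by (simp add: hpoly.add)
next
  case (mult d p e q)
  then have "dder v (\<lambda>x. p x * q x) = (\<lambda>x. dder v p x * q x + p x * dder v q x)"
    by (auto simp: dder_mult hpoly_differentiable)
  moreover have "hpoly (d + e - 1) (\<lambda>x. dder v p x * q x)" "hpoly (d + e - 1) (\<lambda>x. p x * dder v q x)"
    by (rule hpoly_mult'[OF mult.IH(1) mult.hyps(2)], simp, rule hpoly_mult'[OF mult.hyps(1) mult.IH(2)], simp)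
  ultimately show ?case by (simp add: hpoly.add)
qed

lemma hpoly_euler: "hpoly d p \<Longrightarrow> dder x p x = of_int d * p x"
proof (induction rule: hpoly.induct)
  case (mult d p e q)
  then show ?case by (simp add: dder_mult hpoly_differentiable algebra_simps)
qed (auto simp: dder_const dder_inner dder_add hpoly_differentiable algebra_simps)

lemma norm_root_reflection: "norm (root_reflection \<alpha> x) = norm x"
proof (cases "\<alpha> = 0")
  case False
  have "root_reflection \<alpha> x \<bullet> root_reflection \<alpha> x = x \<bullet> x"
    using False by (simp add: root_reflection_def inner_diff_left inner_diff_right inner_commute
        power2_norm_eq_inner)
  then show ?thesis by (simp add: norm_eq_sqrt_inner)
qed (simp add: root_reflection_def)

text \<open>The second identity says that the numerator of the singular part of \<open>\<Delta>\<^sub>k p\<close> is divisible by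
  \<open>\<langle>\<alpha>, x\<rangle>\<close> once more.\<close>

lemma hpoly_divided_difference:
  assumes "hpoly d p" "\<alpha> \<noteq> 0"
  shows "\<exists>q n. hpoly (d - 1) q \<and> hpoly (d - 2) n \<and>
    (\<forall>x. p x - p (root_reflection \<alpha> x) = (\<alpha> \<bullet> x) * q x) \<and>
    (\<forall>x. 2 * dder \<alpha> p x - (norm \<alpha>)\<^sup>2 * q x = (\<alpha> \<bullet> x) * n x)"
  using assms(1)
proof (induction rule: hpoly.induct)
  case (zero d)
  show ?case by (intro exI[of _ "\<lambda>x. 0"]) (auto simp: dder_const hpoly.zero)
next
  case (const c)
  show ?case by (intro exI[of _ "\<lambda>x. 0"]) (auto simp: dder_const hpoly.zero)
next
  case (inner b)
  have "hpoly (1 - 1) (\<lambda>x. 2 * (b \<bullet> \<alpha>) / (norm \<alpha>)\<^sup>2)" using hpoly.const by simp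
  then show ?case
    using assms(2) by (intro exI[of _ "\<lambda>x. 2 * (b \<bullet> \<alpha>) / (norm \<alpha>)\<^sup>2"] exI[of _ "\<lambda>x. 0"])
      (auto simp: dder_inner hpoly.zero root_reflection_def inner_diff_right)
next
  case (add d p q)
  from add.IH(1) obtain qp np where p: "hpoly (d - 1) qp" "hpoly (d - 2) np"
    "\<And>x. p x - p (root_reflection \<alpha> x) = (\<alpha> \<bullet> x) * qp x"
    "\<And>x. 2 * dder \<alpha> p x - (norm \<alpha>)\<^sup>2 * qp x = (\<alpha> \<bullet> x) * np x" by blast
  from add.IH(2) obtain qq nq where q: "hpoly (d - 1) qq" "hpoly (d - 2) nq"
    "\<And>x. q x - q (root_reflection \<alpha> x) = (\<alpha> \<bullet> x) * qq x"
    "\<And>x. 2 * dder \<alpha> q x - (norm \<alpha>)\<^sup>2 * qq x = (\<alpha> \<bullet> x) * nq x" by blast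
  have "p x + q x - (p (root_reflection \<alpha> x) + q (root_reflection \<alpha> x)) = (\<alpha> \<bullet> x) * (qp x + qq x)"
    "2 * dder \<alpha> (\<lambda>x. p x + q x) x - (norm \<alpha>)\<^sup>2 * (qp x + qq x) = (\<alpha> \<bullet> x) * (np x + nq x)" for x
    using p(3)[of x] q(3)[of x] p(4)[of x] q(4)[of x]
    by (simp_all add: dder_add hpoly_differentiable[OF add.hyps(1)] hpoly_differentiable[OF add.hyps(2)]
        algebra_simps)
  then show ?case
    by (intro exI[of _ "\<lambda>x. qp x + qq x"] exI[of _ "\<lambda>x. np x + nq x"])
      (auto intro: hpoly.add p q)
next
  case (mult d p e q)
  from mult.IH(1) obtain qp np where p: "hpoly (d - 1) qp" "hpoly (d - 2) np"
    "\<And>x. p x - p (root_reflection \<alpha> x) = (\<alpha> \<bullet> x) * qp x"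
    "\<And>x. 2 * dder \<alpha> p x - (norm \<alpha>)\<^sup>2 * qp x = (\<alpha> \<bullet> x) * np x" by blast
  from mult.IH(2) obtain qq nq where q: "hpoly (e - 1) qq" "hpoly (e - 2) nq"
    "\<And>x. q x - q (root_reflection \<alpha> x) = (\<alpha> \<bullet> x) * qq x"
    "\<And>x. 2 * dder \<alpha> q x - (norm \<alpha>)\<^sup>2 * qq x = (\<alpha> \<bullet> x) * nq x" by blast
  \<comment> \<open>Twisted Leibniz rule: \<open>qq\<close> is multiplied by p at the reflected
    point. Replacing that value by \<open>p x\<close> costs (alpha . x) \<open>qp x\<close>, which
    is where the last term of \<open>?n\<close> comes from.\<close>
  let ?q = "\<lambda>x. qp x * q x + p (root_reflection \<alpha> x) * qq x"
  let ?n = "\<lambda>x. (np x * q x + p x * nq x) + (norm \<alpha>)\<^sup>2 * (qp x * qq x)"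
  have "hpoly (d + e - 1) ?q"
    by (intro hpoly.add hpoly_mult'[OF p(1) mult.hyps(2)]
        hpoly_mult'[OF hpoly_reflection[OF mult.hyps(1)] q(1)]) auto
  moreover have "hpoly (d + e - 2) ?n"
    by (intro hpoly.add hpoly_scale hpoly_mult'[OF p(2) mult.hyps(2)] hpoly_mult'[OF mult.hyps(1) q(2)]
        hpoly_mult'[OF p(1) q(1)]) auto
  moreover have "p x * q x - p (root_reflection \<alpha> x) * q (root_reflection \<alpha> x) = (\<alpha> \<bullet> x) * ?q x" for x
  proof -
    have "p x * q x - p (root_reflection \<alpha> x) * q (root_reflection \<alpha> x) =
      (p x - p (root_reflection \<alpha> x)) * q x + p (root_reflection \<alpha> x) * (q x - q (root_reflection \<alpha> x))"
      by (simp add: algebra_simps)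
    then show ?thesis by (simp add: p(3) q(3) algebra_simps)
  qed
  moreover have "2 * dder \<alpha> (\<lambda>x. p x * q x) x - (norm \<alpha>)\<^sup>2 * ?q x = (\<alpha> \<bullet> x) * ?n x" for x
  proof -
    have eq: "2 * dder \<alpha> (\<lambda>x. p x * q x) x - (norm \<alpha>)\<^sup>2 * ?q x =
      (2 * dder \<alpha> p x - (norm \<alpha>)\<^sup>2 * qp x) * q x + p x * (2 * dder \<alpha> q x - (norm \<alpha>)\<^sup>2 * qq x)
      + (norm \<alpha>)\<^sup>2 * ((p x - p (root_reflection \<alpha> x)) * qq x)"
      by (simp add: dder_mult hpoly_differentiable[OF mult.hyps(1)] hpoly_differentiable[OF mult.hyps(2)]
          algebra_simps)
    show ?thesis unfolding eq p(3,4) q(4) by (simp add: algebra_simps)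
  qed
  ultimately show ?case by (intro exI[of _ ?q] exI[of _ ?n]) blast
qed

lemma hpoly_laplacian: "hpoly d p \<Longrightarrow> hpoly (d - 2) (laplacian p)"
  unfolding laplacian_def[abs_def]
  using hpoly_dder[OF hpoly_dder] by (intro hpoly_sum) fastforce

text \<open>Writing p - p o r = (alpha . x) q turns the summand of the root alpha into (2 dp -
  |alpha|^2 q) / (alpha . x), and the second identity of \<open>hpoly_divided_difference\<close>
  removes this denominator as well.\<close>

lemma hpoly_dunkl_laplacian:
  assumes "hpoly d p" "0 \<notin> Rp"
  shows "\<exists>r. hpoly (d - 2) r \<and> (\<forall>x. (\<forall>\<alpha>\<in>Rp. \<alpha> \<bullet> x \<noteq> 0) \<longrightarrow> dunkl_laplacian Rp k p x = r x)"
proof -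
  have "\<forall>\<alpha>. \<exists>n. \<alpha> \<in> Rp \<longrightarrow> hpoly (d - 2) n \<and> (\<forall>x. \<alpha> \<bullet> x \<noteq> 0 \<longrightarrow>
     (2 / (\<alpha> \<bullet> x)) * dder \<alpha> p x - ((norm \<alpha>)\<^sup>2 / (\<alpha> \<bullet> x)\<^sup>2) * (p x - p (root_reflection \<alpha> x)) = n x)"
  proof (rule allI)
    fix \<alpha>
    show "\<exists>n. \<alpha> \<in> Rp \<longrightarrow> hpoly (d - 2) n \<and> (\<forall>x. \<alpha> \<bullet> x \<noteq> 0 \<longrightarrow>
     (2 / (\<alpha> \<bullet> x)) * dder \<alpha> p x - ((norm \<alpha>)\<^sup>2 / (\<alpha> \<bullet> x)\<^sup>2) * (p x - p (root_reflection \<alpha> x)) = n x)"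
    proof (cases "\<alpha> \<in> Rp")
      case True
      then have "\<alpha> \<noteq> 0" using assms by auto
      from hpoly_divided_difference[OF assms(1) this] obtain q n where
        n: "hpoly (d - 2) n" "\<And>x. p x - p (root_reflection \<alpha> x) = (\<alpha> \<bullet> x) * q x"
        "\<And>x. 2 * dder \<alpha> p x - (norm \<alpha>)\<^sup>2 * q x = (\<alpha> \<bullet> x) * n x" by blast
      have "(2 / (\<alpha> \<bullet> x)) * dder \<alpha> p x - ((norm \<alpha>)\<^sup>2 / (\<alpha> \<bullet> x)\<^sup>2) * (p x - p (root_reflection \<alpha> x)) = n x"
        if "\<alpha> \<bullet> x \<noteq> 0" for x
      proof -
        have "(2 / (\<alpha> \<bullet> x)) * dder \<alpha> p x - ((norm \<alpha>)\<^sup>2 / (\<alpha> \<bullet> x)\<^sup>2) * (p x - p (root_reflection \<alpha> x))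
          = (2 * dder \<alpha> p x - (norm \<alpha>)\<^sup>2 * q x) / (\<alpha> \<bullet> x)"
          unfolding n(2) using that by (simp add: power2_eq_square field_simps)
        then show ?thesis unfolding n(3) using that by simp
      qed
      with n(1) show ?thesis by blast
    qed auto
  qed
  from choice[OF this] obtain n where n: "\<And>\<alpha>. \<alpha> \<in> Rp \<Longrightarrow> hpoly (d - 2) (n \<alpha>)"
    "\<And>\<alpha> x. \<alpha> \<in> Rp \<Longrightarrow> \<alpha> \<bullet> x \<noteq> 0 \<Longrightarrow> (2 / (\<alpha> \<bullet> x)) * dder \<alpha> p x -
      ((norm \<alpha>)\<^sup>2 / (\<alpha> \<bullet> x)\<^sup>2) * (p x - p (root_reflection \<alpha> x)) = n \<alpha> x" by blast
  have "hpoly (d - 2) (\<lambda>x. laplacian p x + (\<Sum>\<alpha>\<in>Rp. k \<alpha> * n \<alpha> x))"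
    by (intro hpoly.add hpoly_laplacian assms hpoly_sum hpoly_scale n)
  moreover have "dunkl_laplacian Rp k p x = laplacian p x + (\<Sum>\<alpha>\<in>Rp. k \<alpha> * n \<alpha> x)"
    if "\<forall>\<alpha>\<in>Rp. \<alpha> \<bullet> x \<noteq> 0" for x
    unfolding dunkl_laplacian_def using that n(2) by simp
  ultimately show ?thesis by blast
qed

lemma laplacian_lin_comb:
  assumes "real_polynomial_function p" "real_polynomial_function q"
  shows "laplacian (\<lambda>x. a * p x + b * q x) x = a * laplacian p x + b * laplacian q x"
proof -
  have 1: "dder v (\<lambda>x. a * p x + b * q x) x = a * dder v p x + b * dder v q x"
    if "p differentiable (at x)" "q differentiable (at x)" for v p q x
    by (rule dderI) (intro has_derivative_add has_derivative_mult_right has_derivative_dder that)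
  show ?thesis
    unfolding laplacian_def using assms
    by (simp add: 1 differentiable_real_poly real_polynomial_function_dder sum.distrib sum_distrib_left)
qed

lemma dunkl_laplacian_lin_comb:
  assumes "real_polynomial_function p" "real_polynomial_function q"
  shows "dunkl_laplacian Rp k (\<lambda>x. a * p x + b * q x) x =
    a * dunkl_laplacian Rp k p x + b * dunkl_laplacian Rp k q x"
proof -
  have 1: "dder v (\<lambda>x. a * p x + b * q x) x = a * dder v p x + b * dder v q x" for v x
    by (rule dderI)
      (intro has_derivative_add has_derivative_mult_right has_derivative_dder differentiable_real_poly assms)
  have "(\<Sum>\<alpha>\<in>Rp. k \<alpha> * (2 / (\<alpha> \<bullet> x) * (a * dder \<alpha> p x + b * dder \<alpha> q x) - (norm \<alpha>)\<^sup>2 / (\<alpha> \<bullet> x)\<^sup>2 *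
      (a * p x + b * q x - (a * p (root_reflection \<alpha> x) + b * q (root_reflection \<alpha> x)))))
    = a * (\<Sum>\<alpha>\<in>Rp. k \<alpha> * (2 / (\<alpha> \<bullet> x) * dder \<alpha> p x - (norm \<alpha>)\<^sup>2 / (\<alpha> \<bullet> x)\<^sup>2 * (p x - p (root_reflection \<alpha> x))))
    + b * (\<Sum>\<alpha>\<in>Rp. k \<alpha> * (2 / (\<alpha> \<bullet> x) * dder \<alpha> q x - (norm \<alpha>)\<^sup>2 / (\<alpha> \<bullet> x)\<^sup>2 * (q x - q (root_reflection \<alpha> x))))"
    unfolding sum_distrib_left sum.distrib[symmetric]
    by (intro sum.cong refl) (simp add: algebra_simps add_divide_distrib diff_divide_distrib)
  then show ?thesis
    unfolding dunkl_laplacian_def laplacian_lin_comb[OF assms] 1 by (simp add: algebra_simps)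
qed

section \<open>Commutation with powers of the norm and the Fischer decomposition\<close>

lemma laplacian_norm_sq_mult:
  fixes g :: "'a::euclidean_space \<Rightarrow> real"
  assumes "hpoly d g"
  shows "laplacian (\<lambda>x. (norm x)\<^sup>2 * g x) x =
    (norm x)\<^sup>2 * laplacian g x + (2 * real DIM('a) + 4 * of_int d) * g x"
proof -
  have g: "g differentiable (at x)" "dder b g differentiable (at x)" for b x
    using assms hpoly_dder hpoly_differentiable by blast+
  have ns: "(\<lambda>x::'a. (norm x)\<^sup>2) differentiable (at x)" for x
    by (rule hpoly_differentiable[OF hpoly_norm_sq])
  have 1: "dder b (\<lambda>x. (norm x)\<^sup>2 * g x) = (\<lambda>x. 2 * (b \<bullet> x) * g x + (norm x)\<^sup>2 * dder b g x)" for b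
    by (rule ext) (simp add: dder_mult g ns dder_norm_sq)
  have l: "(\<lambda>x. 2 * (b \<bullet> x)) differentiable (at x)" for b x :: 'a
    using hpoly_differentiable[OF hpoly_scale[OF hpoly.inner]] by blast
  have lg: "(\<lambda>x. 2 * (b \<bullet> x) * g x) differentiable (at x)" "(\<lambda>x. (norm x)\<^sup>2 * dder b g x) differentiable (at x)" for b x
    by (intro differentiable_mult l g ns)+
  have l': "dder b (\<lambda>x. 2 * (b \<bullet> x)) x = 2 * (b \<bullet> b)" for b x :: 'a
    by (rule dderI) (auto intro!: derivative_eq_intros)
  have 2: "dder b (\<lambda>x. 2 * (b \<bullet> x) * g x + (norm x)\<^sup>2 * dder b g x) x
     = (2 * g x + 4 * ((b \<bullet> x) * dder b g x)) + (norm x)\<^sup>2 * dder b (dder b g) x" if "b \<in> Basis" for b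
    using that by (simp add: dder_add lg dder_mult l g ns l' dder_norm_sq)
  \<comment> \<open>The cross terms of the product rule assemble to the radial derivative, which
    Euler's identity evaluates.\<close>
  have "(\<Sum>b\<in>Basis. (b \<bullet> x) * dder b g x) = dder x g x"
  proof -
    have lin: "linear (\<lambda>v. dder v g x)" by (rule linear_frechet_derivative[OF g(1)])
    have "dder x g x = dder (\<Sum>b\<in>Basis. (x \<bullet> b) *\<^sub>R b) g x" by (simp add: euclidean_representation)
    also have "\<dots> = (\<Sum>b\<in>Basis. (x \<bullet> b) * dder b g x)"
      by (simp only: linear_sum[OF lin] linear_scale[OF lin] real_scaleR_def)
    finally show ?thesis by (simp add: inner_commute)
  qed
  then have E: "(\<Sum>b\<in>Basis. (b \<bullet> x) * dder b g x) = of_int d * g x" by (simp add: hpoly_euler[OF assms])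
  have "laplacian (\<lambda>x. (norm x)\<^sup>2 * g x) x =
      (\<Sum>b\<in>Basis. (2 * g x + 4 * ((b \<bullet> x) * dder b g x)) + (norm x)\<^sup>2 * dder b (dder b g) x)"
    unfolding laplacian_def 1 by (intro sum.cong refl 2)
  also have "\<dots> = (2 * real DIM('a) * g x + 4 * (of_int d * g x)) + (norm x)\<^sup>2 * laplacian g x"
    by (simp add: sum.distrib laplacian_def E[symmetric] sum_distrib_left)
  finally show ?thesis by (simp add: algebra_simps)
qed

text \<open>Reflections preserve the norm, so the difference part commutes with |x|^2; the gradient
  part contributes 4 k(alpha) g for each root.\<close>

lemma dunkl_laplacian_norm_sq_mult:
  fixes g :: "'a::euclidean_space \<Rightarrow> real"
  assumes "hpoly d g" "\<forall>\<alpha>\<in>Rp. \<alpha> \<bullet> x \<noteq> 0"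
  shows "dunkl_laplacian Rp k (\<lambda>x. (norm x)\<^sup>2 * g x) x = (norm x)\<^sup>2 * dunkl_laplacian Rp k g x
    + (2 * real DIM('a) + 4 * of_int d + 4 * mult_sum Rp k) * g x"
proof -
  have d: "dder \<alpha> (\<lambda>x. (norm x)\<^sup>2 * g x) x = 2 * (\<alpha> \<bullet> x) * g x + (norm x)\<^sup>2 * dder \<alpha> g x" for \<alpha>
    by (simp add: dder_mult hpoly_differentiable[OF assms(1)] hpoly_differentiable[OF hpoly_norm_sq] dder_norm_sq)
  have "(\<Sum>\<alpha>\<in>Rp. k \<alpha> * (2 / (\<alpha> \<bullet> x) * dder \<alpha> (\<lambda>x. (norm x)\<^sup>2 * g x) x - (norm \<alpha>)\<^sup>2 / (\<alpha> \<bullet> x)\<^sup>2 *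
      ((norm x)\<^sup>2 * g x - (norm (root_reflection \<alpha> x))\<^sup>2 * g (root_reflection \<alpha> x))))
     = (\<Sum>\<alpha>\<in>Rp. 4 * g x * k \<alpha> + (norm x)\<^sup>2 * (k \<alpha> * (2 / (\<alpha> \<bullet> x) * dder \<alpha> g x - (norm \<alpha>)\<^sup>2 / (\<alpha> \<bullet> x)\<^sup>2 *
      (g x - g (root_reflection \<alpha> x)))))"
  proof (rule sum.cong[OF refl])
    have aux: "K * (u * (s + N * D) - w * (N * g1 - N * g2)) = 4 * g1 * K + N * (K * (u * D - w * (g1 - g2)))"
      if "u * s = 4 * g1" for K u s N D w g1 g2 :: real
    proof -
      have "K * (u * (s + N * D) - w * (N * g1 - N * g2)) = (u * s) * K + N * (K * (u * D - w * (g1 - g2)))"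
        by (simp add: algebra_simps)
      then show ?thesis unfolding that .
    qed
    fix \<alpha> assume "\<alpha> \<in> Rp"
    then have "\<alpha> \<bullet> x \<noteq> 0" using assms by auto
    then have "2 / (\<alpha> \<bullet> x) * (2 * (\<alpha> \<bullet> x) * g x) = 4 * g x" by simp
    then show "k \<alpha> * (2 / (\<alpha> \<bullet> x) * dder \<alpha> (\<lambda>x. (norm x)\<^sup>2 * g x) x - (norm \<alpha>)\<^sup>2 / (\<alpha> \<bullet> x)\<^sup>2 *
      ((norm x)\<^sup>2 * g x - (norm (root_reflection \<alpha> x))\<^sup>2 * g (root_reflection \<alpha> x)))
      = 4 * g x * k \<alpha> + (norm x)\<^sup>2 * (k \<alpha> * (2 / (\<alpha> \<bullet> x) * dder \<alpha> g x - (norm \<alpha>)\<^sup>2 / (\<alpha> \<bullet> x)\<^sup>2 *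
      (g x - g (root_reflection \<alpha> x))))"
      unfolding d norm_root_reflection by (rule aux)
  qed
  also have "\<dots> = 4 * mult_sum Rp k * g x + (norm x)\<^sup>2 * (\<Sum>\<alpha>\<in>Rp. k \<alpha> * (2 / (\<alpha> \<bullet> x) * dder \<alpha> g x -
      (norm \<alpha>)\<^sup>2 / (\<alpha> \<bullet> x)\<^sup>2 * (g x - g (root_reflection \<alpha> x))))"
    by (simp add: sum.distrib mult_sum_def flip: sum_distrib_left)
  finally show ?thesis
    unfolding dunkl_laplacian_def laplacian_norm_sq_mult[OF assms(1)] by (simp add: algebra_simps)
qed

text \<open>The sl(2) commutation relation for higher powers. For d >= 0 and nonnegative
  multiplicities its constant is positive, and this is what makes the recursion for harmonics
  solvable.\<close>

lemma dunkl_laplacian_norm_pow_mult: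
  fixes g :: "'a::euclidean_space \<Rightarrow> real"
  assumes "hpoly d g" "\<forall>\<alpha>\<in>Rp. \<alpha> \<bullet> x \<noteq> 0"
  shows "dunkl_laplacian Rp k (\<lambda>x. norm x ^ (2 * Suc j) * g x) x = norm x ^ (2 * Suc j) * dunkl_laplacian Rp k g x
    + 2 * (1 + real j) * (real DIM('a) + 2 * of_int d + 2 * mult_sum Rp k + 2 * real j) * (norm x ^ (2 * j) * g x)"
proof (induction j)
  case 0
  show ?case using dunkl_laplacian_norm_sq_mult[OF assms] by (simp add: power2_eq_square algebra_simps)
next
  case (Suc j)
  have "dunkl_laplacian Rp k (\<lambda>x. norm x ^ (2 * Suc (Suc j)) * g x) x =
      dunkl_laplacian Rp k (\<lambda>x. (norm x)\<^sup>2 * (norm x ^ (2 * Suc j) * g x)) x"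
    by (simp add: power2_eq_square mult_ac)
  also have "\<dots> = (norm x)\<^sup>2 * dunkl_laplacian Rp k (\<lambda>x. norm x ^ (2 * Suc j) * g x) x +
     (2 * real DIM('a) + 4 * of_int (d + 2 * int (Suc j)) + 4 * mult_sum Rp k) * (norm x ^ (2 * Suc j) * g x)"
    by (rule dunkl_laplacian_norm_sq_mult[OF hpoly_norm_pow[OF assms(1)] assms(2)])
  finally show ?case unfolding Suc by (simp add: power2_eq_square algebra_simps)
qed

text \<open>With q = r / c the commutation relation leaves the error |x|^(2j+2) (Delta_k r) / c. As
  Delta_k r has degree d - 2, the induction hypothesis at j + 1 provides q' that produces exactly
  this error, and q = (r - |x|^2 q') / c removes it.\<close>

lemma dunkl_laplacian_norm_pow_solve:
  fixes r :: "'a::euclidean_space \<Rightarrow> real"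
  assumes Rp: "0 \<notin> Rp" and k: "mult_sum Rp k \<ge> 0" and "hpoly d r"
  shows "\<exists>q. hpoly d q \<and> (\<forall>x. (\<forall>\<alpha>\<in>Rp. \<alpha> \<bullet> x \<noteq> 0) \<longrightarrow>
    dunkl_laplacian Rp k (\<lambda>x. norm x ^ (2 * Suc j) * q x) x = norm x ^ (2 * j) * r x)"
  using assms(3)
proof (induction "nat (d + 1)" arbitrary: d r j rule: less_induct)
  case (less d r j)
  show ?case
  proof (cases "d < 0")
    case True
    then have "r x = 0" for x using hpoly_neg less.prems by blast
    moreover have "dunkl_laplacian Rp k (\<lambda>x. norm x ^ (2 * Suc j) * 0) x = 0" for x :: 'a
      by (simp add: dunkl_laplacian_def laplacian_def dder_const)
    ultimately show ?thesis by (intro exI[of _ "\<lambda>x. 0"]) (auto intro: hpoly.zero)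
  next
    case False
    define c where "c = 2 * (1 + real j) * (real DIM('a) + 2 * of_int d + 2 * mult_sum Rp k + 2 * real j)"
    have "real DIM('a) + 2 * of_int d + 2 * mult_sum Rp k + 2 * real j > 0"
      using False k DIM_positive[where 'a='a] by (intro add_pos_nonneg) auto
    then have c: "c \<noteq> 0" unfolding c_def by simp
    obtain r' where r': "hpoly (d - 2) r'" "\<And>x. \<forall>\<alpha>\<in>Rp. \<alpha> \<bullet> x \<noteq> 0 \<Longrightarrow> dunkl_laplacian Rp k r x = r' x"
      using hpoly_dunkl_laplacian[OF less.prems Rp] by blast
    have "nat (d - 2 + 1) < nat (d + 1)" using False by simp
    from less.hyps[OF this r'(1), of "Suc j"] obtain q' where q': "hpoly (d - 2) q'"
      "\<And>x. \<forall>\<alpha>\<in>Rp. \<alpha> \<bullet> x \<noteq> 0 \<Longrightarrow>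
        dunkl_laplacian Rp k (\<lambda>x. norm x ^ (2 * Suc (Suc j)) * q' x) x = norm x ^ (2 * Suc j) * r' x" by blast
    define q where "q x = (1 / c) * r x + (- 1 / c) * ((norm x)\<^sup>2 * q' x)" for x
    have "hpoly d q"
      unfolding q_def by (intro hpoly.add hpoly_scale less.prems hpoly_mult'[OF hpoly_norm_sq q'(1)]) auto
    moreover have "dunkl_laplacian Rp k (\<lambda>x. norm x ^ (2 * Suc j) * q x) x = norm x ^ (2 * j) * r x"
      if x: "\<forall>\<alpha>\<in>Rp. \<alpha> \<bullet> x \<noteq> 0" for x
    proof -
      have "(\<lambda>x. norm x ^ (2 * Suc j) * q x) = (\<lambda>x. (1 / c) * (norm x ^ (2 * Suc j) * r x)
          + (- 1 / c) * (norm x ^ (2 * Suc (Suc j)) * q' x))"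
        by (auto simp: q_def power2_eq_square algebra_simps)
      then have "dunkl_laplacian Rp k (\<lambda>x. norm x ^ (2 * Suc j) * q x) x =
          (1 / c) * dunkl_laplacian Rp k (\<lambda>x. norm x ^ (2 * Suc j) * r x) x +
          (- 1 / c) * dunkl_laplacian Rp k (\<lambda>x. norm x ^ (2 * Suc (Suc j)) * q' x) x"
        by (simp only: dunkl_laplacian_lin_comb[OF hpoly_poly[OF hpoly_norm_pow[OF less.prems]]
            hpoly_poly[OF hpoly_norm_pow[OF q'(1)]]])
      also have "\<dots> = norm x ^ (2 * j) * r x"
        unfolding q'(2)[OF x] dunkl_laplacian_norm_pow_mult[OF less.prems x] r'(2)[OF x] c_def[symmetric]
        using c by (simp add: field_simps)
      finally show ?thesis .
    qed
    ultimately show ?thesis by blast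
  qed
qed

inductive harmonic_sum :: "'a::euclidean_space set \<Rightarrow> ('a \<Rightarrow> real) \<Rightarrow> ('a \<Rightarrow> real) \<Rightarrow> bool"
  for Rp k where
  zero: "harmonic_sum Rp k (\<lambda>x. 0)"
| base: "hpoly (int m) h \<Longrightarrow> (\<And>x. \<forall>\<alpha>\<in>Rp. \<alpha> \<bullet> x \<noteq> 0 \<Longrightarrow> dunkl_laplacian Rp k h x = 0) \<Longrightarrow>
    harmonic_sum Rp k (\<lambda>x. norm x ^ (2 * j) * h x)"
| add: "harmonic_sum Rp k p \<Longrightarrow> harmonic_sum Rp k q \<Longrightarrow> harmonic_sum Rp k (\<lambda>x. p x + q x)"

text \<open>Fischer decomposition: choose q with Delta_k (|x|^2 q) = Delta_k p; then p - |x|^2 q is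
  harmonic and q has degree d - 2.\<close>

lemma hpoly_harmonic_sum:
  assumes Rp: "0 \<notin> Rp" and k: "mult_sum Rp k \<ge> 0" and "hpoly d p"
  shows "harmonic_sum Rp k (\<lambda>x. norm x ^ (2 * j) * p x)"
  using assms(3)
proof (induction "nat (d + 1)" arbitrary: d p j rule: less_induct)
  case (less d p j)
  show ?case
  proof (cases "d < 0")
    case True
    then have "p x = 0" for x using hpoly_neg less.prems by blast
    then show ?thesis using harmonic_sum.zero by simp
  next
    case False
    obtain r where r: "hpoly (d - 2) r" "\<And>x. \<forall>\<alpha>\<in>Rp. \<alpha> \<bullet> x \<noteq> 0 \<Longrightarrow> dunkl_laplacian Rp k p x = r x"
      using hpoly_dunkl_laplacian[OF less.prems Rp] by blast
    from dunkl_laplacian_norm_pow_solve[OF Rp k r(1), of 0] obtain q where q: "hpoly (d - 2) q"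
      "\<And>x. \<forall>\<alpha>\<in>Rp. \<alpha> \<bullet> x \<noteq> 0 \<Longrightarrow> dunkl_laplacian Rp k (\<lambda>x. (norm x)\<^sup>2 * q x) x = r x"
      by (auto simp: numeral_2_eq_2)
    define h where "h x = 1 * p x + (-1) * ((norm x)\<^sup>2 * q x)" for x
    have nq: "hpoly d (\<lambda>x. (norm x)\<^sup>2 * q x)" by (intro hpoly_mult'[OF hpoly_norm_sq q(1)]) simp
    have "hpoly (int (nat d)) h"
      unfolding h_def using False by (simp add: hpoly_diff less.prems nq)
    moreover have "dunkl_laplacian Rp k h x = 0" if "\<forall>\<alpha>\<in>Rp. \<alpha> \<bullet> x \<noteq> 0" for x
      unfolding h_def dunkl_laplacian_lin_comb[OF hpoly_poly[OF less.prems] hpoly_poly[OF nq]]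
      by (simp add: q(2)[OF that] r(2)[OF that])
    ultimately have "harmonic_sum Rp k (\<lambda>x. norm x ^ (2 * j) * h x)" by (rule harmonic_sum.base)
    moreover have "harmonic_sum Rp k (\<lambda>x. norm x ^ (2 * Suc j) * q x)"
      using False by (intro less.hyps[OF _ q(1)]) simp
    ultimately have "harmonic_sum Rp k (\<lambda>x. norm x ^ (2 * j) * h x + norm x ^ (2 * Suc j) * q x)"
      by (rule harmonic_sum.add)
    then show ?thesis by (simp add: h_def power2_eq_square algebra_simps)
  qed
qed

text \<open>Closure of homogeneous polynomials under sums. It is closed under products too, so
  induction over polynomials yields their homogeneous decomposition.\<close>

inductive hpoly_sum_of :: "('a::euclidean_space \<Rightarrow> real) \<Rightarrow> bool" where
  base: "hpoly d p \<Longrightarrow> hpoly_sum_of p"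
| add: "hpoly_sum_of p \<Longrightarrow> hpoly_sum_of q \<Longrightarrow> hpoly_sum_of (\<lambda>x. p x + q x)"

lemma hpoly_sum_of_mult_hpoly:
  "hpoly_sum_of p \<Longrightarrow> hpoly d q \<Longrightarrow> hpoly_sum_of (\<lambda>x. p x * q x)"
  by (induction rule: hpoly_sum_of.induct)
    (auto simp: distrib_right intro: hpoly_sum_of.intros hpoly.mult)

lemma hpoly_sum_of_mult:
  "hpoly_sum_of q \<Longrightarrow> hpoly_sum_of p \<Longrightarrow> hpoly_sum_of (\<lambda>x. p x * q x)"
  by (induction rule: hpoly_sum_of.induct)
    (auto simp: distrib_left intro: hpoly_sum_of.add hpoly_sum_of_mult_hpoly)

lemma real_polynomial_hpoly_sum_of:
  fixes p :: "'a::euclidean_space \<Rightarrow> real"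
  assumes "real_polynomial_function p"
  shows "hpoly_sum_of p"
  using assms
proof (induction rule: real_polynomial_function.induct)
  case (linear f)
  then have lin: "linear f" by (rule bounded_linear.linear)
  have "f x = (\<Sum>b\<in>Basis. f b * (b \<bullet> x))" for x
  proof -
    have "f x = f (\<Sum>b\<in>Basis. (x \<bullet> b) *\<^sub>R b)" by (simp add: euclidean_representation)
    also have "\<dots> = (\<Sum>b\<in>Basis. f b * (b \<bullet> x))"
      unfolding linear_sum[OF lin] linear_scale[OF lin] real_scaleR_def
      by (intro sum.cong refl) (simp add: inner_commute)
    finally show ?thesis .
  qed
  then have eq: "f = (\<lambda>x. \<Sum>b\<in>Basis. f b * (b \<bullet> x))" by (rule ext)
  have "hpoly 1 f"
    by (subst eq) (intro hpoly_sum hpoly_scale hpoly.inner)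
  then show ?case by (rule hpoly_sum_of.base)
qed (auto intro: hpoly_sum_of.intros hpoly_sum_of_mult hpoly.const)

lemma real_polynomial_harmonic_sum:
  assumes "0 \<notin> Rp" "mult_sum Rp k \<ge> 0" "real_polynomial_function p"
  shows "harmonic_sum Rp k p"
  using real_polynomial_hpoly_sum_of[OF assms(3)]
proof (induction rule: hpoly_sum_of.induct)
  case (base d p)
  then show ?case using hpoly_harmonic_sum[OF assms(1,2) base, of 0] by simp
qed (auto intro: harmonic_sum.add)

lemma harmonic_poly_of_real:
  assumes h: "hpoly (int m) h" "\<And>x. \<forall>\<alpha>\<in>Rp. \<alpha> \<bullet> x \<noteq> 0 \<Longrightarrow> dunkl_laplacian Rp k h x = 0"
  shows "harmonic_poly Rp k m (\<lambda>x. complex_of_real (h x))"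
proof -
  have p: "polynomial_function h" using hpoly_poly[OF h(1)] by (simp add: real_polynomial_function_eq)
  have "polynomial_function ((\<lambda>t. t *\<^sub>R (1::complex)) \<circ> h)"
    by (intro polynomial_function_compose p polynomial_function_bounded_linear bounded_linear_scaleR_left)
  then show ?thesis
    using hpoly_hom[OF h(1)] h(2)
    by (auto simp: harmonic_poly_def o_def scaleR_conv_of_real
        dunkl_laplacian_bounded_linear[OF bounded_linear_of_real p])
qed

lemma harmonic_poly_bounded_linear:
  assumes "harmonic_poly Rp k m p" and T: "bounded_linear (T :: complex \<Rightarrow> real)"
  shows "real_polynomial_function (\<lambda>x. T (p x))" "T (p (t *\<^sub>R x)) = t ^ m * T (p x)"
    "\<forall>\<alpha>\<in>Rp. \<alpha> \<bullet> x \<noteq> 0 \<Longrightarrow> dunkl_laplacian Rp k (\<lambda>x. T (p x)) x = 0"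
proof -
  interpret T: bounded_linear T by (rule T)
  show "real_polynomial_function (\<lambda>x. T (p x))"
    using assms by (auto simp: harmonic_poly_def polynomial_function_def o_def)
  show "T (p (t *\<^sub>R x)) = t ^ m * T (p x)"
    using assms by (simp add: harmonic_poly_def T.scaleR)
  show "dunkl_laplacian Rp k (\<lambda>x. T (p x)) x = 0" if "\<forall>\<alpha>\<in>Rp. \<alpha> \<bullet> x \<noteq> 0"
    using assms that by (simp add: harmonic_poly_def dunkl_laplacian_bounded_linear T.zero)
qed

section \<open>Integration with respect to homogeneous weights\<close>

lemma cball_sets_borel[measurable]: "cball x r \<in> sets borel"
  by (simp add: borel_closed)

lemma ennreal_le_suminf: "f n \<le> (\<Sum>i. f i :: ennreal)"
  using sum_le_suminf[of f "{n}"] by simp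

lemma nn_integral_lborel_scale:
  fixes f :: "'a::euclidean_space \<Rightarrow> ennreal"
  assumes [measurable]: "f \<in> borel_measurable borel" and c: "c > 0"
  shows "(\<integral>\<^sup>+x. f x \<partial>lborel) = ennreal (c ^ DIM('a)) * (\<integral>\<^sup>+x. f (c *\<^sub>R x) \<partial>lborel)"
  using c by (subst lborel_affine[of c 0])
    (simp_all add: nn_integral_density nn_integral_distr nn_integral_cmult ennreal_power)

lemma integral_lborel_scale:
  fixes f :: "'a::euclidean_space \<Rightarrow> 'b::{banach, second_countable_topology}"
  assumes [measurable]: "f \<in> borel_measurable borel" and c: "c > 0"
  shows "(\<integral>x. f x \<partial>lborel) = c ^ DIM('a) *\<^sub>R (\<integral>x. f (c *\<^sub>R x) \<partial>lborel)"
  using c by (subst lborel_affine[of c 0])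
    (simp_all add: integral_density integral_distr integrable_density)

lemma nn_integral_lborel_translate:
  fixes f :: "'a::euclidean_space \<Rightarrow> ennreal"
  assumes [measurable]: "f \<in> borel_measurable borel"
  shows "(\<integral>\<^sup>+x. f (x + t) \<partial>lborel) = (\<integral>\<^sup>+x. f x \<partial>lborel)"
  by (subst (2) lborel_distr_plus[of t, symmetric]) (simp add: nn_integral_distr add.commute)

lemma integral_lborel_translate:
  fixes f :: "'a::euclidean_space \<Rightarrow> 'b::{banach, second_countable_topology}"
  assumes [measurable]: "f \<in> borel_measurable borel"
  shows "(\<integral>x. f (x + t) \<partial>lborel) = (\<integral>x. f x \<partial>lborel)"
  by (subst (2) lborel_distr_plus[of t, symmetric]) (simp add: integral_distr add.commute)

lemma integrable_lborel_translate:
  fixes f :: "'a::euclidean_space \<Rightarrow> 'b::{banach, second_countable_topology}"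
  assumes "integrable lborel f"
  shows "integrable lborel (\<lambda>x. f (x + t))"
proof -
  have [measurable]: "f \<in> borel_measurable borel" using borel_measurable_integrable[OF assms] by simp
  have "integrable (distr lborel borel ((+) t)) f" using assms by (simp add: lborel_distr_plus)
  then show ?thesis by (simp add: integrable_distr_eq add.commute)
qed

lemma emeasure_lborel_cball_scale:
  assumes "r > 0"
  shows "emeasure lborel (cball (0::'a::euclidean_space) r) =
    ennreal (r ^ DIM('a)) * emeasure lborel (cball (0::'a) 1)"
proof -
  have "emeasure lborel (cball (0::'a) r) = (\<integral>\<^sup>+x. indicator (cball (0::'a) r) x \<partial>lborel)" by simp
  also have "\<dots> = ennreal (r ^ DIM('a)) * (\<integral>\<^sup>+x. indicator (cball (0::'a) r) (r *\<^sub>R x) \<partial>lborel)"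
    by (rule nn_integral_lborel_scale) (use assms in \<open>auto intro!: borel_measurable_indicator\<close>)
  also have "(\<lambda>x::'a. indicator (cball 0 r) (r *\<^sub>R x) :: ennreal) = indicator (cball 0 1)"
    using assms by (auto simp: indicator_def fun_eq_iff)
  finally show ?thesis by simp
qed

text \<open>Dyadic shells: for 2^-(n+1) < |x| <= 2^-n the integrand is at most 2^(-c(n+1)), while
  the ball of radius 2^-n has volume V 2^(-nN). The ratio of the resulting geometric series is s =
  2^(-c-N) < 1.\<close>

lemma nn_integral_powr_unit_ball:
  assumes c: "c > - real DIM('a)" "c \<le> 0"
  shows "(\<integral>\<^sup>+x. ennreal (norm x powr c) * indicator (cball 0 1) (x::'a::euclidean_space) \<partial>lborel) < \<infinity>"
proof -
  define V where "V = measure lborel (cball (0::'a) 1)"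
  have V: "emeasure lborel (cball (0::'a) 1) = ennreal V"
    unfolding V_def using emeasure_lborel_cball_finite[of "0::'a" 1] by (intro emeasure_eq_ennreal_measure) auto
  have V0: "V \<ge> 0" by (simp add: V_def)
  define s where "s = 2 powr (- c) * (1/2) ^ DIM('a)"
  have s: "0 \<le> s" "s < 1"
  proof -
    have "s = 2 powr (- c - real DIM('a))"
      by (simp add: s_def powr_diff powr_realpow power_one_over)
    then show "s < 1" using c powr_less_cancel_iff[of 2 "- c - real DIM('a)" 0] by simp
  qed (simp add: s_def)
  have "ennreal (norm x powr c) * indicator (cball 0 1) x \<le>
    (\<Sum>n. ennreal (2 powr (- c) * (2 powr (- c)) ^ n) * indicator (cball 0 ((1/2) ^ n)) x)" for x :: 'a
  \<comment> \<open>At the origin the integrand is 0 because \<open>0 powr c = 0\<close>; outside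
    the unit ball the indicator vanishes.\<close>
  proof (cases "x = 0 \<or> norm x > 1")
    case False
    then have x: "0 < norm x" "norm x \<le> 1" by auto
    define n where "n = (LEAST n. (1/2) ^ Suc n < norm x)"
    have ex: "\<exists>n. (1/2) ^ Suc n < norm x"
    proof -
      obtain n where "(1/2) ^ n < norm x" using real_arch_pow_inv[OF x(1), of "1/2"] by auto
      moreover have "(1/2::real) ^ Suc n < (1/2) ^ n" by simp
      ultimately show ?thesis using less_trans by blast
    qed
    have n1: "(1/2) ^ Suc n < norm x" unfolding n_def by (rule LeastI_ex[OF ex])
    have n2: "norm x \<le> (1/2) ^ n"
    proof (cases n)
      case (Suc m)
      then have "\<not> (1/2) ^ Suc m < norm x" unfolding n_def by (intro not_less_Least) simp
      then show ?thesis using Suc by simp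
    qed (use x in simp)
    have "norm x powr c \<le> ((1/2) ^ Suc n) powr c"
      using n1 c by (intro powr_mono2') auto
    also have "\<dots> = 2 powr (- c) * (2 powr (- c)) ^ n"
      by (simp add: powr_realpow[symmetric] powr_powr powr_minus powr_divide powr_mult powr_add
          field_simps flip: powr_realpow)
    finally have "ennreal (norm x powr c) * indicator (cball 0 1) x \<le>
       ennreal (2 powr (- c) * (2 powr (- c)) ^ n) * indicator (cball 0 ((1/2) ^ n)) x"
      using n2 x by (auto simp: indicator_def intro!: ennreal_leI)
    also have "\<dots> \<le> (\<Sum>n. ennreal (2 powr (- c) * (2 powr (- c)) ^ n) * indicator (cball 0 ((1/2) ^ n)) x)"
      by (rule ennreal_le_suminf)
    finally show ?thesis .
  qed auto
  then have "(\<integral>\<^sup>+x. ennreal (norm x powr c) * indicator (cball 0 1) (x::'a) \<partial>lborel) \<le>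
    (\<integral>\<^sup>+x. (\<Sum>n. ennreal (2 powr (- c) * (2 powr (- c)) ^ n) * indicator (cball 0 ((1/2) ^ n)) (x::'a)) \<partial>lborel)"
    by (intro nn_integral_mono) auto
  also have "\<dots> = (\<Sum>n. \<integral>\<^sup>+x. ennreal (2 powr (- c) * (2 powr (- c)) ^ n) * indicator (cball 0 ((1/2) ^ n)) (x::'a) \<partial>lborel)"
    by (rule nn_integral_suminf) simp
  also have "\<dots> = (\<Sum>n. ennreal (2 powr (- c) * V * s ^ n))"
  proof (rule suminf_cong)
    fix n
    have "(\<integral>\<^sup>+x. ennreal (2 powr (- c) * (2 powr (- c)) ^ n) * indicator (cball 0 ((1/2) ^ n)) (x::'a) \<partial>lborel)
      = ennreal (2 powr (- c) * (2 powr (- c)) ^ n) * (ennreal (((1/2) ^ n) ^ DIM('a)) * ennreal V)"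
      by (simp add: nn_integral_cmult emeasure_lborel_cball_scale V)
    also have "\<dots> = ennreal (2 powr (- c) * V * s ^ n)"
      using V0 by (simp add: s_def power_mult_distrib ennreal_mult[symmetric] power_mult[symmetric] mult_ac)
    finally show "(\<integral>\<^sup>+x. ennreal (2 powr (- c) * (2 powr (- c)) ^ n) * indicator (cball 0 ((1/2) ^ n)) (x::'a) \<partial>lborel)
      = ennreal (2 powr (- c) * V * s ^ n)" .
  qed
  also have "\<dots> = ennreal (\<Sum>n. 2 powr (- c) * V * s ^ n)"
    using s V0 by (intro suminf_ennreal2) auto
  finally show ?thesis by (rule le_less_trans) simp
qed

text \<open>Dyadic shells going outward: the decay 2^(-n(N+1)) against the volume V 2^((n+1)N)
  leaves 2^N V 2^-n.\<close>

lemma nn_integral_decay: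
  "(\<integral>\<^sup>+x. ennreal ((1 + norm (x::'a::euclidean_space)) powr (- real (DIM('a) + 1))) \<partial>lborel) < \<infinity>"
proof -
  define V where "V = measure lborel (cball (0::'a) 1)"
  have V: "emeasure lborel (cball (0::'a) 1) = ennreal V"
    unfolding V_def using emeasure_lborel_cball_finite[of "0::'a" 1] by (intro emeasure_eq_ennreal_measure) auto
  have V0: "V \<ge> 0" by (simp add: V_def)
  let ?N = "DIM('a)"
  let ?c = "\<lambda>n::nat. (1/2::real) ^ (n * (?N + 1))"
  have "ennreal ((1 + norm x) powr (- real (?N + 1))) \<le> (\<Sum>n. ennreal (?c n) * indicator (cball 0 (2 ^ Suc n)) x)" for x :: 'a
  proof -
    define n where "n = (LEAST n. 1 + norm x < 2 ^ Suc n)"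
    have ex: "\<exists>n. 1 + norm x < 2 ^ Suc n"
    proof -
      obtain n where "1 + norm x < 2 ^ n" using real_arch_pow[of 2 "1 + norm x"] by auto
      also have "(2::real) ^ n < 2 ^ Suc n" by simp
      finally show ?thesis by blast
    qed
    have n1: "1 + norm x < 2 ^ Suc n" unfolding n_def by (rule LeastI_ex[OF ex])
    have n2: "2 ^ n \<le> 1 + norm x"
    proof (cases n)
      case (Suc m)
      then have "\<not> 1 + norm x < 2 ^ Suc m" unfolding n_def by (intro not_less_Least) simp
      then show ?thesis using Suc by simp
    qed simp
    have "(1 + norm x) powr (- real (?N + 1)) \<le> (2 ^ n) powr (- real (?N + 1))"
      using n2 by (intro powr_mono2') auto
    also have "\<dots> = ?c n"
      by (simp only: powr_minus powr_realpow zero_less_power zero_less_numeral power_mult power_one_over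
          inverse_eq_divide flip: power_mult)
    finally have "ennreal ((1 + norm x) powr (- real (?N + 1))) \<le> ennreal (?c n) * indicator (cball 0 (2 ^ Suc n)) x"
      using n1 by (auto simp: indicator_def intro!: ennreal_leI)
    also have "\<dots> \<le> (\<Sum>n. ennreal (?c n) * indicator (cball 0 (2 ^ Suc n)) x)"
      by (rule ennreal_le_suminf)
    finally show ?thesis .
  qed
  then have "(\<integral>\<^sup>+x. ennreal ((1 + norm (x::'a)) powr (- real (?N + 1))) \<partial>lborel) \<le>
      (\<integral>\<^sup>+x. (\<Sum>n. ennreal (?c n) * indicator (cball 0 (2 ^ Suc n)) (x::'a)) \<partial>lborel)"
    by (intro nn_integral_mono) auto
  also have "\<dots> = (\<Sum>n. \<integral>\<^sup>+x. ennreal (?c n) * indicator (cball 0 (2 ^ Suc n)) (x::'a) \<partial>lborel)"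
    by (rule nn_integral_suminf) simp
  also have "\<dots> = (\<Sum>n. ennreal (2 ^ ?N * V * (1/2) ^ n))"
  proof (rule suminf_cong)
    fix n
    have "(\<integral>\<^sup>+x. ennreal (?c n) * indicator (cball 0 (2 ^ Suc n)) (x::'a) \<partial>lborel)
      = ennreal (?c n) * (ennreal ((2 ^ Suc n) ^ ?N) * ennreal V)"
      by (simp add: nn_integral_cmult emeasure_lborel_cball_scale V del: power_Suc)
    also have "\<dots> = ennreal (?c n * (2 ^ Suc n) ^ ?N * V)"
      using V0 by (simp add: ennreal_mult[symmetric] mult.assoc)
    also have "?c n * (2 ^ Suc n) ^ ?N = 2 ^ ?N * (1/2) ^ n"
      by (simp add: power_mult_distrib power_add power_one_over field_simps flip: power_mult)
    finally show "(\<integral>\<^sup>+x. ennreal (?c n) * indicator (cball 0 (2 ^ Suc n)) (x::'a) \<partial>lborel)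
      = ennreal (2 ^ ?N * V * (1/2) ^ n)" by (simp add: mult_ac)
  qed
  also have "\<dots> = ennreal (\<Sum>n. 2 ^ ?N * V * (1/2) ^ n)"
    using V0 by (intro suminf_ennreal2 summable_mult summable_geometric) auto
  finally show ?thesis by (rule le_less_trans) simp
qed

section \<open>Functions of polynomial growth against exponential decay\<close>

lemma powr_le_const_mult_exp:
  fixes z p :: real
  assumes z: "z > 0" and p: "p \<ge> 0"
  shows "\<exists>C\<ge>0. \<forall>y\<ge>0. y powr p \<le> C * exp (z * y)"
proof -
  define n where "n = nat \<lceil>p\<rceil> + 1"
  have n: "p \<le> real n" "n > 0" unfolding n_def by linarith+
  define C where "C = 1 + (real n / z) ^ n"
  have "y powr p \<le> C * exp (z * y)" if y: "y \<ge> 0" for y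
  proof -
    have e1: "1 \<le> exp (z * y)" using z y by simp
    have "(z * y / real n) ^ n \<le> (1 + z * y / real n) ^ n"
      using z y by (intro power_mono) auto
    also have "\<dots> \<le> exp (z * y)"
      using z y n by (intro exp_ge_one_plus_x_over_n_power_n) (auto intro: order_trans[of _ 0])
    finally have "(z * y / real n) ^ n \<le> exp (z * y)" .
    then have "(real n / z) ^ n * (z * y / real n) ^ n \<le> (real n / z) ^ n * exp (z * y)"
      using z by (intro mult_left_mono) auto
    moreover have "(real n / z) ^ n * (z * y / real n) ^ n = y ^ n"
      using z n by (simp flip: power_mult_distrib)
    ultimately have yn: "y ^ n \<le> (real n / z) ^ n * exp (z * y)" by simp
    have "y powr p \<le> 1 + y ^ n"
    proof (cases "y \<le> 1")
      case True
      then have "y powr p \<le> 1" using y p by (intro powr_le1) auto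
      then show ?thesis using y by (smt (verit) zero_le_power)
    next
      case False
      then have "y powr p \<le> y powr real n" using n by (intro powr_mono) auto
      then show ?thesis using False by (simp add: powr_realpow)
    qed
    also have "\<dots> \<le> C * exp (z * y)" using yn e1 unfolding C_def distrib_right by linarith
    finally show ?thesis .
  qed
  moreover have "C \<ge> 0" using z by (simp add: C_def)
  ultimately show ?thesis by blast
qed

text \<open>With y = r^a a power of r becomes a power of y, and 1 + r is at most 2 max(1,
  r).\<close>

lemma exp_decay_bound:
  fixes z a m :: real
  assumes z: "z > 0" and a: "a > 0" and m: "m \<ge> 0"
  shows "\<exists>C\<ge>0. \<forall>r\<ge>0. (1 + r) powr m * exp (- (z * r powr a)) \<le> C"
proof -
  obtain C where C: "C \<ge> 0" "\<And>y. y \<ge> 0 \<Longrightarrow> y powr (m / a) \<le> C * exp (z * y)"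
    using powr_le_const_mult_exp[OF z, of "m / a"] a m by auto
  have "(1 + r) powr m * exp (- (z * r powr a)) \<le> 2 powr m * (1 + C)" if r: "r \<ge> 0" for r
  proof -
    have e: "exp (- (z * r powr a)) \<le> 1" using z by simp
    have "(1 + r) powr m \<le> (2 * max 1 r) powr m" using r m by (intro powr_mono2) auto
    also have "\<dots> = 2 powr m * max 1 r powr m" by (simp add: powr_mult)
    also have "\<dots> \<le> 2 powr m * (1 + r powr m)" by (intro mult_left_mono) (auto simp: max_def)
    finally have "(1 + r) powr m * exp (- (z * r powr a)) \<le> 2 powr m * (1 + r powr m) * exp (- (z * r powr a))"
      by (intro mult_right_mono) auto
    also have "\<dots> = 2 powr m * (exp (- (z * r powr a)) + r powr m * exp (- (z * r powr a)))"
      by (simp add: algebra_simps)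
    also have "\<dots> \<le> 2 powr m * (1 + C)"
    proof (intro mult_left_mono add_mono e)
      have "r powr m = (r powr a) powr (m / a)" using a by (simp add: powr_powr)
      also have "\<dots> \<le> C * exp (z * r powr a)" by (rule C) simp
      finally have "r powr m * exp (- (z * r powr a)) \<le> C * exp (z * r powr a) * exp (- (z * r powr a))"
        by (intro mult_right_mono) auto
      then show "r powr m * exp (- (z * r powr a)) \<le> C" by (simp add: exp_minus field_simps)
    qed simp
    finally show ?thesis .
  qed
  then show ?thesis using C by (intro exI[of _ "2 powr m * (1 + C)"]) auto
qed

text \<open>Measurable functions of polynomial growth: an algebra that contains polynomials,
  nonnegative powers of the norm and the weight, and on which all Gaussian integrals below
  converge.\<close>

definition tempered :: "('a::euclidean_space \<Rightarrow> 'b::real_normed_vector) \<Rightarrow> bool" where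
  "tempered f \<longleftrightarrow> f \<in> borel_measurable borel \<and> (\<exists>C\<ge>0. \<exists>n. \<forall>x. norm (f x) \<le> C * (1 + norm x) ^ n)"

lemma temperedI:
  "f \<in> borel_measurable borel \<Longrightarrow> C \<ge> 0 \<Longrightarrow> (\<And>x. norm (f x) \<le> C * (1 + norm x) ^ n) \<Longrightarrow> tempered f"
  by (auto simp: tempered_def)

lemma tempered_measurable[measurable_dest]: "tempered f \<Longrightarrow> f \<in> borel_measurable borel"
  by (simp add: tempered_def)

lemma tempered_const[intro!]: "tempered (\<lambda>x. c)"
  by (rule temperedI[of _ "norm c" 0]) auto

lemma one_plus_norm_power_mono: "m \<le> n \<Longrightarrow> (1 + norm x) ^ m \<le> (1 + norm x) ^ n"
  by (rule power_increasing) auto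

lemma tempered_add[intro]:
  fixes f g :: "'a::euclidean_space \<Rightarrow> 'b::{real_normed_vector, second_countable_topology}"
  assumes "tempered f" "tempered g"
  shows "tempered (\<lambda>x. f x + g x)"
proof -
  obtain C n where f: "C \<ge> 0" "\<And>x. norm (f x) \<le> C * (1 + norm x) ^ n" using assms(1) by (auto simp: tempered_def)
  obtain D m where g: "D \<ge> 0" "\<And>x. norm (g x) \<le> D * (1 + norm x) ^ m" using assms(2) by (auto simp: tempered_def)
  show ?thesis
  proof (rule temperedI[of _ "C + D" "n + m"])
    fix x
    have "norm (f x + g x) \<le> C * (1 + norm x) ^ n + D * (1 + norm x) ^ m"
      using f(2)[of x] g(2)[of x] norm_triangle_ineq[of "f x" "g x"] by linarith
    also have "\<dots> \<le> C * (1 + norm x) ^ (n + m) + D * (1 + norm x) ^ (n + m)"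
      using f g by (intro add_mono mult_left_mono one_plus_norm_power_mono) auto
    finally show "norm (f x + g x) \<le> (C + D) * (1 + norm x) ^ (n + m)" by (simp add: distrib_right)
  qed (use assms f g in \<open>auto simp: tempered_def\<close>)
qed

lemma tempered_mult[intro]:
  fixes f g :: "'a::euclidean_space \<Rightarrow> 'b::{real_normed_algebra, second_countable_topology}"
  assumes "tempered f" "tempered g"
  shows "tempered (\<lambda>x. f x * g x)"
proof -
  obtain C n where f: "C \<ge> 0" "\<And>x. norm (f x) \<le> C * (1 + norm x) ^ n" using assms(1) by (auto simp: tempered_def)
  obtain D m where g: "D \<ge> 0" "\<And>x. norm (g x) \<le> D * (1 + norm x) ^ m" using assms(2) by (auto simp: tempered_def)
  show ?thesis
  proof (rule temperedI[of _ "C * D" "n + m"])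
    fix x
    have "norm (f x * g x) \<le> (C * (1 + norm x) ^ n) * (D * (1 + norm x) ^ m)"
      using f(2)[of x] g(2)[of x] norm_mult_ineq[of "f x" "g x"] f(1)
      by (intro order_trans[OF norm_mult_ineq] mult_mono) auto
    then show "norm (f x * g x) \<le> (C * D) * (1 + norm x) ^ (n + m)" by (simp add: power_add mult_ac)
  qed (use assms f g in \<open>auto simp: tempered_def\<close>)
qed

lemma tempered_power[intro]:
  fixes f :: "'a::euclidean_space \<Rightarrow> 'b::{real_normed_algebra_1, second_countable_topology}"
  shows "tempered f \<Longrightarrow> tempered (\<lambda>x. f x ^ n)"
  by (induction n) auto

lemma tempered_bound:
  fixes f :: "'a::euclidean_space \<Rightarrow> 'b::real_normed_vector" and g :: "'a \<Rightarrow> 'c::real_normed_vector"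
  assumes "tempered g" "f \<in> borel_measurable borel" "\<And>x. norm (f x) \<le> norm (g x)"
  shows "tempered f"
  using assms unfolding tempered_def by (meson order_trans)

lemma tempered_norm_powr:
  assumes "c \<ge> 0"
  shows "tempered (\<lambda>x::'a::euclidean_space. norm x powr c)"
proof (rule temperedI[of _ 1 "nat \<lceil>c\<rceil>"])
  fix x :: 'a
  have "norm x powr c \<le> (1 + norm x) powr c" using assms by (intro powr_mono2) auto
  also have "\<dots> \<le> (1 + norm x) powr real (nat \<lceil>c\<rceil>)" by (intro powr_mono real_nat_ceiling_ge) simp
  finally show "norm (norm x powr c) \<le> 1 * (1 + norm x) ^ nat \<lceil>c\<rceil>"
    by (simp add: powr_realpow add_pos_nonneg)
qed auto

lemma tempered_of_real: "tempered f \<Longrightarrow> tempered (\<lambda>x. complex_of_real (f x))"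
  by (rule tempered_bound[of f]) auto

lemma tempered_real_polynomial:
  fixes f :: "'a::euclidean_space \<Rightarrow> real"
  shows "real_polynomial_function f \<Longrightarrow> tempered f"
proof (induction rule: real_polynomial_function.induct)
  case (linear f)
  then obtain K where K: "K \<ge> 0" "\<And>x. norm (f x) \<le> norm x * K" using bounded_linear.nonneg_bounded by blast
  show ?case
  proof (rule temperedI[of _ "\<bar>K\<bar>" 1])
    fix x :: 'a
    have "norm x * K \<le> (1 + norm x) * \<bar>K\<bar>" using K(1) by (intro mult_mono) auto
    with K(2)[of x] show "norm (f x) \<le> \<bar>K\<bar> * (1 + norm x) ^ 1" by (simp add: mult.commute)
  qed (auto intro!: borel_measurable_continuous_onI linear_continuous_on linear)
qed auto

lemma tempered_polynomial:
  fixes f :: "'a::euclidean_space \<Rightarrow> complex"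
  assumes "polynomial_function f"
  shows "tempered f"
proof -
  have "tempered (\<lambda>x. Re (f x))" "tempered (\<lambda>x. Im (f x))"
    using assms bounded_linear_Re bounded_linear_Im
    by (auto simp: polynomial_function_def o_def intro!: tempered_real_polynomial)
  then have "tempered (\<lambda>x. complex_of_real (Re (f x)) + \<i> * complex_of_real (Im (f x)))"
    by (intro tempered_add tempered_mult tempered_const tempered_of_real)
  then show ?thesis by (simp add: complex_eq[symmetric])
qed

text \<open>Inside the unit ball c > -N makes the power of the norm integrable; outside it the
  exponential absorbs both the growth of f and the power.\<close>

lemma tempered_integrable_norm_powr:
  fixes f :: "'a::euclidean_space \<Rightarrow> 'b::{banach, second_countable_topology}"
  assumes f: "tempered f" and c: "c > - real DIM('a)" and z: "z > 0" and a: "a > 0"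
  shows "integrable lborel (\<lambda>x. (norm x powr c * exp (- (z * norm x powr a))) *\<^sub>R f x)"
proof -
  obtain K n where K: "K \<ge> 0" "\<And>x. norm (f x) \<le> K * (1 + norm x) ^ n" using f by (auto simp: tempered_def)
  note [measurable] = tempered_measurable[OF f]
  let ?N = "real (DIM('a) + 1)"
  \<comment> \<open>On the unit ball lowering the exponent only enlarges the power, which brings it
    into the nonpositive range of \<open>nn_integral_powr_unit_ball\<close>.\<close>
  define c' where "c' = min c 0"
  define m where "m = \<bar>c\<bar> + real n + ?N"
  obtain C where C: "C \<ge> 0" "\<And>r. r \<ge> 0 \<Longrightarrow> (1 + r) powr m * exp (- (z * r powr a)) \<le> C"
    using exp_decay_bound[OF z a, of m] by (auto simp: m_def)
  have bd: "norm ((norm x powr c * exp (- (z * norm x powr a))) *\<^sub>R f x) \<le>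
     K * C * (norm x powr c' * indicator (cball 0 1) x + (1 + norm x) powr (- ?N))" for x :: 'a
  proof -
    let ?e = "exp (- (z * norm x powr a))"
    have dec: "(1 + norm x) powr (real n + \<bar>c\<bar>) * ?e \<le> C * (1 + norm x) powr (- ?N)"
    proof -
      have "(1 + norm x) powr (real n + \<bar>c\<bar>) = (1 + norm x) powr m * (1 + norm x) powr (- ?N)"
        by (simp add: m_def add_ac flip: powr_add)
      then have "(1 + norm x) powr (real n + \<bar>c\<bar>) * ?e = ((1 + norm x) powr m * ?e) * (1 + norm x) powr (- ?N)"
        by simp
      also have "\<dots> \<le> C * (1 + norm x) powr (- ?N)" by (intro mult_right_mono C) auto
      finally show ?thesis .
    qed
    have decn: "(1 + norm x) ^ n * ?e \<le> C"
    proof -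
      have "(1 + norm x) ^ n * ?e \<le> (1 + norm x) powr m * ?e"
        unfolding powr_realpow[symmetric, of "1 + norm x", OF add_pos_nonneg[OF zero_less_one norm_ge_zero]]
        by (intro mult_right_mono powr_mono) (auto simp: m_def)
      also have "\<dots> \<le> C" by (rule C) simp
      finally show ?thesis .
    qed
    have "norm x powr c * ((1 + norm x) ^ n * ?e) \<le>
      C * (norm x powr c' * indicator (cball 0 1) x + (1 + norm x) powr (- ?N))"
    proof (cases "norm x \<le> 1")
      case True
      have "norm x powr c \<le> norm x powr c'"
        unfolding c'_def using True by (intro powr_mono') auto
      then have "norm x powr c * ((1 + norm x) ^ n * ?e) \<le> norm x powr c' * C"
        using decn by (intro mult_mono) auto
      then show ?thesis using True C(1) by (simp add: algebra_simps add_increasing2)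
    next
      case False
      have "norm x powr c \<le> norm x powr \<bar>c\<bar>" using False by (intro powr_mono) auto
      also have "\<dots> \<le> (1 + norm x) powr \<bar>c\<bar>" by (intro powr_mono2) auto
      finally have "norm x powr c * ((1 + norm x) ^ n * ?e) \<le> (1 + norm x) powr \<bar>c\<bar> * ((1 + norm x) ^ n * ?e)"
        by (intro mult_right_mono) auto
      also have "\<dots> = (1 + norm x) powr (real n + \<bar>c\<bar>) * ?e"
        by (simp add: powr_add powr_realpow add_pos_nonneg)
      finally have A: "norm x powr c * ((1 + norm x) ^ n * ?e) \<le> (1 + norm x) powr (real n + \<bar>c\<bar>) * ?e" .
      have ind: "indicator (cball 0 1) x = (0::real)" using False by simp
      show ?thesis unfolding ind mult_zero_right add_0 by (rule order_trans[OF A dec])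
    qed
    then have "K * (norm x powr c * ((1 + norm x) ^ n * ?e)) \<le>
      K * (C * (norm x powr c' * indicator (cball 0 1) x + (1 + norm x) powr (- ?N)))"
      using K(1) by (rule mult_left_mono)
    moreover have "norm ((norm x powr c * ?e) *\<^sub>R f x) \<le> (norm x powr c * ?e) * (K * (1 + norm x) ^ n)"
      using K(2)[of x] by (simp add: mult_left_mono)
    ultimately show ?thesis by (simp add: mult_ac)
  qed
  have 1: "integrable lborel (\<lambda>x::'a. norm x powr c' * indicator (cball 0 1) x)"
    using nn_integral_powr_unit_ball[where 'a='a, of c'] c
    by (intro integrableI_bounded) (auto simp: c'_def ennreal_mult ennreal_indicator)
  have 2: "integrable lborel (\<lambda>x::'a. (1 + norm x) powr (- ?N))"
    using nn_integral_decay[where 'a='a] by (intro integrableI_bounded) auto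
  show ?thesis
    by (rule Bochner_Integration.integrable_bound[OF integrable_mult_right[OF Bochner_Integration.integrable_add[OF 1 2]]],
        measurable) (intro AE_I2 order_trans[OF bd], simp only: real_norm_def, rule abs_ge_self)
qed

section \<open>Singularities along a hyperplane\<close>

lemma nn_integral_segment_powr:
  assumes c: "-1 < c" "c \<le> 0" and b: "b > 0"
  shows "\<exists>C\<ge>0. \<forall>u. (\<integral>\<^sup>+t. ennreal (\<bar>u + t * b\<bar> powr c) * indicator {0..1} t \<partial>lborel) \<le> ennreal C"
proof -
  \<comment> \<open>After the substitution s = u + t b the singular part is at most the integral
    over [-1, 1], divided by b, independently of u.\<close>
  define I where "I = (\<integral>\<^sup>+s. ennreal (\<bar>s\<bar> powr c) * indicator (cball 0 1) (s::real) \<partial>lborel)"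
  have I: "I < \<infinity>" unfolding I_def using nn_integral_powr_unit_ball[where 'a=real, of c] c by simp
  have "(\<integral>\<^sup>+t. ennreal (\<bar>u + t * b\<bar> powr c) * indicator {0..1} t \<partial>lborel) \<le> ennreal (1 + enn2real I / b)" for u
  proof -
    have le: "\<bar>s\<bar> powr c \<le> 1 + \<bar>s\<bar> powr c * indicator (cball 0 1) s" for s :: real
    proof (cases "\<bar>s\<bar> \<le> 1")
      case False
      then have "\<bar>s\<bar> powr c \<le> 1 powr c" using c by (intro powr_mono2') auto
      then show ?thesis using False by (simp add: indicator_def)
    qed (simp add: indicator_def)
    have "(\<integral>\<^sup>+t. ennreal (\<bar>u + t * b\<bar> powr c) * indicator {0..1} t \<partial>lborel) \<le>
      (\<integral>\<^sup>+t. indicator {0..1} t + ennreal (\<bar>u + b * t\<bar> powr c) * indicator (cball 0 1) (u + b * t) \<partial>lborel)"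
    proof (rule nn_integral_mono)
      fix t :: real
      show "ennreal (\<bar>u + t * b\<bar> powr c) * indicator {0..1} t \<le>
          indicator {0..1} t + ennreal (\<bar>u + b * t\<bar> powr c) * indicator (cball 0 1) (u + b * t)"
      proof (cases "t \<in> {0..1}")
        case True
        have "ennreal (\<bar>u + b * t\<bar> powr c) \<le> ennreal (1 + \<bar>u + b * t\<bar> powr c * indicator (cball 0 1) (u + b * t))"
          by (intro ennreal_leI le)
        also have "\<dots> = 1 + ennreal (\<bar>u + b * t\<bar> powr c) * indicator (cball 0 1) (u + b * t)"
          by (subst ennreal_plus) (auto simp: ennreal_mult ennreal_indicator)
        finally show ?thesis using True by (simp add: mult.commute)
      qed simp
    qed
    also have "\<dots> = 1 + (\<integral>\<^sup>+t. ennreal (\<bar>u + b * t\<bar> powr c) * indicator (cball 0 1) (u + b * t) \<partial>lborel)"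
      by (subst nn_integral_add; (measurable | simp))
    also have "(\<integral>\<^sup>+t. ennreal (\<bar>u + b * t\<bar> powr c) * indicator (cball 0 1) (u + b * t) \<partial>lborel) = I / ennreal b"
    proof -
      have "I = ennreal \<bar>b\<bar> * (\<integral>\<^sup>+t. ennreal (\<bar>u + b * t\<bar> powr c) * indicator (cball 0 1) (u + b * t) \<partial>lborel)"
        unfolding I_def by (rule nn_integral_real_affine) (use b in auto)
      then show ?thesis using b
        by (simp only: mult.commute[of "ennreal \<bar>b\<bar>"]) (simp add: mult_divide_eq_ennreal)
    qed
    also have "1 + I / ennreal b = ennreal (1 + enn2real I / b)"
      using I b by (subst ennreal_plus) (auto simp: divide_ennreal[symmetric])
    finally show ?thesis .
  qed
  then show ?thesis using b by (intro exI[of _ "1 + enn2real I / b"]) auto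
qed

text \<open>Averaging over a translation in the direction \<open>\<alpha>\<close> reduces the hyperplane singularity to a
  one-dimensional integral.\<close>

lemma tempered_integrable_inner_powr:
  fixes f :: "'a::euclidean_space \<Rightarrow> 'b::{banach, second_countable_topology}"
  assumes f: "tempered f" and c: "-1 < c" and z: "z > 0" and a: "a > 0" and \<alpha>: "\<alpha> \<noteq> (0::'a)"
  shows "integrable lborel (\<lambda>x. (\<bar>\<alpha> \<bullet> x\<bar> powr c * exp (- (z * norm x powr a))) *\<^sub>R f x)"
proof -
  note [measurable] = tempered_measurable[OF f]
  let ?N = "real (DIM('a) + 1)"
  let ?G = "\<lambda>x::'a. (1 + norm x) powr (- ?N)"
  have main: "integrable lborel (\<lambda>x::'a. \<bar>\<alpha> \<bullet> x\<bar> powr min c 0 * ?G x)"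
  proof (rule integrableI_bounded)
    define d where "d = min c 0"
    have d: "-1 < d" "d \<le> 0" using c by (auto simp: d_def)
    obtain C where C: "C \<ge> 0" "\<And>u. (\<integral>\<^sup>+t. ennreal (\<bar>u + t * (\<alpha> \<bullet> \<alpha>)\<bar> powr d) * indicator {0..1} t \<partial>lborel) \<le> ennreal C"
      using nn_integral_segment_powr[OF d, of "\<alpha> \<bullet> \<alpha>"] \<alpha> by auto
    \<comment> \<open>L bounds the change of the decay factor under a translation by
      \<open>t *\<^sub>R \<alpha>\<close> with 0 <= t <= 1.\<close>
    define L where "L = (1 + norm \<alpha>) powr ?N"
    let ?g = "\<lambda>x. ennreal (\<bar>\<alpha> \<bullet> x\<bar> powr d * ?G x)"
    have "(\<integral>\<^sup>+x. ?g x \<partial>lborel) = (\<integral>\<^sup>+t. (\<integral>\<^sup>+x. ?g x \<partial>lborel) * indicator {0..1::real} t \<partial>lborel)"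
      by (subst nn_integral_cmult) auto
    also have "\<dots> = (\<integral>\<^sup>+t. (\<integral>\<^sup>+x. ?g (x + t *\<^sub>R \<alpha>) * indicator {0..1::real} t \<partial>lborel) \<partial>lborel)"
    proof (rule nn_integral_cong)
      fix t :: real
      have "(\<integral>\<^sup>+x. ?g (x + t *\<^sub>R \<alpha>) * indicator {0..1::real} t \<partial>lborel) =
          (\<integral>\<^sup>+x. ?g (x + t *\<^sub>R \<alpha>) \<partial>lborel) * indicator {0..1} t"
        by (rule nn_integral_multc) measurable
      also have "(\<integral>\<^sup>+x. ?g (x + t *\<^sub>R \<alpha>) \<partial>lborel) = (\<integral>\<^sup>+x. ?g x \<partial>lborel)"
        by (rule nn_integral_lborel_translate) measurable
      finally show "(\<integral>\<^sup>+x. ?g x \<partial>lborel) * indicator {0..1} t =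
          (\<integral>\<^sup>+x. ?g (x + t *\<^sub>R \<alpha>) * indicator {0..1::real} t \<partial>lborel)" ..
    qed
    also have "\<dots> = (\<integral>\<^sup>+x. (\<integral>\<^sup>+t. ?g (x + t *\<^sub>R \<alpha>) * indicator {0..1::real} t \<partial>lborel) \<partial>lborel)"
      by (rule lborel_pair.Fubini') measurable
    also have "\<dots> \<le> (\<integral>\<^sup>+x. ennreal (L * C) * ennreal (?G x) \<partial>lborel)"
    proof (rule nn_integral_mono)
      fix x :: 'a
      have "(\<integral>\<^sup>+t. ?g (x + t *\<^sub>R \<alpha>) * indicator {0..1::real} t \<partial>lborel) \<le>
        (\<integral>\<^sup>+t. ennreal (L * ?G x) * (ennreal (\<bar>\<alpha> \<bullet> x + t * (\<alpha> \<bullet> \<alpha>)\<bar> powr d) * indicator {0..1} t) \<partial>lborel)"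
      proof (rule nn_integral_mono)
        fix t :: real
        have "?G (x + t *\<^sub>R \<alpha>) \<le> L * ?G x" if t: "t \<in> {0..1}"
        proof -
          have "norm x \<le> norm (x + t *\<^sub>R \<alpha>) + norm (t *\<^sub>R \<alpha>)"
            using norm_triangle_ineq4[of "x + t *\<^sub>R \<alpha>" "t *\<^sub>R \<alpha>"] by simp
          also have "norm (t *\<^sub>R \<alpha>) \<le> norm \<alpha>" using t by (simp add: mult_left_le_one_le)
          finally have tri: "norm x \<le> norm (x + t *\<^sub>R \<alpha>) + norm \<alpha>" by simp
          have "1 + norm x \<le> (1 + norm (x + t *\<^sub>R \<alpha>)) * (1 + norm \<alpha>)"
          proof -
            have "(1 + norm (x + t *\<^sub>R \<alpha>)) * (1 + norm \<alpha>) =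
                1 + norm (x + t *\<^sub>R \<alpha>) + norm \<alpha> + norm (x + t *\<^sub>R \<alpha>) * norm \<alpha>"
              by (simp add: algebra_simps)
            moreover have "norm (x + t *\<^sub>R \<alpha>) * norm \<alpha> \<ge> 0" by simp
            ultimately show ?thesis using tri by linarith
          qed
          then have "((1 + norm (x + t *\<^sub>R \<alpha>)) * (1 + norm \<alpha>)) powr (- ?N) \<le> ?G x"
            by (intro powr_mono2') (auto intro: add_pos_nonneg)
          then have "?G (x + t *\<^sub>R \<alpha>) * (1 + norm \<alpha>) powr (- ?N) \<le> ?G x"
            by (simp add: powr_mult)
          then have "?G (x + t *\<^sub>R \<alpha>) * (1 + norm \<alpha>) powr (- ?N) * L \<le> ?G x * L"
            by (intro mult_right_mono) (auto simp: L_def)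
          moreover have "(1 + norm \<alpha>) powr (- ?N) * L = 1"
            unfolding L_def powr_add[symmetric] using add_pos_nonneg[of 1 "norm \<alpha>"] by simp
          ultimately show ?thesis unfolding mult.assoc mult_1_right by (simp only: mult.commute mult_1_right mult_1_left)
        qed
        then show "?g (x + t *\<^sub>R \<alpha>) * indicator {0..1::real} t \<le>
          ennreal (L * ?G x) * (ennreal (\<bar>\<alpha> \<bullet> x + t * (\<alpha> \<bullet> \<alpha>)\<bar> powr d) * indicator {0..1} t)"
          by (cases "t \<in> {0..1}")
            (auto simp: inner_add_right ennreal_mult[symmetric] L_def mult.commute intro!: ennreal_leI mult_left_mono)
      qed
      also have "\<dots> = ennreal (L * ?G x) * (\<integral>\<^sup>+t. (ennreal (\<bar>\<alpha> \<bullet> x + t * (\<alpha> \<bullet> \<alpha>)\<bar> powr d) * indicator {0..1} t) \<partial>lborel)"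
        by (rule nn_integral_cmult) auto
      also have "\<dots> \<le> ennreal (L * ?G x) * ennreal C" by (intro mult_left_mono C) auto
      also have "\<dots> = ennreal (L * C) * ennreal (?G x)"
        using C(1) by (simp add: ennreal_mult[symmetric] L_def mult_ac)
      finally show "(\<integral>\<^sup>+t. ?g (x + t *\<^sub>R \<alpha>) * indicator {0..1::real} t \<partial>lborel) \<le> ennreal (L * C) * ennreal (?G x)" .
    qed
    also have "\<dots> = ennreal (L * C) * (\<integral>\<^sup>+x. ennreal (?G x) \<partial>lborel)" by (rule nn_integral_cmult) auto
    also have "\<dots> < \<infinity>" using nn_integral_decay[where 'a='a] by (auto simp: ennreal_mult_less_top)
    finally show "(\<integral>\<^sup>+x. ennreal (norm (\<bar>\<alpha> \<bullet> x\<bar> powr min c 0 * ?G x)) \<partial>lborel) < \<infinity>" by (simp add: d_def)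
  qed simp
  obtain K n where K: "K \<ge> 0" "\<And>x. norm (f x) \<le> K * (1 + norm x) ^ n" using f by (auto simp: tempered_def)
  \<comment> \<open>c = min c 0 + max c 0: the negative part is the singularity just treated, the
    positive part is absorbed by the exponential.\<close>
  define e where "e = max c 0"
  define m where "m = e + real n + ?N"
  obtain C where C: "C \<ge> 0" "\<And>r. r \<ge> 0 \<Longrightarrow> (1 + r) powr m * exp (- (z * r powr a)) \<le> C"
    using exp_decay_bound[OF z a, of m] by (auto simp: m_def e_def)
  have bd: "norm ((\<bar>\<alpha> \<bullet> x\<bar> powr c * exp (- (z * norm x powr a))) *\<^sub>R f x) \<le>
     (K * (norm \<alpha> powr e * C)) * (\<bar>\<alpha> \<bullet> x\<bar> powr min c 0 * ?G x)" for x :: 'a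
  proof -
    let ?e = "exp (- (z * norm x powr a))"
    have "\<bar>\<alpha> \<bullet> x\<bar> powr c = \<bar>\<alpha> \<bullet> x\<bar> powr min c 0 * \<bar>\<alpha> \<bullet> x\<bar> powr e"
      by (simp add: e_def min_def max_def flip: powr_add)
    also have "\<dots> \<le> \<bar>\<alpha> \<bullet> x\<bar> powr min c 0 * (norm \<alpha> powr e * (1 + norm x) powr e)"
    proof (intro mult_left_mono)
      have "\<bar>\<alpha> \<bullet> x\<bar> powr e \<le> (norm \<alpha> * (1 + norm x)) powr e"
        using Cauchy_Schwarz_ineq2[of \<alpha> x]
        by (intro powr_mono2) (auto simp: e_def algebra_simps intro: order_trans)
      then show "\<bar>\<alpha> \<bullet> x\<bar> powr e \<le> norm \<alpha> powr e * (1 + norm x) powr e" by (simp add: powr_mult)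
    qed simp
    finally have "\<bar>\<alpha> \<bullet> x\<bar> powr c * ((1 + norm x) ^ n * ?e) \<le>
      (\<bar>\<alpha> \<bullet> x\<bar> powr min c 0 * (norm \<alpha> powr e * (1 + norm x) powr e)) * ((1 + norm x) ^ n * ?e)"
      by (intro mult_right_mono) auto
    also have "\<dots> = (\<bar>\<alpha> \<bullet> x\<bar> powr min c 0 * norm \<alpha> powr e) * (((1 + norm x) powr m * ?e) * ?G x)"
    proof -
      have "(1 + norm x) powr e * (1 + norm x) ^ n = (1 + norm x) powr m * ?G x"
        unfolding powr_realpow[symmetric, of "1 + norm x", OF add_pos_nonneg[OF zero_less_one norm_ge_zero]]
        by (simp add: m_def flip: powr_add)
      then show ?thesis by (simp add: mult_ac)
    qed
    also have "\<dots> \<le> (\<bar>\<alpha> \<bullet> x\<bar> powr min c 0 * norm \<alpha> powr e) * (C * ?G x)"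
      by (intro mult_left_mono mult_right_mono C) auto
    finally have "K * (\<bar>\<alpha> \<bullet> x\<bar> powr c * ((1 + norm x) ^ n * ?e)) \<le> K * ((\<bar>\<alpha> \<bullet> x\<bar> powr min c 0 * norm \<alpha> powr e) * (C * ?G x))"
      using K(1) by (rule mult_left_mono)
    moreover have "norm ((\<bar>\<alpha> \<bullet> x\<bar> powr c * ?e) *\<^sub>R f x) \<le> (\<bar>\<alpha> \<bullet> x\<bar> powr c * ?e) * (K * (1 + norm x) ^ n)"
      using K(2)[of x] by (simp add: mult_left_mono)
    ultimately show ?thesis by (simp add: mult_ac)
  qed
  show ?thesis
    by (rule Bochner_Integration.integrable_bound[OF integrable_mult_right[OF main]], measurable)
      (intro AE_I2 order_trans[OF bd], simp only: real_norm_def, rule abs_ge_self)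
qed

section \<open>Orthogonality of Dunkl harmonics of different degrees\<close>

text \<open>Uniqueness of Haar measure: both sides are compared through a double integral against the
  unit ball, which the isometry preserves.\<close>

lemma nn_integral_lborel_linear_isometry:
  fixes T :: "'a::euclidean_space \<Rightarrow> 'a"
  assumes lin: "linear T" and iso: "\<And>x. norm (T x) = norm x" and surj: "surj T"
    and f[measurable]: "f \<in> borel_measurable borel"
  shows "(\<integral>\<^sup>+x. f (T x) \<partial>lborel) = (\<integral>\<^sup>+x. f x \<partial>lborel)"
proof -
  have [measurable]: "T \<in> borel_measurable borel"
    by (intro borel_measurable_continuous_onI linear_continuous_on linear_conv_bounded_linear[THEN iffD1] lin)
  let ?B = "cball (0::'a) 1"
  let ?i = "\<lambda>x::'a. indicator ?B x :: ennreal"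
  define V where "V = emeasure lborel ?B"
  have V: "V \<noteq> 0" "V \<noteq> \<infinity>"
    using content_cball_pos[of 1 "0::'a"] emeasure_lborel_cball_finite[of "0::'a" 1]
    by (auto simp: V_def measure_def)
  \<comment> \<open>Surjectivity turns a translation after T into a translation before T, under
    which Lebesgue measure is invariant.\<close>
  have inv: "(\<integral>\<^sup>+x. g (T x + y) \<partial>lborel) = (\<integral>\<^sup>+x. g (T x) \<partial>lborel)"
    if [measurable]: "g \<in> borel_measurable borel" for g :: "'a \<Rightarrow> ennreal" and y
  proof -
    obtain y' where "y = T y'" using surj by (metis surjD)
    then have "(\<integral>\<^sup>+x. g (T x + y) \<partial>lborel) = (\<integral>\<^sup>+x. g (T (x + y')) \<partial>lborel)"
      by (simp add: linear_add[OF lin])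
    then show ?thesis by (simp add: nn_integral_lborel_translate[where f="\<lambda>x. g (T x)"])
  qed
  have ball: "(\<integral>\<^sup>+x. ?i (y - T x) \<partial>lborel) = V" for y
  proof -
    obtain y' where y: "y = T y'" using surj by (metis surjD)
    have "?i (y - T x) = ?i (x + (- y'))" for x
    proof -
      have "norm (y - T x) = norm (x + (- y'))"
        using iso[of "y' - x"] by (simp add: y linear_diff[OF lin] norm_minus_commute)
      then show ?thesis by (simp add: indicator_def)
    qed
    then have "(\<integral>\<^sup>+x. ?i (y - T x) \<partial>lborel) = (\<integral>\<^sup>+x. ?i (x + (- y')) \<partial>lborel)" by simp
    also have "\<dots> = (\<integral>\<^sup>+x. ?i x \<partial>lborel)" by (rule nn_integral_lborel_translate) measurable
    finally show ?thesis by (simp add: V_def)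
  qed
  \<comment> \<open>Averaging over translations y in the unit ball and exchanging the integrals
    moves T from the argument of f into the indicator, where \<open>ball\<close> evaluates
    it.\<close>
  have "V * (\<integral>\<^sup>+x. f (T x) \<partial>lborel) = (\<integral>\<^sup>+y. ?i y * (\<integral>\<^sup>+x. f (T x) \<partial>lborel) \<partial>lborel)"
    by (simp add: nn_integral_multc V_def)
  also have "\<dots> = (\<integral>\<^sup>+y. (\<integral>\<^sup>+x. ?i y * f (T x + y) \<partial>lborel) \<partial>lborel)"
    by (intro nn_integral_cong) (simp add: nn_integral_cmult inv)
  also have "\<dots> = (\<integral>\<^sup>+x. (\<integral>\<^sup>+y. ?i y * f (T x + y) \<partial>lborel) \<partial>lborel)"
    by (rule lborel_pair.Fubini') measurable
  also have "\<dots> = (\<integral>\<^sup>+x. (\<integral>\<^sup>+y. ?i (y - T x) * f y \<partial>lborel) \<partial>lborel)"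
  proof (rule nn_integral_cong)
    fix x
    have "(\<integral>\<^sup>+y. ?i (y - T x) * f y \<partial>lborel) = (\<integral>\<^sup>+y. ?i (y + T x - T x) * f (y + T x) \<partial>lborel)"
      by (rule nn_integral_lborel_translate[symmetric]) measurable
    then show "(\<integral>\<^sup>+y. ?i y * f (T x + y) \<partial>lborel) = (\<integral>\<^sup>+y. ?i (y - T x) * f y \<partial>lborel)"
      by (simp add: add.commute)
  qed
  also have "\<dots> = (\<integral>\<^sup>+y. (\<integral>\<^sup>+x. ?i (y - T x) * f y \<partial>lborel) \<partial>lborel)"
    by (rule lborel_pair.Fubini') measurable
  also have "\<dots> = (\<integral>\<^sup>+y. V * f y \<partial>lborel)"
    by (intro nn_integral_cong) (simp add: nn_integral_multc ball)
  also have "\<dots> = V * (\<integral>\<^sup>+x. f x \<partial>lborel)" by (simp add: nn_integral_cmult)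
  finally show ?thesis using V by (simp add: ennreal_mult_cancel_left)
qed

section \<open>Reflections and the divergence theorem\<close>

lemma root_reflection_involution: "root_reflection \<alpha> (root_reflection \<alpha> x) = x"
proof (cases "\<alpha> = 0")
  case False
  then have "\<alpha> \<bullet> root_reflection \<alpha> x = - (\<alpha> \<bullet> x)"
    by (simp add: root_reflection_def inner_diff_right power2_norm_eq_inner)
  then show ?thesis by (subst root_reflection_def) (simp add: root_reflection_def)
qed (simp add: root_reflection_def)

lemma inner_root_reflection: "\<alpha> \<noteq> 0 \<Longrightarrow> \<alpha> \<bullet> root_reflection \<alpha> x = - (\<alpha> \<bullet> x)"
  by (simp add: root_reflection_def inner_diff_right power2_norm_eq_inner)

lemma linear_root_reflection: "linear (root_reflection \<alpha>)"
  by (rule linearI) (simp_all add: root_reflection_def inner_add_right algebra_simps add_divide_distrib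
      scaleR_add_left flip: scaleR_add_left)

lemma measurable_root_reflection[measurable]: "root_reflection \<alpha> \<in> borel_measurable borel"
  by (intro borel_measurable_continuous_onI linear_continuous_on
      linear_conv_bounded_linear[THEN iffD1] linear_root_reflection)

lemma integral_lborel_root_reflection:
  fixes f :: "'a::euclidean_space \<Rightarrow> real"
  assumes [measurable]: "f \<in> borel_measurable borel"
  shows "(\<integral>x. f (root_reflection \<alpha> x) \<partial>lborel) = (\<integral>x. f x \<partial>lborel)"
proof -
  have surj: "surj (root_reflection \<alpha>)"
    by (rule surjI[where f="root_reflection \<alpha>"]) (rule root_reflection_involution)
  have "distr lborel borel (root_reflection \<alpha>) = lborel"
  proof (rule measure_eqI)
    fix A assume "A \<in> sets (distr lborel borel (root_reflection \<alpha>))"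
    then have [measurable]: "A \<in> sets borel" by simp
    have "emeasure (distr lborel borel (root_reflection \<alpha>)) A = (\<integral>\<^sup>+x. indicator A x \<partial>distr lborel borel (root_reflection \<alpha>))"
      by simp
    also have "\<dots> = (\<integral>\<^sup>+x. indicator A (root_reflection \<alpha> x) \<partial>lborel)"
      by (rule nn_integral_distr) auto
    also have "\<dots> = (\<integral>\<^sup>+x. indicator A x \<partial>lborel)"
      by (rule nn_integral_lborel_linear_isometry[OF linear_root_reflection norm_root_reflection surj]) auto
    finally show "emeasure (distr lborel borel (root_reflection \<alpha>)) A = emeasure lborel A" by simp
  qed simp
  then have "(\<integral>x. f x \<partial>lborel) = (\<integral>x. f x \<partial>distr lborel borel (root_reflection \<alpha>))" by simp
  also have "\<dots> = (\<integral>x. f (root_reflection \<alpha> x) \<partial>lborel)" by (rule integral_distr) auto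
  finally show ?thesis ..
qed

text \<open>The divergence theorem for a field decaying at infinity: integrate
  \<open>G (x + b) - G x = \<integral>\<^sub>0\<^sup>1 \<partial>\<^sub>b G (x + t b) dt\<close> over \<open>x\<close>.\<close>

lemma integral_directional_derivative_zero:
  fixes G G' :: "'a::euclidean_space \<Rightarrow> real"
  assumes G: "integrable lborel G" and G': "integrable lborel G'" and cont: "continuous_on UNIV G"
    and der: "AE x in lborel. \<exists>S. finite S \<and>
      (\<forall>t. t \<notin> S \<longrightarrow> ((\<lambda>t. G (x + t *\<^sub>R b)) has_real_derivative G' (x + t *\<^sub>R b)) (at t))"
  shows "(\<integral>x. G' x \<partial>lborel) = 0"
proof -
  note [measurable] = borel_measurable_integrable[OF G, simplified] borel_measurable_integrable[OF G', simplified]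
  let ?h = "\<lambda>(t::real) x. indicator {0..1} t * G' (x + t *\<^sub>R b)"
  have int: "integrable (lborel \<Otimes>\<^sub>M lborel) (\<lambda>(t, x). ?h t x)"
  proof (rule lborel_pair.Fubini_integrable)
    show "integrable lborel (\<lambda>t. \<integral>x. norm (case (t, x) of (t, x) \<Rightarrow> ?h t x) \<partial>lborel)"
    proof -
      have "(\<integral>x. norm (?h t x) \<partial>lborel) = indicator {0..1} t * (\<integral>x. norm (G' x) \<partial>lborel)" for t
        using integral_lborel_translate[of "\<lambda>x. norm (G' x)" "t *\<^sub>R b"] by (simp add: norm_mult abs_mult)
      then show ?thesis by simp
    qed
    show "AE t in lborel. integrable lborel (\<lambda>x. case (t, x) of (t, x) \<Rightarrow> ?h t x)"
      using integrable_lborel_translate[OF G'] by simp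
  qed measurable
  have "(\<integral>x. G' x \<partial>lborel) = (\<integral>t. indicator {0..1::real} t * (\<integral>x. G' x \<partial>lborel) \<partial>lborel)" by simp
  also have "\<dots> = (\<integral>t. (\<integral>x. ?h t x \<partial>lborel) \<partial>lborel)"
    by (intro Bochner_Integration.integral_cong refl)
      (simp add: integral_lborel_translate[where f=G'])
  also have "\<dots> = (\<integral>x. (\<integral>t. ?h t x \<partial>lborel) \<partial>lborel)"
    by (rule lborel_pair.Fubini_integral[OF int, symmetric])
  also have "\<dots> = (\<integral>x. G (x + b) - G x \<partial>lborel)"
  proof (rule integral_cong_AE)
    show "AE x in lborel. (\<integral>t. ?h t x \<partial>lborel) = G (x + b) - G x"
      using der lborel_pair.AE_integrable_snd[OF int]
    proof eventually_elim
      case (elim x)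
      then obtain S where S: "finite S"
        "\<And>t. t \<notin> S \<Longrightarrow> ((\<lambda>t. G (x + t *\<^sub>R b)) has_real_derivative G' (x + t *\<^sub>R b)) (at t)" by blast
      \<comment> \<open>The strong form of the fundamental theorem tolerates the finite set S, here
        the crossings of hyperplanes and of the origin, as long as G is continuous there.\<close>
      have "((\<lambda>t. G' (x + t *\<^sub>R b)) has_integral (G (x + 1 *\<^sub>R b) - G (x + 0 *\<^sub>R b))) {0..1}"
      proof (rule fundamental_theorem_of_calculus_interior_strong[OF S(1)])
        show "continuous_on {0..1} (\<lambda>t. G (x + t *\<^sub>R b))"
          by (intro continuous_on_compose2[OF cont] continuous_intros) auto
      qed (use S(2) in \<open>auto simp: has_real_derivative_iff_has_vector_derivative\<close>)
      moreover have "set_integrable lborel {0..1} (\<lambda>t. G' (x + t *\<^sub>R b))"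
        using elim(2) by (simp add: set_integrable_def)
      ultimately show ?case
        using set_borel_integral_eq_integral(2)[of "{0..1}" "\<lambda>t. G' (x + t *\<^sub>R b)"]
        by (simp add: set_lebesgue_integral_def integral_unique)
    qed
  qed measurable
  also have "\<dots> = (\<integral>x. G (x + b) \<partial>lborel) - (\<integral>x. G x \<partial>lborel)"
    by (intro Bochner_Integration.integral_diff integrable_lborel_translate G)
  also have "\<dots> = 0" by (simp add: integral_lborel_translate[where f=G])
  finally show ?thesis .
qed

lemma has_real_derivative_line:
  fixes p :: "'a::real_normed_vector \<Rightarrow> real"
  assumes "p differentiable (at (x + t *\<^sub>R v))"
  shows "((\<lambda>t. p (x + t *\<^sub>R v)) has_real_derivative dder v p (x + t *\<^sub>R v)) (at t)"
proof -
  have l: "((\<lambda>t. x + t *\<^sub>R v) has_derivative (\<lambda>h. h *\<^sub>R v)) (at t)"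
    by (auto intro!: derivative_eq_intros)
  have "((\<lambda>t. p (x + t *\<^sub>R v)) has_derivative (\<lambda>h. dder (h *\<^sub>R v) p (x + t *\<^sub>R v))) (at t)"
    by (rule has_derivative_compose[OF l has_derivative_dder[OF assms]])
  then show ?thesis
    by (simp add: has_field_derivative_def linear_scale[OF linear_frechet_derivative[OF assms]] mult_commute_abs)
qed

text \<open>\<open>harmonic_poly\<close> records homogeneity as a functional equation, so Euler's
  identity is obtained by differentiating along the ray through x.\<close>

lemma euler_homogeneous:
  fixes p :: "'a::euclidean_space \<Rightarrow> real"
  assumes "p differentiable (at x)" "\<And>t. p (t *\<^sub>R x) = t ^ m * p x"
  shows "dder x p x = real m * p x"
proof -
  have "((\<lambda>t. p (x + t *\<^sub>R x)) has_real_derivative dder x p x) (at 0)"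
    using has_real_derivative_line[of p x 0 x] assms(1) by simp
  moreover have "((\<lambda>t. p (x + t *\<^sub>R x)) has_real_derivative real m * p x) (at 0)"
  proof -
    have "p (x + t *\<^sub>R x) = (1 + t) ^ m * p x" for t
      using assms(2)[of "1 + t"] by (simp add: scaleR_add_left)
    then show ?thesis by (auto intro!: derivative_eq_intros)
  qed
  ultimately show ?thesis by (rule DERIV_unique)
qed

lemma AE_inner_nonzero: "\<alpha> \<noteq> 0 \<Longrightarrow> AE x in lborel. (\<alpha>::'a::euclidean_space) \<bullet> x \<noteq> 0"
proof -
  assume "\<alpha> \<noteq> 0"
  then have "negligible {x. \<alpha> \<bullet> x = 0}" by (intro negligible_hyperplane) auto
  moreover have "{x. \<alpha> \<bullet> x = 0} \<in> sets borel" by measurable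
  ultimately have "{x. \<alpha> \<bullet> x = 0} \<in> null_sets lborel"
    by (simp add: negligible_iff_null_sets null_sets_completion_iff)
  then show ?thesis by (intro AE_I'[of "{x. \<alpha> \<bullet> x = 0}"]) auto
qed

lemma AE_nonzero: "AE x in lborel. (x::'a::euclidean_space) \<noteq> 0"
proof -
  obtain b :: 'a where "b \<in> Basis" using nonempty_Basis by blast
  then have "AE x in lborel. b \<bullet> x \<noteq> 0" by (intro AE_inner_nonzero) auto
  then show ?thesis by eventually_elim auto
qed

lemma tempered_integrable_exp:
  fixes f :: "'a::euclidean_space \<Rightarrow> 'b::{banach, second_countable_topology}"
  assumes f: "tempered f" and z: "z > 0" and a: "a > 0"
  shows "integrable lborel (\<lambda>x. exp (- (z * norm x powr a)) *\<^sub>R f x)"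
proof -
  note [measurable] = tempered_measurable[OF f]
  \<comment> \<open>\<open>norm x powr 0\<close> is 0 at the origin and 1 elsewhere, hence the
    comparison almost everywhere below.\<close>
  have "integrable lborel (\<lambda>x. (norm x powr 0 * exp (- (z * norm x powr a))) *\<^sub>R f x)"
    by (intro tempered_integrable_norm_powr f z a) auto
  then show ?thesis
  proof (rule Bochner_Integration.integrable_bound)
    show "AE x in lborel. norm (exp (- (z * norm x powr a)) *\<^sub>R f x) \<le>
        norm ((norm x powr 0 * exp (- (z * norm x powr a))) *\<^sub>R f x)"
      using AE_nonzero by eventually_elim auto
  qed measurable
qed

lemma real_polynomial_divided_difference:
  fixes p :: "'a::euclidean_space \<Rightarrow> real"
  assumes "real_polynomial_function p" "\<alpha> \<noteq> 0"
  shows "\<exists>q. real_polynomial_function q \<and> (\<forall>x. p x - p (root_reflection \<alpha> x) = (\<alpha> \<bullet> x) * q x)"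
  using real_polynomial_hpoly_sum_of[OF assms(1)]
proof (induction rule: hpoly_sum_of.induct)
  case (base d p)
  then show ?case using hpoly_divided_difference[OF base assms(2)] hpoly_poly by blast
next
  case (add p q)
  then obtain p' q' where *: "real_polynomial_function p'" "\<And>x. p x - p (root_reflection \<alpha> x) = (\<alpha> \<bullet> x) * p' x"
    "real_polynomial_function q'" "\<And>x. q x - q (root_reflection \<alpha> x) = (\<alpha> \<bullet> x) * q' x" by blast
  have "p x + q x - (p (root_reflection \<alpha> x) + q (root_reflection \<alpha> x)) = (\<alpha> \<bullet> x) * (p' x + q' x)" for x
    unfolding distrib_left *(2,4)[symmetric] by simp
  with real_polynomial_function.intros(3)[OF *(1,3)] show ?case by blast
qed

section \<open>The Dunkl weight and orthogonality of harmonics\<close>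

text \<open>Roots of multiplicity zero are left out, so that the weight is continuous.\<close>

definition eff_roots :: "'a::euclidean_space set \<Rightarrow> ('a \<Rightarrow> real) \<Rightarrow> 'a set" where
  "eff_roots Rp k = {\<alpha>\<in>Rp. k \<alpha> \<noteq> 0}"

definition pweight :: "'a::euclidean_space set \<Rightarrow> ('a \<Rightarrow> real) \<Rightarrow> 'a \<Rightarrow> real" where
  "pweight Rp k x = (\<Prod>\<alpha>\<in>eff_roots Rp k. \<bar>\<alpha> \<bullet> x\<bar> powr (2 * k \<alpha>))"

text \<open>The symmetry of the root system enters the analysis as
  \<open>pweight_reflection\<close>, which \<open>root_system_dunkl_setting\<close> derives from the
  root axioms.\<close>

locale dunkl_setting =
  fixes Rp :: "'a::euclidean_space set" and k :: "'a \<Rightarrow> real" and a :: real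
  assumes finite_Rp: "finite Rp" and zero_Rp: "0 \<notin> Rp" and k_nonneg: "\<And>\<alpha>. \<alpha> \<in> Rp \<Longrightarrow> k \<alpha> \<ge> 0"
    and a_pos: "a > 0" and dim_pos: "a + 2 * mult_sum Rp k + real DIM('a) > 2"
    and pweight_reflection: "\<And>\<alpha> x. \<alpha> \<in> eff_roots Rp k \<Longrightarrow> pweight Rp k (root_reflection \<alpha> x) = pweight Rp k x"
begin

abbreviation "Eff \<equiv> eff_roots Rp k"

lemma eff_roots: "finite Eff" "\<alpha> \<in> Eff \<Longrightarrow> k \<alpha> > 0" "\<alpha> \<in> Eff \<Longrightarrow> \<alpha> \<noteq> 0" "\<alpha> \<in> Eff \<Longrightarrow> \<alpha> \<in> Rp"
  using finite_Rp zero_Rp k_nonneg by (auto simp: eff_roots_def less_le)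

lemma AE_regular: "AE x in lborel. x \<noteq> 0 \<and> (\<forall>\<alpha>\<in>Rp. \<alpha> \<bullet> x \<noteq> 0)"
proof -
  have "AE x in lborel. \<forall>\<alpha>\<in>Rp. \<alpha> \<bullet> x \<noteq> 0"
    using zero_Rp by (intro AE_finite_allI finite_Rp AE_inner_nonzero) auto
  then show ?thesis using AE_nonzero by eventually_elim auto
qed

lemma tempered_partial_weight: "S \<subseteq> Eff \<Longrightarrow> tempered (\<lambda>x. \<Prod>\<alpha>\<in>S. \<bar>\<alpha> \<bullet> x\<bar> powr (2 * k \<alpha>))"
proof (induction S rule: infinite_finite_induct)
  case (insert \<beta> S)
  have "tempered (\<lambda>x. \<bar>\<beta> \<bullet> x\<bar> powr (2 * k \<beta>))"
  proof (rule tempered_bound[of "\<lambda>x. norm \<beta> powr (2 * k \<beta>) * norm x powr (2 * k \<beta>)"])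
    have kb: "k \<beta> > 0" using insert eff_roots by auto
    then show "tempered (\<lambda>x::'a. norm \<beta> powr (2 * k \<beta>) * norm x powr (2 * k \<beta>))"
      by (intro tempered_mult tempered_const tempered_norm_powr) auto
    fix x
    have "\<bar>\<beta> \<bullet> x\<bar> powr (2 * k \<beta>) \<le> (norm \<beta> * norm x) powr (2 * k \<beta>)"
      using kb by (intro powr_mono2 Cauchy_Schwarz_ineq2) auto
    then show "norm (\<bar>\<beta> \<bullet> x\<bar> powr (2 * k \<beta>)) \<le> norm (norm \<beta> powr (2 * k \<beta>) * norm x powr (2 * k \<beta>))"
      by (simp add: powr_mult)
  qed simp
  with insert show ?case by auto
qed auto

lemma tempered_pweight: "tempered (pweight Rp k)"
  unfolding pweight_def[abs_def] by (rule tempered_partial_weight) simp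

lemma measurable_pweight[measurable]: "pweight Rp k \<in> borel_measurable borel"
  by (rule tempered_measurable[OF tempered_pweight])

lemma continuous_pweight: "continuous_on UNIV (pweight Rp k)"
  unfolding pweight_def[abs_def]
  using eff_roots(2) by (intro continuous_intros continuous_on_powr') (auto simp: less_imp_le)

text \<open>The weight contains |alpha . x|^(2k) with k > 0, so after division by alpha . x the
  exponent is still 2k - 1 > -1.\<close>

lemma integrable_singular_root:
  assumes \<alpha>: "\<alpha> \<in> Eff" and f: "tempered f" and z: "z > 0"
  shows "integrable lborel (\<lambda>x. f x / (\<alpha> \<bullet> x) * (pweight Rp k x * exp (- (z * norm x powr a))) :: real)"
proof -
  let ?P = "\<lambda>x. \<Prod>\<beta>\<in>Eff - {\<alpha>}. \<bar>\<beta> \<bullet> x\<bar> powr (2 * k \<beta>)"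
  note [measurable] = tempered_measurable[OF f]
  have P: "tempered ?P" by (rule tempered_partial_weight) auto
  have "integrable lborel (\<lambda>x. (\<bar>\<alpha> \<bullet> x\<bar> powr (2 * k \<alpha> - 1) * exp (- (z * norm x powr a))) *\<^sub>R (?P x * f x))"
    using eff_roots(2,3)[OF \<alpha>] by (intro tempered_integrable_inner_powr tempered_mult P f z a_pos) auto
  then show ?thesis
  proof (rule Bochner_Integration.integrable_bound)
    show "AE x in lborel. norm (f x / (\<alpha> \<bullet> x) * (pweight Rp k x * exp (- (z * norm x powr a)))) \<le>
       norm ((\<bar>\<alpha> \<bullet> x\<bar> powr (2 * k \<alpha> - 1) * exp (- (z * norm x powr a))) *\<^sub>R (?P x * f x))"
      using AE_regular
    proof eventually_elim
      case (elim x)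
      then have x: "\<alpha> \<bullet> x \<noteq> 0" using eff_roots(4)[OF \<alpha>] by auto
      have "pweight Rp k x = \<bar>\<alpha> \<bullet> x\<bar> powr (2 * k \<alpha>) * ?P x"
        unfolding pweight_def by (rule prod.remove[OF eff_roots(1) \<alpha>])
      also have "\<bar>\<alpha> \<bullet> x\<bar> powr (2 * k \<alpha>) = \<bar>\<alpha> \<bullet> x\<bar> powr (2 * k \<alpha> - 1) * \<bar>\<alpha> \<bullet> x\<bar>"
        using x by (simp add: powr_diff)
      finally show ?case using x by (simp add: abs_mult)
    qed
  qed measurable
qed

text \<open>Logarithms of squares need no case distinction on the sign of alpha . x, and they turn
  the derivative of the product into a sum.\<close>

lemma pweight_exp:
  assumes "\<And>\<alpha>. \<alpha> \<in> Eff \<Longrightarrow> \<alpha> \<bullet> x \<noteq> 0"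
  shows "pweight Rp k x = exp (\<Sum>\<alpha>\<in>Eff. k \<alpha> * ln ((\<alpha> \<bullet> x)\<^sup>2))"
  unfolding pweight_def exp_sum[OF eff_roots(1)]
proof (rule prod.cong[OF refl])
  fix \<alpha> assume "\<alpha> \<in> Eff"
  with assms have "\<alpha> \<bullet> x \<noteq> 0" by auto
  then have "ln ((\<alpha> \<bullet> x)\<^sup>2) = 2 * ln \<bar>\<alpha> \<bullet> x\<bar>"
    using ln_realpow[of "\<bar>\<alpha> \<bullet> x\<bar>" 2] by simp
  then show "\<bar>\<alpha> \<bullet> x\<bar> powr (2 * k \<alpha>) = exp (k \<alpha> * ln ((\<alpha> \<bullet> x)\<^sup>2))"
    using \<open>\<alpha> \<bullet> x \<noteq> 0\<close> by (simp add: powr_def)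
qed

text \<open>The factor |x|^(a-2) of the measure is left out on purpose: differentiating the
  exponential brings it back, multiplied by z a.\<close>

definition gweight :: "real \<Rightarrow> 'a \<Rightarrow> real" where
  "gweight z x = pweight Rp k x * exp (- (z * norm x powr a))"

definition gweight_logder :: "real \<Rightarrow> 'a \<Rightarrow> 'a \<Rightarrow> real" where
  "gweight_logder z b x = (\<Sum>\<alpha>\<in>Eff. 2 * k \<alpha> * (\<alpha> \<bullet> b) / (\<alpha> \<bullet> x)) - z * a * norm x powr (a - 2) * (x \<bullet> b)"

lemma gweight_line_derivative:
  assumes x: "x + t *\<^sub>R b \<noteq> 0" "\<And>\<alpha>. \<alpha> \<in> Eff \<Longrightarrow> \<alpha> \<bullet> (x + t *\<^sub>R b) \<noteq> 0"
  shows "((\<lambda>t. gweight z (x + t *\<^sub>R b)) has_real_derivative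
    gweight z (x + t *\<^sub>R b) * gweight_logder z b (x + t *\<^sub>R b)) (at t)"
proof -
  \<comment> \<open>An open neighbourhood of t on which the exponential form of
    \<open>gweight\<close> is valid, so that its derivative can be transferred.\<close>
  define S where "S = {t. x + t *\<^sub>R b \<noteq> 0} \<inter> (\<Inter>\<alpha>\<in>Eff. {t. \<alpha> \<bullet> (x + t *\<^sub>R b) \<noteq> 0})"
  have S: "open S"
    unfolding S_def by (intro open_Int open_INT eff_roots(1) ballI open_Collect_neq continuous_intros)
  have tS: "t \<in> S" using x by (auto simp: S_def)
  define P where "P t = (\<Sum>\<alpha>\<in>Eff. k \<alpha> * ln ((\<alpha> \<bullet> x + t * (\<alpha> \<bullet> b))\<^sup>2))" for t
  define Q where "Q t = a / 2 * ln (x \<bullet> x + 2 * t * (x \<bullet> b) + t\<^sup>2 * (b \<bullet> b))" for t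
  have sq: "(x + t *\<^sub>R b) \<bullet> (x + t *\<^sub>R b) = x \<bullet> x + 2 * t * (x \<bullet> b) + t\<^sup>2 * (b \<bullet> b)" for t
    by (simp add: inner_add_left inner_add_right inner_commute power2_eq_square algebra_simps)
  have eQ: "exp (Q t) = norm (x + t *\<^sub>R b) powr a" if "x + t *\<^sub>R b \<noteq> 0" for t
  proof -
    have "ln ((norm (x + t *\<^sub>R b))\<^sup>2) = 2 * ln (norm (x + t *\<^sub>R b))"
      using that ln_realpow[of "norm (x + t *\<^sub>R b)" 2] by simp
    moreover have "x \<bullet> x + 2 * t * (x \<bullet> b) + t\<^sup>2 * (b \<bullet> b) = (norm (x + t *\<^sub>R b))\<^sup>2"
      by (simp only: sq power2_norm_eq_inner)
    ultimately have "Q t = a * ln (norm (x + t *\<^sub>R b))" by (simp only: Q_def)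
    then show ?thesis using that by (simp add: powr_def)
  qed
  have eP: "exp (P t) = pweight Rp k (x + t *\<^sub>R b)" if "\<And>\<alpha>. \<alpha> \<in> Eff \<Longrightarrow> \<alpha> \<bullet> (x + t *\<^sub>R b) \<noteq> 0" for t
    using pweight_exp[OF that] by (simp add: P_def inner_add_right)
  have dP: "(P has_real_derivative (\<Sum>\<alpha>\<in>Eff. 2 * k \<alpha> * (\<alpha> \<bullet> b) / (\<alpha> \<bullet> (x + t *\<^sub>R b)))) (at t)"
    unfolding P_def
  proof (intro DERIV_sum)
    fix \<alpha> assume "\<alpha> \<in> Eff"
    with x(2) have y: "\<alpha> \<bullet> x + t * (\<alpha> \<bullet> b) \<noteq> 0" by (auto simp: inner_add_right)
    have d: "((\<lambda>t. (\<alpha> \<bullet> x + t * (\<alpha> \<bullet> b))\<^sup>2) has_real_derivative 2 * (\<alpha> \<bullet> x + t * (\<alpha> \<bullet> b)) * (\<alpha> \<bullet> b)) (at t)"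
      by (auto intro!: derivative_eq_intros)
    have "2 * k \<alpha> * (\<alpha> \<bullet> b) / y = k \<alpha> * (1 / y\<^sup>2 * (2 * y * (\<alpha> \<bullet> b)))" if "y \<noteq> 0" for y
      using that by (simp add: power2_eq_square)
    from this[OF y] show "((\<lambda>t. k \<alpha> * ln ((\<alpha> \<bullet> x + t * (\<alpha> \<bullet> b))\<^sup>2)) has_real_derivative
        2 * k \<alpha> * (\<alpha> \<bullet> b) / (\<alpha> \<bullet> (x + t *\<^sub>R b))) (at t)"
      using DERIV_cmult[OF DERIV_chain2[OF DERIV_ln_divide d], of "k \<alpha>"] y
      by (simp add: inner_add_right)
  qed
  have pos: "x \<bullet> x + 2 * t * (x \<bullet> b) + t\<^sup>2 * (b \<bullet> b) > 0"
    unfolding sq[symmetric] using x(1) by simp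
  have dQ: "(Q has_real_derivative a * ((x + t *\<^sub>R b) \<bullet> b) / (norm (x + t *\<^sub>R b))\<^sup>2) (at t)"
    unfolding Q_def power2_norm_eq_inner sq using pos
    by (auto intro!: derivative_eq_intros simp: inner_add_left field_simps)
  have "((\<lambda>t. exp (P t) * exp (- (z * exp (Q t)))) has_real_derivative
      exp (P t) * exp (- (z * exp (Q t))) * ((\<Sum>\<alpha>\<in>Eff. 2 * k \<alpha> * (\<alpha> \<bullet> b) / (\<alpha> \<bullet> (x + t *\<^sub>R b)))
        - z * (exp (Q t) * (a * ((x + t *\<^sub>R b) \<bullet> b) / (norm (x + t *\<^sub>R b))\<^sup>2)))) (at t)"
    by (rule derivative_eq_intros dP dQ refl | simp add: algebra_simps)+
  also have "exp (P t) * exp (- (z * exp (Q t))) * ((\<Sum>\<alpha>\<in>Eff. 2 * k \<alpha> * (\<alpha> \<bullet> b) / (\<alpha> \<bullet> (x + t *\<^sub>R b)))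
        - z * (exp (Q t) * (a * ((x + t *\<^sub>R b) \<bullet> b) / (norm (x + t *\<^sub>R b))\<^sup>2)))
     = gweight z (x + t *\<^sub>R b) * gweight_logder z b (x + t *\<^sub>R b)"
  proof -
    have "norm (x + t *\<^sub>R b) powr (a - 2) = norm (x + t *\<^sub>R b) powr a / (norm (x + t *\<^sub>R b))\<^sup>2"
      using x(1) by (simp add: powr_diff)
    moreover have "exp (P t) = pweight Rp k (x + t *\<^sub>R b)" by (rule eP) (rule x(2))
    ultimately show ?thesis
      unfolding gweight_def gweight_logder_def eQ[OF x(1)] by simp
  qed
  finally show ?thesis
  proof (rule has_field_derivative_transform_within_open[OF _ S tS])
    fix s assume "s \<in> S"
    then show "exp (P s) * exp (- (z * exp (Q s))) = gweight z (x + s *\<^sub>R b)"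
      using eP eQ by (auto simp: S_def gweight_def)
  qed
qed

lemma measurable_gweight[measurable]: "gweight z \<in> borel_measurable borel"
  unfolding gweight_def[abs_def] by measurable

lemma continuous_gweight: "continuous_on UNIV (gweight z)"
  unfolding gweight_def[abs_def]
  using a_pos by (intro continuous_intros continuous_pweight continuous_on_powr') auto

lemma tempered_integrable_gweight:
  assumes "tempered f" "z > 0"
  shows "integrable lborel (\<lambda>x. f x * gweight z x :: real)"
  using tempered_integrable_exp[OF tempered_mult[OF assms(1) tempered_pweight] assms(2) a_pos]
  by (simp add: gweight_def mult_ac)

lemma tempered_integrable_gweight_logder:
  assumes f: "tempered f" and z: "z > 0"
  shows "integrable lborel (\<lambda>x. f x * (gweight z x * gweight_logder z b x) :: real)"
proof -
  note [measurable] = tempered_measurable[OF f]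
  have 1: "integrable lborel (\<lambda>x. \<Sum>\<alpha>\<in>Eff. (2 * k \<alpha> * (\<alpha> \<bullet> b)) * (f x / (\<alpha> \<bullet> x) * gweight z x))"
    unfolding gweight_def
    by (intro Bochner_Integration.integrable_sum integrable_mult_right integrable_singular_root f z)
  \<comment> \<open>Cauchy-Schwarz gives |x|^(a-2) |x . b| <= |b| |x|^(a-1), and this exponent
    exceeds -N because a > 0 and N >= 1.\<close>
  have c1: "a - 1 > - real DIM('a)" using a_pos DIM_positive[where 'a='a] by linarith
  have "integrable lborel (\<lambda>x. (norm x powr (a - 1) * exp (- (z * norm x powr a))) *\<^sub>R (norm b * f x * pweight Rp k x))"
    by (intro tempered_integrable_norm_powr tempered_mult tempered_const f tempered_pweight z a_pos c1)
  then have 2: "integrable lborel (\<lambda>x. norm x powr (a - 2) * (x \<bullet> b) * (f x * gweight z x))"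
  proof (rule Bochner_Integration.integrable_bound)
    show "AE x in lborel. norm (norm x powr (a - 2) * (x \<bullet> b) * (f x * gweight z x)) \<le>
      norm ((norm x powr (a - 1) * exp (- (z * norm x powr a))) *\<^sub>R (norm b * f x * pweight Rp k x))"
      using AE_nonzero
    proof eventually_elim
      case (elim x)
      have "norm x powr (a - 2) * \<bar>x \<bullet> b\<bar> \<le> norm x powr (a - 2) * (norm x * norm b)"
        by (intro mult_left_mono Cauchy_Schwarz_ineq2) auto
      also have "\<dots> = norm x powr (a - 1) * norm b"
        using elim by (simp add: powr_diff power2_eq_square)
      finally have "norm x powr (a - 2) * \<bar>x \<bullet> b\<bar> * (\<bar>f x\<bar> * \<bar>gweight z x\<bar>) \<le>
          norm x powr (a - 1) * norm b * (\<bar>f x\<bar> * \<bar>gweight z x\<bar>)"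
        by (rule mult_right_mono) auto
      then show ?case by (simp add: gweight_def abs_mult mult_ac)
    qed
  qed measurable
  have "f x * (gweight z x * gweight_logder z b x) =
    (\<Sum>\<alpha>\<in>Eff. (2 * k \<alpha> * (\<alpha> \<bullet> b)) * (f x / (\<alpha> \<bullet> x) * gweight z x))
      - (z * a) * (norm x powr (a - 2) * (x \<bullet> b) * (f x * gweight z x))" for x
    unfolding gweight_logder_def right_diff_distrib sum_distrib_left
    by (intro arg_cong2[where f="(-)"] sum.cong) (simp_all add: mult_ac)
  then show ?thesis
    using Bochner_Integration.integrable_diff[OF 1 integrable_mult_right[OF 2, of "z * a"]] by simp
qed

lemma integral_divergence_gweight:
  assumes p: "real_polynomial_function p" and z: "z > 0"
  shows "integrable lborel (\<lambda>x. dder b p x * gweight z x + p x * (gweight z x * gweight_logder z b x))"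
    and "(\<integral>x. dder b p x * gweight z x + p x * (gweight z x * gweight_logder z b x) \<partial>lborel) = 0"
proof -
  have tp: "tempered p" "tempered (dder b p)"
    using p real_polynomial_function_dder tempered_real_polynomial by blast+
  show int: "integrable lborel (\<lambda>x. dder b p x * gweight z x + p x * (gweight z x * gweight_logder z b x))"
    by (intro Bochner_Integration.integrable_add tempered_integrable_gweight tempered_integrable_gweight_logder tp z)
  show "(\<integral>x. dder b p x * gweight z x + p x * (gweight z x * gweight_logder z b x) \<partial>lborel) = 0"
  proof (rule integral_directional_derivative_zero[where G="\<lambda>x. p x * gweight z x" and b=b])
    show "integrable lborel (\<lambda>x. p x * gweight z x)" by (rule tempered_integrable_gweight[OF tp(1) z])
    show "continuous_on UNIV (\<lambda>x. p x * gweight z x)"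
      using p by (intro continuous_on_mult continuous_gweight)
        (auto intro!: continuous_on_polymonial_function simp: real_polynomial_function_eq[symmetric])
    show "AE x in lborel. \<exists>S. finite S \<and> (\<forall>t. t \<notin> S \<longrightarrow>
      ((\<lambda>t. p (x + t *\<^sub>R b) * gweight z (x + t *\<^sub>R b)) has_real_derivative
        dder b p (x + t *\<^sub>R b) * gweight z (x + t *\<^sub>R b) +
        p (x + t *\<^sub>R b) * (gweight z (x + t *\<^sub>R b) * gweight_logder z b (x + t *\<^sub>R b))) (at t))"
      using AE_regular
    proof eventually_elim
      case (elim x)
      \<comment> \<open>The line starts off the hyperplane, so it is not contained in it and meets
        it at most once.\<close>
      have fin: "finite {t. \<alpha> \<bullet> (x + t *\<^sub>R b) = 0}" if "\<alpha> \<bullet> x \<noteq> 0" for \<alpha>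
      proof (rule finite_subset)
        show "{t. \<alpha> \<bullet> (x + t *\<^sub>R b) = 0} \<subseteq> {- (\<alpha> \<bullet> x) / (\<alpha> \<bullet> b)}"
        proof
          fix t assume "t \<in> {t. \<alpha> \<bullet> (x + t *\<^sub>R b) = 0}"
          then have e: "t * (\<alpha> \<bullet> b) = - (\<alpha> \<bullet> x)" by (simp add: inner_add_right)
          with that have "\<alpha> \<bullet> b \<noteq> 0" by auto
          with e show "t \<in> {- (\<alpha> \<bullet> x) / (\<alpha> \<bullet> b)}"
            using nonzero_eq_divide_eq[of "\<alpha> \<bullet> b" t "- (\<alpha> \<bullet> x)"] by blast
        qed
      qed auto
      \<comment> \<open>If x + t b = 0 then also x . (x + t b) = 0, so the hyperplane bound with
        normal x covers the origin.\<close>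
      have fx: "finite {t. x + t *\<^sub>R b = 0}"
        by (rule finite_subset[OF _ fin[of x]]) (use elim in auto)
      show ?case
      proof (intro exI[of _ "{t. x + t *\<^sub>R b = 0} \<union> (\<Union>\<alpha>\<in>Eff. {t. \<alpha> \<bullet> (x + t *\<^sub>R b) = 0})"] conjI allI impI)
        show "finite ({t. x + t *\<^sub>R b = 0} \<union> (\<Union>\<alpha>\<in>Eff. {t. \<alpha> \<bullet> (x + t *\<^sub>R b) = 0}))"
          using elim eff_roots by (intro finite_UnI fx finite_UN_I fin) auto
        fix t assume t: "t \<notin> {t. x + t *\<^sub>R b = 0} \<union> (\<Union>\<alpha>\<in>Eff. {t. \<alpha> \<bullet> (x + t *\<^sub>R b) = 0})"
        have 1: "((\<lambda>t. p (x + t *\<^sub>R b)) has_real_derivative dder b p (x + t *\<^sub>R b)) (at t)"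
          by (intro has_real_derivative_line differentiable_real_poly p)
        have 2: "((\<lambda>t. gweight z (x + t *\<^sub>R b)) has_real_derivative
            gweight z (x + t *\<^sub>R b) * gweight_logder z b (x + t *\<^sub>R b)) (at t)"
          using t by (intro gweight_line_derivative) auto
        show "((\<lambda>t. p (x + t *\<^sub>R b) * gweight z (x + t *\<^sub>R b)) has_real_derivative
          dder b p (x + t *\<^sub>R b) * gweight z (x + t *\<^sub>R b) +
          p (x + t *\<^sub>R b) * (gweight z (x + t *\<^sub>R b) * gweight_logder z b (x + t *\<^sub>R b))) (at t)"
          using DERIV_mult[OF 1 2] by (simp add: algebra_simps)
      qed
    qed
  qed (rule int)
qed

lemma dunkl_laplacian_eff_roots:
  "dunkl_laplacian Rp k p x = laplacian p x + (\<Sum>\<alpha>\<in>Eff. k \<alpha> * (2 / (\<alpha> \<bullet> x) * dder \<alpha> p x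
     - (norm \<alpha>)\<^sup>2 / (\<alpha> \<bullet> x)\<^sup>2 * (p x - p (root_reflection \<alpha> x))))"
  unfolding dunkl_laplacian_def real_scaleR_def
  by (intro arg_cong2[where f="(+)"] refl sum.mono_neutral_right finite_Rp) (auto simp: eff_roots_def)

text \<open>For harmonic \<open>p\<close> and \<open>q\<close> the divergence of \<open>(q \<nabla>p - p \<nabla>q) w\<close>, with \<open>w = \<close> \<^const>\<open>gweight\<close>, consists of terms
  that are odd under the reflections and of a multiple of \<open>(m - n) \<parallel>x\<parallel>\<^bsup>a-2\<^esup> p q w\<close>.\<close>

lemma harmonic_orthogonal:
  assumes p: "real_polynomial_function p" "\<And>t x. p (t *\<^sub>R x) = t ^ m * p x"
      "\<And>x. \<forall>\<alpha>\<in>Rp. \<alpha> \<bullet> x \<noteq> 0 \<Longrightarrow> dunkl_laplacian Rp k p x = 0"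
    and q: "real_polynomial_function q" "\<And>t x. q (t *\<^sub>R x) = t ^ n * q x"
      "\<And>x. \<forall>\<alpha>\<in>Rp. \<alpha> \<bullet> x \<noteq> 0 \<Longrightarrow> dunkl_laplacian Rp k q x = 0"
    and z: "z > 0" and mn: "m \<noteq> n"
  shows "(\<integral>x. norm x powr (a - 2) * p x * q x * gweight z x \<partial>lborel) = 0"
proof -
  define V where "V b x = dder b p x * q x - p x * dder b q x" for b x
  define D where "D b x = dder b (V b) x * gweight z x + V b x * (gweight z x * gweight_logder z b x)" for b x
  have polyV: "real_polynomial_function (V b)" for b
    unfolding V_def[abs_def]
    by (intro real_polynomial_function_diff real_polynomial_function.intros(4) real_polynomial_function_dder p q)
  have D: "integrable lborel (D b)" "(\<integral>x. D b x \<partial>lborel) = 0" for b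
    using integral_divergence_gweight[OF polyV[of b] z, of b] by (simp_all add: D_def[abs_def])
  have dV: "dder b (V b) x = dder b (dder b p) x * q x - p x * dder b (dder b q) x" for b x
  proof -
    note diff = differentiable_real_poly[OF p(1)] differentiable_real_poly[OF q(1)]
      differentiable_real_poly[OF real_polynomial_function_dder[OF p(1)]]
      differentiable_real_poly[OF real_polynomial_function_dder[OF q(1)]]
    have "((\<lambda>x. dder b p x * q x - p x * dder b q x) has_derivative
      (\<lambda>v. (dder b p x * dder v q x + dder v (dder b p) x * q x) - (p x * dder v (dder b q) x + dder v p x * dder b q x))) (at x)"
      by (intro has_derivative_diff has_derivative_mult has_derivative_dder diff)
    from dderI[OF this, of b] show ?thesis unfolding V_def[abs_def] by simp
  qed
  \<comment> \<open>What remains for one root once the gradient terms of the two Dunkl Laplacians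
    have cancelled against the logarithmic derivative of the weight.\<close>
  define H where "H \<alpha> x = k \<alpha> * (norm \<alpha>)\<^sup>2 * ((p x * q (root_reflection \<alpha> x) - p (root_reflection \<alpha> x) * q x)
      / (\<alpha> \<bullet> x)\<^sup>2) * gweight z x" for \<alpha> x
  have H: "integrable lborel (H \<alpha>) \<and> (\<integral>x. H \<alpha> x \<partial>lborel) = 0" if \<alpha>: "\<alpha> \<in> Eff" for \<alpha>
  proof
    note \<alpha>0 = eff_roots(3)[OF \<alpha>]
    obtain P where P: "real_polynomial_function P" "\<And>x. p x - p (root_reflection \<alpha> x) = (\<alpha> \<bullet> x) * P x"
      using real_polynomial_divided_difference[OF p(1) \<alpha>0] by blast
    obtain Q where Q: "real_polynomial_function Q" "\<And>x. q x - q (root_reflection \<alpha> x) = (\<alpha> \<bullet> x) * Q x"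
      using real_polynomial_divided_difference[OF q(1) \<alpha>0] by blast
    have "p x * q (root_reflection \<alpha> x) - p (root_reflection \<alpha> x) * q x =
        (p x - p (root_reflection \<alpha> x)) * q x - p x * (q x - q (root_reflection \<alpha> x))" for x
      by (simp add: algebra_simps)
    \<comment> \<open>One factor alpha . x of the squared denominator cancels, which leaves a
      singularity covered by \<open>integrable_singular_root\<close>.\<close>
    then have eq: "p x * q (root_reflection \<alpha> x) - p (root_reflection \<alpha> x) * q x = (\<alpha> \<bullet> x) * (P x * q x - p x * Q x)" for x
      unfolding P(2) Q(2) by (simp add: algebra_simps)
    have eqH: "H \<alpha> = (\<lambda>x. k \<alpha> * (norm \<alpha>)\<^sup>2 * ((P x * q x - p x * Q x) / (\<alpha> \<bullet> x) * gweight z x))"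
      unfolding H_def eq by (auto simp: power2_eq_square)
    have i: "integrable lborel (\<lambda>x. (P x * q x - p x * Q x) / (\<alpha> \<bullet> x) * gweight z x)"
      unfolding gweight_def
      by (intro integrable_singular_root \<alpha> z tempered_real_polynomial real_polynomial_function_diff
          real_polynomial_function.intros(4) p q P Q)
    show int: "integrable lborel (H \<alpha>)" unfolding eqH by (rule integrable_mult_right[OF i])
    \<comment> \<open>H is odd under a reflection that preserves Lebesgue measure, so its integral
      equals its own negative.\<close>
    have "H \<alpha> (root_reflection \<alpha> x) = - H \<alpha> x" for x
      unfolding H_def gweight_def pweight_reflection[OF \<alpha>] norm_root_reflection root_reflection_involution
        inner_root_reflection[OF \<alpha>0] power2_minus
      by (simp add: algebra_simps diff_divide_distrib)
    then have "(\<integral>x. H \<alpha> x \<partial>lborel) = - (\<integral>x. H \<alpha> x \<partial>lborel)"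
      using integral_lborel_root_reflection[of "H \<alpha>" \<alpha>] borel_measurable_integrable[OF int] by simp
    then show "(\<integral>x. H \<alpha> x \<partial>lborel) = 0" by simp
  qed
  have AE: "AE x in lborel. (z * a * (real m - real n)) * (norm x powr (a - 2) * p x * q x * gweight z x) =
      (\<Sum>\<alpha>\<in>Eff. H \<alpha> x) - (\<Sum>b\<in>Basis. D b x)"
    using AE_regular
  proof eventually_elim
    case (elim x)
    have lin: "(\<Sum>b\<in>Basis. (v \<bullet> b) * dder b f x) = dder v f x" if "real_polynomial_function f" for v f
    proof -
      have l: "linear (\<lambda>v. dder v f x)"
        by (rule linear_frechet_derivative[OF differentiable_real_poly[OF that]])
      have "dder v f x = dder (\<Sum>b\<in>Basis. (v \<bullet> b) *\<^sub>R b) f x" by (simp add: euclidean_representation)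
      also have "\<dots> = (\<Sum>b\<in>Basis. (v \<bullet> b) * dder b f x)"
        by (simp only: linear_sum[OF l] linear_scale[OF l] real_scaleR_def)
      finally show ?thesis ..
    qed
    have linV: "(\<Sum>b\<in>Basis. (v \<bullet> b) * V b x) = dder v p x * q x - p x * dder v q x" for v
    proof -
      have "(\<Sum>b\<in>Basis. (v \<bullet> b) * V b x) =
          (\<Sum>b\<in>Basis. (v \<bullet> b) * dder b p x) * q x - p x * (\<Sum>b\<in>Basis. (v \<bullet> b) * dder b q x)"
        unfolding V_def sum_distrib_left sum_distrib_right sum_subtractf[symmetric]
        by (intro sum.cong refl) (simp add: algebra_simps)
      then show ?thesis by (simp only: lin[OF p(1)] lin[OF q(1)])
    qed
    \<comment> \<open>The degrees enter here: the radial part of the logarithmic derivative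
      contributes the factor m - n.\<close>
    have ep: "dder x p x = real m * p x" and eq: "dder x q x = real n * q x"
      using p q by (auto intro!: euler_homogeneous differentiable_real_poly)
    have "(\<Sum>b\<in>Basis. V b x * gweight_logder z b x) =
        (\<Sum>\<alpha>\<in>Eff. 2 * k \<alpha> / (\<alpha> \<bullet> x) * (\<Sum>b\<in>Basis. (\<alpha> \<bullet> b) * V b x))
        - z * a * norm x powr (a - 2) * (\<Sum>b\<in>Basis. (x \<bullet> b) * V b x)"
      unfolding gweight_logder_def right_diff_distrib sum_subtractf sum_distrib_left
      by (subst sum.swap) (simp add: algebra_simps)
    also have "\<dots> = (\<Sum>\<alpha>\<in>Eff. 2 * k \<alpha> / (\<alpha> \<bullet> x) * (dder \<alpha> p x * q x - p x * dder \<alpha> q x))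
        - z * a * norm x powr (a - 2) * ((real m - real n) * (p x * q x))"
      unfolding linV ep eq by (simp add: algebra_simps)
    finally have VE: "(\<Sum>b\<in>Basis. V b x * gweight_logder z b x) = \<dots>" .
    have lap: "laplacian p x = - (\<Sum>\<alpha>\<in>Eff. k \<alpha> * (2 / (\<alpha> \<bullet> x) * dder \<alpha> p x
     - (norm \<alpha>)\<^sup>2 / (\<alpha> \<bullet> x)\<^sup>2 * (p x - p (root_reflection \<alpha> x))))"
      "laplacian q x = - (\<Sum>\<alpha>\<in>Eff. k \<alpha> * (2 / (\<alpha> \<bullet> x) * dder \<alpha> q x
     - (norm \<alpha>)\<^sup>2 / (\<alpha> \<bullet> x)\<^sup>2 * (q x - q (root_reflection \<alpha> x))))"
      using p(3)[of x] q(3)[of x] elim unfolding dunkl_laplacian_eff_roots by auto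
    have "(\<Sum>b\<in>Basis. dder b (V b) x) = laplacian p x * q x - p x * laplacian q x"
      unfolding dV laplacian_def by (simp add: sum_subtractf sum_distrib_left sum_distrib_right)
    also have "\<dots> = (\<Sum>\<alpha>\<in>Eff. - (k \<alpha> * (2 / (\<alpha> \<bullet> x) * dder \<alpha> p x
     - (norm \<alpha>)\<^sup>2 / (\<alpha> \<bullet> x)\<^sup>2 * (p x - p (root_reflection \<alpha> x)))) * q x + p x * (k \<alpha> * (2 / (\<alpha> \<bullet> x) * dder \<alpha> q x
     - (norm \<alpha>)\<^sup>2 / (\<alpha> \<bullet> x)\<^sup>2 * (q x - q (root_reflection \<alpha> x)))))"
      unfolding lap by (simp add: sum.distrib sum_subtractf sum_distrib_left sum_distrib_right sum_negf)
    finally have "(\<Sum>b\<in>Basis. dder b (V b) x) + (\<Sum>b\<in>Basis. V b x * gweight_logder z b x) =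
      (\<Sum>\<alpha>\<in>Eff. (- (k \<alpha> * (2 / (\<alpha> \<bullet> x) * dder \<alpha> p x
     - (norm \<alpha>)\<^sup>2 / (\<alpha> \<bullet> x)\<^sup>2 * (p x - p (root_reflection \<alpha> x)))) * q x + p x * (k \<alpha> * (2 / (\<alpha> \<bullet> x) * dder \<alpha> q x
     - (norm \<alpha>)\<^sup>2 / (\<alpha> \<bullet> x)\<^sup>2 * (q x - q (root_reflection \<alpha> x)))))
       + 2 * k \<alpha> / (\<alpha> \<bullet> x) * (dder \<alpha> p x * q x - p x * dder \<alpha> q x))
        - z * a * norm x powr (a - 2) * ((real m - real n) * (p x * q x))"
      unfolding VE by (simp add: sum.distrib)
    also have "\<dots> = (\<Sum>\<alpha>\<in>Eff. k \<alpha> * (norm \<alpha>)\<^sup>2 * ((p x * q (root_reflection \<alpha> x) - p (root_reflection \<alpha> x) * q x)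
      / (\<alpha> \<bullet> x)\<^sup>2)) - z * a * norm x powr (a - 2) * ((real m - real n) * (p x * q x))"
    proof (intro arg_cong2[where f="(-)"] sum.cong refl)
      have aux: "- (K * (2 / s * dp - N / s\<^sup>2 * (p0 - p1))) * q0 + p0 * (K * (2 / s * dq - N / s\<^sup>2 * (q0 - q1)))
         + 2 * K / s * (dp * q0 - p0 * dq) = K * N * ((p0 * q1 - p1 * q0) / s\<^sup>2)"
        for K s dp dq N p0 p1 q0 q1 :: real
        by (simp add: algebra_simps diff_divide_distrib add_divide_distrib)
      show "- (k \<alpha> * (2 / (\<alpha> \<bullet> x) * dder \<alpha> p x
     - (norm \<alpha>)\<^sup>2 / (\<alpha> \<bullet> x)\<^sup>2 * (p x - p (root_reflection \<alpha> x)))) * q x + p x * (k \<alpha> * (2 / (\<alpha> \<bullet> x) * dder \<alpha> q x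
     - (norm \<alpha>)\<^sup>2 / (\<alpha> \<bullet> x)\<^sup>2 * (q x - q (root_reflection \<alpha> x))))
       + 2 * k \<alpha> / (\<alpha> \<bullet> x) * (dder \<alpha> p x * q x - p x * dder \<alpha> q x) =
       k \<alpha> * (norm \<alpha>)\<^sup>2 * ((p x * q (root_reflection \<alpha> x) - p (root_reflection \<alpha> x) * q x) / (\<alpha> \<bullet> x)\<^sup>2)" for \<alpha>
        by (rule aux)
    qed
    finally have main: "(\<Sum>b\<in>Basis. dder b (V b) x) + (\<Sum>b\<in>Basis. V b x * gweight_logder z b x) = \<dots>" .
    have "(\<Sum>b\<in>Basis. D b x) = ((\<Sum>b\<in>Basis. dder b (V b) x) + (\<Sum>b\<in>Basis. V b x * gweight_logder z b x)) * gweight z x"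
      unfolding D_def sum.distrib[symmetric] sum_distrib_right
      by (intro sum.cong refl) (simp add: algebra_simps)
    also have "\<dots> = (\<Sum>\<alpha>\<in>Eff. H \<alpha> x) - (z * a * (real m - real n)) * (norm x powr (a - 2) * p x * q x * gweight z x)"
      unfolding main H_def left_diff_distrib[of _ _ "gweight z x"] sum_distrib_right by (simp add: mult_ac)
    finally show ?case by simp
  qed
  have m1: "(\<lambda>x. (z * a * (real m - real n)) * (norm x powr (a - 2) * p x * q x * gweight z x)) \<in> borel_measurable lborel"
    using tempered_measurable[OF tempered_real_polynomial[OF p(1)]] tempered_measurable[OF tempered_real_polynomial[OF q(1)]]
    by measurable
  have iH: "integrable lborel (\<lambda>x. \<Sum>\<alpha>\<in>Eff. H \<alpha> x)" and iD: "integrable lborel (\<lambda>x. \<Sum>b\<in>Basis. D b x)"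
    using H D by (auto intro!: Bochner_Integration.integrable_sum)
  have "(z * a * (real m - real n)) * (\<integral>x. norm x powr (a - 2) * p x * q x * gweight z x \<partial>lborel) =
    (\<integral>x. (z * a * (real m - real n)) * (norm x powr (a - 2) * p x * q x * gweight z x) \<partial>lborel)" by simp
  also have "\<dots> = (\<integral>x. (\<Sum>\<alpha>\<in>Eff. H \<alpha> x) - (\<Sum>b\<in>Basis. D b x) \<partial>lborel)"
    by (rule integral_cong_AE[OF m1 _ AE]) (use iH iD in \<open>auto dest!: borel_measurable_integrable\<close>)
  also have "\<dots> = 0"
    using H D by (simp add: Bochner_Integration.integral_diff[OF iH iD])
  finally show ?thesis using z a_pos mn by simp
qed

end

section \<open>Gaussian integrals and density\<close>

lemma sets_ka_measure[simp, measurable_cong]: "sets (ka_measure Rp k a) = sets borel"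
  by (simp add: ka_measure_def)

lemma space_ka_measure[simp]: "space (ka_measure Rp k a) = UNIV"
  by (simp add: ka_measure_def)

lemma measurable_ka_weight[measurable]: "finite Rp \<Longrightarrow> ka_weight Rp k a \<in> borel_measurable borel"
  unfolding ka_weight_def[abs_def] dunkl_weight_def by measurable

lemma AE_ka_measure:
  assumes "finite Rp" "AE x in lborel. P x"
  shows "AE x in ka_measure Rp k a. P x"
proof -
  have [measurable]: "ka_weight Rp k a \<in> borel_measurable borel" by (rule measurable_ka_weight[OF assms(1)])
  show ?thesis
    unfolding ka_measure_def using assms(2) by (subst AE_density) auto
qed

section \<open>The measure and the integrability of Gaussians\<close>

context dunkl_setting
begin

abbreviation "M \<equiv> ka_measure Rp k a"

definition phi :: "'a \<Rightarrow> real" where "phi x = norm x powr a / a"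

text \<open>The scaling exponent: for H homogeneous of degree n, the integral of H exp(-z phi) is
  proportional to z^(-nu n). The numerator is n plus the homogeneous dimension of the measure, and
  division by a comes from the degree of \<open>phi\<close>.\<close>

definition nu :: "real \<Rightarrow> real" where "nu n = (n + 2 * mult_sum Rp k + real DIM('a) + a - 2) / a"

text \<open>Agrees with \<open>ka_weight\<close> almost everywhere. Roots of multiplicity zero are
  dropped, since \<open>0 powr 0 = 0\<close> would spoil homogeneous estimates on their
  hyperplanes.\<close>

definition wt :: "'a \<Rightarrow> real" where "wt x = norm x powr (a - 2) * pweight Rp k x"

definition gauss :: "('a \<Rightarrow> complex) \<Rightarrow> real \<Rightarrow> 'a \<Rightarrow> complex" where
  "gauss p z x = p x * complex_of_real (exp (- (z * phi x)))"

lemma phi_nonneg[simp]: "phi x \<ge> 0"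
  using a_pos by (simp add: phi_def)

lemma measurable_phi[measurable]: "phi \<in> borel_measurable borel"
  unfolding phi_def[abs_def] by measurable

lemma measurable_wt[measurable]: "wt \<in> borel_measurable borel"
  unfolding wt_def[abs_def] by measurable

lemma measurable_gauss[measurable (raw)]: "p \<in> borel_measurable borel \<Longrightarrow> gauss p z \<in> borel_measurable borel"
proof -
  assume [measurable]: "p \<in> borel_measurable borel"
  have [measurable]: "(\<lambda>x. exp (- (z * phi x))) \<in> borel_measurable borel" by measurable
  have "(\<lambda>x. complex_of_real (exp (- (z * phi x)))) \<in> borel_measurable borel"
    by (rule borel_measurable_continuous_on[of complex_of_real]) (auto intro: continuous_intros)
  then show ?thesis unfolding gauss_def[abs_def] by measurable
qed

lemma measurable_M[simp]: "borel_measurable M = borel_measurable borel"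
  by (intro measurable_cong_sets) auto

lemma wt_nonneg[simp]: "wt x \<ge> 0"
  by (auto simp: wt_def pweight_def intro!: mult_nonneg_nonneg prod_nonneg)

lemma tempered_phi: "tempered phi"
  using a_pos tempered_mult[OF tempered_norm_powr[of a] tempered_const[of "1 / a"]]
  by (simp add: phi_def[abs_def])

lemma mult_sum_eff: "mult_sum Rp k = (\<Sum>\<alpha>\<in>Eff. k \<alpha>)"
  unfolding mult_sum_def by (intro sum.mono_neutral_right finite_Rp) (auto simp: eff_roots_def)

lemma mult_sum_nonneg: "mult_sum Rp k \<ge> 0"
  unfolding mult_sum_def by (intro sum_nonneg k_nonneg)

lemma nu_mono: "m \<ge> 0 \<Longrightarrow> nu 0 \<le> nu m"
  using a_pos by (simp add: nu_def divide_right_mono)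

lemma nu_pos: "m \<ge> 0 \<Longrightarrow> nu m > 0"
  using a_pos dim_pos by (simp add: nu_def)

lemma nu_eq: "nu (2 * real m) = ka_lambda Rp k a m + 1"
  using a_pos by (simp add: nu_def ka_lambda_def field_simps)

lemma AE_wt: "AE x in lborel. ka_weight Rp k a x = wt x"
  using AE_regular
proof eventually_elim
  case (elim x)
  have "dunkl_weight Rp k x = pweight Rp k x"
    unfolding dunkl_weight_def pweight_def using elim
    by (intro prod.mono_neutral_right finite_Rp) (auto simp: eff_roots_def)
  then show ?case by (simp add: ka_weight_def wt_def)
qed

lemma integrable_M_iff:
  fixes f :: "'a \<Rightarrow> 'b::{banach, second_countable_topology}"
  assumes [measurable]: "f \<in> borel_measurable borel"
  shows "integrable M f \<longleftrightarrow> integrable lborel (\<lambda>x. wt x *\<^sub>R f x)"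
proof -
  have [measurable]: "ka_weight Rp k a \<in> borel_measurable borel" by (rule measurable_ka_weight[OF finite_Rp])
  have "integrable M f \<longleftrightarrow> integrable lborel (\<lambda>x. ka_weight Rp k a x *\<^sub>R f x)"
    unfolding ka_measure_def
    by (rule integrable_density) (auto simp: ka_weight_def dunkl_weight_def intro!: mult_nonneg_nonneg prod_nonneg)
  also have "\<dots> \<longleftrightarrow> integrable lborel (\<lambda>x. wt x *\<^sub>R f x)"
    using AE_wt by (intro integrable_cong_AE) (auto elim!: eventually_mono)
  finally show ?thesis .
qed

lemma integral_M:
  fixes f :: "'a \<Rightarrow> 'b::{banach, second_countable_topology}"
  assumes [measurable]: "f \<in> borel_measurable borel"
  shows "(\<integral>x. f x \<partial>M) = (\<integral>x. wt x *\<^sub>R f x \<partial>lborel)"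
proof -
  have [measurable]: "ka_weight Rp k a \<in> borel_measurable borel" by (rule measurable_ka_weight[OF finite_Rp])
  have "(\<integral>x. f x \<partial>M) = (\<integral>x. ka_weight Rp k a x *\<^sub>R f x \<partial>lborel)"
    unfolding ka_measure_def
    by (rule integral_density) (auto simp: ka_weight_def dunkl_weight_def intro!: mult_nonneg_nonneg prod_nonneg)
  also have "\<dots> = (\<integral>x. wt x *\<^sub>R f x \<partial>lborel)"
    using AE_wt by (intro integral_cong_AE) (auto elim!: eventually_mono)
  finally show ?thesis .
qed

text \<open>Bounding |alpha . x| by |alpha| |x| reduces integrability to a radial exponent, which
  exceeds -N exactly by the assumption \<open>dim_pos\<close>.\<close>

lemma wt_bound: "\<exists>K\<ge>0. \<forall>x. wt x \<le> K * norm x powr (a - 2 + 2 * mult_sum Rp k)"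
proof -
  define K where "K = (\<Prod>\<alpha>\<in>Eff. norm \<alpha> powr (2 * k \<alpha>))"
  have K: "K \<ge> 0" by (auto simp: K_def intro: prod_nonneg)
  have "wt x \<le> K * norm x powr (a - 2 + 2 * mult_sum Rp k)" for x
  proof (cases "x = 0")
    case False
    have "pweight Rp k x \<le> (\<Prod>\<alpha>\<in>Eff. norm \<alpha> powr (2 * k \<alpha>) * norm x powr (2 * k \<alpha>))"
      unfolding pweight_def
    proof (intro prod_mono conjI)
      fix \<alpha> assume "\<alpha> \<in> Eff"
      then have "\<bar>\<alpha> \<bullet> x\<bar> powr (2 * k \<alpha>) \<le> (norm \<alpha> * norm x) powr (2 * k \<alpha>)"
        using eff_roots(2)[of \<alpha>] by (intro powr_mono2 Cauchy_Schwarz_ineq2) auto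
      then show "\<bar>\<alpha> \<bullet> x\<bar> powr (2 * k \<alpha>) \<le> norm \<alpha> powr (2 * k \<alpha>) * norm x powr (2 * k \<alpha>)"
        by (simp add: powr_mult)
    qed simp
    also have "\<dots> = K * norm x powr (2 * mult_sum Rp k)"
      using False eff_roots(1) by (simp add: prod.distrib K_def mult_sum_eff sum_distrib_left powr_sum)
    finally have "norm x powr (a - 2) * pweight Rp k x \<le>
        norm x powr (a - 2) * (K * norm x powr (2 * mult_sum Rp k))"
      by (rule mult_left_mono) simp
    then show ?thesis by (simp add: wt_def powr_add mult_ac)
  qed (simp add: wt_def)
  with K show ?thesis by blast
qed

lemma integrable_gauss:
  assumes f: "tempered f" and z: "z > 0"
  shows "integrable M (gauss f z)"
proof -
  note [measurable] = tempered_measurable[OF f]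
  obtain K where K: "K \<ge> 0" "\<And>x. wt x \<le> K * norm x powr (a - 2 + 2 * mult_sum Rp k)" using wt_bound by blast
  have 1: "integrable lborel (\<lambda>x. (norm x powr (a - 2 + 2 * mult_sum Rp k) * exp (- (z / a * norm x powr a))) *\<^sub>R (of_real K * f x))"
    using z a_pos dim_pos by (intro tempered_integrable_norm_powr tempered_mult tempered_const f) auto
  have "integrable lborel (\<lambda>x. wt x *\<^sub>R gauss f z x)"
  proof (rule Bochner_Integration.integrable_bound[OF 1])
    show "AE x in lborel. norm (wt x *\<^sub>R gauss f z x) \<le>
      norm ((norm x powr (a - 2 + 2 * mult_sum Rp k) * exp (- (z / a * norm x powr a))) *\<^sub>R (of_real K * f x))"
    proof (intro AE_I2)
      fix x
      have "wt x * (cmod (f x) * exp (- (z * phi x))) \<le>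
        (K * norm x powr (a - 2 + 2 * mult_sum Rp k)) * (cmod (f x) * exp (- (z * phi x)))"
        by (intro mult_right_mono K) auto
      then show "norm (wt x *\<^sub>R gauss f z x) \<le>
        norm ((norm x powr (a - 2 + 2 * mult_sum Rp k) * exp (- (z / a * norm x powr a))) *\<^sub>R (of_real K * f x))"
        using K(1) by (simp add: gauss_def norm_mult phi_def mult_ac)
    qed
  qed measurable
  then show ?thesis by (subst integrable_M_iff) auto
qed

lemma gauss_L2:
  assumes f: "tempered f" and z: "z > 0"
  shows "gauss f z \<in> L2_space M"
proof (rule L2_spaceI)
  note [measurable] = tempered_measurable[OF f]
  show "gauss f z \<in> borel_measurable M" by simp
  have "tempered (\<lambda>x. cnj (f x))" by (rule tempered_bound[OF f]) auto
  then have "integrable M (gauss (\<lambda>x. f x * cnj (f x)) (2 * z))"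
    using f z by (intro integrable_gauss tempered_mult) auto
  then have "integrable M (\<lambda>x. norm (gauss (\<lambda>x. f x * cnj (f x)) (2 * z) x))" by (rule integrable_norm)
  moreover have "norm (gauss (\<lambda>x. f x * cnj (f x)) (2 * z) x) = (cmod (gauss f z x))\<^sup>2" for x
    by (simp add: gauss_def norm_mult power2_eq_square exp_add[symmetric] mult_ac flip: exp_add)
  ultimately show "integrable M (\<lambda>x. (cmod (gauss f z x))\<^sup>2)" by simp
qed

section \<open>Scaling laws and moments\<close>

lemma wt_scale: "c > 0 \<Longrightarrow> wt (c *\<^sub>R x) = c powr (a - 2 + 2 * mult_sum Rp k) * wt x"
proof -
  assume c: "c > 0"
  have "pweight Rp k (c *\<^sub>R x) = (\<Prod>\<alpha>\<in>Eff. c powr (2 * k \<alpha>) * \<bar>\<alpha> \<bullet> x\<bar> powr (2 * k \<alpha>))"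
    unfolding pweight_def using c by (intro prod.cong refl) (simp add: abs_mult powr_mult)
  also have "\<dots> = c powr (2 * mult_sum Rp k) * pweight Rp k x"
    using c eff_roots(1) by (simp add: prod.distrib pweight_def mult_sum_eff sum_distrib_left powr_sum)
  finally show ?thesis using c by (simp add: wt_def powr_mult powr_add mult_ac)
qed

text \<open>The dilation by c with z c^a = 1 reduces the exponent to 1; Jacobian, weight and H
  together contribute c^(a nu n) = z^(-nu n).\<close>

lemma gauss_integral_scale:
  assumes H[measurable]: "H \<in> borel_measurable borel"
    and hom: "\<And>t x. t > 0 \<Longrightarrow> H (t *\<^sub>R x) = of_real (t powr n) * H x" and z: "z > 0"
  shows "(\<integral>x. gauss H z x \<partial>M) = of_real (z powr (- nu n)) * (\<integral>x. gauss H 1 x \<partial>M)"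
proof -
  define c where "c = z powr (- 1 / a)"
  have c: "c > 0" using z by (simp add: c_def)
  have ca: "z * c powr a = 1"
  proof -
    have "c powr a = z powr (- 1)" unfolding c_def powr_powr using a_pos by simp
    then show ?thesis using z by (simp add: powr_minus)
  qed
  have "(\<integral>x. gauss H z x \<partial>M) = (\<integral>x. wt x *\<^sub>R gauss H z x \<partial>lborel)" by (rule integral_M) simp
  also have "\<dots> = c ^ DIM('a) *\<^sub>R (\<integral>x. wt (c *\<^sub>R x) *\<^sub>R gauss H z (c *\<^sub>R x) \<partial>lborel)"
    by (rule integral_lborel_scale[OF _ c]) measurable
  also have "(\<lambda>x. wt (c *\<^sub>R x) *\<^sub>R gauss H z (c *\<^sub>R x)) =
      (\<lambda>x. (c powr (a - 2 + 2 * mult_sum Rp k) * c powr n) *\<^sub>R (wt x *\<^sub>R gauss H 1 x))"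
  proof
    fix x
    have "z * phi (c *\<^sub>R x) = (z * c powr a) * phi x" using c by (simp add: phi_def powr_mult)
    then have "z * phi (c *\<^sub>R x) = phi x" unfolding ca by simp
    then show "wt (c *\<^sub>R x) *\<^sub>R gauss H z (c *\<^sub>R x) =
      (c powr (a - 2 + 2 * mult_sum Rp k) * c powr n) *\<^sub>R (wt x *\<^sub>R gauss H 1 x)"
      unfolding gauss_def hom[OF c] wt_scale[OF c] by (simp add: scaleR_conv_of_real mult_ac)
  qed
  also have "c ^ DIM('a) *\<^sub>R (\<integral>x. (c powr (a - 2 + 2 * mult_sum Rp k) * c powr n) *\<^sub>R (wt x *\<^sub>R gauss H 1 x) \<partial>lborel)
    = (c ^ DIM('a) * (c powr (a - 2 + 2 * mult_sum Rp k) * c powr n)) *\<^sub>R (\<integral>x. wt x *\<^sub>R gauss H 1 x \<partial>lborel)"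
    by (subst integral_scaleR_right) (rule scaleR_scaleR)
  also have "c ^ DIM('a) * (c powr (a - 2 + 2 * mult_sum Rp k) * c powr n) = z powr (- nu n)"
  proof -
    have "a * nu n = real DIM('a) + (a - 2 + 2 * mult_sum Rp k + n)" using a_pos by (simp add: nu_def)
    then have "c ^ DIM('a) * (c powr (a - 2 + 2 * mult_sum Rp k) * c powr n) = c powr (a * nu n)"
      using c by (simp only: powr_add) (simp add: powr_realpow)
    also have "\<dots> = z powr (- nu n)" using a_pos by (simp add: c_def powr_powr)
    finally show ?thesis .
  qed
  also have "(\<integral>x. wt x *\<^sub>R gauss H 1 x \<partial>lborel) = (\<integral>x. gauss H 1 x \<partial>M)" by (rule integral_M[symmetric]) simp
  finally show ?thesis by (simp add: scaleR_conv_of_real)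
qed

text \<open>Differentiating the scaling law at \<open>z = 1\<close> gives the moments in \<open>phi\<close>.\<close>

lemma gauss_integral_phi:
  assumes H: "tempered H" and hom: "\<And>t x. t > 0 \<Longrightarrow> H (t *\<^sub>R x) = of_real (t powr n) * H x"
  shows "(\<integral>x. gauss (\<lambda>x. H x * of_real (phi x)) 1 x \<partial>M) = of_real (nu n) * (\<integral>x. gauss H 1 x \<partial>M)"
proof -
  note [measurable] = tempered_measurable[OF H]
  \<comment> \<open>Step sizes of the difference quotients at z = 1. The quotients are evaluated
    once by dominated convergence, since (1 - exp(-h phi)) / h <= phi, and once by the scaling
    law.\<close>
  let ?h = "\<lambda>i::nat. inverse (real (Suc i))"
  let ?X = "\<lambda>i. of_real (real (Suc i)) * ((\<integral>x. gauss H 1 x \<partial>M) - (\<integral>x. gauss H (1 + ?h i) x \<partial>M))"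
  have "?X \<longlonglongrightarrow> (\<integral>x. gauss (\<lambda>x. H x * of_real (phi x)) 1 x \<partial>M)"
  proof -
    have "(\<lambda>i. \<integral>x. of_real (real (Suc i)) * (gauss H 1 x - gauss H (1 + ?h i) x) \<partial>M) \<longlonglongrightarrow>
      (\<integral>x. gauss (\<lambda>x. H x * of_real (phi x)) 1 x \<partial>M)"
    proof (rule integral_dominated_convergence)
      have tp: "tempered (\<lambda>x. H x * complex_of_real (phi x))"
        by (intro tempered_mult H tempered_of_real tempered_phi)
      show "integrable M (\<lambda>x. norm (gauss (\<lambda>x. H x * of_real (phi x)) 1 x))"
        by (intro integrable_norm integrable_gauss tp) simp
      have eq: "of_real (real (Suc i)) * (gauss H 1 x - gauss H (1 + ?h i) x) =
          gauss H 1 x * of_real ((1 - exp (- (?h i * phi x))) / ?h i)" for i x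
      proof -
        have "exp (- ((1 + ?h i) * phi x)) = exp (- phi x) * exp (- (?h i * phi x))"
          by (simp add: exp_add[symmetric] distrib_right flip: exp_add)
        then have "gauss H 1 x - gauss H (1 + ?h i) x = gauss H 1 x * of_real (1 - exp (- (?h i * phi x)))"
          by (simp add: gauss_def right_diff_distrib del: of_nat_Suc)
        moreover have "(1 - exp (- (?h i * phi x))) / ?h i = real (Suc i) * (1 - exp (- (?h i * phi x)))"
          by (simp add: divide_inverse mult.commute)
        ultimately show ?thesis by (simp only: of_real_mult mult_ac)
      qed
      show "AE x in M. (\<lambda>i. of_real (real (Suc i)) * (gauss H 1 x - gauss H (1 + ?h i) x)) \<longlonglongrightarrow>
          gauss (\<lambda>x. H x * of_real (phi x)) 1 x"
      proof (intro AE_I2)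
        fix x
        have "((\<lambda>h. 1 - exp (- (h * phi x))) has_real_derivative phi x) (at 0)"
          by (auto intro!: derivative_eq_intros)
        then have "((\<lambda>h. (1 - exp (- (h * phi x))) / h) \<longlongrightarrow> phi x) (at 0)"
          by (simp add: DERIV_def)
        then have "(\<lambda>i. (1 - exp (- (?h i * phi x))) / ?h i) \<longlonglongrightarrow> phi x"
          by (rule filterlim_compose) (simp add: filterlim_at LIMSEQ_inverse_real_of_nat del: of_nat_Suc)
        then have "(\<lambda>i. gauss H 1 x * of_real ((1 - exp (- (?h i * phi x))) / ?h i)) \<longlonglongrightarrow> gauss H 1 x * of_real (phi x)"
          by (intro tendsto_intros)
        then show "(\<lambda>i. of_real (real (Suc i)) * (gauss H 1 x - gauss H (1 + ?h i) x)) \<longlonglongrightarrow>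
          gauss (\<lambda>x. H x * of_real (phi x)) 1 x"
          unfolding eq by (simp add: gauss_def mult_ac)
      qed
      show "AE x in M. norm (of_real (real (Suc i)) * (gauss H 1 x - gauss H (1 + ?h i) x)) \<le>
          norm (gauss (\<lambda>x. H x * of_real (phi x)) 1 x)" for i
      proof (intro AE_I2)
        fix x
        have h: "?h i > 0" by simp
        have "1 - exp (- (?h i * phi x)) \<le> ?h i * phi x"
          using exp_ge_add_one_self[of "- (?h i * phi x)"] by linarith
        then have "(1 - exp (- (?h i * phi x))) / ?h i \<le> phi x"
          using h by (simp add: pos_divide_le_eq mult.commute del: of_nat_Suc)
        moreover have "0 \<le> (1 - exp (- (?h i * phi x))) / ?h i" using h by (intro divide_nonneg_pos) auto
        ultimately have "norm (gauss H 1 x) * \<bar>(1 - exp (- (?h i * phi x))) / ?h i\<bar> \<le> norm (gauss H 1 x) * phi x"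
          by (intro mult_left_mono) auto
        then show "norm (of_real (real (Suc i)) * (gauss H 1 x - gauss H (1 + ?h i) x)) \<le>
          norm (gauss (\<lambda>x. H x * of_real (phi x)) 1 x)"
          unfolding eq norm_mult norm_of_real by (simp add: gauss_def norm_mult mult_ac)
      qed
    qed auto
    moreover have "(\<integral>x. of_real (real (Suc i)) * (gauss H 1 x - gauss H (1 + ?h i) x) \<partial>M) = ?X i" for i
    proof -
      have 1: "integrable M (gauss H 1)" "integrable M (gauss H (1 + ?h i))"
        by (intro integrable_gauss H; simp add: add_pos_pos)+
      show ?thesis by (simp only: integral_mult_right_zero Bochner_Integration.integral_diff[OF 1])
    qed
    ultimately show ?thesis by (simp only:)
  qed
  moreover have "?X \<longlonglongrightarrow> of_real (nu n) * (\<integral>x. gauss H 1 x \<partial>M)"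
  proof -
    have "((\<lambda>h. 1 - (1 + h) powr (- nu n)) has_real_derivative nu n) (at 0)"
      by (auto intro!: derivative_eq_intros)
    then have "((\<lambda>h. (1 - (1 + h) powr (- nu n)) / h) \<longlongrightarrow> nu n) (at 0)"
      by (simp add: DERIV_def)
    then have "(\<lambda>i. (1 - (1 + ?h i) powr (- nu n)) / ?h i) \<longlonglongrightarrow> nu n"
      by (rule filterlim_compose) (simp add: filterlim_at LIMSEQ_inverse_real_of_nat del: of_nat_Suc)
    then have "(\<lambda>i. of_real ((1 - (1 + ?h i) powr (- nu n)) / ?h i) * (\<integral>x. gauss H 1 x \<partial>M)) \<longlonglongrightarrow>
        of_real (nu n) * (\<integral>x. gauss H 1 x \<partial>M)" by (intro tendsto_intros)
    moreover have "?X i = of_real ((1 - (1 + ?h i) powr (- nu n)) / ?h i) * (\<integral>x. gauss H 1 x \<partial>M)" for i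
    proof -
      have "1 + ?h i > 0" by (simp add: add_pos_pos)
      then have e: "(\<integral>x. gauss H (1 + ?h i) x \<partial>M) = of_real ((1 + ?h i) powr (- nu n)) * (\<integral>x. gauss H 1 x \<partial>M)"
        by (intro gauss_integral_scale hom) auto
      have "(1 - (1 + ?h i) powr (- nu n)) / ?h i = real (Suc i) * (1 - (1 + ?h i) powr (- nu n))"
        by (simp add: divide_inverse mult.commute)
      then show ?thesis
        unfolding e by (simp only: of_real_mult of_real_diff of_real_1 left_diff_distrib right_diff_distrib mult_1 mult.assoc)
    qed
    ultimately show ?thesis by (simp only:)
  qed
  ultimately show ?thesis by (rule LIMSEQ_unique)
qed

text \<open>H phi^j is homogeneous of degree n + a j, which raises \<open>nu\<close> by exactly j;
  iterating the first moment therefore produces the rising factorial.\<close>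

lemma gauss_moments:
  assumes H: "tempered H" and hom: "\<And>t x. t > 0 \<Longrightarrow> H (t *\<^sub>R x) = of_real (t powr n) * H x" and z: "z > 0"
  shows "(\<integral>x. gauss (\<lambda>x. H x * of_real (phi x ^ j)) z x \<partial>M) =
    of_real (pochhammer (nu n) j * z powr (- (nu n + real j))) * (\<integral>x. gauss H 1 x \<partial>M)"
proof -
  have t: "tempered (\<lambda>x. H x * complex_of_real (phi x ^ j))" for j
    by (intro tempered_mult H tempered_of_real tempered_power tempered_phi)
  have nuj: "nu (n + a * real j) = nu n + real j" for j
    using a_pos by (simp add: nu_def add_divide_distrib diff_divide_distrib)
  have homj: "H (t *\<^sub>R x) * of_real (phi (t *\<^sub>R x) ^ j) = of_real (t powr (n + a * real j)) * (H x * of_real (phi x ^ j))"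
    if "t > 0" for t x j
  proof -
    have "phi (t *\<^sub>R x) ^ j = (t powr a) ^ j * phi x ^ j"
      using that by (simp add: phi_def powr_mult power_mult_distrib power_divide)
    also have "(t powr a) ^ j = t powr (a * real j)" using that by (simp add: powr_powr flip: powr_realpow)
    finally show ?thesis using that by (simp add: hom powr_add)
  qed
  have one: "(\<integral>x. gauss (\<lambda>x. H x * of_real (phi x ^ j)) 1 x \<partial>M) = of_real (pochhammer (nu n) j) * (\<integral>x. gauss H 1 x \<partial>M)"
  proof (induction j)
    case (Suc j)
    have "(\<lambda>x. H x * complex_of_real (phi x ^ Suc j)) = (\<lambda>x. (H x * of_real (phi x ^ j)) * of_real (phi x))"
      by (auto simp: mult_ac)
    then have "(\<integral>x. gauss (\<lambda>x. H x * of_real (phi x ^ Suc j)) 1 x \<partial>M) =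
        of_real (nu (n + a * real j)) * (\<integral>x. gauss (\<lambda>x. H x * of_real (phi x ^ j)) 1 x \<partial>M)"
      using gauss_integral_phi[OF t homj] by simp
    then show ?case unfolding Suc nuj by (simp add: pochhammer_rec' mult_ac)
  qed simp
  have "(\<integral>x. gauss (\<lambda>x. H x * of_real (phi x ^ j)) z x \<partial>M) =
      of_real (z powr (- nu (n + a * real j))) * (\<integral>x. gauss (\<lambda>x. H x * of_real (phi x ^ j)) 1 x \<partial>M)"
    by (rule gauss_integral_scale[OF tempered_measurable[OF t] homj z])
  then show ?thesis unfolding one nuj by (simp add: mult_ac)
qed

section \<open>Inner products of Gaussians with harmonic factors\<close>

lemma harmonic_tempered: "harmonic_poly Rp k m p \<Longrightarrow> tempered p"
  by (auto simp: harmonic_poly_def intro: tempered_polynomial)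

lemma harmonic_product:
  assumes "harmonic_poly Rp k m p" "harmonic_poly Rp k n q"
  shows "tempered (\<lambda>x. p x * cnj (q x))"
    "t > 0 \<Longrightarrow> p (t *\<^sub>R x) * cnj (q (t *\<^sub>R x)) = of_real (t powr real (m + n)) * (p x * cnj (q x))"
proof -
  have "tempered (\<lambda>x. cnj (q x))"
    using harmonic_tempered[OF assms(2)] by (rule tempered_bound) (use harmonic_tempered[OF assms(2)] in auto)
  then show "tempered (\<lambda>x. p x * cnj (q x))" using harmonic_tempered[OF assms(1)] by auto
  show "p (t *\<^sub>R x) * cnj (q (t *\<^sub>R x)) = of_real (t powr real (m + n)) * (p x * cnj (q x))" if "t > 0"
    using assms that unfolding harmonic_poly_def powr_realpow[OF that] by (simp add: scaleR_conv_of_real power_add)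
qed

lemma harmonic_integral_zero:
  assumes p: "harmonic_poly Rp k m p" and q: "harmonic_poly Rp k n q" and mn: "m \<noteq> n" and z: "z > 0"
  shows "(\<integral>x. gauss (\<lambda>x. p x * cnj (q x)) z x \<partial>M) = 0"
proof -
  have R: "integrable M (gauss (\<lambda>x. of_real (T (p x) * T' (q x))) z) \<and>
      (\<integral>x. gauss (\<lambda>x. of_real (T (p x) * T' (q x))) z x \<partial>M) = 0"
    if T: "bounded_linear T" "bounded_linear T'" for T T' :: "complex \<Rightarrow> real"
  proof
    note P = harmonic_poly_bounded_linear[OF p T(1)] and Q = harmonic_poly_bounded_linear[OF q T(2)]
    have t: "tempered (\<lambda>x. complex_of_real (T (p x) * T' (q x)))"
      by (intro tempered_of_real tempered_mult tempered_real_polynomial P Q)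
    then show "integrable M (gauss (\<lambda>x. of_real (T (p x) * T' (q x))) z)" by (intro integrable_gauss z)
    have "(\<integral>x. gauss (\<lambda>x. of_real (T (p x) * T' (q x))) z x \<partial>M) =
        (\<integral>x. wt x *\<^sub>R gauss (\<lambda>x. of_real (T (p x) * T' (q x))) z x \<partial>lborel)"
      by (intro integral_M measurable_gauss tempered_measurable[OF t])
    \<comment> \<open>The parameter becomes z / a because \<open>phi\<close> contains the factor 1 /
      a and \<open>gweight\<close> does not.\<close>
    also have "\<dots> = (\<integral>x. complex_of_real (norm x powr (a - 2) * T (p x) * T' (q x) * gweight (z / a) x) \<partial>lborel)"
      by (intro Bochner_Integration.integral_cong refl)
        (simp add: wt_def gauss_def gweight_def phi_def scaleR_conv_of_real mult_ac)
    also have "\<dots> = of_real (\<integral>x. norm x powr (a - 2) * T (p x) * T' (q x) * gweight (z / a) x \<partial>lborel)"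
      by (rule integral_complex_of_real)
    also have "(\<integral>x. norm x powr (a - 2) * T (p x) * T' (q x) * gweight (z / a) x \<partial>lborel) = 0"
      using z a_pos by (intro harmonic_orthogonal[OF P Q _ mn]) auto
    finally show "(\<integral>x. gauss (\<lambda>x. of_real (T (p x) * T' (q x))) z x \<partial>M) = 0" by simp
  qed
  note rr = R[OF bounded_linear_Re bounded_linear_Re] and ii = R[OF bounded_linear_Im bounded_linear_Im]
    and ri = R[OF bounded_linear_Re bounded_linear_Im] and ir = R[OF bounded_linear_Im bounded_linear_Re]
  have "gauss (\<lambda>x. p x * cnj (q x)) z = (\<lambda>x. (gauss (\<lambda>x. of_real (Re (p x) * Re (q x))) z x
     + gauss (\<lambda>x. of_real (Im (p x) * Im (q x))) z x) + (\<i> * gauss (\<lambda>x. of_real (Im (p x) * Re (q x))) z x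
     - \<i> * gauss (\<lambda>x. of_real (Re (p x) * Im (q x))) z x))"
    by (rule ext) (simp add: gauss_def complex_eq_iff algebra_simps)
  then show ?thesis using rr ii ri ir by simp
qed

text \<open>The Gram form of harmonics at exponent 1. It is not computed; within one degree it only
  occurs as a common factor of the inner products compared.\<close>

definition hip :: "('a \<Rightarrow> complex) \<Rightarrow> ('a \<Rightarrow> complex) \<Rightarrow> complex" where
  "hip p q = (\<integral>x. gauss (\<lambda>x. p x * cnj (q x)) 1 x \<partial>M)"

text \<open>The exponents add, and the product of two harmonics of degree m is homogeneous of degree
  2m, hence \<open>nu\<close> at 2m.\<close>

lemma ip_gauss_phi:
  assumes p: "harmonic_poly Rp k m p" and q: "harmonic_poly Rp k m q" and z: "z + z' > 0"
  shows "ip M (gauss (\<lambda>x. p x * of_real (phi x ^ j)) z) (gauss q z') =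
    of_real (pochhammer (nu (2 * real m)) j * (z + z') powr (- (nu (2 * real m) + real j))) * hip p q"
proof -
  have "ip M (gauss (\<lambda>x. p x * of_real (phi x ^ j)) z) (gauss q z') =
      (\<integral>x. gauss (\<lambda>x. (p x * cnj (q x)) * of_real (phi x ^ j)) (z + z') x \<partial>M)"
    unfolding ip_def
    by (intro Bochner_Integration.integral_cong refl) (simp add: gauss_def distrib_right exp_add[symmetric] mult_ac flip: of_real_mult exp_add)
  also have "\<dots> = of_real (pochhammer (nu (real (m + m))) j * (z + z') powr (- (nu (real (m + m)) + real j))) * hip p q"
    unfolding hip_def by (rule gauss_moments[OF harmonic_product[OF p q] z])
  finally show ?thesis by simp
qed

lemma ip_gauss_ortho:
  assumes p: "harmonic_poly Rp k m p" and q: "harmonic_poly Rp k n q" and mn: "m \<noteq> n" and z: "z + z' > 0"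
  shows "ip M (gauss p z) (gauss q z') = 0"
proof -
  have "ip M (gauss p z) (gauss q z') = (\<integral>x. gauss (\<lambda>x. p x * cnj (q x)) (z + z') x \<partial>M)"
    unfolding ip_def
    by (intro Bochner_Integration.integral_cong refl) (simp add: gauss_def distrib_right exp_add[symmetric] mult_ac flip: of_real_mult exp_add)
  then show ?thesis using harmonic_integral_zero[OF p q mn z] by simp
qed

section \<open>Density of Gaussians with harmonic factors\<close>

lemma gauss_dominated:
  fixes h :: "nat \<Rightarrow> 'a \<Rightarrow> complex"
  assumes u: "\<And>s. s \<in> I \<Longrightarrow> u s \<in> L2_space M"
    and h: "\<And>n. h n \<in> clspan M I u" and f: "f \<in> borel_measurable borel"
    and lim: "\<And>x. (\<lambda>n. h n x) \<longlonglongrightarrow> f x"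
    and g: "tempered g" "z > 0" and bd: "\<And>n x. cmod (h n x) \<le> cmod (gauss g z x)"
  shows "f \<in> clspan M I u"
proof (rule clspan_dominated[where h=h, OF u h])
  have L: "gauss g z \<in> L2_space M" by (rule gauss_L2[OF g])
  show "(\<lambda>x. cmod (gauss g z x)) \<in> borel_measurable M" "integrable M (\<lambda>x. (cmod (gauss g z x))\<^sup>2)"
    using L by (auto simp: L2_space_iff)
qed (use f lim bd in auto)

text \<open>Taylor expansion of \<open>exp (- s \<phi>)\<close>; it converges in \<open>L\<^sup>2\<close> only for \<open>\<bar>s\<bar> < c\<close>.\<close>

lemma clspan_gauss_shift:
  assumes u: "\<And>s. s \<in> I \<Longrightarrow> u s \<in> L2_space M" and p: "tempered p"
    and cl: "\<And>j. gauss (\<lambda>x. p x * of_real (phi x ^ j)) c \<in> clspan M I u" and s: "\<bar>s\<bar> < c"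
  shows "gauss (\<lambda>x. p x * of_real (phi x ^ j)) (c + s) \<in> clspan M I u"
proof (rule gauss_dominated[OF u])
  note [measurable] = tempered_measurable[OF p]
  define h where "h n x = (\<Sum>i<n. of_real ((- s) ^ i / fact i) * gauss (\<lambda>x. p x * of_real (phi x ^ (i + j))) c x)" for n x
  show "h n \<in> clspan M I u" for n
    unfolding h_def[abs_def] by (intro clspan_comb u cl)
  have hx: "h n x = gauss (\<lambda>x. p x * of_real (phi x ^ j)) c x * of_real (\<Sum>i<n. (- s * phi x) ^ i / fact i)" for n x
    unfolding h_def of_real_sum sum_distrib_left
    unfolding power_mult_distrib by (intro sum.cong refl) (simp add: gauss_def power_add mult_ac)
  show "(\<lambda>n. h n x) \<longlonglongrightarrow> gauss (\<lambda>x. p x * of_real (phi x ^ j)) (c + s) x" for x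
  proof -
    have "(\<lambda>i. (- s * phi x) ^ i / fact i) sums exp (- s * phi x)"
      using exp_converges[of "- s * phi x"] by (simp add: divide_inverse mult.commute)
    then have "(\<lambda>n. gauss (\<lambda>x. p x * of_real (phi x ^ j)) c x * of_real (\<Sum>i<n. (- s * phi x) ^ i / fact i)) \<longlonglongrightarrow>
        gauss (\<lambda>x. p x * of_real (phi x ^ j)) c x * of_real (exp (- s * phi x))"
      unfolding sums_def by (intro tendsto_intros)
    moreover have "gauss (\<lambda>x. p x * of_real (phi x ^ j)) c x * of_real (exp (- s * phi x)) =
        gauss (\<lambda>x. p x * of_real (phi x ^ j)) (c + s) x"
      by (simp add: gauss_def mult.assoc flip: of_real_mult exp_add) (simp add: algebra_simps)
    ultimately show ?thesis unfolding hx by (simp only:)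
  qed
  show "tempered (\<lambda>x. p x * of_real (phi x ^ j))"
    by (intro tempered_mult p tempered_of_real tempered_power tempered_phi)
  show "c - \<bar>s\<bar> > 0" using s by simp
  show "cmod (h n x) \<le> cmod (gauss (\<lambda>x. p x * of_real (phi x ^ j)) (c - \<bar>s\<bar>) x)" for n x
  proof -
    have "\<bar>\<Sum>i<n. (- s * phi x) ^ i / fact i\<bar> \<le> (\<Sum>i<n. \<bar>(- s * phi x) ^ i / fact i\<bar>)" by (rule sum_abs)
    also have "\<dots> = (\<Sum>i<n. (\<bar>s\<bar> * phi x) ^ i / fact i)" by (simp add: abs_mult power_abs)
    also have "\<dots> \<le> exp (\<bar>s\<bar> * phi x)"
    proof -
      have "(\<lambda>i. (\<bar>s\<bar> * phi x) ^ i / fact i) sums exp (\<bar>s\<bar> * phi x)"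
        using exp_converges[of "\<bar>s\<bar> * phi x"] by (simp add: divide_inverse mult.commute)
      then have "summable (\<lambda>i. (\<bar>s\<bar> * phi x) ^ i / fact i)" "(\<Sum>i. (\<bar>s\<bar> * phi x) ^ i / fact i) = exp (\<bar>s\<bar> * phi x)"
        by (auto simp: sums_iff)
      moreover have "(\<Sum>i<n. (\<bar>s\<bar> * phi x) ^ i / fact i) \<le> (\<Sum>i. (\<bar>s\<bar> * phi x) ^ i / fact i)"
        by (rule sum_le_suminf[OF calculation(1)]) auto
      ultimately show ?thesis by simp
    qed
    finally have "cmod (h n x) \<le> cmod (gauss (\<lambda>x. p x * of_real (phi x ^ j)) c x) * exp (\<bar>s\<bar> * phi x)"
      unfolding hx norm_mult norm_of_real by (intro mult_left_mono) auto
    also have "\<dots> = cmod (gauss (\<lambda>x. p x * of_real (phi x ^ j)) (c - \<bar>s\<bar>) x)"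
      by (simp add: gauss_def norm_mult mult.assoc flip: exp_add) (simp add: algebra_simps)
    finally show ?thesis .
  qed
qed (assumption, intro measurable_gauss tempered_measurable tempered_mult p tempered_of_real tempered_power tempered_phi)

text \<open>In the variable s = exp(-phi/2), with values in [0, 1], a polynomial times exp(-phi) is
  a combination of Gaussians of exponents 1 + i/2. So psi is written as s^2 G(s) and G is
  approximated uniformly by polynomials; the split-off factor s^2 = exp(-phi) supplies the Gaussian
  majorant.\<close>

lemma clspan_radial_cutoff:
  assumes u: "\<And>s. s \<in> I \<Longrightarrow> u s \<in> L2_space M" and p: "tempered p"
    and cl: "\<And>i::nat. gauss p (1 + real i / 2) \<in> clspan M I u"
    and \<psi>: "continuous_on {0..} \<psi>" "\<And>r. r \<ge> R \<Longrightarrow> \<psi> r = 0" and R: "R > 0"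
  shows "(\<lambda>x. p x * complex_of_real (\<psi> (norm x))) \<in> clspan M I u"
proof -
  note [measurable] = tempered_measurable[OF p]
  \<comment> \<open>The value of s at |x| = R. Smaller s belong to |x| > R, where psi vanishes, so
    \<open>max s \<delta>\<close> keeps the logarithm and the division away from 0 without changing
    the product \<open>s\<^sup>2 * G s\<close>.\<close>
  define \<delta> where "\<delta> = exp (- (R powr a / a) / 2)"
  define G where "G s = \<psi> ((- (2 * a * ln (max s \<delta>))) powr (1 / a)) / (max s \<delta>)\<^sup>2" for s
  have \<delta>: "\<delta> > 0" "\<delta> \<le> 1" using a_pos by (auto simp: \<delta>_def)
  have cG: "continuous_on {0..1} G"
  proof -
    have "ln (max s \<delta>) \<le> 0" if "s \<in> {0..1}" for s
      using \<delta> that by (subst ln_le_zero_iff) auto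
    then have nn: "- (2 * a * ln (max s \<delta>)) \<ge> 0" if "s \<in> {0..1}" for s
      using that a_pos by (simp add: mult_nonneg_nonpos)
    have m0: "max s \<delta> \<noteq> 0" for s using \<delta> by (auto simp: max_def)
    have "continuous_on {0..1} (\<lambda>s. (- (2 * a * ln (max s \<delta>))) powr (1 / a))"
      using nn a_pos m0 \<delta> by (intro continuous_on_powr' continuous_intros) auto
    then have "continuous_on {0..1} (\<lambda>s. \<psi> ((- (2 * a * ln (max s \<delta>))) powr (1 / a)))"
      by (rule continuous_on_compose2[OF \<psi>(1)]) auto
    then show ?thesis unfolding G_def[abs_def] using m0 by (intro continuous_intros) auto
  qed
  have "bounded (G ` {0..1})" by (rule compact_imp_bounded[OF compact_continuous_image[OF cG compact_Icc]])
  then obtain B where B: "\<And>s. s \<in> {0..1} \<Longrightarrow> \<bar>G s\<bar> \<le> B"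
    unfolding bounded_iff real_norm_def by blast
  define s where "s x = exp (- (phi x / 2))" for x
  have s: "s x \<in> {0..1}" for x by (simp add: s_def)
  have psiG: "\<psi> (norm x) = (s x)\<^sup>2 * G (s x)" for x
  proof (cases "norm x \<le> R")
    case True
    then have "norm x powr a / a \<le> R powr a / a"
      using a_pos by (intro divide_right_mono powr_mono2) auto
    then have m: "max (s x) \<delta> = s x" by (simp add: s_def \<delta>_def phi_def)
    have "- (2 * a * ln (s x)) = norm x powr a" using a_pos by (simp add: s_def phi_def)
    then have "(- (2 * a * ln (s x))) powr (1 / a) = norm x" using a_pos by (simp add: powr_powr)
    then show ?thesis unfolding G_def m by (simp add: s_def)
  next
    case False
    then have "R powr a / a \<le> norm x powr a / a"
      using a_pos R by (intro divide_right_mono powr_mono2) auto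
    then have m: "max (s x) \<delta> = \<delta>" by (simp add: s_def \<delta>_def phi_def)
    have "- (2 * a * ln \<delta>) = R powr a" using a_pos by (simp add: \<delta>_def)
    then have "(- (2 * a * ln \<delta>)) powr (1 / a) = R" using a_pos R by (simp add: powr_powr)
    then have "G (s x) = \<psi> R / \<delta>\<^sup>2" unfolding G_def m by simp
    then show ?thesis using \<psi>(2)[of R] \<psi>(2)[of "norm x"] False by simp
  qed
  have "\<forall>n. \<exists>q. real_polynomial_function q \<and> (\<forall>s\<in>{0..1}. \<bar>G s - q s\<bar> < 1 / real (Suc n))"
  proof
    fix n
    obtain q where "real_polynomial_function q" "\<And>s. s \<in> {0..1} \<Longrightarrow> \<bar>G s - q s\<bar> < 1 / real (Suc n)"
      using Stone_Weierstrass_real_polynomial_function[OF compact_Icc cG, of "1 / real (Suc n)"] by auto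
    then show "\<exists>q. real_polynomial_function q \<and> (\<forall>s\<in>{0..1}. \<bar>G s - q s\<bar> < 1 / real (Suc n))" by blast
  qed
  from choice[OF this] obtain q where q: "\<And>n. real_polynomial_function (q n)"
    "\<And>n s. s \<in> {0..1} \<Longrightarrow> \<bar>G s - q n s\<bar> < 1 / real (Suc n)" by blast
  show ?thesis
  proof (rule gauss_dominated[OF u, where h="\<lambda>n x. gauss p 1 x * of_real (q n (s x))"])
    show "(\<lambda>x. gauss p 1 x * of_real (q n (s x))) \<in> clspan M I u" for n
    proof -
      obtain c d where c: "q n = (\<lambda>x. \<Sum>i\<le>d. c i * x ^ i)"
        using q(1)[of n] unfolding real_polynomial_function_iff_sum by blast
      have "gauss p 1 x * of_real (q n (s x)) = (\<Sum>i\<le>d. of_real (c i) * gauss p (1 + real i / 2) x)" for x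
        unfolding c of_real_sum sum_distrib_left
      proof (intro sum.cong refl)
        fix i
        have "s x ^ i = exp (- (real i / 2 * phi x))" by (simp add: s_def flip: exp_of_nat_mult)
        moreover have "exp (- ((1 + real i / 2) * phi x)) = exp (- phi x) * exp (- (real i / 2 * phi x))"
          by (simp add: distrib_right flip: exp_add)
        ultimately show "gauss p 1 x * of_real (c i * s x ^ i) = of_real (c i) * gauss p (1 + real i / 2) x"
          by (simp add: gauss_def)
      qed
      then show ?thesis using clspan_comb[where f="\<lambda>i. gauss p (1 + real i / 2)" and S="{..d}", OF u cl] by simp
    qed
    show "(\<lambda>x. p x * complex_of_real (\<psi> (norm x))) \<in> borel_measurable borel"
    proof -
      have "continuous_on UNIV (\<lambda>x::'a. \<psi> (norm x))"
        by (rule continuous_on_compose2[OF \<psi>(1)]) (auto intro: continuous_intros)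
      then have "continuous_on UNIV (\<lambda>x::'a. complex_of_real (\<psi> (norm x)))" by (intro continuous_intros)
      then have "(\<lambda>x::'a. complex_of_real (\<psi> (norm x))) \<in> borel_measurable borel"
        by (rule borel_measurable_continuous_onI)
      then show ?thesis by measurable
    qed
    show "(\<lambda>n. gauss p 1 x * of_real (q n (s x))) \<longlonglongrightarrow> p x * complex_of_real (\<psi> (norm x))" for x
    proof -
      have "(\<lambda>n. \<bar>G (s x) - q n (s x)\<bar>) \<longlonglongrightarrow> 0"
      proof (rule tendsto_sandwich[OF _ _ tendsto_const])
        show "(\<lambda>n. 1 / real (Suc n)) \<longlonglongrightarrow> 0" using LIMSEQ_inverse_real_of_nat by (simp add: inverse_eq_divide)
      qed (use q(2)[OF s[of x]] in \<open>auto intro!: always_eventually less_imp_le\<close>)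
      then have "(\<lambda>n. G (s x) - q n (s x)) \<longlonglongrightarrow> 0" by (rule tendsto_rabs_zero_cancel)
      then have "(\<lambda>n. G (s x) - (G (s x) - q n (s x))) \<longlonglongrightarrow> G (s x) - 0" by (intro tendsto_intros)
      then have "(\<lambda>n. gauss p 1 x * of_real (q n (s x))) \<longlonglongrightarrow> gauss p 1 x * of_real (G (s x))"
        by (intro tendsto_intros) simp
      moreover have "gauss p 1 x * of_real (G (s x)) = p x * complex_of_real (\<psi> (norm x))"
      proof -
        have "exp (- phi x) = (s x)\<^sup>2" by (simp add: s_def power2_eq_square flip: exp_add)
        then show ?thesis unfolding psiG by (simp add: gauss_def)
      qed
      ultimately show ?thesis by simp
    qed
    show "tempered (\<lambda>x. p x * of_real (B + 1))" by (intro tempered_mult p tempered_const)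
    show "cmod (gauss p 1 x * of_real (q n (s x))) \<le> cmod (gauss (\<lambda>x. p x * of_real (B + 1)) 1 x)" for n x
    proof -
      have "1 / real (Suc n) \<le> 1" by simp
      then have "\<bar>q n (s x)\<bar> \<le> B + 1" using q(2)[OF s[of x], of n] B[OF s[of x]] by linarith
      then have "cmod (gauss p 1 x) * \<bar>q n (s x)\<bar> \<le> cmod (gauss p 1 x) * \<bar>B + 1\<bar>"
        by (intro mult_left_mono) auto
      then show ?thesis by (simp add: gauss_def norm_mult mult_ac del: of_real_add)
    qed
  qed auto
qed

definition cutoff :: "real \<Rightarrow> real \<Rightarrow> real" where "cutoff R r = max 0 (min 1 (R + 1 - r))"

lemma cutoff: "0 \<le> cutoff R r" "cutoff R r \<le> 1" "r \<ge> R + 1 \<Longrightarrow> cutoff R r = 0" "r \<le> R \<Longrightarrow> cutoff R r = 1"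
  by (auto simp: cutoff_def)

lemma continuous_cutoff: "continuous_on S (cutoff R)"
  unfolding cutoff_def[abs_def] by (intro continuous_intros)

lemma measurable_cutoff[measurable]: "cutoff R \<in> borel_measurable borel"
  by (intro borel_measurable_continuous_onI continuous_cutoff)

text \<open>Bounded functions with bounded support are dominated by a multiple of the Gaussian of
  exponent 1, which is square integrable for this measure.\<close>

lemma compact_support_bound:
  assumes "B \<ge> 0"
  shows "\<exists>K. \<forall>(x::'a) c. norm c \<le> B \<longrightarrow> (norm x > R \<longrightarrow> c = 0) \<longrightarrow> cmod c \<le> cmod (gauss (\<lambda>x. of_real K) 1 x)"
proof (intro exI[of _ "B * exp (R powr a / a)"] allI impI)
  fix x :: 'a and c :: complex assume c: "norm c \<le> B" "norm x > R \<longrightarrow> c = 0"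
  show "cmod c \<le> cmod (gauss (\<lambda>x. of_real (B * exp (R powr a / a))) 1 x)"
  proof (cases "norm x > R")
    case False
    then have "norm x powr a / a \<le> R powr a / a" using a_pos by (intro divide_right_mono powr_mono2) auto
    then have "1 \<le> exp (R powr a / a) * exp (- phi x)" by (simp add: phi_def flip: exp_add)
    then have "B * 1 \<le> B * (exp (R powr a / a) * exp (- phi x))" using assms by (intro mult_left_mono) auto
    with c(1) show ?thesis using assms by (simp add: gauss_def norm_mult mult_ac)
  qed (use c in simp)
qed

text \<open>From Gaussians times harmonic polynomials to all of \<open>L\<^sup>2\<close>: Gaussians, radial cutoffs,
  polynomials with cutoff, continuous functions with cutoff, bounded measurable functions.\<close>

lemma clspan_eq_L2:
  assumes u: "\<And>s. s \<in> I \<Longrightarrow> u s \<in> L2_space M"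
    and cl: "\<And>m p i. harmonic_poly Rp k m p \<Longrightarrow> gauss p (1 + real i / 2) \<in> clspan M I u"
  shows "clspan M I u = L2_space M"
proof -
  \<comment> \<open>By the Fischer decomposition each summand is a harmonic times an even power of
    the norm, and the power joins the radial profile.\<close>
  have radial: "(\<lambda>x. complex_of_real (f x * cutoff R (norm x))) \<in> clspan M I u"
    if f: "real_polynomial_function f" and R: "R > 0" for f R
    using real_polynomial_harmonic_sum[OF zero_Rp mult_sum_nonneg f]
  proof (induction rule: harmonic_sum.induct)
    case zero
    show ?case using clspan_zero by simp
  next
    case (base m h j)
    note h = harmonic_poly_of_real[OF base]
    have "(\<lambda>x. complex_of_real (h x) * complex_of_real (norm x ^ (2 * j) * cutoff R (norm x))) \<in> clspan M I u"
      using R by (intro clspan_radial_cutoff[OF u harmonic_tempered[OF h] cl[OF h], of _ "R + 1"])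
        (auto intro!: continuous_intros continuous_cutoff simp: cutoff)
    then show ?case by (simp add: mult_ac)
  next
    case (add p q)
    then show ?case using clspan_lin_comb[OF u add.IH, of 1 1] by (simp add: distrib_right)
  qed
  have poly: "(\<lambda>x. f x * complex_of_real (cutoff R (norm x))) \<in> clspan M I u"
    if f: "polynomial_function f" and R: "R > 0" for f :: "'a \<Rightarrow> complex" and R
  proof -
    have "real_polynomial_function (\<lambda>x. Re (f x))" "real_polynomial_function (\<lambda>x. Im (f x))"
      using f bounded_linear_Re bounded_linear_Im by (auto simp: polynomial_function_def o_def)
    then have "(\<lambda>x. 1 * complex_of_real (Re (f x) * cutoff R (norm x)) + \<i> * complex_of_real (Im (f x) * cutoff R (norm x)))
       \<in> clspan M I u"
      by (intro clspan_lin_comb u radial R)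
    moreover have "1 * complex_of_real (Re (f x) * cutoff R (norm x)) + \<i> * complex_of_real (Im (f x) * cutoff R (norm x))
      = f x * complex_of_real (cutoff R (norm x))" for x
      by (simp add: complex_eq_iff)
    ultimately show ?thesis by simp
  qed
  have cont: "(\<lambda>x. f x * complex_of_real (cutoff R (norm x))) \<in> clspan M I u"
    if f: "continuous_on UNIV f" and R: "R > 0" for f :: "'a \<Rightarrow> complex" and R
  proof -
    let ?S = "cball (0::'a) (R + 1)"
    have fS: "continuous_on ?S f" using f continuous_on_subset by blast
    have "bounded (f ` ?S)" by (rule compact_imp_bounded[OF compact_continuous_image[OF fS compact_cball]])
    then obtain B where B: "\<And>x. x \<in> ?S \<Longrightarrow> cmod (f x) \<le> B"  "B > 0"
      unfolding bounded_pos by blast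
    have "\<forall>n. \<exists>q. polynomial_function q \<and> (\<forall>x\<in>?S. cmod (f x - q x) < 1 / real (Suc n))"
    proof
      fix n
      obtain q where "polynomial_function q" "\<And>x. x \<in> ?S \<Longrightarrow> cmod (f x - q x) < 1 / real (Suc n)"
        using Stone_Weierstrass_polynomial_function[OF compact_cball fS, of "1 / real (Suc n)"] by auto
      then show "\<exists>q. polynomial_function q \<and> (\<forall>x\<in>?S. cmod (f x - q x) < 1 / real (Suc n))" by blast
    qed
    from choice[OF this] obtain q where q: "\<And>n. polynomial_function (q n)"
      "\<And>n x. x \<in> ?S \<Longrightarrow> cmod (f x - q n x) < 1 / real (Suc n)" by blast
    have B1: "B + 1 \<ge> 0" using B(2) by simp
    from compact_support_bound[OF B1, of "R + 1"] obtain K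
      where K: "\<forall>(x::'a) c. norm c \<le> B + 1 \<longrightarrow> (norm x > R + 1 \<longrightarrow> c = 0) \<longrightarrow>
        cmod c \<le> cmod (gauss (\<lambda>x. of_real K) 1 x)" by (rule exE)
    show ?thesis
    proof (rule gauss_dominated[OF u poly[OF q(1) R] _ _ tempered_const[of "of_real K"], where z=1])
      show "(\<lambda>x. f x * complex_of_real (cutoff R (norm x))) \<in> borel_measurable borel"
      proof -
        have [measurable]: "f \<in> borel_measurable borel" by (rule borel_measurable_continuous_onI[OF f])
        have "continuous_on UNIV (\<lambda>x::'a. complex_of_real (cutoff R (norm x)))"
          by (intro continuous_on_of_real continuous_on_compose2[OF continuous_cutoff] continuous_intros) auto
        then have [measurable]: "(\<lambda>x::'a. complex_of_real (cutoff R (norm x))) \<in> borel_measurable borel"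
          by (rule borel_measurable_continuous_onI)
        show ?thesis by measurable
      qed
      show "(\<lambda>n. q n x * complex_of_real (cutoff R (norm x))) \<longlonglongrightarrow> f x * complex_of_real (cutoff R (norm x))" for x
      proof (cases "x \<in> ?S")
        case True
        have "(\<lambda>n. cmod (f x - q n x)) \<longlonglongrightarrow> 0"
        proof (rule tendsto_sandwich[OF _ _ tendsto_const])
          show "(\<lambda>n. 1 / real (Suc n)) \<longlonglongrightarrow> 0" using LIMSEQ_inverse_real_of_nat by (simp add: inverse_eq_divide)
        qed (use q(2)[OF True] in \<open>auto intro!: always_eventually less_imp_le\<close>)
        then have "(\<lambda>n. f x - q n x) \<longlonglongrightarrow> 0" by (simp add: tendsto_norm_zero_iff)
        then have "(\<lambda>n. f x - (f x - q n x)) \<longlonglongrightarrow> f x - 0" by (intro tendsto_intros)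
        then show ?thesis by (intro tendsto_intros) simp
      qed (simp add: cutoff)
      show "cmod (q n x * complex_of_real (cutoff R (norm x))) \<le> cmod (gauss (\<lambda>x. of_real K) 1 x)" for n x
      proof (rule K[rule_format])
        show "norm (q n x * complex_of_real (cutoff R (norm x))) \<le> B + 1"
        proof (cases "x \<in> ?S")
          case True
          have "1 / real (Suc n) \<le> 1" by simp
          then have "cmod (q n x) \<le> B + 1"
            using q(2)[OF True, of n] B(1)[OF True] norm_triangle_ineq3[of "q n x" "f x"]
            unfolding norm_minus_commute[of "q n x"] by linarith
          then have "cmod (q n x) * \<bar>cutoff R (norm x)\<bar> \<le> (B + 1) * 1"
            using B(2) cutoff[of R "norm x"] by (intro mult_mono) auto
          then show ?thesis by (simp add: norm_mult)
        qed (use B(2) in \<open>simp add: cutoff\<close>)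
      qed (simp add: cutoff)
    qed auto
  qed
  have bounded: "(\<lambda>x. f x * complex_of_real (cutoff R (norm x))) \<in> clspan M I u"
    if [measurable]: "f \<in> borel_measurable borel" and fB: "\<And>x. cmod (f x) \<le> B" and B: "B > 0" and R: "R > 0"
    for f :: "'a \<Rightarrow> complex" and R B
  proof -
    \<comment> \<open>A measurable function is an almost everywhere limit of continuous ones;
      Lebesgue null sets are null for the weighted measure as well.\<close>
    have "f \<in> borel_measurable lebesgue" by (rule measurable_completion) simp
    then have "f measurable_on UNIV"
      using lebesgue_measurable_imp_measurable_on[of f UNIV] by (simp add: lebesgue_on_UNIV_eq)
    then have "\<exists>N g. negligible N \<and> (\<forall>n::nat. continuous_on UNIV (g n)) \<and>
        (\<forall>x. x \<notin> N \<longrightarrow> (\<lambda>n. g n x) \<longlonglongrightarrow> f x)"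
      by (simp add: measurable_on_def)
    then obtain N g where N: "negligible N" and g: "\<forall>n::nat. continuous_on UNIV (g n)"
      "\<forall>x. x \<notin> N \<longrightarrow> (\<lambda>n. g n x) \<longlonglongrightarrow> f x"
      by (elim exE conjE)
    note g = g[rule_format]
    \<comment> \<open>Caps the modulus at B without losing continuity; since |f| <= B the cap is
      inactive in the limit.\<close>
    define h where "h n x = g n x * complex_of_real (B / max B (cmod (g n x)))" for n x
    have hc: "continuous_on UNIV (h n)" for n
    proof -
      have m: "\<forall>x\<in>UNIV. max B (cmod (g n x)) \<noteq> 0" using B by (auto simp: max_def)
      have "continuous_on UNIV (\<lambda>x. B / max B (cmod (g n x)))"
        by (rule continuous_on_divide[OF continuous_on_const continuous_on_max[OF continuous_on_const continuous_on_norm[OF g(1)]] m])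
      then have "continuous_on UNIV (\<lambda>x. complex_of_real (B / max B (cmod (g n x))))" by (rule continuous_on_of_real)
      then show ?thesis unfolding h_def[abs_def] by (rule continuous_on_mult[OF g(1)])
    qed
    have hB: "cmod (h n x) \<le> B" for n x
    proof -
      have m: "max B (cmod (g n x)) > 0" using B by simp
      have "cmod (h n x) = cmod (g n x) * (B / max B (cmod (g n x)))"
        using B m by (simp only: h_def norm_mult norm_of_real abs_of_nonneg less_imp_le divide_nonneg_pos)
      also have "\<dots> = B * (cmod (g n x) / max B (cmod (g n x)))" by simp
      also have "\<dots> \<le> B * 1" using B m by (intro mult_left_mono) (auto simp: pos_divide_le_eq)
      finally show ?thesis by simp
    qed
    have [measurable]: "(\<lambda>x::'a. complex_of_real (cutoff R (norm x))) \<in> borel_measurable borel"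
      by (intro borel_measurable_continuous_onI continuous_on_of_real continuous_on_compose2[OF continuous_cutoff] continuous_intros) auto
    from compact_support_bound[OF less_imp_le[OF B], of "R + 1"] obtain K
      where K: "\<forall>(x::'a) c. norm c \<le> B \<longrightarrow> (norm x > R + 1 \<longrightarrow> c = 0) \<longrightarrow>
        cmod c \<le> cmod (gauss (\<lambda>x. of_real K) 1 x)" by (rule exE)
    show ?thesis
    proof (rule clspan_dominated[OF u cont[OF hc R]])
      have L: "gauss (\<lambda>x. of_real K) 1 \<in> L2_space M" by (intro gauss_L2 tempered_const) simp
      show "(\<lambda>x. cmod (gauss (\<lambda>x. of_real K) 1 x)) \<in> borel_measurable M"
        "integrable M (\<lambda>x. (cmod (gauss (\<lambda>x. of_real K) 1 x))\<^sup>2)" using L by (auto simp: L2_space_iff)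
      show "(\<lambda>x. f x * complex_of_real (cutoff R (norm x))) \<in> borel_measurable M" by simp
      have "AE x in lebesgue. x \<notin> N"
        using N by (intro AE_not_in) (simp add: negligible_iff_null_sets)
      then have "AE x in lborel. x \<notin> N" by (simp add: AE_completion_iff)
      then have "AE x in M. x \<notin> N" by (rule AE_ka_measure[OF finite_Rp])
      then show "AE x in M. (\<lambda>n. h n x * complex_of_real (cutoff R (norm x))) \<longlonglongrightarrow> f x * complex_of_real (cutoff R (norm x))"
      proof eventually_elim
        case (elim x)
        have "max B (cmod (f x)) \<noteq> 0" using B by (auto simp: max_def)
        then have "(\<lambda>n. h n x) \<longlonglongrightarrow> f x * complex_of_real (B / max B (cmod (f x)))"
          unfolding h_def by (intro tendsto_intros g elim) auto
        moreover have "B / max B (cmod (f x)) = 1" using B fB[of x] by (simp add: max_def)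
        ultimately show ?case by (intro tendsto_intros) simp
      qed
      show "AE x in M. cmod (h n x * complex_of_real (cutoff R (norm x))) \<le> cmod (gauss (\<lambda>x. of_real K) 1 x)" for n
      proof (intro AE_I2 K[rule_format])
        fix x
        have "cmod (h n x) * \<bar>cutoff R (norm x)\<bar> \<le> B * 1"
          using B hB cutoff[of R "norm x"] by (intro mult_mono) auto
        then show "norm (h n x * complex_of_real (cutoff R (norm x))) \<le> B" by (simp add: norm_mult)
      qed (simp add: cutoff)
    qed
  qed
  have "f \<in> clspan M I u" if f: "f \<in> L2_space M" for f
  proof -
    have [measurable]: "f \<in> borel_measurable borel" using f by (simp add: L2_space_iff)
    \<comment> \<open>Truncation in value, combined below with a cutoff in space at the same level.
      At each point both are eventually inactive, and |f| is a majorant.\<close>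
    define g where "g n x = (if cmod (f x) \<le> real (Suc n) then f x else 0)" for n x
    have [measurable]: "g n \<in> borel_measurable borel" for n unfolding g_def[abs_def] by measurable
    have gcl: "(\<lambda>x. g n x * complex_of_real (cutoff (real (Suc n)) (norm x))) \<in> clspan M I u" for n
      by (rule bounded[of _ "real (Suc n)"]) (auto simp: g_def)
    show ?thesis
    proof (rule clspan_dominated[OF u gcl])
      show "(\<lambda>x. cmod (f x)) \<in> borel_measurable M" "integrable M (\<lambda>x. (cmod (f x))\<^sup>2)" "f \<in> borel_measurable M"
        using f by (auto simp: L2_space_iff)
      show "AE x in M. (\<lambda>n. g n x * complex_of_real (cutoff (real (Suc n)) (norm x))) \<longlonglongrightarrow> f x"
      proof (intro AE_I2 tendsto_eventually)
        fix x
        obtain n0 where n0: "max (cmod (f x)) (norm x) \<le> real n0" using real_arch_simple by blast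
        show "\<forall>\<^sub>F n in sequentially. g n x * complex_of_real (cutoff (real (Suc n)) (norm x)) = f x"
          using eventually_ge_at_top[of n0]
        proof eventually_elim
          case (elim n)
          then have "real n0 \<le> real (Suc n)" by simp
          then have "cmod (f x) \<le> real (Suc n)" "norm x \<le> real (Suc n)" using n0 by linarith+
          then show ?case by (simp add: g_def cutoff del: of_nat_Suc)
        qed
      qed
      show "AE x in M. cmod (g n x * complex_of_real (cutoff (real (Suc n)) (norm x))) \<le> cmod (f x)" for n
      proof (intro AE_I2)
        fix x
        have "cmod (g n x) * \<bar>cutoff (real (Suc n)) (norm x)\<bar> \<le> cmod (f x) * 1"
          using cutoff[of "real (Suc n)" "norm x"] by (intro mult_mono) (auto simp: g_def)
        then show "cmod (g n x * complex_of_real (cutoff (real (Suc n)) (norm x))) \<le> cmod (f x)"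
          by (simp add: norm_mult)
      qed
    qed
  qed
  then show ?thesis using clspan_L2 by blast
qed

end

section \<open>Unitary operators on dense families\<close>

lemma unitary_L2: "unitary_on_L2 M U \<Longrightarrow> f \<in> L2_space M \<Longrightarrow> U f \<in> L2_space M"
  by (simp add: unitary_on_L2_def)

lemma unitary_nrm:
  assumes "unitary_on_L2 M U" "f \<in> L2_space M"
  shows "nrm M (U f) = nrm M f"
proof -
  have "ennreal (nrm M (U f)) = ennreal (nrm M f)"
    using assms unitary_L2[OF assms] by (simp add: unitary_on_L2_def flip: L2_norm_eq_nrm)
  then show ?thesis by simp
qed

lemma unitary_linear:
  assumes "unitary_on_L2 M U" "f \<in> L2_space M" "g \<in> L2_space M"
  shows "AE x in M. U (\<lambda>y. c * f y + d * g y) x = c * U f x + d * U g x"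
  using assms by (simp add: unitary_on_L2_def)

lemma unitary_nrm_lin_comb:
  assumes U: "unitary_on_L2 M U" and f: "f \<in> L2_space M" and g: "g \<in> L2_space M"
  shows "nrm M (\<lambda>x. c * U f x + d * U g x) = nrm M (\<lambda>x. c * f x + d * g x)"
proof -
  have L: "(\<lambda>x. c * f x + d * g x) \<in> L2_space M" using f g by auto
  have "nrm M (\<lambda>x. c * U f x + d * U g x) = nrm M (U (\<lambda>x. c * f x + d * g x))"
  proof (rule nrm_cong_AE)
    show "AE x in M. c * U f x + d * U g x = U (\<lambda>x. c * f x + d * g x) x"
      using unitary_linear[OF U f g, of c d] by eventually_elim simp
    have "(\<lambda>x. c * U f x + d * U g x) \<in> L2_space M"
      by (intro L2_add L2_scale unitary_L2[OF U] f g)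
    then show "(\<lambda>x. c * U f x + d * U g x) \<in> borel_measurable M" by (rule L2_space_measurable)
    show "U (\<lambda>x. c * f x + d * g x) \<in> borel_measurable M"
      by (rule L2_space_measurable[OF unitary_L2[OF U L]])
  qed
  then show ?thesis by (simp add: unitary_nrm[OF U L])
qed

lemma unitary_nrm_diff:
  assumes "unitary_on_L2 M U" "f \<in> L2_space M" "g \<in> L2_space M"
  shows "nrm M (\<lambda>x. U f x - U g x) = nrm M (\<lambda>x. f x - g x)"
  using unitary_nrm_lin_comb[OF assms, of 1 "-1"] by simp

lemma nrm_add_scaled_sq:
  assumes f: "f \<in> L2_space M" and g: "g \<in> L2_space M"
  shows "(nrm M (\<lambda>x. 1 * f x + c * g x))\<^sup>2 = (nrm M f)\<^sup>2 + (cmod c)\<^sup>2 * (nrm M g)\<^sup>2 + 2 * Re (cnj c * ip M f g)"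
proof -
  have cg: "(\<lambda>x. c * g x) \<in> L2_space M" using g by auto
  have "complex_of_real ((nrm M (\<lambda>x. 1 * f x + c * g x))\<^sup>2) = ip M (\<lambda>x. f x + c * g x) (\<lambda>x. f x + c * g x)"
    by (simp add: ip_self)
  also have "\<dots> = ip M f f + cnj c * ip M f g + (c * ip M g f + c * (cnj c * ip M g g))"
    using f g cg L2_add[OF f cg] by (simp add: ip_add_left ip_add_right ip_scale_left ip_scale_right algebra_simps)
  also have "\<dots> = of_real ((nrm M f)\<^sup>2 + (cmod c)\<^sup>2 * (nrm M g)\<^sup>2) + (cnj c * ip M f g + cnj (cnj c * ip M f g))"
    by (simp add: ip_self ip_cnj[of M g f] algebra_simps flip: complex_norm_square)
  also have "\<dots> = of_real ((nrm M f)\<^sup>2 + (cmod c)\<^sup>2 * (nrm M g)\<^sup>2 + 2 * Re (cnj c * ip M f g))"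
    unfolding complex_add_cnj by simp
  finally show ?thesis unfolding of_real_eq_iff .
qed

text \<open>Polarization: the norm of f + c g determines Re (cnj c <f, g>), and c = 1 and c = i give
  the real and the imaginary part.\<close>

lemma unitary_ip:
  assumes U: "unitary_on_L2 M U" and f: "f \<in> L2_space M" and g: "g \<in> L2_space M"
  shows "ip M (U f) (U g) = ip M f g"
proof -
  have "Re (cnj c * ip M (U f) (U g)) = Re (cnj c * ip M f g)" for c
    using nrm_add_scaled_sq[OF f g, of c] nrm_add_scaled_sq[OF unitary_L2[OF U f] unitary_L2[OF U g], of c]
      unitary_nrm_lin_comb[OF U f g, of 1 c] unitary_nrm[OF U f] unitary_nrm[OF U g] by simp
  from this[of 1] this[of "\<i>"] show ?thesis by (simp add: complex_eq_iff)
qed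

text \<open>\<open>unitary_on_L2\<close> gives linearity for two summands and only almost
  everywhere, hence the induction; for the empty sum, the image of 0 has norm 0.\<close>

lemma unitary_comb:
  assumes U: "unitary_on_L2 M U" and u: "\<And>s. s \<in> S \<Longrightarrow> u s \<in> L2_space M" and fin: "finite S"
  shows "AE x in M. U (\<lambda>y. \<Sum>s\<in>S. c s * u s y) x = (\<Sum>s\<in>S. c s * U (u s) x)"
  using fin u
proof (induction S rule: finite_induct)
  case empty
  have "nrm M (U (\<lambda>x. 0)) = 0" using unitary_nrm[OF U L2_zero] by (simp add: nrm_def)
  then show ?case using nrm_eq_0_iff[OF unitary_L2[OF U L2_zero]] by simp
next
  case (insert s S)
  have L: "(\<lambda>y. \<Sum>s\<in>S. c s * u s y) \<in> L2_space M" using insert.prems by (intro L2_comb) auto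
  have "AE x in M. U (\<lambda>y. c s * u s y + 1 * (\<Sum>s\<in>S. c s * u s y)) x = c s * U (u s) x + 1 * U (\<lambda>y. \<Sum>s\<in>S. c s * u s y) x"
    by (rule unitary_linear[OF U _ L]) (use insert.prems in auto)
  moreover have "AE x in M. U (\<lambda>y. \<Sum>s\<in>S. c s * u s y) x = (\<Sum>s\<in>S. c s * U (u s) x)"
    by (rule insert.IH) (use insert.prems in auto)
  ultimately show ?case by eventually_elim (use insert.hyps in simp)
qed

lemma unitary_eq_on_clspan:
  assumes U: "unitary_on_L2 M U" and V: "unitary_on_L2 M V"
    and u: "\<And>s. s \<in> I \<Longrightarrow> u s \<in> L2_space M"
    and eq: "\<And>s. s \<in> I \<Longrightarrow> AE x in M. U (u s) x = V (u s) x"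
    and f: "f \<in> clspan M I u"
  shows "AE x in M. U f x = V f x"
proof -
  note fL = clspan_L2[OF f]
  have "nrm M (\<lambda>x. U f x - V f x) \<le> e" if e: "e > 0" for e
  proof -
    from clspan_approx[OF f half_gt_zero[OF e]] obtain S c where S: "finite S" "S \<subseteq> I"
      "nrm M (\<lambda>x. f x - (\<Sum>s\<in>S. c s * u s x)) < e / 2" .
    let ?g = "\<lambda>x. \<Sum>s\<in>S. c s * u s x"
    have g: "?g \<in> L2_space M" using S u by (intro L2_comb) auto
    have uS: "s \<in> S \<Longrightarrow> u s \<in> L2_space M" for s using S u by auto
    have "AE x in M. \<forall>s\<in>S. U (u s) x = V (u s) x" using S eq by (intro AE_finite_allI) auto
    moreover have "AE x in M. U ?g x = (\<Sum>s\<in>S. c s * U (u s) x)"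
      by (rule unitary_comb[OF U _ S(1)]) (rule uS)
    moreover have "AE x in M. V ?g x = (\<Sum>s\<in>S. c s * V (u s) x)"
      by (rule unitary_comb[OF V _ S(1)]) (rule uS)
    ultimately have "AE x in M. U ?g x = V ?g x" by eventually_elim simp
    then have "nrm M (\<lambda>x. U ?g x - V ?g x) = 0"
      using nrm_eq_0_iff[OF L2_diff[OF unitary_L2[OF U g] unitary_L2[OF V g]]] by simp
    moreover have "nrm M (\<lambda>x. U f x - V f x) \<le> nrm M (\<lambda>x. U f x - U ?g x) + (nrm M (\<lambda>x. U ?g x - V ?g x) + nrm M (\<lambda>x. V ?g x - V f x))"
      using nrm_triangle_diff[OF unitary_L2[OF U fL] unitary_L2[OF U g] unitary_L2[OF V fL]]
        nrm_triangle_diff[OF unitary_L2[OF U g] unitary_L2[OF V g] unitary_L2[OF V fL]] by linarith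
    ultimately show ?thesis
      using S(3) unitary_nrm_diff[OF U fL g] unitary_nrm_diff[OF V g fL] nrm_minus_commute[of M f ?g] by linarith
  qed
  from this[of "nrm M (\<lambda>x. U f x - V f x) / 2"] have "\<not> nrm M (\<lambda>x. U f x - V f x) > 0" by auto
  then have "nrm M (\<lambda>x. U f x - V f x) = 0" using nrm_nonneg[of M "\<lambda>x. U f x - V f x"] by linarith
  then show ?thesis using nrm_eq_0_iff[OF L2_diff[OF unitary_L2[OF U fL] unitary_L2[OF V fL]]] by simp
qed

text \<open>For a combination g within e of d, <d, d> = <d, d - g>, so the norm of d cannot exceed
  e.\<close>

lemma ip_zero_on_clspan:
  assumes d: "d \<in> clspan M I v" and v: "\<And>s. s \<in> I \<Longrightarrow> v s \<in> L2_space M"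
    and z: "\<And>s. s \<in> I \<Longrightarrow> ip M d (v s) = 0"
  shows "nrm M d = 0"
proof -
  note dL = clspan_L2[OF d]
  have "nrm M d \<le> e" if e: "e > 0" for e
  proof (rule ccontr)
    assume n: "\<not> nrm M d \<le> e"
    from clspan_approx[OF d e] obtain S c where S: "finite S" "S \<subseteq> I"
      "nrm M (\<lambda>x. d x - (\<Sum>s\<in>S. c s * v s x)) < e" .
    let ?g = "\<lambda>x. \<Sum>s\<in>S. c s * v s x"
    have g: "?g \<in> L2_space M" using S v by (intro L2_comb) auto
    have "ip M d ?g = 0" using S v z dL by (subst ip_sum_right) (auto intro!: sum.neutral)
    moreover have "ip M d d = ip M d (\<lambda>x. d x - ?g x) + ip M d ?g"
      using ip_add_right[OF dL L2_diff[OF dL g] g] by simp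
    ultimately have "ip M d d = ip M d (\<lambda>x. d x - ?g x)" by simp
    moreover have "cmod (ip M d d) = (nrm M d)\<^sup>2" unfolding ip_self norm_of_real by simp
    ultimately have "(nrm M d)\<^sup>2 = cmod (ip M d (\<lambda>x. d x - ?g x))" by simp
    also have "\<dots> \<le> nrm M d * nrm M (\<lambda>x. d x - ?g x)" by (rule cmod_ip_le[OF dL L2_diff[OF dL g]])
    also have "\<dots> < nrm M d * e" using S(3) n e by (intro mult_strict_left_mono) auto
    finally show False using n e by (simp add: power2_eq_square)
  qed
  from this[of "nrm M d / 2"] have "\<not> nrm M d > 0" by auto
  then show ?thesis using nrm_nonneg[of M d] by linarith
qed

section \<open>Construction of the transform\<close>

context dunkl_setting
begin

text \<open>Coefficients with respect to powers of \<open>phi\<close>: the Laguerre argument (2/a)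
  |x|^a is 2 phi, hence the factor 2^j.\<close>

definition lag_coeff :: "nat \<Rightarrow> nat \<Rightarrow> nat \<Rightarrow> real" where
  "lag_coeff l m j = (-1) ^ j * ((real l + ka_lambda Rp k a m) gchoose (l - j)) * 2 ^ j / fact j"

lemma ka_Phi_expand:
  "ka_Phi Rp k a l m p x = (\<Sum>j\<le>l. of_real (lag_coeff l m j) * gauss (\<lambda>x. p x * of_real (phi x ^ j)) 1 x)"
proof -
  have "laguerre l (ka_lambda Rp k a m) (2 / a * norm x powr a) = (\<Sum>j\<le>l. lag_coeff l m j * phi x ^ j)"
    unfolding laguerre_def lag_coeff_def phi_def
    by (intro sum.cong refl) (simp add: power_mult_distrib power_divide mult_ac)
  then have "ka_Phi Rp k a l m p x = p x * of_real ((\<Sum>j\<le>l. lag_coeff l m j * phi x ^ j) * exp (- phi x))"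
    by (simp add: ka_Phi_def phi_def)
  also have "\<dots> = (\<Sum>j\<le>l. of_real (lag_coeff l m j) * gauss (\<lambda>x. p x * of_real (phi x ^ j)) 1 x)"
    unfolding sum_distrib_right of_real_sum sum_distrib_left
    by (intro sum.cong refl) (simp add: gauss_def)
  finally show ?thesis .
qed

lemma tempered_mult_phi_power: "tempered p \<Longrightarrow> tempered (\<lambda>x. p x * complex_of_real (phi x ^ j))"
  by (intro tempered_mult tempered_of_real tempered_power tempered_phi)

lemma ka_Phi_L2: "harmonic_poly Rp k m p \<Longrightarrow> ka_Phi Rp k a l m p \<in> L2_space M"
  unfolding ka_Phi_expand[abs_def]
  by (intro L2_comb gauss_L2 tempered_mult_phi_power harmonic_tempered) auto

definition Phi_index :: "(nat \<times> nat \<times> ('a \<Rightarrow> complex)) set" where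
  "Phi_index = {(l, m, p). harmonic_poly Rp k m p}"

definition Phi_fam :: "nat \<times> nat \<times> ('a \<Rightarrow> complex) \<Rightarrow> 'a \<Rightarrow> complex" where
  "Phi_fam s = (case s of (l, m, p) \<Rightarrow> ka_Phi Rp k a l m p)"

lemma Phi_fam_L2: "s \<in> Phi_index \<Longrightarrow> Phi_fam s \<in> L2_space M"
  by (auto simp: Phi_index_def Phi_fam_def ka_Phi_L2)

text \<open>The passage from powers of \<open>phi\<close> to Laguerre polynomials is triangular with
  nonzero diagonal, so it can be inverted degree by degree.\<close>

lemma gauss_power_in_Phi_span:
  assumes p: "harmonic_poly Rp k m p"
  shows "gauss (\<lambda>x. p x * of_real (phi x ^ j)) 1 \<in> clspan M Phi_index Phi_fam"
proof (induction j rule: less_induct)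
  case (less j)
  let ?E = "\<lambda>j. gauss (\<lambda>x. p x * of_real (phi x ^ j)) 1"
  have c: "lag_coeff j m j \<noteq> 0" by (simp add: lag_coeff_def)
  have "ka_Phi Rp k a j m p x = (\<Sum>i<j. of_real (lag_coeff j m i) * ?E i x) + of_real (lag_coeff j m j) * ?E j x" for x
    unfolding ka_Phi_expand by (simp add: lessThan_Suc_atMost[symmetric])
  then have eq: "?E j x = of_real (1 / lag_coeff j m j) * ka_Phi Rp k a j m p x
      + of_real (- 1 / lag_coeff j m j) * (\<Sum>i<j. of_real (lag_coeff j m i) * ?E i x)" for x
    using c by (simp add: field_simps)
  have "ka_Phi Rp k a j m p \<in> clspan M Phi_index Phi_fam"
    using clspan_base[of "(j, m, p)" Phi_index Phi_fam M] ka_Phi_L2[OF p] p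
    by (simp add: Phi_index_def Phi_fam_def)
  then have "(\<lambda>x. of_real (1 / lag_coeff j m j) * ka_Phi Rp k a j m p x
      + of_real (- 1 / lag_coeff j m j) * (\<Sum>i<j. of_real (lag_coeff j m i) * ?E i x)) \<in> clspan M Phi_index Phi_fam"
    by (intro clspan_lin_comb clspan_comb Phi_fam_L2 less.IH) auto
  moreover have "?E j = (\<lambda>x. of_real (1 / lag_coeff j m j) * ka_Phi Rp k a j m p x
      + of_real (- 1 / lag_coeff j m j) * (\<Sum>i<j. of_real (lag_coeff j m i) * ?E i x))"
    by (rule ext) (rule eq)
  ultimately show ?case by (simp only:)
qed

lemma Phi_dense: "clspan M Phi_index Phi_fam = L2_space M"
proof (rule clspan_eq_L2[OF Phi_fam_L2])
  fix m p i assume p: "harmonic_poly Rp k m p"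
  have "gauss (\<lambda>x. p x * of_real (phi x ^ j)) (1 + real i / 2) \<in> clspan M Phi_index Phi_fam" for j
  \<comment> \<open>Exponents grow in steps of 1/2, inside the radius of convergence because they
    are at least 1. All powers of \<open>phi\<close> are carried along, since the Taylor expansion
    of the next step consumes them.\<close>
  proof (induction i arbitrary: j)
    case 0
    show ?case using gauss_power_in_Phi_span[OF p] by simp
  next
    case (Suc i)
    have "gauss (\<lambda>x. p x * of_real (phi x ^ j)) ((1 + real i / 2) + 1 / 2) \<in> clspan M Phi_index Phi_fam"
      by (rule clspan_gauss_shift[OF Phi_fam_L2 harmonic_tempered[OF p] Suc]) auto
    then show ?case by (simp add: add_divide_distrib algebra_simps)
  qed
  from this[of 0] show "gauss p (1 + real i / 2) \<in> clspan M Phi_index Phi_fam" by simp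
qed

section \<open>Gaussians and their prescribed images\<close>

definition nm :: "nat \<Rightarrow> real" where "nm m = nu (2 * real m)"

lemma nm_ge: "nm m \<ge> nm 0"
  using nu_mono[of "2 * real m"] by (simp add: nm_def)

lemma nm_pos: "nm m > 0"
  using nu_pos[of "2 * real m"] by (simp add: nm_def)

definition phase :: "nat \<Rightarrow> complex" where "phase m = exp (- (\<i> * of_real (pi * (real m / a))))"

lemma phase_norm: "cmod (phase m) = 1"
  by (simp add: phase_def)

lemma phase_cnj: "phase m * cnj (phase m) = 1"
  using complex_norm_square[of "phase m"] by (simp add: phase_norm)

lemma ip_gauss:
  assumes "harmonic_poly Rp k m p" "harmonic_poly Rp k m q" "z + z' > 0"
  shows "ip M (gauss p z) (gauss q z') = of_real ((z + z') powr (- nm m)) * hip p q"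
  using ip_gauss_phi[OF assms, of 0] by (simp add: nm_def)

definition G_index :: "(nat \<times> ('a \<Rightarrow> complex) \<times> real) set" where
  "G_index = {(m, p, z). harmonic_poly Rp k m p \<and> z > 0}"

definition G_fam :: "nat \<times> ('a \<Rightarrow> complex) \<times> real \<Rightarrow> 'a \<Rightarrow> complex" where
  "G_fam s = (case s of (m, p, z) \<Rightarrow> gauss p z)"

text \<open>The images predicted by the Laguerre generating function: for z = (1 + w) / (1 - w) the
  Gaussian is (1 - w)^nu times the sum of w^l Phi_l. The eigenvalues turn w into -w, which gives the
  exponent 1 / z and the factor ((1 - w) / (1 + w))^nu = z^-nu.\<close>

definition FG_fam :: "nat \<times> ('a \<Rightarrow> complex) \<times> real \<Rightarrow> 'a \<Rightarrow> complex" where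
  "FG_fam s = (case s of (m, p, z) \<Rightarrow> (\<lambda>x. (phase m * of_real (z powr (- nm m))) * gauss p (1 / z) x))"

lemma G_fam_L2: "s \<in> G_index \<Longrightarrow> G_fam s \<in> L2_space M"
  by (auto simp: G_index_def G_fam_def intro!: gauss_L2 harmonic_tempered)

lemma FG_fam_L2: "s \<in> G_index \<Longrightarrow> FG_fam s \<in> L2_space M"
  by (auto simp: G_index_def FG_fam_def intro!: L2_scale gauss_L2 harmonic_tempered)

lemma G_isometric: "isometric_families M G_index G_fam FG_fam"
proof
  fix s t assume "s \<in> G_index" "t \<in> G_index"
  then obtain m p z n q y where s: "s = (m, p, z)" "harmonic_poly Rp k m p" "z > 0"
    and t: "t = (n, q, y)" "harmonic_poly Rp k n q" "y > 0" by (auto simp: G_index_def)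
  show "ip M (G_fam s) (G_fam t) = ip M (FG_fam s) (FG_fam t)"
  proof (cases "m = n")
    case False
    have "ip M (gauss p z) (gauss q y) = 0" "ip M (gauss p (1 / z)) (gauss q (1 / y)) = 0"
      using s t by (auto intro!: ip_gauss_ortho[OF _ _ False] add_pos_pos)
    then show ?thesis by (simp add: s t G_fam_def FG_fam_def ip_scale_left ip_scale_right)
  next
    case True
    \<comment> \<open>The Gram matrices agree because z y (1/z + 1/y) = z + y.\<close>
    have "z powr (- nm m) * y powr (- nm m) * (1 / z + 1 / y) powr (- nm m) = (z * y * (1 / z + 1 / y)) powr (- nm m)"
      using s(3) t(3) by (simp add: powr_mult)
    also have "z * y * (1 / z + 1 / y) = z + y" using s(3) t(3) by (simp add: field_simps)
    finally have e: "z powr (- nm m) * y powr (- nm m) * (1 / z + 1 / y) powr (- nm m) = (z + y) powr (- nm m)" .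
    have p1: "z + y > 0" "1 / z + 1 / y > 0" using s(3) t(3) by (auto intro: add_pos_pos)
    have tq: "harmonic_poly Rp k m q" using t(2) True by simp
    have "ip M (FG_fam s) (FG_fam t) = (phase m * cnj (phase m)) *
        of_real (z powr (- nm m) * y powr (- nm m) * (1 / z + 1 / y) powr (- nm m)) * hip p q"
      unfolding s t FG_fam_def prod.case ip_scale_left ip_scale_right True[symmetric] ip_gauss[OF s(2) tq p1(2)]
      by simp
    also have "\<dots> = ip M (G_fam s) (G_fam t)"
      unfolding e phase_cnj by (simp add: s t G_fam_def ip_gauss[OF s(2) tq p1(1)])
    finally show ?thesis ..
  qed
next
  show "clspan M G_index G_fam = L2_space M"
  proof (rule clspan_eq_L2[OF G_fam_L2])
    fix m p i assume p: "harmonic_poly Rp k m p"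
    have "(m, p, 1 + real i / 2) \<in> G_index" using p by (simp add: G_index_def add_pos_nonneg)
    from clspan_base[of _ G_index G_fam M, OF this G_fam_L2[OF this]]
    show "gauss p (1 + real i / 2) \<in> clspan M G_index G_fam" by (simp add: G_fam_def)
  qed
  show "clspan M G_index FG_fam = L2_space M"
  proof (rule clspan_eq_L2[OF FG_fam_L2])
    fix m p i assume p: "harmonic_poly Rp k m p"
    \<comment> \<open>The image of exponent z has exponent 1 / z, so the reciprocal is chosen to hit
      the Gaussians demanded by \<open>clspan_eq_L2\<close>.\<close>
    define z where "z = 1 / (1 + real i / 2)"
    have z: "z > 0" "1 / z = 1 + real i / 2" by (simp_all add: z_def add_pos_nonneg)
    define c where "c = phase m * of_real (z powr (- nm m))"
    have c: "c \<noteq> 0" using z phase_norm[of m] by (auto simp: c_def)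
    have i: "(m, p, z) \<in> G_index" using p z by (simp add: G_index_def)
    have "(\<lambda>x. (1 / c) * FG_fam (m, p, z) x) \<in> clspan M G_index FG_fam"
      by (rule clspan_scale[OF FG_fam_L2 clspan_base[of _ G_index FG_fam M, OF i FG_fam_L2[OF i]]])
    moreover have "(1 / c) * FG_fam (m, p, z) x = gauss p (1 + real i / 2) x" for x
      using c by (simp add: FG_fam_def z(2) c_def[symmetric])
    ultimately show "gauss p (1 + real i / 2) \<in> clspan M G_index FG_fam" by simp
  qed
qed (auto simp: G_fam_L2 FG_fam_L2)

text \<open>The binomial theorem sums the Laguerre terms, with 1 - 2 / (1 + z) = (z - 1) / (z + 1).
  This quotient changes sign under z -> 1 / z, which is the source of the eigenvalue factor
  (-1)^l.\<close>

lemma ip_Phi_gauss: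
  assumes p: "harmonic_poly Rp k m p" and q: "harmonic_poly Rp k m q" and z: "z > 0"
  shows "ip M (ka_Phi Rp k a l m p) (gauss q z) =
    of_real (pochhammer (nm m) l / fact l * (1 + z) powr (- nm m) * ((z - 1) / (z + 1)) ^ l) * hip p q"
proof -
  have pos: "1 + z > 0" using z by simp
  have qL: "gauss q z \<in> L2_space M" by (intro gauss_L2 harmonic_tempered[OF q] z)
  have EL: "gauss (\<lambda>x. p x * of_real (phi x ^ j)) 1 \<in> L2_space M" for j
    by (intro gauss_L2 tempered_mult_phi_power harmonic_tempered[OF p]) simp
  have coeff: "lag_coeff l m j * (pochhammer (nm m) j * (1 + z) powr (- (nm m + real j))) =
     pochhammer (nm m) l / fact l * (1 + z) powr (- nm m) * (real (l choose j) * (- 2 / (1 + z)) ^ j)" if j: "j \<le> l" for j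
  proof -
    have lam: "ka_lambda Rp k a m = nm m - 1" by (simp add: nm_def nu_eq)
    \<comment> \<open>For this upper argument the binomial coefficient is a rising factorial
      starting at nm m + j, so it completes \<open>pochhammer (nm m) j\<close> to
      \<open>pochhammer (nm m) l\<close>.\<close>
    have "(real l + ka_lambda Rp k a m) gchoose (l - j) = pochhammer (nm m + real j) (l - j) / fact (l - j)"
      unfolding gbinomial_pochhammer' lam using j by (simp add: of_nat_diff)
    then have "((real l + ka_lambda Rp k a m) gchoose (l - j)) * pochhammer (nm m) j = pochhammer (nm m) l / fact (l - j)"
      using pochhammer_product[OF j, of "nm m"] by simp
    moreover have "(1 + z) powr (- (nm m + real j)) = (1 + z) powr (- nm m) / (1 + z) ^ j"
      using pos by (simp add: powr_diff powr_realpow)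
    moreover have "real (l choose j) = fact l / (fact j * fact (l - j))"
      using binomial_fact[OF j, where 'a=real] .
    moreover have "(- 2 / (1 + z)) ^ j = (- 1) ^ j * 2 ^ j / (1 + z) ^ j"
    proof -
      have "(- 2 / (1 + z)) ^ j = ((- 1) * (2 / (1 + z))) ^ j" by simp
      also have "\<dots> = (- 1) ^ j * 2 ^ j / (1 + z) ^ j" unfolding power_mult_distrib power_divide by simp
      finally show ?thesis .
    qed
    moreover have "E * G * T / fj * (P * (W / Y)) = Q / fl * W * (fl / (fj * flj) * (E * T / Y))"
      if "G * P = Q / flj" "fl \<noteq> 0" for E G T fj P W Y Q fl flj :: real
    proof -
      have "E * G * T / fj * (P * (W / Y)) = (G * P) * (E * T / fj * (W / Y))" by simp
      then show ?thesis unfolding that(1) using that(2) by (simp add: mult_ac)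
    qed
    ultimately show ?thesis
      unfolding lag_coeff_def by (simp only: fact_nonzero not_False_eq_True)
  qed
  have "ip M (ka_Phi Rp k a l m p) (gauss q z) =
      (\<Sum>j\<le>l. of_real (lag_coeff l m j) * ip M (gauss (\<lambda>x. p x * of_real (phi x ^ j)) 1) (gauss q z))"
    unfolding ka_Phi_expand[abs_def] by (rule ip_sum_left[OF EL qL])
  also have "\<dots> = (\<Sum>j\<le>l. of_real (lag_coeff l m j * (pochhammer (nm m) j * (1 + z) powr (- (nm m + real j)))) * hip p q)"
    using ip_gauss_phi[OF p q pos] by (simp add: nm_def mult_ac)
  also have "\<dots> = (\<Sum>j\<le>l. of_real (pochhammer (nm m) l / fact l * (1 + z) powr (- nm m) * (real (l choose j) * (- 2 / (1 + z)) ^ j)) * hip p q)"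
    by (intro sum.cong refl) (use coeff in simp)
  also have "\<dots> = of_real (pochhammer (nm m) l / fact l * (1 + z) powr (- nm m) * (\<Sum>j\<le>l. real (l choose j) * (- 2 / (1 + z)) ^ j)) * hip p q"
    by (simp only: of_real_sum of_real_mult sum_distrib_left sum_distrib_right)
  also have "(\<Sum>j\<le>l. real (l choose j) * (- 2 / (1 + z)) ^ j) = ((z - 1) / (z + 1)) ^ l"
  proof -
    have "(\<Sum>j\<le>l. real (l choose j) * (- 2 / (1 + z)) ^ j) = (- 2 / (1 + z) + 1) ^ l"
      using binomial_ring[of "- 2 / (1 + z)" 1 l] by simp
    also have "- 2 / (1 + z) + 1 = (z - 1) / (z + 1)" using pos by (simp add: field_simps)
    finally show ?thesis .
  qed
  finally show ?thesis .
qed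

lemma ip_Phi_gauss_ortho:
  assumes p: "harmonic_poly Rp k m p" and q: "harmonic_poly Rp k n q" and mn: "m \<noteq> n" and z: "z > 0"
  shows "ip M (ka_Phi Rp k a l m p) (gauss q z) = 0"
proof -
  have qL: "gauss q y \<in> L2_space M" if "y > 0" for y by (intro gauss_L2 harmonic_tempered[OF q] that)
  have EL: "gauss (\<lambda>x. p x * of_real (phi x ^ j)) 1 \<in> L2_space M" for j
    by (intro gauss_L2 tempered_mult_phi_power harmonic_tempered[OF p]) simp
  have "ip M (gauss (\<lambda>x. p x * of_real (phi x ^ j)) 1) (gauss q z) = 0" for j
  proof -
    note H = harmonic_product[OF p q]
    have "ip M (gauss (\<lambda>x. p x * of_real (phi x ^ j)) 1) (gauss q z) =
      (\<integral>x. gauss (\<lambda>x. (p x * cnj (q x)) * of_real (phi x ^ j)) (1 + z) x \<partial>M)"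
      unfolding ip_def
      by (intro Bochner_Integration.integral_cong refl) (simp add: gauss_def distrib_right mult_ac flip: of_real_mult exp_add)
    also have "\<dots> = 0"
      using z harmonic_integral_zero[OF p q mn, of 1] by (subst gauss_moments[OF H]) auto
    finally show ?thesis .
  qed
  then show ?thesis unfolding ka_Phi_expand[abs_def] using EL qL[OF z] by (simp add: ip_sum_left)
qed

section \<open>Existence and uniqueness of the transform\<close>

definition eigval :: "nat \<Rightarrow> nat \<Rightarrow> complex" where
  "eigval l m = exp (- (\<i> * complex_of_real (pi * (real l + real m / a))))"

lemma eigval_eq: "eigval l m = (-1) ^ l * phase m"
proof -
  have "eigval l m = exp (- (\<i> * of_real (pi * real l))) * phase m"
    unfolding eigval_def phase_def exp_add[symmetric] by (simp add: algebra_simps)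
  also have "exp (- (\<i> * of_real (pi * real l))) = (exp (- (\<i> * of_real pi))) ^ l"
    unfolding exp_of_nat_mult[symmetric] by (simp add: algebra_simps)
  also have "exp (- (\<i> * of_real pi)) = -1" by (simp add: exp_minus)
  finally show ?thesis .
qed

text \<open>The defect U Phi - eigval Phi is tested against the total family \<open>FG_fam\<close>.
  Unitarity replaces <U Phi, U G> by <Phi, G>, so both terms become explicit inner products of Phi
  with Gaussians.\<close>

lemma ka_fourier_exists:
  "\<exists>U. is_ka_fourier Rp k a U \<and> (\<forall>s\<in>G_index. AE x in M. U (G_fam s) x = FG_fam s x)"
proof -
  interpret iso: isometric_families M G_index G_fam FG_fam by (rule G_isometric)
  obtain U where U: "unitary_on_L2 M U" and UG: "\<And>s. s \<in> G_index \<Longrightarrow> AE x in M. U (G_fam s) x = FG_fam s x"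
    using iso.unitary_extension by blast
  have "AE x in M. U (ka_Phi Rp k a l m p) x = eigval l m * ka_Phi Rp k a l m p x"
    if p: "harmonic_poly Rp k m p" for l m p
  proof -
    let ?P = "ka_Phi Rp k a l m p"
    have PL: "?P \<in> L2_space M" by (rule ka_Phi_L2[OF p])
    note UL = unitary_L2[OF U]
    have d: "(\<lambda>x. 1 * U ?P x + (- eigval l m) * ?P x) \<in> L2_space M"
      by (intro L2_add L2_scale UL PL)
    have "nrm M (\<lambda>x. 1 * U ?P x + (- eigval l m) * ?P x) = 0"
    proof (rule ip_zero_on_clspan[OF _ FG_fam_L2])
      show "(\<lambda>x. 1 * U ?P x + (- eigval l m) * ?P x) \<in> clspan M G_index FG_fam" using d iso.dense_v by simp
      fix s assume s: "s \<in> G_index"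
      then obtain n q z where s': "s = (n, q, z)" "harmonic_poly Rp k n q" "z > 0" by (auto simp: G_index_def)
      have "ip M (U ?P) (FG_fam s) = ip M (U ?P) (U (G_fam s))"
        unfolding ip_def
      proof (rule integral_cong_AE)
        show "AE x in M. U ?P x * cnj (FG_fam s x) = U ?P x * cnj (U (G_fam s) x)"
          using UG[OF s] by eventually_elim simp
      qed (use UL[OF PL] UL[OF G_fam_L2[OF s]] FG_fam_L2[OF s] ip_integrable in \<open>auto dest!: L2_space_measurable\<close>)
      also have "\<dots> = ip M ?P (G_fam s)" by (rule unitary_ip[OF U PL G_fam_L2[OF s]])
      finally have 1: "ip M (U ?P) (FG_fam s) = ip M ?P (gauss q z)" by (simp add: s' G_fam_def)
      have 2: "ip M ?P (FG_fam s) = cnj (phase n) * of_real (z powr (- nm n)) * ip M ?P (gauss q (1 / z))"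
        by (simp add: s' FG_fam_def ip_scale_right)
      have "ip M (\<lambda>x. 1 * U ?P x + (- eigval l m) * ?P x) (FG_fam s) =
          ip M (U ?P) (FG_fam s) - eigval l m * ip M ?P (FG_fam s)"
        using ip_add_left[OF L2_scale[OF UL[OF PL]] L2_scale[OF PL] FG_fam_L2[OF s], of 1 "- eigval l m"]
        by (simp only: ip_scale_left) simp
      also have "\<dots> = 0"
      proof (cases "m = n")
        case False
        then show ?thesis unfolding 1 2 using ip_Phi_gauss_ortho[OF p s'(2) False] s'(3) by simp
      next
        case True
        then have q: "harmonic_poly Rp k m q" using s'(2) by simp
        have iz: "1 / z > 0" using s'(3) by simp
        have e1: "z powr (- nm m) * (1 + 1 / z) powr (- nm m) = (1 + z) powr (- nm m)"
        proof -
          have "z * (1 + 1 / z) = 1 + z" using s'(3) by (simp add: field_simps)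
          then show ?thesis using powr_mult[of z "1 + 1 / z" "- nm m"] s'(3) by simp
        qed
        \<comment> \<open>The sign of the quotient under z -> 1 / z cancels the sign of the
          eigenvalue.\<close>
        have e2: "(-1) ^ l * ((1 / z - 1) / (1 / z + 1)) ^ l = ((z - 1) / (z + 1)) ^ l"
        proof -
          have "1 / z - 1 = - (z - 1) / z" "1 / z + 1 = (z + 1) / z" using s'(3) by (simp_all add: diff_divide_distrib add_divide_distrib)
          then have "(1 / z - 1) / (1 / z + 1) = (- (z - 1) / z) / ((z + 1) / z)" by (simp only:)
          also have "\<dots> = - (z - 1) / (z + 1)" using s'(3) by simp
          also have "\<dots> = - ((z - 1) / (z + 1))" by (rule minus_divide_left[symmetric])
          finally have "(1 / z - 1) / (1 / z + 1) = - ((z - 1) / (z + 1))" .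
          note eq = this
          show ?thesis unfolding eq power_mult_distrib[symmetric]
            by (simp only: mult_minus_left mult_minus_right minus_minus mult_1_left)
        qed
        have "eigval l m * (cnj (phase m) * of_real (z powr (- nm m)) * ip M ?P (gauss q (1 / z))) =
          (phase m * cnj (phase m)) * of_real (pochhammer (nm m) l / fact l * (z powr (- nm m) * (1 + 1 / z) powr (- nm m))
            * ((-1) ^ l * ((1 / z - 1) / (1 / z + 1)) ^ l)) * hip p q"
          unfolding ip_Phi_gauss[OF p q iz] eigval_eq by (simp add: mult_ac)
        also have "\<dots> = ip M ?P (gauss q z)"
          unfolding e1 e2 phase_cnj ip_Phi_gauss[OF p q s'(3)] by simp
        finally show ?thesis unfolding 1 2 using True by simp
      qed
      finally show "ip M (\<lambda>x. 1 * U ?P x + (- eigval l m) * ?P x) (FG_fam s) = 0" .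
    qed
    then have "AE x in M. 1 * U ?P x + (- eigval l m) * ?P x = 0" using nrm_eq_0_iff[OF d] by blast
    then show ?thesis by eventually_elim simp
  qed
  then have "is_ka_fourier Rp k a U" using U unfolding is_ka_fourier_def eigval_def by blast
  with UG show ?thesis by blast
qed

abbreviation "F \<equiv> ka_fourier Rp k a"

lemma F_is_ka_fourier: "is_ka_fourier Rp k a F"
  unfolding ka_fourier_def using ka_fourier_exists by (intro someI_ex[of "is_ka_fourier Rp k a"]) blast

lemma F_unitary: "unitary_on_L2 M F"
  using F_is_ka_fourier by (simp add: is_ka_fourier_def)

text \<open>\<open>F\<close> comes from the choice operator and need not be the operator constructed
  above, but both act alike on the functions Phi, whose span is dense.\<close>

lemma F_gauss:
  assumes "harmonic_poly Rp k m p" "z > 0"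
  shows "AE x in M. F (gauss p z) x = (phase m * of_real (z powr (- nm m))) * gauss p (1 / z) x"
proof -
  obtain U where U: "is_ka_fourier Rp k a U" and UG: "\<forall>s\<in>G_index. AE x in M. U (G_fam s) x = FG_fam s x"
    using ka_fourier_exists by blast
  have s: "(m, p, z) \<in> G_index" using assms by (simp add: G_index_def)
  have "AE x in M. F (gauss p z) x = U (gauss p z) x"
  proof (rule unitary_eq_on_clspan[OF F_unitary _ Phi_fam_L2])
    show "unitary_on_L2 M U" using U by (simp add: is_ka_fourier_def)
    show "gauss p z \<in> clspan M Phi_index Phi_fam"
      unfolding Phi_dense by (intro gauss_L2 harmonic_tempered[OF assms(1)] assms(2))
    fix s assume "s \<in> Phi_index"
    then obtain l m p where s: "s = (l, m, p)" "harmonic_poly Rp k m p" by (auto simp: Phi_index_def)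
    have "AE x in M. F (ka_Phi Rp k a l m p) x = exp (- (\<i> * complex_of_real (pi * (real l + real m / a)))) * ka_Phi Rp k a l m p x"
      "AE x in M. U (ka_Phi Rp k a l m p) x = exp (- (\<i> * complex_of_real (pi * (real l + real m / a)))) * ka_Phi Rp k a l m p x"
      using F_is_ka_fourier U s(2) unfolding is_ka_fourier_def by blast+
    then show "AE x in M. F (Phi_fam s) x = U (Phi_fam s) x"
      unfolding s Phi_fam_def prod.case by eventually_elim simp
  qed
  with bspec[OF UG s] show ?thesis unfolding G_fam_def FG_fam_def prod.case by eventually_elim simp
qed

end

section \<open>The uncertainty inequality\<close>

lemma pochhammer_binomial_sums:
  fixes c u :: real
  assumes "\<bar>u\<bar> < 1"
  shows "(\<lambda>l. pochhammer c l / fact l * u ^ l) sums (1 - u) powr (- c)"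
proof -
  have "(\<lambda>n. (- c gchoose n) * (- u) ^ n) sums (1 + - u) powr (- c)"
    by (rule gen_binomial_real) (use assms in simp)
  moreover have "(- c gchoose n) * (- u) ^ n = pochhammer c n / fact n * u ^ n" for n
  proof -
    have "(- c gchoose n) * (- u) ^ n = ((- 1) * (- u)) ^ n * (pochhammer c n / fact n)"
      unfolding gbinomial_pochhammer power_mult_distrib by simp
    then show ?thesis by simp
  qed
  ultimately show ?thesis by simp
qed

text \<open>Equals (1 + sqrt 2)^2, the reciprocal of the contraction ratio of the exponent map in
  Cayley coordinates.\<close>

definition gam :: real where "gam = 3 + 2 * sqrt 2"

lemma gam: "gam > 1" "1 / gam = 3 - 2 * sqrt 2"
proof -
  show "gam > 1" by (simp add: gam_def add_pos_nonneg)
  have "(3 - 2 * sqrt 2) * gam = 1" by (simp add: gam_def algebra_simps)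
  then show "1 / gam = 3 - 2 * sqrt 2" using \<open>gam > 1\<close> by (simp add: field_simps)
qed

text \<open>With \<open>w = (z\<^sub>0 - x) / (z\<^sub>0 + x)\<close>, where \<open>z\<^sub>0 = t \<surd>2\<close> is the fixed point of the fractional linear map by which
  \<open>e\<^bsup>-\<phi>/t\<^esup> F e\<^bsup>-t\<phi>\<^esup>\<close> acts on the exponents of Gaussians, that map becomes \<open>w \<mapsto> - w / gam\<close>.\<close>

lemma cayley_identities:
  fixes x y t :: real
  assumes "t > 0" "x > 0" "y > 0"
  defines "z0 \<equiv> t * sqrt 2"
  defines "w \<equiv> (\<lambda>x. (z0 - x) / (z0 + x))"
  shows "x + y = (x + z0) * (y + z0) / (2 * z0) * (1 - w x * w y)"
    and "(x + t) * (y + t) * (1 / (x + t) + 1 / t + (1 / (y + t) + 1 / t)) =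
      gam * ((x + z0) * (y + z0) / (2 * z0) * (1 - (1 / gam)\<^sup>2 * (w x * w y)))"
    and "\<bar>w x\<bar> < 1"
proof -
  have z0: "z0 > 0" using assms(1) by (simp add: z0_def)
  have "x + z0 > 0" "y + z0 > 0" using z0 assms(2,3) by simp_all
  then have nz: "x + z0 \<noteq> 0" "y + z0 \<noteq> 0" by simp_all
  have ww: "(x + z0) * (y + z0) * (w x * w y) = (z0 - x) * (z0 - y)"
    using nz by (simp add: w_def add.commute)
  have "(x + z0) * (y + z0) / (2 * z0) * (1 - w x * w y) = ((x + z0) * (y + z0) - (x + z0) * (y + z0) * (w x * w y)) / (2 * z0)"
    by (simp add: right_diff_distrib diff_divide_distrib)
  also have "\<dots> = x + y" unfolding ww using z0 by (simp add: field_simps)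
  finally show "x + y = (x + z0) * (y + z0) / (2 * z0) * (1 - w x * w y)" ..
  have zz: "z0 * z0 = 2 * (t * t)" by (simp add: z0_def)
  have "gam * ((x + z0) * (y + z0) / (2 * z0) * (1 - (1 / gam)\<^sup>2 * (w x * w y))) =
     (gam * ((x + z0) * (y + z0)) - gam * (1 / gam)\<^sup>2 * ((x + z0) * (y + z0) * (w x * w y))) / (2 * z0)"
    by (simp add: right_diff_distrib diff_divide_distrib)
  also have "gam * (1 / gam)\<^sup>2 = 1 / gam" using gam(1) by (simp add: power2_eq_square)
  also have "(gam * ((x + z0) * (y + z0)) - 1 / gam * ((x + z0) * (y + z0) * (w x * w y))) =
      4 * sqrt 2 * (x * y + z0 * z0) + 6 * z0 * (x + y)"
    unfolding ww gam(2) by (simp add: gam_def algebra_simps)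
  also have "\<dots> = (2 * z0) * (2 / t * (x * y + 2 * (t * t)) + 3 * (x + y))"
    unfolding zz using assms(1) by (simp add: z0_def field_simps)
  also have "\<dots> / (2 * z0) = 2 / t * (x * y + 2 * (t * t)) + 3 * (x + y)" using z0 by simp
  also have "\<dots> = (x + t) * (y + t) * (1 / (x + t) + 1 / t + (1 / (y + t) + 1 / t))"
  proof -
    have "X * Y * (u + r + (v + r)) = Y * (X * u) + X * (Y * v) + (2 * r) * (X * Y)" for X Y u v r :: real
      by (simp add: algebra_simps)
    from this[of "x + t" "y + t" "1 / (x + t)" "1 / t" "1 / (y + t)"]
    have "(x + t) * (y + t) * (1 / (x + t) + 1 / t + (1 / (y + t) + 1 / t)) =
      (y + t) * ((x + t) * (1 / (x + t))) + (x + t) * ((y + t) * (1 / (y + t))) + 2 / t * ((x + t) * (y + t))"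
      by simp
    also have "\<dots> = (y + t) + (x + t) + 2 / t * ((x + t) * (y + t))" using assms by simp
    also have "\<dots> = 2 / t * (x * y + 2 * (t * t)) + 3 * (x + y)" using assms(1) by (simp add: field_simps)
    finally show ?thesis ..
  qed
  finally show "(x + t) * (y + t) * (1 / (x + t) + 1 / t + (1 / (y + t) + 1 / t)) =
      gam * ((x + z0) * (y + z0) / (2 * z0) * (1 - (1 / gam)\<^sup>2 * (w x * w y)))" ..
  show "\<bar>w x\<bar> < 1" using z0 assms(2) by (simp add: w_def abs_less_iff divide_less_eq less_divide_eq)
qed

section \<open>Contraction of the damped transform\<close>

context dunkl_setting
begin

lemma nrm_gauss_comb_sq:
  assumes fin: "finite S" and p: "\<And>i. i \<in> S \<Longrightarrow> harmonic_poly Rp k m (p i)" and y: "\<And>i. i \<in> S \<Longrightarrow> y i > 0"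
  shows "complex_of_real ((nrm M (\<lambda>x. \<Sum>i\<in>S. d i * gauss (p i) (y i) x))\<^sup>2) =
    (\<Sum>i\<in>S. \<Sum>j\<in>S. d i * cnj (d j) * (of_real ((y i + y j) powr (- nm m)) * hip (p i) (p j)))"
proof -
  have "complex_of_real ((nrm M (\<lambda>x. \<Sum>i\<in>S. d i * gauss (p i) (y i) x))\<^sup>2) =
    (\<Sum>i\<in>S. \<Sum>j\<in>S. d i * cnj (d j) * ip M (gauss (p i) (y i)) (gauss (p j) (y j)))"
    by (rule nrm_comb_sq) (intro gauss_L2 harmonic_tempered[OF p] y)
  also have "\<dots> = (\<Sum>i\<in>S. \<Sum>j\<in>S. d i * cnj (d j) * (of_real ((y i + y j) powr (- nm m)) * hip (p i) (p j)))"
    by (intro sum.cong refl arg_cong2[where f="(*)"] ip_gauss p add_pos_pos y)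
  finally show ?thesis .
qed

text \<open>Both squared norms are expanded in powers of the Cayley variables; the coefficients are squared
  norms again, and the operator multiplies the \<open>l\<close>-th one by \<open>gam\<^bsup>-nm m - 2l\<^esup>\<close>.\<close>

lemma gauss_contraction_fixed_degree:
  assumes fin: "finite S" and p: "\<And>i. i \<in> S \<Longrightarrow> harmonic_poly Rp k m (p i)" and z: "\<And>i. i \<in> S \<Longrightarrow> z i > 0"
    and t: "t > 0"
  shows "(nrm M (\<lambda>x. \<Sum>i\<in>S. (c i * of_real ((z i + t) powr (- nm m))) * gauss (p i) (1 / (z i + t) + 1 / t) x))\<^sup>2
    \<le> gam powr (- nm m) * (nrm M (\<lambda>x. \<Sum>i\<in>S. c i * gauss (p i) (z i) x))\<^sup>2"
proof -
  define \<nu> where "\<nu> = nm m"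
  have \<nu>: "\<nu> > 0" by (simp add: \<nu>_def nm_pos)
  define z0 where "z0 = t * sqrt 2"
  have z0: "z0 > 0" using t by (simp add: z0_def)
  define w where "w x = (z0 - x) / (z0 + x)" for x
  define b where "b l = pochhammer \<nu> l / fact l" for l
  have b0: "b l \<ge> 0" for l
    using \<nu> by (simp add: b_def pochhammer_nonneg)
  \<comment> \<open>Splits the prefactor in \<open>cayley_identities\<close> into a part for i and a
    part for j: \<open>A i * A j\<close> is its power with exponent -nu, and each part takes half of
    the factor 2 z0.\<close>
  define A where "A i = ((z i + z0) powr (- \<nu>)) * (2 * z0) powr (\<nu> / 2)" for i
  \<comment> \<open>The exponent 1/2 makes the sum of two exponents 1, so that the Gram matrix of
    these Gaussians is \<open>hip\<close> alone; hence each power of the Cayley variables carries a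
    squared norm.\<close>
  define X where "X l = (nrm M (\<lambda>x. \<Sum>i\<in>S. (c i * of_real (A i * w (z i) ^ l)) * gauss (p i) (1 / 2) x))\<^sup>2" for l
  have Xc: "complex_of_real (X l) = (\<Sum>i\<in>S. \<Sum>j\<in>S. c i * cnj (c j) * hip (p i) (p j) *
      of_real (A i * A j * (w (z i) * w (z j)) ^ l))" for l
    unfolding X_def by (subst nrm_gauss_comb_sq[OF fin p]) (auto intro!: sum.cong simp: power_mult_distrib mult_ac)
  have AA: "A i * A j = ((z i + z0) * (z j + z0) / (2 * z0)) powr (- \<nu>)" if "i \<in> S" "j \<in> S" for i j
  proof -
    have pos: "z i + z0 > 0" "z j + z0 > 0" using z[OF that(1)] z[OF that(2)] z0 by auto
    have "A i * A j = (z i + z0) powr (- \<nu>) * (z j + z0) powr (- \<nu>) * ((2 * z0) powr (\<nu> / 2) * (2 * z0) powr (\<nu> / 2))"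
      by (simp add: A_def)
    also have "(2 * z0) powr (\<nu> / 2) * (2 * z0) powr (\<nu> / 2) = (2 * z0) powr \<nu>"
      by (simp flip: powr_add)
    also have "\<dots> = (1 / (2 * z0)) powr (- \<nu>)" using z0 by (simp add: powr_divide powr_minus field_simps)
    finally show ?thesis using pos z0 by (simp add: powr_mult[symmetric])
  qed
  have wlt: "\<bar>w (z i) * w (z j)\<bar> < 1" if "i \<in> S" "j \<in> S" for i j
  proof -
    have "\<bar>w (z i)\<bar> < 1" "\<bar>w (z j)\<bar> < 1"
      using cayley_identities(3)[OF t z z] that by (auto simp: w_def z0_def)
    then have "\<bar>w (z i)\<bar> * \<bar>w (z j)\<bar> < 1 * 1" by (intro mult_strict_mono) auto
    then show ?thesis by (simp add: abs_mult)
  qed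
  \<comment> \<open>Both squared norms are instances of this expansion: C = 1 and q = 1 before, C =
    gam^-nu and q = gam^-2 after applying the operator.\<close>
  have series: "(\<lambda>l. complex_of_real (C * (b l * q ^ l * X l))) sums of_real B"
    if q: "0 \<le> q" "q \<le> 1" and
      B: "complex_of_real B = (\<Sum>i\<in>S. \<Sum>j\<in>S. c i * cnj (c j) * hip (p i) (p j) *
         of_real (C * (A i * A j * (1 - q * (w (z i) * w (z j))) powr (- \<nu>))))" for q C B
  proof -
    have "(\<lambda>l. \<Sum>i\<in>S. \<Sum>j\<in>S. c i * cnj (c j) * hip (p i) (p j) *
        of_real (C * (A i * A j * (b l * (q * (w (z i) * w (z j))) ^ l)))) sums of_real B"
      unfolding B
    proof (intro sums_sum sums_mult)
      fix i j assume ij: "i \<in> S" "j \<in> S"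
      have "\<bar>q * (w (z i) * w (z j))\<bar> \<le> 1 * \<bar>w (z i) * w (z j)\<bar>"
        unfolding abs_mult[of q] using q by (intro mult_right_mono) auto
      then have "\<bar>q * (w (z i) * w (z j))\<bar> < 1" using wlt[OF ij] by simp
      then have "(\<lambda>l. b l * (q * (w (z i) * w (z j))) ^ l) sums (1 - q * (w (z i) * w (z j))) powr (- \<nu>)"
        unfolding b_def by (rule pochhammer_binomial_sums)
      then have "(\<lambda>l. C * (A i * A j * (b l * (q * (w (z i) * w (z j))) ^ l))) sums
          (C * (A i * A j * (1 - q * (w (z i) * w (z j))) powr (- \<nu>)))" by (intro sums_mult)
      then show "(\<lambda>l. complex_of_real (C * (A i * A j * (b l * (q * (w (z i) * w (z j))) ^ l)))) sums
          of_real (C * (A i * A j * (1 - q * (w (z i) * w (z j))) powr (- \<nu>)))" by (rule sums_of_real)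
    qed
    moreover have "(\<Sum>i\<in>S. \<Sum>j\<in>S. c i * cnj (c j) * hip (p i) (p j) *
        of_real (C * (A i * A j * (b l * (q * (w (z i) * w (z j))) ^ l)))) = complex_of_real (C * (b l * q ^ l * X l))" for l
      unfolding of_real_mult[of C] of_real_mult[of "b l * q ^ l"] Xc sum_distrib_left
      by (intro sum.cong refl) (simp add: power_mult_distrib mult_ac)
    ultimately show ?thesis by simp
  qed
  have sN: "(\<lambda>l. 1 * (b l * 1 ^ l * X l)) sums (nrm M (\<lambda>x. \<Sum>i\<in>S. c i * gauss (p i) (z i) x))\<^sup>2"
  proof -
    have "(\<lambda>l. complex_of_real (1 * (b l * 1 ^ l * X l))) sums of_real ((nrm M (\<lambda>x. \<Sum>i\<in>S. c i * gauss (p i) (z i) x))\<^sup>2)"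
    proof (rule series)
      have e: "1 * (A i * A j * (1 - 1 * (w (z i) * w (z j))) powr (- \<nu>)) = (z i + z j) powr (- \<nu>)"
        if ij: "i \<in> S" "j \<in> S" for i j
      proof -
        have "z i + z j = (z i + z0) * (z j + z0) / (2 * z0) * (1 - w (z i) * w (z j))"
          using cayley_identities(1)[OF t z[OF ij(1)] z[OF ij(2)]] by (simp only: w_def z0_def)
        moreover have "1 - w (z i) * w (z j) > 0" using wlt[OF ij] by linarith
        moreover have "(z i + z0) * (z j + z0) / (2 * z0) > 0"
          using z[OF ij(1)] z[OF ij(2)] z0 by (intro divide_pos_pos mult_pos_pos) auto
        ultimately show ?thesis unfolding AA[OF ij] by (simp only: mult_1 powr_mult less_imp_le)
      qed
      have E: "complex_of_real ((nrm M (\<lambda>x. \<Sum>i\<in>S. c i * gauss (p i) (z i) x))\<^sup>2) =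
        (\<Sum>i\<in>S. \<Sum>j\<in>S. c i * cnj (c j) * (of_real ((z i + z j) powr (- nm m)) * hip (p i) (p j)))"
        by (rule nrm_gauss_comb_sq[OF fin]) (use p z in auto)
      show "complex_of_real ((nrm M (\<lambda>x. \<Sum>i\<in>S. c i * gauss (p i) (z i) x))\<^sup>2) =
        (\<Sum>i\<in>S. \<Sum>j\<in>S. c i * cnj (c j) * hip (p i) (p j) *
         of_real (1 * (A i * A j * (1 - 1 * (w (z i) * w (z j))) powr (- \<nu>))))"
        unfolding E \<nu>_def[symmetric] by (intro sum.cong refl) (simp add: e[symmetric] mult_ac)
    qed auto
    then show ?thesis unfolding sums_of_real_iff .
  qed
  have sT: "(\<lambda>l. gam powr (- \<nu>) * (b l * ((1 / gam)\<^sup>2) ^ l * X l)) sums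
    (nrm M (\<lambda>x. \<Sum>i\<in>S. (c i * of_real ((z i + t) powr (- nm m))) * gauss (p i) (1 / (z i + t) + 1 / t) x))\<^sup>2"
    (is "_ sums ?R")
  proof -
    have "(\<lambda>l. complex_of_real (gam powr (- \<nu>) * (b l * ((1 / gam)\<^sup>2) ^ l * X l))) sums of_real ?R"
    proof (rule series)
      show g1: "(1 / gam)\<^sup>2 \<le> 1" using gam(1) by (simp add: power_le_one)
      have y: "1 / (z i + t) + 1 / t > 0" if "i \<in> S" for i using z[OF that] t by (intro add_pos_pos) auto
      have e: "(z i + t) powr (- \<nu>) * (z j + t) powr (- \<nu>) * (1 / (z i + t) + 1 / t + (1 / (z j + t) + 1 / t)) powr (- \<nu>)
          = gam powr (- \<nu>) * (A i * A j * (1 - (1 / gam)\<^sup>2 * (w (z i) * w (z j))) powr (- \<nu>))"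
        if ij: "i \<in> S" "j \<in> S" for i j
      proof -
        have "\<bar>(1 / gam)\<^sup>2 * (w (z i) * w (z j))\<bar> \<le> 1 * \<bar>w (z i) * w (z j)\<bar>"
          unfolding abs_mult[of "(1 / gam)\<^sup>2"] using g1 by (intro mult_right_mono) auto
        then have pos: "1 - (1 / gam)\<^sup>2 * (w (z i) * w (z j)) > 0" using wlt[OF ij] by linarith
        have pos2: "z i + t > 0" "z j + t > 0" "z i + z0 > 0" "z j + z0 > 0"
          using z[OF ij(1)] z[OF ij(2)] t z0 by auto
        have "(z i + t) powr (- \<nu>) * (z j + t) powr (- \<nu>) * (1 / (z i + t) + 1 / t + (1 / (z j + t) + 1 / t)) powr (- \<nu>)
          = ((z i + t) * (z j + t) * (1 / (z i + t) + 1 / t + (1 / (z j + t) + 1 / t))) powr (- \<nu>)"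
          using pos2 y[OF ij(1)] y[OF ij(2)] by (simp add: powr_mult)
        also have "(z i + t) * (z j + t) * (1 / (z i + t) + 1 / t + (1 / (z j + t) + 1 / t)) =
          gam * ((z i + z0) * (z j + z0) / (2 * z0) * (1 - (1 / gam)\<^sup>2 * (w (z i) * w (z j))))"
          using cayley_identities(2)[OF t z[OF ij(1)] z[OF ij(2)]] by (simp only: w_def z0_def)
        also have "\<dots> powr (- \<nu>) = gam powr (- \<nu>) * (((z i + z0) * (z j + z0) / (2 * z0)) powr (- \<nu>)
            * (1 - (1 / gam)\<^sup>2 * (w (z i) * w (z j))) powr (- \<nu>))"
          by (simp only: powr_mult)
        finally show ?thesis unfolding AA[OF ij] .
      qed
      have E: "complex_of_real ?R = (\<Sum>i\<in>S. \<Sum>j\<in>S. (c i * of_real ((z i + t) powr (- nm m))) *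
          cnj (c j * of_real ((z j + t) powr (- nm m))) *
          (of_real ((1 / (z i + t) + 1 / t + (1 / (z j + t) + 1 / t)) powr (- nm m)) * hip (p i) (p j)))"
        by (rule nrm_gauss_comb_sq[OF fin]) (use p y in auto)
      show "complex_of_real ?R = (\<Sum>i\<in>S. \<Sum>j\<in>S. c i * cnj (c j) * hip (p i) (p j) *
         of_real (gam powr (- \<nu>) * (A i * A j * (1 - (1 / gam)\<^sup>2 * (w (z i) * w (z j))) powr (- \<nu>))))"
        unfolding E unfolding \<nu>_def[symmetric]
        by (intro sum.cong refl) (simp only: e[symmetric],
          simp only: of_real_mult complex_cnj_mult complex_cnj_complex_of_real mult_ac)
    qed auto
    then show ?thesis unfolding sums_of_real_iff .
  qed
  have "?R \<le> gam powr (- \<nu>) * (nrm M (\<lambda>x. \<Sum>i\<in>S. c i * gauss (p i) (z i) x))\<^sup>2"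
  \<comment> \<open>Termwise comparison, possible because \<open>b l\<close> and \<open>X l\<close>
    are nonnegative. The powers of gam^-2 are just bounded by 1; the gain is the prefactor
    gam^-nu.\<close>
  proof (rule sums_le[OF _ sT sums_mult[OF sN]])
    fix l
    have "((1 / gam)\<^sup>2) ^ l \<le> 1" using gam(1) by (intro power_le_one) (auto simp: power_le_one)
    then have "b l * ((1 / gam)\<^sup>2) ^ l * X l \<le> b l * 1 * X l"
      using b0[of l] by (intro mult_right_mono mult_left_mono) (auto simp: X_def)
    then show "gam powr (- \<nu>) * (b l * ((1 / gam)\<^sup>2) ^ l * X l) \<le> gam powr (- \<nu>) * (1 * (b l * 1 ^ l * X l))"
      by (intro mult_left_mono) auto
  qed
  then show ?thesis by (simp add: \<nu>_def)
qed

text \<open>Pythagoras: harmonics of different degrees are orthogonal for every pair of Gaussian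
  exponents.\<close>

lemma nrm_sq_split_degree:
  assumes fin: "finite S" and p: "\<And>i. i \<in> S \<Longrightarrow> harmonic_poly Rp k (m i) (p i)" and y: "\<And>i. i \<in> S \<Longrightarrow> y i > 0"
  shows "(nrm M (\<lambda>x. \<Sum>i\<in>S. d i * gauss (p i) (y i) x))\<^sup>2 =
    (\<Sum>n\<in>m ` S. (nrm M (\<lambda>x. \<Sum>i\<in>{i\<in>S. m i = n}. d i * gauss (p i) (y i) x))\<^sup>2)"
proof -
  let ?A = "\<lambda>i j. d i * cnj (d j) * ip M (gauss (p i) (y i)) (gauss (p j) (y j))"
  have L: "gauss (p i) (y i) \<in> L2_space M" if "i \<in> S" for i
    by (intro gauss_L2 harmonic_tempered[OF p] y that)
  have z: "?A i j = 0" if "i \<in> S" "j \<in> S" "m i \<noteq> m j" for i j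
    using ip_gauss_ortho[OF p[OF that(1)] p[OF that(2)] that(3) add_pos_pos[OF y[OF that(1)] y[OF that(2)]]] by simp
  have "complex_of_real ((nrm M (\<lambda>x. \<Sum>i\<in>S. d i * gauss (p i) (y i) x))\<^sup>2) = (\<Sum>i\<in>S. \<Sum>j\<in>S. ?A i j)"
    by (rule nrm_comb_sq) (rule L)
  also have "\<dots> = (\<Sum>n\<in>m ` S. \<Sum>i\<in>{i\<in>S. m i = n}. \<Sum>j\<in>S. ?A i j)"
    by (rule sum.image_gen[OF fin])
  also have "\<dots> = (\<Sum>n\<in>m ` S. \<Sum>i\<in>{i\<in>S. m i = n}. \<Sum>j\<in>{i\<in>S. m i = n}. ?A i j)"
    by (intro sum.cong refl sum.mono_neutral_right fin ballI z) auto
  also have "\<dots> = (\<Sum>n\<in>m ` S. complex_of_real ((nrm M (\<lambda>x. \<Sum>i\<in>{i\<in>S. m i = n}. d i * gauss (p i) (y i) x))\<^sup>2))"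
    by (intro sum.cong refl nrm_comb_sq[symmetric]) (auto intro: L)
  finally have "complex_of_real ((nrm M (\<lambda>x. \<Sum>i\<in>S. d i * gauss (p i) (y i) x))\<^sup>2) =
    of_real (\<Sum>n\<in>m ` S. (nrm M (\<lambda>x. \<Sum>i\<in>{i\<in>S. m i = n}. d i * gauss (p i) (y i) x))\<^sup>2)" by simp
  then show ?thesis unfolding of_real_eq_iff .
qed

definition damp :: "real \<Rightarrow> ('a \<Rightarrow> complex) \<Rightarrow> 'a \<Rightarrow> complex" where
  "damp s f x = of_real (exp (- (s * phi x))) * f x"

lemma damp_L2: "s \<ge> 0 \<Longrightarrow> f \<in> L2_space M \<Longrightarrow> damp s f \<in> L2_space M"
proof (rule L2_space_bound[of _ _ f])
  assume s: "s \<ge> 0" and f: "f \<in> L2_space M"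
  have [measurable]: "f \<in> borel_measurable borel" using f by (simp add: L2_space_iff)
  have "gauss f s \<in> borel_measurable borel" by (rule measurable_gauss) simp
  moreover have "damp s f = gauss f s" by (auto simp: damp_def gauss_def mult.commute)
  ultimately show "damp s f \<in> borel_measurable M" by simp
  show "AE x in M. cmod (damp s f x) \<le> cmod (f x)"
  proof (intro AE_I2)
    fix x
    have "exp (- (s * phi x)) \<le> 1" using s by simp
    then have "exp (- (s * phi x)) * cmod (f x) \<le> 1 * cmod (f x)" by (intro mult_right_mono) auto
    then show "cmod (damp s f x) \<le> cmod (f x)" by (simp add: damp_def norm_mult)
  qed
qed

lemma damp_nrm: "s \<ge> 0 \<Longrightarrow> f \<in> L2_space M \<Longrightarrow> nrm M (damp s f) \<le> nrm M f"
proof (rule nrm_mono_AE[OF damp_L2])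
  assume s: "s \<ge> 0"
  show "AE x in M. cmod (damp s f x) \<le> cmod (f x)"
  proof (intro AE_I2)
    fix x
    have "exp (- (s * phi x)) \<le> 1" using s by simp
    then have "exp (- (s * phi x)) * cmod (f x) \<le> 1 * cmod (f x)" by (intro mult_right_mono) auto
    then show "cmod (damp s f x) \<le> cmod (f x)" by (simp add: damp_def norm_mult)
  qed
qed

lemma damp_diff: "damp s (\<lambda>x. f x - g x) = (\<lambda>x. damp s f x - damp s g x)"
  by (auto simp: damp_def right_diff_distrib)

lemma damp_gauss: "damp s (gauss p z) = gauss p (z + s)"
  by (auto simp: damp_def gauss_def distrib_right mult_ac simp flip: of_real_mult exp_add)

text \<open>The squared norm shrinks by gam^(-nm n) in degree n. The worst case is n = 0 since
  \<open>nm\<close> is increasing, and the half in the exponent comes from the square root.\<close>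

definition rho :: real where "rho = gam powr (- nm 0 / 2)"

lemma rho: "0 < rho" "rho < 1"
  using gam(1) nm_pos[of 0] powr_less_cancel_iff[of gam "- nm 0 / 2" 0] by (auto simp: rho_def)

text \<open>On Gaussians the operator is explicit. Its phases depend only on the degree, so after
  splitting by degree they are unimodular factors and drop out of the norm.\<close>

lemma damped_F_gauss_comb:
  assumes fin: "finite S" and S: "S \<subseteq> G_index" and t: "t > 0"
  shows "nrm M (damp (1 / t) (F (damp t (\<lambda>x. \<Sum>s\<in>S. c s * G_fam s x)))) \<le> rho * nrm M (\<lambda>x. \<Sum>s\<in>S. c s * G_fam s x)"
proof -
  define m where "m s = fst s" for s :: "nat \<times> ('a \<Rightarrow> complex) \<times> real"
  define p where "p s = fst (snd s)" for s :: "nat \<times> ('a \<Rightarrow> complex) \<times> real"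
  define z where "z s = snd (snd s)" for s :: "nat \<times> ('a \<Rightarrow> complex) \<times> real"
  have p: "harmonic_poly Rp k (m s) (p s)" and z: "z s > 0" if "s \<in> S" for s
    using that S by (auto simp: G_index_def m_def p_def z_def)
  have G: "G_fam s = gauss (p s) (z s)" for s by (simp add: G_fam_def p_def z_def split: prod.split)
  have zt: "z s + t > 0" "1 / (z s + t) > 0" "1 / (z s + t) + 1 / t > 0" if "s \<in> S" for s
    using z[OF that] t by (auto intro!: add_pos_pos)
  have L: "gauss (p s) y \<in> L2_space M" if "s \<in> S" "y > 0" for s y
    by (intro gauss_L2 harmonic_tempered[OF p] that)
  let ?f = "\<lambda>x. \<Sum>s\<in>S. c s * gauss (p s) (z s) x"
  define d where "d s = c s * (phase (m s) * of_real ((z s + t) powr (- nm (m s))))" for s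
  have dt: "damp t ?f = (\<lambda>x. \<Sum>s\<in>S. c s * gauss (p s) (z s + t) x)"
    unfolding damp_gauss[symmetric] by (auto simp: damp_def sum_distrib_left mult_ac)
  have fL: "damp t ?f \<in> L2_space M" unfolding dt by (intro L2_comb L zt)
  have "AE x in M. F (damp t ?f) x = (\<Sum>s\<in>S. c s * F (gauss (p s) (z s + t)) x)"
    unfolding dt by (rule unitary_comb[OF F_unitary _ fin]) (intro L zt)
  moreover have "AE x in M. \<forall>s\<in>S. F (gauss (p s) (z s + t)) x =
      (phase (m s) * of_real ((z s + t) powr (- nm (m s)))) * gauss (p s) (1 / (z s + t)) x"
    by (intro AE_finite_allI fin F_gauss p zt)
  ultimately have "AE x in M. damp (1 / t) (F (damp t ?f)) x = (\<Sum>s\<in>S. d s * gauss (p s) (1 / (z s + t) + 1 / t) x)"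
  proof eventually_elim
    case (elim x)
    have "F (damp t ?f) x = (\<Sum>s\<in>S. d s * gauss (p s) (1 / (z s + t)) x)"
      unfolding elim(1) d_def by (intro sum.cong refl) (use elim(2) in \<open>simp add: mult_ac\<close>)
    then show ?case
      unfolding damp_gauss[symmetric] by (simp add: damp_def sum_distrib_left mult_ac)
  qed
  then have "nrm M (damp (1 / t) (F (damp t ?f))) = nrm M (\<lambda>x. \<Sum>s\<in>S. d s * gauss (p s) (1 / (z s + t) + 1 / t) x)"
  proof (rule nrm_cong_AE)
    show "damp (1 / t) (F (damp t ?f)) \<in> borel_measurable M"
      using t by (intro L2_space_measurable damp_L2 unitary_L2[OF F_unitary] fL) auto
    show "(\<lambda>x. \<Sum>s\<in>S. d s * gauss (p s) (1 / (z s + t) + 1 / t) x) \<in> borel_measurable M"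
      by (intro L2_space_measurable L2_comb L zt)
  qed
  then have "(nrm M (damp (1 / t) (F (damp t ?f))))\<^sup>2 =
      (\<Sum>n\<in>m ` S. (nrm M (\<lambda>x. \<Sum>s\<in>{s\<in>S. m s = n}. d s * gauss (p s) (1 / (z s + t) + 1 / t) x))\<^sup>2)"
    using nrm_sq_split_degree[OF fin p zt(3), where d=d] by simp
  also have "\<dots> \<le> (\<Sum>n\<in>m ` S. rho\<^sup>2 * (nrm M (\<lambda>x. \<Sum>s\<in>{s\<in>S. m s = n}. c s * gauss (p s) (z s) x))\<^sup>2)"
  proof (rule sum_mono)
    fix n
    let ?S = "{s\<in>S. m s = n}"
    let ?g = "\<lambda>x. \<Sum>s\<in>?S. (c s * of_real ((z s + t) powr (- nm n))) * gauss (p s) (1 / (z s + t) + 1 / t) x"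
    have "(\<lambda>x. \<Sum>s\<in>?S. d s * gauss (p s) (1 / (z s + t) + 1 / t) x) = (\<lambda>x. phase n * ?g x)"
      unfolding d_def sum_distrib_left by (intro ext sum.cong refl) auto
    then have "(nrm M (\<lambda>x. \<Sum>s\<in>?S. d s * gauss (p s) (1 / (z s + t) + 1 / t) x))\<^sup>2 = (nrm M ?g)\<^sup>2"
      by (simp only: nrm_scale phase_norm mult_1)
    also have "\<dots> \<le> gam powr (- nm n) * (nrm M (\<lambda>x. \<Sum>s\<in>?S. c s * gauss (p s) (z s) x))\<^sup>2"
      by (rule gauss_contraction_fixed_degree[OF _ _ _ t]) (use fin p z in auto)
    also have "\<dots> \<le> rho\<^sup>2 * (nrm M (\<lambda>x. \<Sum>s\<in>?S. c s * gauss (p s) (z s) x))\<^sup>2"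
    proof (rule mult_right_mono)
      have "rho\<^sup>2 = gam powr (- nm 0)" by (simp add: rho_def power2_eq_square flip: powr_add)
      then show "gam powr (- nm n) \<le> rho\<^sup>2" using gam(1) nm_ge[of n] by (simp add: powr_mono)
    qed simp
    finally show "(nrm M (\<lambda>x. \<Sum>s\<in>?S. d s * gauss (p s) (1 / (z s + t) + 1 / t) x))\<^sup>2 \<le>
      rho\<^sup>2 * (nrm M (\<lambda>x. \<Sum>s\<in>?S. c s * gauss (p s) (z s) x))\<^sup>2" .
  qed
  also have "\<dots> = (rho * nrm M ?f)\<^sup>2"
  proof -
    have "(nrm M ?f)\<^sup>2 = (\<Sum>n\<in>m ` S. (nrm M (\<lambda>x. \<Sum>s\<in>{s\<in>S. m s = n}. c s * gauss (p s) (z s) x))\<^sup>2)"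
      by (rule nrm_sq_split_degree[OF fin p z])
    then show ?thesis by (simp only: power_mult_distrib sum_distrib_left)
  qed
  finally have "nrm M (damp (1 / t) (F (damp t ?f))) \<le> rho * nrm M ?f"
    by (rule power2_le_imp_le) (use rho in simp)
  then show ?thesis unfolding G .
qed

text \<open>Damping does not increase norms and \<open>F\<close> preserves them, so the operator is
  continuous and the bound passes from finite combinations of Gaussians to their closure.\<close>

lemma damped_F_contraction:
  assumes f: "f \<in> L2_space M" and t: "t > 0"
  shows "nrm M (damp (1 / t) (F (damp t f))) \<le> rho * nrm M f"
proof -
  interpret iso: isometric_families M G_index G_fam FG_fam by (rule G_isometric)
  have "nrm M (damp (1 / t) (F (damp t f))) \<le> rho * nrm M f + e" if e: "e > 0" for e
  proof -
    have fc: "f \<in> clspan M G_index G_fam" using f iso.dense_u by simp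
    from clspan_approx[OF fc half_gt_zero[OF e]] obtain S c where S: "finite S" "S \<subseteq> G_index"
      "nrm M (\<lambda>x. f x - (\<Sum>s\<in>S. c s * G_fam s x)) < e / 2" .
    let ?g = "\<lambda>x. \<Sum>s\<in>S. c s * G_fam s x"
    have g: "?g \<in> L2_space M" using S G_fam_L2 by (intro L2_comb) auto
    have D: "damp t h \<in> L2_space M" "F (damp t h) \<in> L2_space M" "damp (1 / t) (F (damp t h)) \<in> L2_space M"
      if "h \<in> L2_space M" for h
      using that t by (auto intro!: damp_L2 unitary_L2[OF F_unitary])
    have "nrm M (\<lambda>x. damp (1 / t) (F (damp t f)) x - damp (1 / t) (F (damp t ?g)) x) \<le>
        nrm M (\<lambda>x. F (damp t f) x - F (damp t ?g) x)"
      unfolding damp_diff[symmetric] using t by (intro damp_nrm L2_diff D f g) auto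
    also have "\<dots> = nrm M (damp t (\<lambda>x. f x - ?g x))"
      unfolding unitary_nrm_diff[OF F_unitary D(1)[OF f] D(1)[OF g]] damp_diff ..
    also have "\<dots> \<le> nrm M (\<lambda>x. f x - ?g x)" using t by (intro damp_nrm L2_diff f g) auto
    finally have 1: "nrm M (\<lambda>x. damp (1 / t) (F (damp t f)) x - damp (1 / t) (F (damp t ?g)) x) \<le> e / 2" using S(3) by simp
    have "nrm M (damp (1 / t) (F (damp t f))) \<le> e / 2 + nrm M (damp (1 / t) (F (damp t ?g)))"
      using nrm_diff_ge[OF D(3)[OF f] D(3)[OF g]] 1 by linarith
    also have "\<dots> \<le> e / 2 + rho * nrm M ?g" using damped_F_gauss_comb[OF S(1,2) t] by simp
    also have "rho * nrm M ?g \<le> rho * (nrm M f + e / 2)"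
      using nrm_diff_ge[OF f g] S(3) rho by (intro mult_left_mono) auto
    also have "e / 2 + rho * (nrm M f + e / 2) \<le> rho * nrm M f + e"
    proof -
      have "rho * (e / 2) \<le> 1 * (e / 2)" using rho e by (intro mult_right_mono) auto
      then show ?thesis by (simp add: distrib_left)
    qed
    finally show ?thesis by simp
  qed
  then show ?thesis by (rule field_le_epsilon)
qed

section \<open>From damping to moments\<close>

text \<open>\<open>1 - e\<^sup>-\<^sup>y \<le> \<epsilon> + (y / \<epsilon>)\<^sup>\<theta>\<close> trades the damping factors for moments of arbitrary order \<open>\<theta>\<close>.\<close>

lemma damp_defect:
  assumes \<theta>: "\<theta> > 0" and \<epsilon>: "\<epsilon> > 0" and s: "s > 0" and f: "f \<in> L2_space M"
    and g: "(\<lambda>x. complex_of_real (norm x powr (a * \<theta>)) * f x) \<in> L2_space M"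
  shows "nrm M (\<lambda>x. f x - damp s f x) \<le> \<epsilon> * nrm M f +
    (s / (\<epsilon> * a)) powr \<theta> * nrm M (\<lambda>x. complex_of_real (norm x powr (a * \<theta>)) * f x)"
proof -
  let ?g = "\<lambda>x. complex_of_real (norm x powr (a * \<theta>)) * f x"
  define C where "C = (s / (\<epsilon> * a)) powr \<theta>"
  have C: "C \<ge> 0" by (simp add: C_def)
  let ?h = "\<lambda>x. complex_of_real (\<epsilon> * cmod (f x) + C * cmod (?g x))"
  have cf: "(\<lambda>x. complex_of_real (cmod (f x))) \<in> L2_space M" "(\<lambda>x. complex_of_real (cmod (?g x))) \<in> L2_space M"
    using f g by (auto simp: L2_space_iff)
  have hL: "?h \<in> L2_space M"
    unfolding of_real_add of_real_mult by (intro L2_add L2_scale cf)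
  have "nrm M (\<lambda>x. f x - damp s f x) \<le> nrm M ?h"
  proof (rule nrm_mono_AE[OF L2_diff[OF f damp_L2[OF less_imp_le[OF s] f]] hL], intro AE_I2)
    fix x
    define y where "y = s * phi x"
    have y: "y \<ge> 0" using s by (simp add: y_def)
    have "1 - exp (- y) \<le> \<epsilon> + (y / \<epsilon>) powr \<theta>"
    proof (cases "y \<le> \<epsilon>")
      case True
      have "1 - exp (- y) \<le> y" using exp_ge_add_one_self[of "- y"] by linarith
      then show ?thesis using True by (smt (verit) powr_ge_zero)
    next
      case False
      then have "1 powr \<theta> \<le> (y / \<epsilon>) powr \<theta>" using \<epsilon> \<theta> by (intro powr_mono2) auto
      then show ?thesis using \<epsilon> exp_gt_zero[of "- y"] by (simp del: exp_gt_zero)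
    qed
    moreover have "(y / \<epsilon>) powr \<theta> = C * norm x powr (a * \<theta>)"
    proof -
      have "y / \<epsilon> = (s / (\<epsilon> * a)) * norm x powr a" by (simp add: y_def phi_def)
      then have "(y / \<epsilon>) powr \<theta> = (s / (\<epsilon> * a)) powr \<theta> * (norm x powr a) powr \<theta>"
        using s \<epsilon> a_pos by (simp only: powr_mult)
      then show ?thesis by (simp add: C_def powr_powr)
    qed
    ultimately have "(1 - exp (- y)) * cmod (f x) \<le> (\<epsilon> + C * norm x powr (a * \<theta>)) * cmod (f x)"
      by (intro mult_right_mono) auto
    moreover have "f x - damp s f x = of_real (1 - exp (- y)) * f x"
      by (simp add: damp_def y_def left_diff_distrib)
    moreover have "1 - exp (- y) \<ge> 0" using y by simp
    ultimately have "cmod (f x - damp s f x) \<le> \<epsilon> * cmod (f x) + C * cmod (?g x)"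
      by (simp only: norm_mult norm_of_real abs_of_nonneg) (simp add: norm_mult distrib_right)
    moreover have "\<epsilon> * cmod (f x) + C * cmod (?g x) \<ge> 0" using \<epsilon> C by simp
    ultimately show "cmod (f x - damp s f x) \<le> cmod (?h x)" by (simp only: norm_of_real abs_of_nonneg)
  qed
  also have "\<dots> \<le> cmod (of_real \<epsilon>) * nrm M (\<lambda>x. complex_of_real (cmod (f x))) + cmod (of_real C) * nrm M (\<lambda>x. complex_of_real (cmod (?g x)))"
    unfolding of_real_add of_real_mult by (rule nrm_lin_comb_le[OF cf])
  also have "\<dots> = \<epsilon> * nrm M f + C * nrm M ?g"
    using \<epsilon> C by (simp add: nrm_def)
  finally show ?thesis by (simp add: C_def)
qed

text \<open>\<open>norm x powr c\<close> vanishes only at the origin, which is a null set.\<close>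

lemma weighted_zero:
  assumes f: "f \<in> L2_space M" and z: "AE x in M. complex_of_real (norm x powr c) * f x = 0"
  shows "nrm M f = 0"
proof -
  have "AE x in M. x \<noteq> 0" by (rule AE_ka_measure[OF finite_Rp AE_nonzero])
  with z have "AE x in M. f x = 0" by eventually_elim auto
  then show ?thesis using nrm_eq_0_iff[OF f] by simp
qed

lemma uncertainty_finite:
  assumes \<theta>: "\<theta> > 0"
  shows "\<exists>K>0. \<forall>f\<in>L2_space M. (\<lambda>x. complex_of_real (norm x powr (a * \<theta>)) * f x) \<in> L2_space M \<longrightarrow>
    (\<lambda>x. complex_of_real (norm x powr (a * \<theta>)) * F f x) \<in> L2_space M \<longrightarrow>
    K * (nrm M f)\<^sup>2 \<le> nrm M (\<lambda>x. complex_of_real (norm x powr (a * \<theta>)) * f x) *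
      nrm M (\<lambda>x. complex_of_real (norm x powr (a * \<theta>)) * F f x)"
proof -
  \<comment> \<open>Each of the two defects costs epsilon times the norm of f and the damped part
    costs \<open>rho\<close>; since 2 epsilon + rho = 1 - delta, the fraction delta of the norm
    remains for the moments.\<close>
  define \<epsilon> where "\<epsilon> = (1 - rho) / 4"
  define \<delta> where "\<delta> = (1 - rho) / 2"
  define C where "C = (1 / (\<epsilon> * a)) powr \<theta>"
  have pos: "\<epsilon> > 0" "\<delta> > 0" using rho by (auto simp: \<epsilon>_def \<delta>_def)
  have C: "C > 0" using pos a_pos by (simp add: C_def)
  \<comment> \<open>The constant is the square of delta |f| <= 2 C sqrt (P Q), the balanced form of
    the estimate \<open>key\<close>.\<close>
  have "(\<delta> / (2 * C))\<^sup>2 * (nrm M f)\<^sup>2 \<le> nrm M (\<lambda>x. complex_of_real (norm x powr (a * \<theta>)) * f x) *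
      nrm M (\<lambda>x. complex_of_real (norm x powr (a * \<theta>)) * F f x)"
    if f: "f \<in> L2_space M" and g: "(\<lambda>x. complex_of_real (norm x powr (a * \<theta>)) * f x) \<in> L2_space M"
      and g': "(\<lambda>x. complex_of_real (norm x powr (a * \<theta>)) * F f x) \<in> L2_space M" for f
  proof -
    define P where "P = nrm M (\<lambda>x. complex_of_real (norm x powr (a * \<theta>)) * f x)"
    define Q where "Q = nrm M (\<lambda>x. complex_of_real (norm x powr (a * \<theta>)) * F f x)"
    note FL = unitary_L2[OF F_unitary f]
    have key: "\<delta> * nrm M f \<le> C * (Q * \<sigma> + P / \<sigma>)" if \<sigma>: "\<sigma> > 0" for \<sigma>
    proof -
      \<comment> \<open>Chosen so that t^theta = 1 / sigma: the two moments then appear with the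
        reciprocal weights sigma and 1 / sigma.\<close>
      define t where "t = \<sigma> powr (- 1 / \<theta>)"
      have t: "t > 0" "1 / t > 0" using \<sigma> by (auto simp: t_def)
      have tpow: "t powr \<theta> = 1 / \<sigma>" "(1 / t) powr \<theta> = \<sigma>"
        using \<sigma> \<theta> by (simp_all add: t_def powr_powr powr_minus powr_divide field_simps)
      have D: "damp t f \<in> L2_space M" using t f by (intro damp_L2) auto
      have FD: "F (damp t f) \<in> L2_space M" by (rule unitary_L2[OF F_unitary D])
      have L1: "damp (1 / t) (F f) \<in> L2_space M" "damp (1 / t) (F (damp t f)) \<in> L2_space M"
        using t FL FD by (auto intro!: damp_L2)
      have "nrm M f = nrm M (F f)" by (rule unitary_nrm[OF F_unitary f, symmetric])
      also have "\<dots> \<le> nrm M (\<lambda>x. F f x - damp (1 / t) (F f) x) + nrm M (damp (1 / t) (F f))"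
        using nrm_diff_ge[OF FL L1(1)] by linarith
      also have "nrm M (damp (1 / t) (F f)) \<le>
          nrm M (\<lambda>x. damp (1 / t) (F f) x - damp (1 / t) (F (damp t f)) x) + nrm M (damp (1 / t) (F (damp t f)))"
        using nrm_diff_ge[OF L1] by linarith
      also have "nrm M (\<lambda>x. damp (1 / t) (F f) x - damp (1 / t) (F (damp t f)) x) \<le> nrm M (\<lambda>x. F f x - F (damp t f) x)"
        unfolding damp_diff[symmetric] using t by (intro damp_nrm L2_diff FL FD) auto
      also have "\<dots> = nrm M (\<lambda>x. f x - damp t f x)" by (rule unitary_nrm_diff[OF F_unitary f D])
      also have "\<dots> \<le> \<epsilon> * nrm M f + (t / (\<epsilon> * a)) powr \<theta> * P"
        unfolding P_def by (rule damp_defect[OF \<theta> pos(1) t(1) f g])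
      also have "nrm M (damp (1 / t) (F (damp t f))) \<le> rho * nrm M f" by (rule damped_F_contraction[OF f t(1)])
      also have "nrm M (\<lambda>x. F f x - damp (1 / t) (F f) x) \<le> \<epsilon> * nrm M (F f) + ((1 / t) / (\<epsilon> * a)) powr \<theta> * Q"
        unfolding Q_def by (rule damp_defect[OF \<theta> pos(1) t(2) FL g'])
      also have "nrm M (F f) = nrm M f" by (rule unitary_nrm[OF F_unitary f])
      also have "((1 / t) / (\<epsilon> * a)) powr \<theta> = C * \<sigma>"
        using t pos a_pos tpow by (simp add: C_def powr_divide powr_mult)
      also have "(t / (\<epsilon> * a)) powr \<theta> = C * (1 / \<sigma>)"
        using t pos a_pos tpow by (simp add: C_def powr_divide powr_mult)
      finally have "nrm M f \<le> (\<epsilon> * nrm M f + C * \<sigma> * Q) + ((\<epsilon> * nrm M f + C * (1 / \<sigma>) * P) + rho * nrm M f)" by simp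
      then have "nrm M f \<le> (2 * \<epsilon> + rho) * nrm M f + C * (Q * \<sigma> + P / \<sigma>)" by (simp add: algebra_simps)
      also have "2 * \<epsilon> + rho = 1 - \<delta>" by (simp add: \<epsilon>_def \<delta>_def field_simps)
      finally show ?thesis by (simp add: left_diff_distrib)
    qed
    show ?thesis
    proof (cases "P = 0 \<or> Q = 0")
      case True
      have "nrm M f = 0"
      proof (cases "P = 0")
        case True
        then show ?thesis unfolding P_def using nrm_eq_0_iff[OF g] by (intro weighted_zero[OF f]) auto
      next
        case False
        then have "nrm M (F f) = 0" using \<open>P = 0 \<or> Q = 0\<close> nrm_eq_0_iff[OF g']
          unfolding Q_def by (intro weighted_zero[OF FL]) auto
        then show ?thesis using unitary_nrm[OF F_unitary f] by simp
      qed
      then show ?thesis by (simp add: mult_nonneg_nonneg)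
    next
      case False
      then have PQ: "P > 0" "Q > 0" unfolding P_def Q_def using nrm_nonneg by (auto simp: less_le)
      \<comment> \<open>Balances the two terms: Q sigma = P / sigma = sqrt (P Q).\<close>
      define \<sigma> where "\<sigma> = sqrt P / sqrt Q"
      have "\<sigma> > 0" using PQ by (simp add: \<sigma>_def)
      from key[OF this] have "\<delta> * nrm M f \<le> C * (Q * \<sigma> + P / \<sigma>)" .
      also have "Q * \<sigma> = sqrt P * sqrt Q"
        using PQ by (simp add: \<sigma>_def field_simps)
      also have "P / \<sigma> = sqrt P * sqrt Q"
        using PQ by (simp add: \<sigma>_def field_simps)
      finally have "\<delta> / (2 * C) * nrm M f \<le> sqrt P * sqrt Q" using C by (simp add: field_simps)
      then have "(\<delta> / (2 * C) * nrm M f)\<^sup>2 \<le> (sqrt P * sqrt Q)\<^sup>2"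
        using pos C by (intro power_mono) auto
      then show ?thesis using PQ by (simp only: power_mult_distrib real_sqrt_pow2 less_imp_le P_def Q_def)
    qed
  qed
  moreover have "(\<delta> / (2 * C))\<^sup>2 > 0" using pos C by simp
  ultimately show ?thesis by blast
qed

lemma uncertainty:
  assumes \<alpha>: "\<alpha> > 0"
  shows "\<exists>K::real. K > 0 \<and> (\<forall>f \<in> L2_space M.
       L2_norm M (\<lambda>x. complex_of_real (norm x powr (\<alpha> / 2)) * f x)
       * L2_norm M (\<lambda>x. complex_of_real (norm x powr (\<alpha> / 2)) * F f x)
       \<ge> ennreal K * (L2_norm M f)\<^sup>2)"
proof -
  \<comment> \<open>\<open>damp_defect\<close> produces the weight |x|^(a theta), so this choice
    matches the exponent alpha / 2.\<close>
  define \<theta> where "\<theta> = \<alpha> / (2 * a)"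
  have \<theta>: "\<theta> > 0" "a * \<theta> = \<alpha> / 2" using \<alpha> a_pos by (auto simp: \<theta>_def)
  obtain K where K: "K > 0" "\<And>f. f \<in> L2_space M \<Longrightarrow> (\<lambda>x. complex_of_real (norm x powr (\<alpha> / 2)) * f x) \<in> L2_space M \<Longrightarrow>
    (\<lambda>x. complex_of_real (norm x powr (\<alpha> / 2)) * F f x) \<in> L2_space M \<Longrightarrow>
    K * (nrm M f)\<^sup>2 \<le> nrm M (\<lambda>x. complex_of_real (norm x powr (\<alpha> / 2)) * f x) *
      nrm M (\<lambda>x. complex_of_real (norm x powr (\<alpha> / 2)) * F f x)"
    using uncertainty_finite[OF \<theta>(1)] unfolding \<theta>(2) by blast
  have "ennreal K * (L2_norm M f)\<^sup>2 \<le> L2_norm M (\<lambda>x. complex_of_real (norm x powr (\<alpha> / 2)) * f x)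
       * L2_norm M (\<lambda>x. complex_of_real (norm x powr (\<alpha> / 2)) * F f x)" if f: "f \<in> L2_space M" for f
  proof -
    let ?W = "\<lambda>f x. complex_of_real (norm x powr (\<alpha> / 2)) * f x"
    note FL = unitary_L2[OF F_unitary f]
    have meas: "?W h \<in> borel_measurable M" if "h \<in> L2_space M" for h
    proof -
      have [measurable]: "h \<in> borel_measurable borel" using that by (simp add: L2_space_iff)
      have "(\<lambda>x::'a. complex_of_real (norm x powr (\<alpha> / 2))) \<in> borel_measurable borel"
        by (rule tempered_measurable[OF tempered_of_real[OF tempered_norm_powr]]) (use \<alpha> in simp)
      then show ?thesis by simp
    qed
    have inf: "L2_norm M (?W h) = \<infinity>" if "h \<in> L2_space M" "?W h \<notin> L2_space M" for h
      using that(2) meas[OF that(1)] by (simp add: L2_space_def less_top[symmetric])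
    have zero: "nrm M h = 0" if h: "h \<in> L2_space M" "L2_norm M (?W h) = 0" for h
    proof -
      have W: "?W h \<in> L2_space M" using inf[OF h(1)] h(2) by fastforce
      then have "nrm M (?W h) = 0" using h(2) by (simp add: L2_norm_eq_nrm)
      then show ?thesis using nrm_eq_0_iff[OF W] by (intro weighted_zero[OF h(1)]) simp
    qed
    show ?thesis
    proof (cases "?W f \<in> L2_space M \<and> ?W (F f) \<in> L2_space M")
      case True
      have "ennreal K * (L2_norm M f)\<^sup>2 = ennreal (K * (nrm M f)\<^sup>2)"
        using K(1) f by (simp add: L2_norm_eq_nrm ennreal_power ennreal_mult)
      also have "\<dots> \<le> ennreal (nrm M (?W f) * nrm M (?W (F f)))" using K(2)[OF f] True by (intro ennreal_leI) auto
      also have "\<dots> = L2_norm M (?W f) * L2_norm M (?W (F f))"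
        using True by (simp add: L2_norm_eq_nrm ennreal_mult)
      finally show ?thesis .
    next
      case False
      show ?thesis
      \<comment> \<open>In the extended reals 0 times infinity is 0, so an infinite factor helps
        only after a vanishing one has been shown to force f = 0.\<close>
      proof (cases "L2_norm M (?W f) = 0 \<or> L2_norm M (?W (F f)) = 0")
        case True
        then have "nrm M f = 0" using zero[OF f] zero[OF FL] unitary_nrm[OF F_unitary f] by auto
        then show ?thesis using f by (simp add: L2_norm_eq_nrm)
      next
        case nz: False
        then have "L2_norm M (?W f) * L2_norm M (?W (F f)) = \<infinity>"
          using False inf[OF f] inf[OF FL] by (auto simp: ennreal_top_mult ennreal_mult_top)
        then show ?thesis by simp
      qed
    qed
  qed
  with K(1) show ?thesis by blast
qed

end

section \<open>Root systems\<close>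

lemma inner_root_reflection_swap: "\<alpha> \<bullet> root_reflection \<beta> x = root_reflection \<beta> \<alpha> \<bullet> x"
  by (simp add: root_reflection_def inner_diff_left inner_diff_right inner_commute)

text \<open>A reflection permutes R but not the positive roots. The product over all roots is
  therefore invariant, and it is the square of the nonnegative function
  \<open>pweight\<close>.\<close>

lemma root_system_dunkl_setting:
  fixes R Rp :: "'a::euclidean_space set" and k :: "'a \<Rightarrow> real" and a :: real
  assumes R: "reduced_root_system R" and Rp: "positive_subsystem R Rp" and k: "multiplicity_function R k"
    and a: "a > 0" "a + 2 * mult_sum Rp k + real DIM('a) > 2"
  shows "dunkl_setting Rp k a"
proof
  have fin: "finite R" and zero: "0 \<notin> R" and refl: "\<And>\<alpha>. \<alpha> \<in> R \<Longrightarrow> root_reflection \<alpha> ` R = R"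
    and neg: "\<And>\<alpha>. \<alpha> \<in> R \<Longrightarrow> - \<alpha> \<in> R"
    using R by (auto simp: reduced_root_system_def)
  obtain \<beta>0 where \<beta>0: "\<And>\<alpha>. \<alpha> \<in> R \<Longrightarrow> \<alpha> \<bullet> \<beta>0 \<noteq> 0" and Rpeq: "Rp = {\<alpha>\<in>R. \<alpha> \<bullet> \<beta>0 > 0}"
    using Rp by (auto simp: positive_subsystem_def)
  have kr: "k (root_reflection \<beta> \<alpha>) = k \<alpha>" if "\<beta> \<in> R" "\<alpha> \<in> R" for \<alpha> \<beta>
  proof -
    have "root_reflection \<beta> \<circ> id \<in> reflection_group R" using that by (intro reflection_group.intros)
    then show ?thesis using k that by (auto simp: multiplicity_function_def)
  qed
  have kneg: "k (- \<alpha>) = k \<alpha>" if "\<alpha> \<in> R" for \<alpha>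
  proof -
    have "\<alpha> \<noteq> 0" using that zero by auto
    then have "root_reflection \<alpha> \<alpha> = - \<alpha>"
      by (simp add: root_reflection_def power2_norm_eq_inner scaleR_2)
    then show ?thesis using kr[OF that that] by simp
  qed
  show "finite Rp" "0 \<notin> Rp" using fin zero Rpeq by auto
  show "\<alpha> \<in> Rp \<Longrightarrow> 0 \<le> k \<alpha>" for \<alpha> using k Rpeq by (auto simp: multiplicity_function_def)
  show "a > 0" "a + 2 * mult_sum Rp k + real DIM('a) > 2" by fact+
  fix \<beta> x assume "\<beta> \<in> eff_roots Rp k"
  then have \<beta>: "\<beta> \<in> R" using Rpeq by (auto simp: eff_roots_def)
  \<comment> \<open>Every root of nonzero multiplicity, of either sign; the set is reflection
    invariant because multiplicities are, and it consists of the effective positive roots and their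
    negatives.\<close>
  define R' where "R' = {\<alpha>\<in>R. k \<alpha> \<noteq> 0}"
  define P where "P x = (\<Prod>\<alpha>\<in>R'. \<bar>\<alpha> \<bullet> x\<bar> powr (2 * k \<alpha>))" for x
  have Psq: "P x = (pweight Rp k x)\<^sup>2" for x
  proof -
    let ?E = "eff_roots Rp k"
    have sub: "?E \<subseteq> R" using Rpeq by (auto simp: eff_roots_def)
    have R'eq: "R' = ?E \<union> uminus ` ?E"
    proof (rule set_eqI)
      fix \<alpha>
      have "\<alpha> \<in> R' \<longleftrightarrow> \<alpha> \<in> ?E \<or> - \<alpha> \<in> ?E"
        using \<beta>0[of \<alpha>] neg[of \<alpha>] neg[of "- \<alpha>"] kneg[of \<alpha>] kneg[of "- \<alpha>"]
        by (auto simp: R'_def eff_roots_def Rpeq)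
      moreover have "- \<alpha> \<in> ?E \<longleftrightarrow> \<alpha> \<in> uminus ` ?E" by (auto intro: image_eqI[of _ _ "- \<alpha>"])
      ultimately show "\<alpha> \<in> R' \<longleftrightarrow> \<alpha> \<in> ?E \<union> uminus ` ?E" by auto
    qed
    have "finite ?E" using sub fin finite_subset by blast
    moreover have "?E \<inter> uminus ` ?E = {}" by (auto simp: eff_roots_def Rpeq)
    ultimately have "P x = (\<Prod>\<alpha>\<in>?E. \<bar>\<alpha> \<bullet> x\<bar> powr (2 * k \<alpha>)) * (\<Prod>\<alpha>\<in>uminus ` ?E. \<bar>\<alpha> \<bullet> x\<bar> powr (2 * k \<alpha>))"
      unfolding P_def R'eq by (intro prod.union_disjoint) auto
    also have "(\<Prod>\<alpha>\<in>uminus ` ?E. \<bar>\<alpha> \<bullet> x\<bar> powr (2 * k \<alpha>)) = (\<Prod>\<alpha>\<in>?E. \<bar>\<alpha> \<bullet> x\<bar> powr (2 * k \<alpha>))"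
      using kneg sub by (subst prod.reindex) (auto intro!: prod.cong)
    finally show ?thesis by (simp add: pweight_def power2_eq_square)
  qed
  have "P (root_reflection \<beta> x) = P x"
  proof -
    have inj: "inj_on (root_reflection \<beta>) R'"
      by (rule inj_on_inverseI[where g="root_reflection \<beta>"]) (rule root_reflection_involution)
    have sub: "root_reflection \<beta> ` R' \<subseteq> R'"
      using refl[OF \<beta>] kr[OF \<beta>] by (auto simp: R'_def)
    have "finite R'" using fin by (simp add: R'_def)
    then have im: "root_reflection \<beta> ` R' = R'" using inj sub by (intro card_subset_eq) (auto simp: card_image)
    have "P (root_reflection \<beta> x) = (\<Prod>\<alpha>\<in>R'. \<bar>root_reflection \<beta> \<alpha> \<bullet> x\<bar> powr (2 * k (root_reflection \<beta> \<alpha>)))"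
      unfolding P_def inner_root_reflection_swap by (intro prod.cong refl) (auto simp: kr[OF \<beta>] R'_def)
    also have "\<dots> = (\<Prod>\<alpha>\<in>root_reflection \<beta> ` R'. \<bar>\<alpha> \<bullet> x\<bar> powr (2 * k \<alpha>))"
      by (subst prod.reindex[OF inj]) simp
    finally show ?thesis unfolding im P_def .
  qed
  then have eq: "(pweight Rp k (root_reflection \<beta> x))\<^sup>2 = (pweight Rp k x)\<^sup>2" by (simp only: Psq)
  have "pweight Rp k y \<ge> 0" for y unfolding pweight_def by (intro prod_nonneg) simp
  from power2_eq_imp_eq[OF eq this this]
  show "pweight Rp k (root_reflection \<beta> x) = pweight Rp k x" .
qed

theorem corollary7p3:
  fixes R Rp :: "'a::euclidean_space set" and k :: "'a \<Rightarrow> real" and a \<alpha> :: real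
  assumes "reduced_root_system R"
    and "positive_subsystem R Rp"
    and "multiplicity_function R k"
    and "a > 0"
    and "a + 2 * mult_sum Rp k + real DIM('a) > 2"
    and "DIM('a) = 1 \<or> a \<in> {1, 2}"
    and "\<alpha> > 0"
  shows "\<exists>K::real. K > 0 \<and>
    (\<forall>f \<in> L2_space (ka_measure Rp k a).
       L2_norm (ka_measure Rp k a) (\<lambda>x. complex_of_real (norm x powr (\<alpha> / 2)) * f x)
       * L2_norm (ka_measure Rp k a)
           (\<lambda>x. complex_of_real (norm x powr (\<alpha> / 2)) * ka_fourier Rp k a f x)
       \<ge> ennreal K * (L2_norm (ka_measure Rp k a) f)\<^sup>2)"
proof -
  interpret dunkl_setting Rp k a by (rule root_system_dunkl_setting[OF assms(1-5)])
  show ?thesis by (rule uncertainty[OF assms(7)])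
qed

end
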